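(* Let $X$ be a separable (complex) Hilbert manifold and let $\Omega\subset X$ be a domain. Suppose there exist a boundary point $p\in\partial\Omega$ at which $\Omega$ is strongly pseudoconvex, a point $q\in\Omega$, and a sequence $\{\varphi_j\}\subset\operatorname{Aut}(\Omega)$ such that $\varphi_j(q)\to p$ in $X$ as $j\to\infty$. Then $\Omega$ is biholomorphic to the open unit ball in a separable Hilbert space $\mathcal{H}$.
   Context: A separable Hilbert manifold is a complex manifold modelled on a separable complex Hilbert space, with holomorphic transition maps. A domain in $X$ is an open connected subset. $\operatorname{Aut}(\Omega)$ is the group of automorphisms of $\Omega$, i.e. bijective holomorphic maps $\Omega\to\Omega$ with holomorphic inverse; biholomorphic means there is a bijective holomorphic map with holomorphic inverse. For a real-valued $C^2$ function $\rho$ on an open subset of a complex Hilbert space $\mathbb{E}$, $d\rho$ and $d^2\rho$ are its first and second real derivatives, $\partial\rho(p;v)=\frac12(d\rho(p;v)-i\,d\rho(p;iv))$, and $\partial\bar\partial\rho(p;v,v)=\frac14\left(d^2\rho(p;v,v)+d^2\rho(p;iv,iv)\right)$ is the Levi form (the positive normalizing factor is immaterial). $\Omega$ is strongly pseudoconvex at $p\in\partial\Omega$ if, in a local holomorphic chart of $X$ around $p$ with values in the model Hilbert space $\mathbb{E}$, there are an open neighborhood $U$ of $p$ in the chart and a $C^2$ function $\rho:U\to\mathbb{R}$ such that: (i) $\Omega\cap U=\{z\in U:\rho(z)<0\}$; (ii) $\partial\Omega\cap U=\{z\in U:\rho(z)=0\}$; (iii) $d\rho(z;\cdot)$ is a non-zero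 functional for every $z\in\partial\Omega\cap U$; (iv) there is a constant $C>0$ such that $\partial\bar\partial\rho(p;v,v)\ge C\|v\|^2$ for every $v\in\mathbb{E}$ with $\partial\rho(p;v)=0$. *)

theory Defs
  imports "HOL-Analysis.Analysis"
begin

section \<open>Complex Hilbert spaces\<close>

text \<open>
  The complex inner product is linear in the first argument; its real part is the library's real
  inner product, so that norm, topology and (real) differentiability are those of the library.
  Separability is the class \<^class>\<open>second_countable_topology\<close>, which for metric spaces is equivalent
  to the existence of a countable dense subset.
\<close>

class complex_hilbert_space = real_inner + complete_space +
  fixes scaleC :: "complex \<Rightarrow> 'a \<Rightarrow> 'a"  (infixr "*\<^sub>C" 75)
    and cinner :: "'a \<Rightarrow> 'a \<Rightarrow> complex"
  assumes scaleR_scaleC: "r *\<^sub>R x = complex_of_real r *\<^sub>C x"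
    and scaleC_add_right: "c *\<^sub>C (x + y) = c *\<^sub>C x + c *\<^sub>C y"
    and scaleC_add_left: "(c + d) *\<^sub>C x = c *\<^sub>C x + d *\<^sub>C x"
    and scaleC_scaleC: "c *\<^sub>C (d *\<^sub>C x) = (c * d) *\<^sub>C x"
    and cinner_commute: "cinner x y = cnj (cinner y x)"
    and cinner_add_left: "cinner (x + y) z = cinner x z + cinner y z"
    and cinner_scaleC_left: "cinner (c *\<^sub>C x) y = c * cinner x y"
    and inner_eq_Re_cinner: "inner x y = Re (cinner x y)"

definition complex_linear :: "('a::complex_hilbert_space \<Rightarrow> 'b::complex_hilbert_space) \<Rightarrow> bool"
  where "complex_linear f \<longleftrightarrow>
    (\<forall>x y. f (x + y) = f x + f y) \<and> (\<forall>c x. f (c *\<^sub>C x) = c *\<^sub>C f x)"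

definition closed_complex_subspace :: "'a::complex_hilbert_space set \<Rightarrow> bool"
  where "closed_complex_subspace H \<longleftrightarrow> closed H \<and> 0 \<in> H \<and>
    (\<forall>x\<in>H. \<forall>y\<in>H. x + y \<in> H) \<and> (\<forall>c. \<forall>x\<in>H. c *\<^sub>C x \<in> H)"


section \<open>The Hilbert space of square summable sequences\<close>

text \<open>
  HOL cannot quantify existentially over types. Every separable complex Hilbert space (of finite or
  infinite dimension) is isometrically isomorphic to a closed complex subspace of \<open>ell2\<close>, and
  conversely every such subspace is a separable complex Hilbert space with the induced inner
  product; hence ``there is a separable Hilbert space'' is rendered as ``there is a closed complex
  subspace of \<open>ell2\<close>''.
\<close>

typedef ell2 = "{x :: nat \<Rightarrow> complex. summable (\<lambda>n. (cmod (x n))\<^sup>2)}"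
  morphisms ell2_nth Abs_ell2
  by (rule exI[of _ "\<lambda>_. 0"]) simp

lemma ell2_summable: "summable (\<lambda>n. (cmod (ell2_nth x n))\<^sup>2)"
  using ell2_nth[of x] by simp

lemma ell2_eqI: "(\<And>n. ell2_nth x n = ell2_nth y n) \<Longrightarrow> x = y"
  by (meson ell2_nth_inject ext)

lemma cmod_add_sq_le: "(cmod (a + b))\<^sup>2 \<le> 2 * (cmod a)\<^sup>2 + 2 * (cmod b)\<^sup>2"
proof -
  have "(cmod (a + b))\<^sup>2 \<le> (cmod a + cmod b)\<^sup>2"
    by (simp add: norm_triangle_ineq power_mono)
  also have "\<dots> \<le> 2 * (cmod a)\<^sup>2 + 2 * (cmod b)\<^sup>2"
    using sum_squares_bound[of "cmod a" "cmod b"] by (simp add: power2_sum)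
  finally show ?thesis .
qed

lemma sq_summable_add:
  assumes "summable (\<lambda>n. (cmod (x n))\<^sup>2)" "summable (\<lambda>n. (cmod (y n))\<^sup>2)"
  shows "summable (\<lambda>n. (cmod (x n + y n))\<^sup>2)"
  by (rule summable_comparison_test'[where g = "\<lambda>n. 2 * (cmod (x n))\<^sup>2 + 2 * (cmod (y n))\<^sup>2" and N = 0])
     (use assms cmod_add_sq_le in \<open>auto intro!: summable_add summable_mult\<close>)

lemma sq_summable_scale:
  assumes "summable (\<lambda>n. (cmod (x n))\<^sup>2)"
  shows "summable (\<lambda>n. (cmod (c * x n))\<^sup>2)"
  using summable_mult[OF assms, of "(cmod c)\<^sup>2"] by (simp add: norm_mult power_mult_distrib)

lemma sq_summable_mult:
  assumes "summable (\<lambda>n. (cmod (x n))\<^sup>2)" "summable (\<lambda>n. (cmod (y n))\<^sup>2)"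
  shows "summable (\<lambda>n. x n * cnj (y n))"
proof (rule summable_norm_cancel, rule summable_comparison_test'[where N = 0])
  show "summable (\<lambda>n. (cmod (x n))\<^sup>2 + (cmod (y n))\<^sup>2)"
    using assms by (rule summable_add)
  fix n :: nat
  have "2 * (cmod (x n) * cmod (y n)) \<le> (cmod (x n))\<^sup>2 + (cmod (y n))\<^sup>2"
    using sum_squares_bound[of "cmod (x n)" "cmod (y n)"] by simp
  moreover have "0 \<le> cmod (x n) * cmod (y n)" by simp
  ultimately show "norm (norm (x n * cnj (y n))) \<le> (cmod (x n))\<^sup>2 + (cmod (y n))\<^sup>2"
    unfolding real_norm_def abs_norm_cancel norm_mult complex_mod_cnj by linarith
qed

lemma ell2_nth_Abs:
  "summable (\<lambda>n. (cmod (x n))\<^sup>2) \<Longrightarrow> ell2_nth (Abs_ell2 x) = x"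
  by (simp add: Abs_ell2_inverse)

instantiation ell2 :: real_inner
begin

definition "0 = Abs_ell2 (\<lambda>_. 0)"
definition "x + y = Abs_ell2 (\<lambda>n. ell2_nth x n + ell2_nth y n)"
definition "- x = Abs_ell2 (\<lambda>n. - ell2_nth x n)"
definition minus_ell2_def: "x - y = x + - (y::ell2)"
definition "r *\<^sub>R x = Abs_ell2 (\<lambda>n. complex_of_real r * ell2_nth x n)"
definition inner_ell2_def: "inner x y = Re (\<Sum>n. ell2_nth x n * cnj (ell2_nth y n))"
definition norm_ell2_def: "norm (x::ell2) = sqrt (inner x x)"
definition dist_ell2_def: "dist x y = norm (x - y :: ell2)"
definition sgn_ell2_def: "sgn x = inverse (norm x) *\<^sub>R (x::ell2)"
definition uniformity_ell2_def:
  "(uniformity :: (ell2 \<times> ell2) filter) = (INF e\<in>{0 <..}. principal {(x, y). dist x y < e})"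
definition open_ell2_def:
  "open (U :: ell2 set) \<longleftrightarrow> (\<forall>x\<in>U. \<forall>\<^sub>F (x', y) in uniformity. x' = x \<longrightarrow> y \<in> U)"

lemma ell2_nth_zero [simp]: "ell2_nth 0 n = 0"
  by (simp add: zero_ell2_def ell2_nth_Abs)

lemma ell2_nth_add [simp]: "ell2_nth (x + y) n = ell2_nth x n + ell2_nth y n"
  by (simp add: plus_ell2_def ell2_nth_Abs sq_summable_add ell2_summable)

lemma ell2_nth_uminus [simp]: "ell2_nth (- x) n = - ell2_nth x n"
  by (simp add: uminus_ell2_def ell2_nth_Abs ell2_summable)

lemma ell2_nth_minus [simp]: "ell2_nth (x - y) n = ell2_nth x n - ell2_nth y n"
  by (simp add: minus_ell2_def)

lemma ell2_nth_scaleR [simp]: "ell2_nth (r *\<^sub>R x) n = complex_of_real r * ell2_nth x n"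
  unfolding scaleR_ell2_def by (subst ell2_nth_Abs) (auto intro: sq_summable_scale ell2_summable)

lemma ell2_prod_summable: "summable (\<lambda>n. ell2_nth x n * cnj (ell2_nth y n))"
  by (intro sq_summable_mult ell2_summable)

lemma inner_self_ell2: "inner x x = (\<Sum>n. (cmod (ell2_nth x n))\<^sup>2)"
proof -
  have "inner x x = (\<Sum>n. Re (ell2_nth x n * cnj (ell2_nth x n)))"
    unfolding inner_ell2_def by (rule Re_suminf[OF ell2_prod_summable])
  also have "\<dots> = (\<Sum>n. (cmod (ell2_nth x n))\<^sup>2)"
    by (simp add: complex_mult_cnj cmod_power2)
  finally show ?thesis .
qed

instance
proof
  fix x y z :: ell2 and r s :: real and U :: "ell2 set"
  show "x + y + z = x + (y + z)" "x + y = y + x" "0 + x = x" "- x + x = 0" "x - y = x + - y"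
    "r *\<^sub>R (x + y) = r *\<^sub>R x + r *\<^sub>R y" "(r + s) *\<^sub>R x = r *\<^sub>R x + s *\<^sub>R x"
    "r *\<^sub>R s *\<^sub>R x = (r * s) *\<^sub>R x" "1 *\<^sub>R x = x"
    by (auto intro!: ell2_eqI simp: algebra_simps)
  show "dist x y = norm (x - y)" by (rule dist_ell2_def)
  show "sgn x = inverse (norm x) *\<^sub>R x" by (rule sgn_ell2_def)
  show "uniformity = (INF e\<in>{0 <..}. principal {(x::ell2, y). dist x y < e})"
    by (rule uniformity_ell2_def)
  show "open U \<longleftrightarrow> (\<forall>x\<in>U. \<forall>\<^sub>F (x', y) in uniformity. x' = x \<longrightarrow> y \<in> U)"
    by (rule open_ell2_def)
  have "(\<Sum>n. ell2_nth x n * cnj (ell2_nth y n)) = cnj (\<Sum>n. ell2_nth y n * cnj (ell2_nth x n))"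
    using summable_sums[OF ell2_prod_summable[of y x]]
    by (subst (asm) sums_cnj[symmetric]) (simp add: sums_iff mult.commute)
  then show "inner x y = inner y x" by (simp add: inner_ell2_def)
  show "inner (x + y) z = inner x z + inner y z"
    by (simp add: inner_ell2_def distrib_right ell2_prod_summable flip: suminf_add)
  show "inner (r *\<^sub>R x) y = r * inner x y"
    by (simp add: inner_ell2_def mult.assoc suminf_mult ell2_prod_summable)
  show "0 \<le> inner x x"
    unfolding inner_self_ell2 by (intro suminf_nonneg ell2_summable) simp
  show "inner x x = 0 \<longleftrightarrow> x = 0"
    unfolding inner_self_ell2
    by (subst suminf_eq_zero_iff) (auto intro!: ell2_summable ell2_eqI)
  show "norm x = sqrt (inner x x)" by (rule norm_ell2_def)
qed

end


lemma norm_ell2_sq: "(norm (x::ell2))\<^sup>2 = (\<Sum>n. (cmod (ell2_nth x n))\<^sup>2)"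
  by (simp add: power2_norm_eq_inner inner_self_ell2)

lemma cmod_ell2_nth_le: "cmod (ell2_nth x n) \<le> norm x"
proof -
  have "(\<Sum>k\<in>{n}. (cmod (ell2_nth x k))\<^sup>2) \<le> (\<Sum>k. (cmod (ell2_nth x k))\<^sup>2)"
    by (intro sum_le_suminf ell2_summable) auto
  then have "(cmod (ell2_nth x n))\<^sup>2 \<le> (norm x)\<^sup>2"
    by (simp add: norm_ell2_sq)
  then show ?thesis by (simp add: power2_le_iff_abs_le)
qed

instantiation ell2 :: complex_hilbert_space
begin

definition "c *\<^sub>C x = Abs_ell2 (\<lambda>n. c * ell2_nth x n)"
definition "cinner x y = (\<Sum>n. ell2_nth x n * cnj (ell2_nth y n))"

lemma ell2_nth_scaleC [simp]: "ell2_nth (c *\<^sub>C x) n = c * ell2_nth x n"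
  unfolding scaleC_ell2_def by (subst ell2_nth_Abs) (auto intro: sq_summable_scale ell2_summable)

instance
proof
  fix X :: "nat \<Rightarrow> ell2"
  assume "Cauchy X"
  have "Cauchy (\<lambda>i. ell2_nth (X i) n)" for n
  proof (rule CauchyI)
    fix e :: real assume "e > 0"
    then obtain M where M: "\<forall>i\<ge>M. \<forall>j\<ge>M. norm (X i - X j) < e"
      using CauchyD[OF \<open>Cauchy X\<close>] by blast
    have "norm (ell2_nth (X i) n - ell2_nth (X j) n) < e" if "i \<ge> M" "j \<ge> M" for i j
      using cmod_ell2_nth_le[of "X i - X j" n] M that by fastforce
    then show "\<exists>M. \<forall>i\<ge>M. \<forall>j\<ge>M. norm (ell2_nth (X i) n - ell2_nth (X j) n) < e" by blast
  qed
  then have "\<exists>l. (\<lambda>i. ell2_nth (X i) n) \<longlonglongrightarrow> l" for n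
    using Cauchy_convergent convergent_def by blast
  then obtain l where l: "\<And>n. (\<lambda>i. ell2_nth (X i) n) \<longlonglongrightarrow> l n" by metis
  have bound: "\<exists>M. \<forall>i\<ge>M. \<forall>N. (\<Sum>n<N. (cmod (ell2_nth (X i) n - l n))\<^sup>2) \<le> e\<^sup>2"
    if "e > 0" for e :: real
  proof -
    obtain M where M: "\<forall>i\<ge>M. \<forall>j\<ge>M. norm (X i - X j) < e"
      using CauchyD[OF \<open>Cauchy X\<close> \<open>e > 0\<close>] by blast
    have "(\<Sum>n<N. (cmod (ell2_nth (X i) n - l n))\<^sup>2) \<le> e\<^sup>2" if "i \<ge> M" for i N
    proof (rule LIMSEQ_le_const2)
      show "(\<lambda>j. \<Sum>n<N. (cmod (ell2_nth (X i) n - ell2_nth (X j) n))\<^sup>2)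
          \<longlonglongrightarrow> (\<Sum>n<N. (cmod (ell2_nth (X i) n - l n))\<^sup>2)"
        by (intro tendsto_intros l)
      have "(\<Sum>n<N. (cmod (ell2_nth (X i) n - ell2_nth (X j) n))\<^sup>2) \<le> e\<^sup>2" if "j \<ge> M" for j
      proof -
        have "(\<Sum>n<N. (cmod (ell2_nth (X i - X j) n))\<^sup>2) \<le> (norm (X i - X j))\<^sup>2"
          unfolding norm_ell2_sq by (intro sum_le_suminf ell2_summable) auto
        also have "\<dots> \<le> e\<^sup>2"
          using M \<open>i \<ge> M\<close> that by (intro power_mono) (auto intro: less_imp_le)
        finally show ?thesis by simp
      qed
      then show "\<exists>J. \<forall>j\<ge>J. (\<Sum>n<N. (cmod (ell2_nth (X i) n - ell2_nth (X j) n))\<^sup>2) \<le> e\<^sup>2"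
        by blast
    qed
    then show ?thesis by blast
  qed
  have summ: "\<exists>M. \<forall>i\<ge>M. summable (\<lambda>n. (cmod (ell2_nth (X i) n - l n))\<^sup>2)
      \<and> (\<Sum>n. (cmod (ell2_nth (X i) n - l n))\<^sup>2) \<le> e\<^sup>2" if "e > 0" for e :: real
  proof -
    obtain M where M: "\<And>i N. i \<ge> M \<Longrightarrow> (\<Sum>n<N. (cmod (ell2_nth (X i) n - l n))\<^sup>2) \<le> e\<^sup>2"
      using bound[OF \<open>e > 0\<close>] by blast
    have s: "summable (\<lambda>n. (cmod (ell2_nth (X i) n - l n))\<^sup>2)" if "i \<ge> M" for i
      by (rule bounded_imp_summable[where B = "e\<^sup>2"])
         (use M[OF that, of "Suc _"] in \<open>auto simp: lessThan_Suc_atMost\<close>)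
    then show ?thesis
      using M suminf_le_const[OF s] by blast
  qed
  obtain M where "\<forall>i\<ge>M. summable (\<lambda>n. (cmod (ell2_nth (X i) n - l n))\<^sup>2)"
    using summ[of 1] by auto
  then have "summable (\<lambda>n. (cmod (ell2_nth (X M) n - l n))\<^sup>2)" by simp
  then have "summable (\<lambda>n. (cmod (- 1 * (ell2_nth (X M) n - l n) + ell2_nth (X M) n))\<^sup>2)"
    by (intro sq_summable_add sq_summable_scale ell2_summable)
  then have nth: "ell2_nth (Abs_ell2 l) = l"
    by (intro ell2_nth_Abs) simp
  have "X \<longlonglongrightarrow> Abs_ell2 l"
  proof (rule LIMSEQ_I)
    fix r :: real assume "r > 0"
    then obtain M where M: "\<And>i. i \<ge> M \<Longrightarrow> (\<Sum>n. (cmod (ell2_nth (X i) n - l n))\<^sup>2) \<le> (r / 2)\<^sup>2"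
      using summ[of "r / 2"] by auto
    have "norm (X i - Abs_ell2 l) < r" if "i \<ge> M" for i
    proof -
      have "(norm (X i - Abs_ell2 l))\<^sup>2 \<le> (r / 2)\<^sup>2"
        using M[OF that] by (simp add: norm_ell2_sq nth)
      then have "norm (X i - Abs_ell2 l) \<le> r / 2"
        using \<open>r > 0\<close> by (auto intro: power2_le_imp_le)
      then show ?thesis using \<open>r > 0\<close> by simp
    qed
    then show "\<exists>M. \<forall>i\<ge>M. norm (X i - Abs_ell2 l) < r" by blast
  qed
  then show "convergent X" by (rule convergentI)
next
  fix x y z :: ell2 and c d :: complex and r :: real
  show "r *\<^sub>R x = complex_of_real r *\<^sub>C x" "c *\<^sub>C (x + y) = c *\<^sub>C x + c *\<^sub>C y"
    "(c + d) *\<^sub>C x = c *\<^sub>C x + d *\<^sub>C x" "c *\<^sub>C d *\<^sub>C x = (c * d) *\<^sub>C x"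
    by (auto intro!: ell2_eqI simp: algebra_simps)
  show "cinner x y = cnj (cinner y x)"
    using summable_sums[OF ell2_prod_summable[of y x]]
    by (subst (asm) sums_cnj[symmetric]) (simp add: sums_iff mult.commute cinner_ell2_def)
  show "cinner (x + y) z = cinner x z + cinner y z"
    by (simp add: cinner_ell2_def distrib_right ell2_prod_summable flip: suminf_add)
  show "cinner (c *\<^sub>C x) y = c * cinner x y"
    by (simp add: cinner_ell2_def mult.assoc suminf_mult ell2_prod_summable)
  show "inner x y = Re (cinner x y)"
    by (simp add: inner_ell2_def cinner_ell2_def)
qed

end

lemma ell2_countable_dense:
  obtains D :: "ell2 set" where "countable D" "\<And>x e. e > 0 \<Longrightarrow> \<exists>d\<in>D. dist d x < e"
proof -
  obtain Q :: "complex set" where Q: "countable Q" "\<And>X. open X \<Longrightarrow> X \<noteq> {} \<Longrightarrow> \<exists>q\<in>Q. q \<in> X"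
    using countable_dense_exists by blast
  define v where "v xs = Abs_ell2 (\<lambda>n. if n < length xs then xs ! n else 0)" for xs :: "complex list"
  have v: "ell2_nth (v xs) n = (if n < length xs then xs ! n else 0)" for xs n
    unfolding v_def
    by (subst ell2_nth_Abs) (auto intro!: summable_finite[of "{..<length xs}"] split: if_splits)
  have "\<exists>d \<in> v ` lists Q. dist d x < e" if "e > 0" for x e
  proof -
    have "e\<^sup>2 / 2 > 0" using that by simp
    from suminf_exist_split[OF this ell2_summable[of x]]
    obtain N where N: "norm (\<Sum>n. (cmod (ell2_nth x (n + N)))\<^sup>2) < e\<^sup>2 / 2" by blast
    define \<delta> where "\<delta> = e / sqrt (2 * (real N + 1))"
    have \<delta>: "\<delta> > 0" "\<delta>\<^sup>2 * (real N + 1) = e\<^sup>2 / 2"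
      using that by (auto simp: \<delta>_def power_divide field_simps)
    have "\<exists>q\<in>Q. q \<in> ball (ell2_nth x n) \<delta>" for n
      using \<delta> by (intro Q) auto
    then obtain q where q: "\<And>n. q n \<in> Q" "\<And>n. cmod (q n - ell2_nth x n) < \<delta>"
      by (metis mem_ball dist_norm norm_minus_commute)
    define d where "d = v (map q [0..<N])"
    have d: "ell2_nth d n = (if n < N then q n else 0)" for n
      by (simp add: d_def v)
    have "(norm (d - x))\<^sup>2 = (\<Sum>n. (cmod (ell2_nth (d - x) (n + N)))\<^sup>2)
        + (\<Sum>n<N. (cmod (ell2_nth (d - x) n))\<^sup>2)"
      unfolding norm_ell2_sq by (rule suminf_split_initial_segment[OF ell2_summable])
    also have "\<dots> < e\<^sup>2 / 2 + e\<^sup>2 / 2"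
    proof (rule add_less_le_mono)
      show "(\<Sum>n. (cmod (ell2_nth (d - x) (n + N)))\<^sup>2) < e\<^sup>2 / 2"
        using N by (simp add: d)
      have "(\<Sum>n<N. (cmod (ell2_nth (d - x) n))\<^sup>2) \<le> (\<Sum>n<N. \<delta>\<^sup>2)"
        by (intro sum_mono power_mono) (use q in \<open>auto simp: d intro: less_imp_le\<close>)
      also have "\<dots> \<le> \<delta>\<^sup>2 * (real N + 1)" by (simp add: algebra_simps)
      finally show "(\<Sum>n<N. (cmod (ell2_nth (d - x) n))\<^sup>2) \<le> e\<^sup>2 / 2" using \<delta> by simp
    qed
    finally have "norm (d - x) < e"
      using that by (auto intro: power2_less_imp_less)
    moreover have "d \<in> v ` lists Q" unfolding d_def using q by (intro imageI) auto
    ultimately show ?thesis by (auto simp: dist_norm)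
  qed
  moreover have "countable (v ` lists Q)" using Q by (intro countable_image countable_lists)
  ultimately show ?thesis using that by blast
qed

instance ell2 :: second_countable_topology
proof
  obtain D :: "ell2 set" where D: "countable D" "\<And>x e. e > 0 \<Longrightarrow> \<exists>d\<in>D. dist d x < e"
    using ell2_countable_dense by blast
  define B where "B = (\<lambda>(d, r). ball d r) ` (D \<times> (\<rat> :: real set))"
  have "topological_basis B"
  proof (rule topological_basisI)
    show "open b" if "b \<in> B" for b using that by (auto simp: B_def)
    fix U :: "ell2 set" and x assume "open U" "x \<in> U"
    then obtain e where e: "e > 0" "ball x e \<subseteq> U" using open_contains_ball by blast
    obtain d where d: "d \<in> D" "dist d x < e / 2" using D(2)[of "e / 2" x] e by auto
    obtain r where r: "r \<in> \<rat>" "dist d x < r" "r < e / 2" using Rats_dense_in_real[OF d(2)] by blast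
    have "ball d r \<subseteq> ball x e"
    proof
      fix y assume "y \<in> ball d r"
      then have "dist x y \<le> dist d x + dist d y" by (metis dist_triangle3)
      then show "y \<in> ball x e" using \<open>y \<in> ball d r\<close> r by simp
    qed
    then show "\<exists>b\<in>B. x \<in> b \<and> b \<subseteq> U"
      using d r e by (intro bexI[of _ "ball d r"]) (auto simp: B_def)
  qed
  moreover have "countable B" unfolding B_def using D countable_rat by auto
  ultimately show "\<exists>B::ell2 set set. countable B \<and> open = generate_topology B"
    using topological_basis_imp_subbasis by blast
qed


section \<open>Complex Hilbert manifolds\<close>

text \<open>
  Complex Frechet differentiability. The set \<open>S\<close> will always be open, or relatively open in a closed
  complex subspace \<open>H\<close>; in the latter case, since a bounded linear map on \<open>H\<close> extends to the whole
  space by composition with the orthogonal projection, this is holomorphy on an open subset of the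
  Hilbert space \<open>H\<close>.
\<close>

definition cholomorphic_on ::
    "('a::complex_hilbert_space \<Rightarrow> 'b::complex_hilbert_space) \<Rightarrow> 'a set \<Rightarrow> bool"
  where "cholomorphic_on f S \<longleftrightarrow>
    (\<forall>x\<in>S. \<exists>D. complex_linear D \<and> (f has_derivative D) (at x within S))"

text \<open>A chart is a pair of its (open) domain and a coordinate map, whose values outside the domain
  are irrelevant.\<close>

type_synonym ('x, 'e) chart = "'x set \<times> ('x \<Rightarrow> 'e)"

definition is_chart :: "('x::topological_space, 'e::complex_hilbert_space) chart \<Rightarrow> bool"
  where "is_chart = (\<lambda>(U, \<kappa>). open U \<and> open (\<kappa> ` U) \<and> (\<exists>\<psi>. homeomorphism U (\<kappa> ` U) \<kappa> \<psi>))"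

definition holomorphic_transition ::
    "('x::topological_space, 'e::complex_hilbert_space) chart \<Rightarrow> ('x, 'e) chart \<Rightarrow> bool"
  where "holomorphic_transition = (\<lambda>(U, \<kappa>) (V, \<mu>).
    cholomorphic_on (\<mu> \<circ> inv_into U \<kappa>) (\<kappa> ` (U \<inter> V)))"

text \<open>Manifolds are Hausdorff, as usual. No countability or paracompactness is assumed.\<close>

definition complex_manifold ::
    "('x::t2_space, 'e::complex_hilbert_space) chart set \<Rightarrow> bool"
  where "complex_manifold \<A> \<longleftrightarrow>
    (\<forall>c\<in>\<A>. is_chart c) \<and> (\<Union>c\<in>\<A>. fst c) = UNIV \<and>
    (\<forall>c\<in>\<A>. \<forall>d\<in>\<A>. holomorphic_transition c d)"

text \<open>Local holomorphic charts: the members of the maximal atlas.\<close>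

definition holomorphic_chart ::
    "('x::t2_space, 'e::complex_hilbert_space) chart set \<Rightarrow> ('x, 'e) chart \<Rightarrow> bool"
  where "holomorphic_chart \<A> c \<longleftrightarrow> is_chart c \<and>
    (\<forall>d\<in>\<A>. holomorphic_transition c d \<and> holomorphic_transition d c)"

text \<open>Holomorphic maps from \<open>S\<close> into the manifold with atlas \<open>\<B>\<close>, where \<open>S\<close> is open in the manifold with
  atlas \<open>\<A>\<close> (or relatively open in a closed complex subspace, see \<open>cholomorphic_on\<close>, if that manifold
  is a Hilbert space).\<close>

definition holomorphic_map ::
    "('x::t2_space, 'e::complex_hilbert_space) chart set \<Rightarrow>
     ('y::t2_space, 'f::complex_hilbert_space) chart set \<Rightarrow> ('x \<Rightarrow> 'y) \<Rightarrow> 'x set \<Rightarrow> bool"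
  where "holomorphic_map \<A> \<B> f S \<longleftrightarrow> continuous_on S f \<and>
    (\<forall>(U, \<kappa>)\<in>\<A>. \<forall>(V, \<mu>)\<in>\<B>.
      cholomorphic_on (\<mu> \<circ> f \<circ> inv_into U \<kappa>) (\<kappa> ` (U \<inter> S \<inter> f -` V)))"

definition biholomorphism ::
    "('x::t2_space, 'e::complex_hilbert_space) chart set \<Rightarrow> 'x set \<Rightarrow>
     ('y::t2_space, 'f::complex_hilbert_space) chart set \<Rightarrow> 'y set \<Rightarrow> ('x \<Rightarrow> 'y) \<Rightarrow> bool"
  where "biholomorphism \<A> S \<B> T f \<longleftrightarrow> bij_betw f S T \<and>
    holomorphic_map \<A> \<B> f S \<and> holomorphic_map \<B> \<A> (inv_into S f) T"

definition biholomorphic ::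
    "('x::t2_space, 'e::complex_hilbert_space) chart set \<Rightarrow> 'x set \<Rightarrow>
     ('y::t2_space, 'f::complex_hilbert_space) chart set \<Rightarrow> 'y set \<Rightarrow> bool"
  where "biholomorphic \<A> S \<B> T \<longleftrightarrow> (\<exists>f. biholomorphism \<A> S \<B> T f)"

text \<open>Automorphisms are represented by functions on the whole manifold; only their restrictions to
  \<open>\<Omega>\<close> matter.\<close>

definition Aut :: "('x::t2_space, 'e::complex_hilbert_space) chart set \<Rightarrow> 'x set \<Rightarrow> ('x \<Rightarrow> 'x) set"
  where "Aut \<A> \<Omega> = {f. biholomorphism \<A> \<Omega> \<A> \<Omega> f}"

definition hilbert_atlas :: "('h::complex_hilbert_space, 'h) chart set"
  where "hilbert_atlas = {(UNIV, id)}"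


section \<open>Strong pseudoconvexity\<close>

definition C2_with_derivs ::
    "('e::complex_hilbert_space \<Rightarrow> real) \<Rightarrow> ('e \<Rightarrow> 'e \<Rightarrow>\<^sub>L real) \<Rightarrow> ('e \<Rightarrow> 'e \<Rightarrow>\<^sub>L 'e \<Rightarrow>\<^sub>L real) \<Rightarrow>
     'e set \<Rightarrow> bool"
  where "C2_with_derivs \<rho> d\<rho> d2\<rho> U \<longleftrightarrow>
    (\<forall>z\<in>U. (\<rho> has_derivative blinfun_apply (d\<rho> z)) (at z)) \<and>
    (\<forall>z\<in>U. (d\<rho> has_derivative blinfun_apply (d2\<rho> z)) (at z)) \<and>
    continuous_on U d2\<rho>"

text \<open>\<open>del_form\<close> and \<open>levi_form\<close> take the first and second derivative of \<open>\<rho>\<close> at the point.\<close>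

definition del_form :: "('e::complex_hilbert_space \<Rightarrow>\<^sub>L real) \<Rightarrow> 'e \<Rightarrow> complex"
  where "del_form L v =
    1 / 2 * (of_real (blinfun_apply L v) - \<i> * of_real (blinfun_apply L (\<i> *\<^sub>C v)))"

definition levi_form :: "('e::complex_hilbert_space \<Rightarrow>\<^sub>L 'e \<Rightarrow>\<^sub>L real) \<Rightarrow> 'e \<Rightarrow> real"
  where "levi_form Q v =
    1 / 4 * (blinfun_apply (blinfun_apply Q v) v + blinfun_apply (blinfun_apply Q (\<i> *\<^sub>C v)) (\<i> *\<^sub>C v))"

text \<open>The neighbourhood \<open>U\<close> lives in the image of the chart \<open>(W, \<kappa>)\<close>.\<close>

definition strongly_pseudoconvex_at ::
    "('x::t2_space, 'e::complex_hilbert_space) chart set \<Rightarrow> 'x set \<Rightarrow> 'x \<Rightarrow> bool"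
  where "strongly_pseudoconvex_at \<A> \<Omega> p \<longleftrightarrow>
    (\<exists>W \<kappa> U \<rho> d\<rho> d2\<rho>.
      holomorphic_chart \<A> (W, \<kappa>) \<and> p \<in> W \<and>
      open U \<and> \<kappa> p \<in> U \<and> U \<subseteq> \<kappa> ` W \<and>
      C2_with_derivs \<rho> d\<rho> d2\<rho> U \<and>
      \<kappa> ` (\<Omega> \<inter> W) \<inter> U = {z \<in> U. \<rho> z < 0} \<and>
      \<kappa> ` (frontier \<Omega> \<inter> W) \<inter> U = {z \<in> U. \<rho> z = 0} \<and>
      (\<forall>z \<in> \<kappa> ` (frontier \<Omega> \<inter> W) \<inter> U. d\<rho> z \<noteq> 0) \<and>
      (\<exists>C>0. \<forall>v. del_form (d\<rho> (\<kappa> p)) v = 0 \<longrightarrow> levi_form (d2\<rho> (\<kappa> p)) v \<ge> C * (norm v)\<^sup>2))"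

end

theory Submission
  imports Defs "HOL-Complex_Analysis.Complex_Analysis"
begin

text \<open>
  A quadratic holomorphic change of coordinates pinches \<open>\<Omega>\<close> near \<open>p\<close>, and uniformly near every boundary
  point close to \<open>p\<close>, between two balls tangent to each other whose radii are as close as one likes; a
  Cayley transform turns this into a squeezing of \<open>\<Omega>\<close> near \<open>p\<close> between the unit ball and a ball of radius
  \<open>r\<close> close to 1. There is no compactness in infinite dimensions, so localisation of holomorphic discs at
  \<open>p\<close> (their values stay near \<open>p\<close> once their centre is near \<open>p\<close>) comes from a maximum principle argument
  with a peak function at \<open>p\<close>, and the set \<open>\<Omega>\<close> is exhausted by the points reached from \<open>q\<close> by chains of
  \<open>k\<close> discs rather than by compact sets. Composing the squeezing maps with the automorphisms gives maps
  \<open>G n\<close> with almost inverses \<open>H n\<close>. The transition maps \<open>G k \<circ> H j\<close> fix the origin and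
  map almost the whole ball into the ball in both directions, so they are close to their derivatives there;
  normalising \<open>G n\<close> by these derivatives yields a uniformly Cauchy sequence, whose limit is a biholomorphism
  onto the unit ball of the limit inner product.
\<close>

section \<open>Complex Hilbert spaces\<close>

text \<open>In the maximum principle the trouble is that a maximising sequence of parameters
  converges, but the Hilbert space values of the disc along it may have no limit point. A small
  linear perturbation makes these values converge along every maximising sequence, after which the
  one-variable principle applies. For the sequence \<open>G n\<close> the trouble is that the
  derivatives \<open>E k j\<close> of the transition maps at the origin are almost isometric but may
  turn without settling. They satisfy an exact cocycle rule, so \<open>E 0 n\<close> composed with
  \<open>G n\<close> has the same derivative at \<open>q\<close> for every \<open>n\<close>, and
  only the nonlinear part of a transition is left to estimate. That estimate needs a distance to the
  sphere independent of \<open>n\<close>: one link of a chain of discs shrinks this distance at most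
  by the factor 5, whatever \<open>n\<close> is. Injectivity does not come from a Hurwitz argument.
  The limit map after an approximate inverse is close to the identity together with its derivative
  on a ball of any radius below 1, and this yields injectivity, surjectivity and a holomorphic
  inverse together.\<close>

instance complex_hilbert_space \<subseteq> banach ..

lemma scaleC_zero_right [simp]: "c *\<^sub>C (0::'a::complex_hilbert_space) = 0"
  using scaleC_add_right[of c "0::'a" 0] by simp

lemma scaleC_zero_left [simp]: "0 *\<^sub>C (x::'a::complex_hilbert_space) = 0"
  using scaleC_add_left[of 0 0 x] by simp

lemma scaleC_one [simp]: "1 *\<^sub>C (x::'a::complex_hilbert_space) = x"
  using scaleR_scaleC[of 1 x] by simp

lemma scaleC_minus_right [simp]: "c *\<^sub>C (- x::'a::complex_hilbert_space) = - (c *\<^sub>C x)"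
  using scaleC_add_right[of c x "-x"] by (simp add: eq_neg_iff_add_eq_0 add.commute)

lemma scaleC_minus_left [simp]: "(- c) *\<^sub>C (x::'a::complex_hilbert_space) = - (c *\<^sub>C x)"
  using scaleC_add_left[of c "-c" x] by (simp add: eq_neg_iff_add_eq_0 add.commute)

lemma scaleC_diff_right: "c *\<^sub>C (x - y::'a::complex_hilbert_space) = c *\<^sub>C x - c *\<^sub>C y"
  using scaleC_add_right[of c x "-y"] by simp

lemma scaleC_diff_left: "(c - d) *\<^sub>C (x::'a::complex_hilbert_space) = c *\<^sub>C x - d *\<^sub>C x"
  using scaleC_add_left[of c "-d" x] by simp

lemma scaleC_scaleR_commute: "c *\<^sub>C (r *\<^sub>R (x::'a::complex_hilbert_space)) = r *\<^sub>R (c *\<^sub>C x)"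
  by (simp add: scaleR_scaleC scaleC_scaleC mult.commute)

lemma scaleC_ii_ii [simp]: "\<i> *\<^sub>C \<i> *\<^sub>C (x::'a::complex_hilbert_space) = - x"
  by (simp add: scaleC_scaleC)

lemma scaleC_complex_decomp: "c *\<^sub>C (x::'a::complex_hilbert_space) = Re c *\<^sub>R x + Im c *\<^sub>R (\<i> *\<^sub>C x)"
proof -
  have "c = of_real (Re c) + of_real (Im c) * \<i>"
    by (simp add: complex_eq mult.commute)
  then have "c *\<^sub>C x = (of_real (Re c) + of_real (Im c) * \<i>) *\<^sub>C x" by simp
  then show ?thesis by (simp add: scaleC_add_left scaleR_scaleC scaleC_scaleC)
qed

lemma cinner_add_right: "cinner x (y + z) = cinner x y + cinner x (z::'a::complex_hilbert_space)"
  using cinner_commute[of x "y+z"] cinner_commute[of x y] cinner_commute[of x z]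
  by (simp add: cinner_add_left)

lemma cinner_scaleC_right: "cinner x (c *\<^sub>C y) = cnj c * cinner x (y::'a::complex_hilbert_space)"
  using cinner_commute[of x "c *\<^sub>C y"] cinner_commute[of x y] by (simp add: cinner_scaleC_left)

lemma cinner_zero_left [simp]: "cinner 0 (y::'a::complex_hilbert_space) = 0"
  using cinner_scaleC_left[of 0 0 y] by simp

lemma cinner_zero_right [simp]: "cinner (y::'a::complex_hilbert_space) 0 = 0"
  using cinner_scaleC_right[of y 0 0] by simp

lemma cinner_minus_left [simp]: "cinner (- x) (y::'a::complex_hilbert_space) = - cinner x y"
  using cinner_scaleC_left[of "-1" x y] by simp

lemma cinner_minus_right [simp]: "cinner x (- y::'a::complex_hilbert_space) = - cinner x y"
  using cinner_scaleC_right[of x "-1" y] by simp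

lemma cinner_diff_left: "cinner (x - y) (z::'a::complex_hilbert_space) = cinner x z - cinner y z"
  using cinner_add_left[of x "-y" z] by simp

lemma cinner_diff_right: "cinner x (y - z::'a::complex_hilbert_space) = cinner x y - cinner x z"
  using cinner_add_right[of x y "-z"] by simp

lemma cinner_self: "cinner x x = of_real ((norm (x::'a::complex_hilbert_space))\<^sup>2)"
proof -
  have "Im (cinner x x) = 0"
    using cinner_commute[of x x] by (metis complex_cnj_cancel_iff Reals_cnj_iff complex_is_Real_iff)
  then show ?thesis
    by (simp add: complex_eq_iff power2_norm_eq_inner inner_eq_Re_cinner)
qed

lemma norm_scaleC [simp]: "norm (c *\<^sub>C (x::'a::complex_hilbert_space)) = cmod c * norm x"
proof -
  have "(norm (c *\<^sub>C x))\<^sup>2 = Re (c * cnj c * cinner x x)"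
    by (simp add: power2_norm_eq_inner inner_eq_Re_cinner cinner_scaleC_left cinner_scaleC_right
        mult.assoc mult.left_commute)
  also have "\<dots> = (cmod c * norm x)\<^sup>2"
    by (simp add: cinner_self power_mult_distrib complex_mult_cnj cmod_power2 flip: of_real_mult)
  finally show ?thesis by (simp add: power2_eq_iff_nonneg)
qed

lemma Im_cinner: "Im (cinner x (y::'a::complex_hilbert_space)) = inner x (\<i> *\<^sub>C y)"
  by (simp add: inner_eq_Re_cinner cinner_scaleC_right)

lemma inner_ii_ii [simp]: "inner (\<i> *\<^sub>C x) (\<i> *\<^sub>C (y::'a::complex_hilbert_space)) = inner x y"
  by (simp add: inner_eq_Re_cinner cinner_scaleC_right cinner_scaleC_left)

text \<open>Multiplying \<open>x\<close> by a unimodular scalar makes the inner product real and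
  nonnegative, so the real Cauchy-Schwarz inequality suffices.\<close>

lemma norm_cinner_le: "cmod (cinner x y) \<le> norm x * norm (y::'a::complex_hilbert_space)"
proof (cases "cinner x y = 0")
  case False
  define c where "c = cnj (sgn (cinner x y))"
  have c: "cmod c = 1" using False by (simp add: c_def norm_sgn)
  have "cinner (c *\<^sub>C x) y = of_real (cmod (cinner x y))"
    using False complex_norm_square[of "cinner x y"]
    by (simp add: cinner_scaleC_left c_def sgn_eq field_simps power2_eq_square)
  then have "cmod (cinner x y) = inner (c *\<^sub>C x) y" by (simp add: inner_eq_Re_cinner)
  also have "\<dots> \<le> norm (c *\<^sub>C x) * norm y" by (rule norm_cauchy_schwarz)
  finally show ?thesis by (simp add: c)
qed simp

text \<open>With the scalars as an instance, an analytic disc is a map out of a Hilbert space, and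
  the manifold notions over \<open>hilbert_atlas\<close> apply to it directly.\<close>

instantiation complex :: complex_hilbert_space
begin
definition scaleC_complex :: "complex \<Rightarrow> complex \<Rightarrow> complex" where "scaleC_complex c x = c * x"
definition cinner_complex :: "complex \<Rightarrow> complex \<Rightarrow> complex" where "cinner_complex x y = x * cnj y"
instance
  by standard (auto simp: scaleC_complex_def cinner_complex_def algebra_simps inner_complex_def scaleR_conv_of_real)
end

lemma scaleC_complex [simp]: "c *\<^sub>C (x::complex) = c * x"
  by (simp add: scaleC_complex_def)

lemma cinner_complex [simp]: "cinner x (y::complex) = x * cnj y"
  by (simp add: cinner_complex_def)


section \<open>Bounded complex linear maps\<close>

definition cblinear :: "('a::complex_hilbert_space \<Rightarrow> 'b::complex_hilbert_space) \<Rightarrow> bool"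
  where "cblinear f \<longleftrightarrow> bounded_linear f \<and> (\<forall>c x. f (c *\<^sub>C x) = c *\<^sub>C f x)"

lemma cblinearI:
  assumes "\<And>x y. f (x + y) = f x + f y" "\<And>c x. f (c *\<^sub>C x) = c *\<^sub>C f x"
    "\<And>x. norm (f x) \<le> K * norm x"
  shows "cblinear f"
  unfolding cblinear_def using assms
  by (auto intro!: bounded_linear_intro[where K = K] simp: scaleR_scaleC mult.commute)

lemma cblinear_bounded: "cblinear f \<Longrightarrow> bounded_linear f"
  and cblinear_scaleC: "cblinear f \<Longrightarrow> f (c *\<^sub>C x) = c *\<^sub>C f x"
  by (auto simp: cblinear_def)

lemma cblinear_add: "cblinear f \<Longrightarrow> f (x + y) = f x + f y"
  and cblinear_diff: "cblinear f \<Longrightarrow> f (x - y) = f x - f y"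
  and cblinear_minus: "cblinear f \<Longrightarrow> f (- x) = - f x"
  and cblinear_zero: "cblinear f \<Longrightarrow> f 0 = 0"
  and cblinear_scaleR: "cblinear f \<Longrightarrow> f (r *\<^sub>R x) = r *\<^sub>R f x"
  by (auto simp: cblinear_def linear_simps)

lemmas cblinear_simps = cblinear_add cblinear_diff cblinear_minus cblinear_zero cblinear_scaleC cblinear_scaleR

lemma complex_linear_iff: "cblinear f \<longleftrightarrow> bounded_linear f \<and> complex_linear f"
  by (auto simp: cblinear_def complex_linear_def linear_simps)

lemma cblinear_bound: "cblinear f \<Longrightarrow> \<exists>K>0. \<forall>x. norm (f x) \<le> K * norm x"
  using bounded_linear.pos_bounded[of f] by (auto simp: cblinear_def mult.commute)

lemma cblinear_compose: "cblinear f \<Longrightarrow> cblinear g \<Longrightarrow> cblinear (\<lambda>x. g (f x))"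
  by (auto simp: cblinear_def intro: bounded_linear_compose)

lemma cblinear_id: "cblinear (\<lambda>x. x)" by (auto simp: cblinear_def bounded_linear_ident)
lemma cblinear_const0: "cblinear (\<lambda>x. 0)" by (auto simp: cblinear_def)
lemma cblinear_plus: "cblinear f \<Longrightarrow> cblinear g \<Longrightarrow> cblinear (\<lambda>x. f x + g x)"
  by (auto simp: cblinear_def bounded_linear_add scaleC_add_right)
lemma cblinear_sub: "cblinear f \<Longrightarrow> cblinear g \<Longrightarrow> cblinear (\<lambda>x. f x - g x)"
  by (auto simp: cblinear_def bounded_linear_sub scaleC_diff_right)
lemma cblinear_uminus: "cblinear f \<Longrightarrow> cblinear (\<lambda>x. - f x)"
  by (auto simp: cblinear_def bounded_linear_minus)
lemma cblinear_scaleC_const: "cblinear (\<lambda>x. c *\<^sub>C x)"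
  by (rule cblinearI[where K = "cmod c"]) (auto simp: scaleC_add_right scaleC_scaleC mult.commute)
lemma cblinear_scaleC_left: "cblinear (\<lambda>c. c *\<^sub>C x)"
  by (rule cblinearI[where K = "norm x"]) (auto simp: scaleC_add_left scaleC_scaleC mult.commute)
lemma cblinear_cinner: "cblinear (\<lambda>x. cinner x y)"
  by (rule cblinearI[where K = "norm y"])
     (auto simp: cinner_add_left cinner_scaleC_left norm_cinner_le mult.commute)

lemmas cblinear_intros = cblinear_id cblinear_const0 cblinear_plus cblinear_sub cblinear_uminus
  cblinear_scaleC_const cblinear_scaleC_left cblinear_cinner

lemma bounded_bilinear_scaleC: "bounded_bilinear (\<lambda>c (x::'a::complex_hilbert_space). c *\<^sub>C x)"
  by standard (auto simp: scaleC_add_left scaleC_add_right scaleR_scaleC scaleC_scaleC mult.commute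
      mult.left_commute intro!: exI[of _ 1])

lemmas tendsto_scaleC [tendsto_intros] = bounded_bilinear.tendsto[OF bounded_bilinear_scaleC]
lemmas continuous_on_scaleC [continuous_intros] = bounded_bilinear.continuous_on[OF bounded_bilinear_scaleC]
lemmas has_derivative_scaleC [derivative_intros] = bounded_bilinear.FDERIV[OF bounded_bilinear_scaleC]

subsection \<open>Holomorphic maps between Hilbert spaces\<close>

lemma cholomorphic_onD:
  assumes "cholomorphic_on f S" "x \<in> S"
  obtains D where "cblinear D" "(f has_derivative D) (at x within S)"
  using assms unfolding cholomorphic_on_def complex_linear_iff by (meson has_derivative_bounded_linear)

lemma cholomorphic_on_openD:
  assumes "cholomorphic_on f S" "open S" "x \<in> S"
  obtains D where "cblinear D" "(f has_derivative D) (at x)"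
  using cholomorphic_onD[OF assms(1,3)] at_within_open[OF assms(3,2)] by metis

lemma cholomorphic_onI:
  "(\<And>x. x \<in> S \<Longrightarrow> \<exists>D. cblinear D \<and> (f has_derivative D) (at x within S)) \<Longrightarrow> cholomorphic_on f S"
  unfolding cholomorphic_on_def by (meson complex_linear_iff)

lemma cholomorphic_on_subset: "cholomorphic_on f S \<Longrightarrow> T \<subseteq> S \<Longrightarrow> cholomorphic_on f T"
  unfolding cholomorphic_on_def by (meson has_derivative_subset subsetD)

lemma cholomorphic_on_cong:
  assumes "cholomorphic_on f S" "\<And>x. x \<in> S \<Longrightarrow> f x = g x"
  shows "cholomorphic_on g S"
  using assms unfolding cholomorphic_on_def by (metis has_derivative_transform)

lemma cholomorphic_on_local:
  assumes "\<And>x. x \<in> S \<Longrightarrow> \<exists>V. open V \<and> x \<in> V \<and> cholomorphic_on f (S \<inter> V)"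
  shows "cholomorphic_on f S"
proof (rule cholomorphic_onI)
  fix x assume "x \<in> S"
  then obtain V where V: "open V" "x \<in> V" "cholomorphic_on f (S \<inter> V)" using assms by blast
  then obtain D where D: "cblinear D" "(f has_derivative D) (at x within (S \<inter> V))"
    using \<open>x \<in> S\<close> cholomorphic_onD[of f "S \<inter> V" x] by blast
  have "at x within (S \<inter> V) = at x within S"
    using V by (intro at_within_nhd[of x V]) auto
  with D show "\<exists>D. cblinear D \<and> (f has_derivative D) (at x within S)" by auto
qed

lemma cholomorphic_on_compose:
  assumes "cholomorphic_on f S" "cholomorphic_on g T" "f ` S \<subseteq> T"
  shows "cholomorphic_on (\<lambda>x. g (f x)) S"
proof (rule cholomorphic_onI)
  fix x assume x: "x \<in> S"
  obtain D where D: "cblinear D" "(f has_derivative D) (at x within S)"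
    using cholomorphic_onD[OF assms(1) x] .
  have "f x \<in> T" using x assms by auto
  then obtain D' where D': "cblinear D'" "(g has_derivative D') (at (f x) within T)"
    using cholomorphic_onD[OF assms(2)] by blast
  then have "((\<lambda>x. g (f x)) has_derivative (\<lambda>x. D' (D x))) (at x within S)"
    by (intro has_derivative_in_compose[OF D(2)] has_derivative_subset[OF _ assms(3)])
  then show "\<exists>D. cblinear D \<and> ((\<lambda>x. g (f x)) has_derivative D) (at x within S)"
    using cblinear_compose[OF D(1) D'(1)] by blast
qed

lemma cholomorphic_on_continuous: "cholomorphic_on f S \<Longrightarrow> continuous_on S f"
  unfolding cholomorphic_on_def continuous_on_eq_continuous_within
  by (meson has_derivative_continuous)

lemma cholomorphic_on_cblinear: "cblinear f \<Longrightarrow> cholomorphic_on f S"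
  by (intro cholomorphic_onI exI[of _ f]) (auto intro: bounded_linear_imp_has_derivative cblinear_bounded)

lemma cholomorphic_on_id: "cholomorphic_on (\<lambda>x. x) S"
  by (intro cholomorphic_on_cblinear cblinear_id)

lemma cholomorphic_on_const: "cholomorphic_on (\<lambda>x. c) S"
  by (intro cholomorphic_onI exI[of _ "\<lambda>_. 0"]) (auto intro: cblinear_const0)

lemma cholomorphic_on_add:
  assumes "cholomorphic_on f S" "cholomorphic_on g S"
  shows "cholomorphic_on (\<lambda>x. f x + g x) S"
proof (rule cholomorphic_onI)
  fix x assume x: "x \<in> S"
  obtain D where D: "cblinear D" "(f has_derivative D) (at x within S)"
    using cholomorphic_onD[OF assms(1) x] .
  obtain D' where D': "cblinear D'" "(g has_derivative D') (at x within S)"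
    using cholomorphic_onD[OF assms(2) x] .
  show "\<exists>D. cblinear D \<and> ((\<lambda>x. f x + g x) has_derivative D) (at x within S)"
    by (rule exI, rule conjI[OF cblinear_plus[OF D(1) D'(1)] has_derivative_add[OF D(2) D'(2)]])
qed

lemma cholomorphic_on_diff:
  assumes "cholomorphic_on f S" "cholomorphic_on g S"
  shows "cholomorphic_on (\<lambda>x. f x - g x) S"
proof (rule cholomorphic_onI)
  fix x assume x: "x \<in> S"
  obtain D where D: "cblinear D" "(f has_derivative D) (at x within S)"
    using cholomorphic_onD[OF assms(1) x] .
  obtain D' where D': "cblinear D'" "(g has_derivative D') (at x within S)"
    using cholomorphic_onD[OF assms(2) x] .
  show "\<exists>D. cblinear D \<and> ((\<lambda>x. f x - g x) has_derivative D) (at x within S)"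
    by (rule exI, rule conjI[OF cblinear_sub[OF D(1) D'(1)] has_derivative_diff[OF D(2) D'(2)]])
qed

lemma cholomorphic_on_scaleC:
  assumes "cholomorphic_on f S" "cholomorphic_on g S"
  shows "cholomorphic_on (\<lambda>x. f x *\<^sub>C g x) S"
proof (rule cholomorphic_onI)
  fix x assume x: "x \<in> S"
  obtain D where D: "cblinear D" "(f has_derivative D) (at x within S)"
    using cholomorphic_onD[OF assms(1) x] .
  obtain D' where D': "cblinear D'" "(g has_derivative D') (at x within S)"
    using cholomorphic_onD[OF assms(2) x] .
  have d: "((\<lambda>x. f x *\<^sub>C g x) has_derivative (\<lambda>h. f x *\<^sub>C D' h + D h *\<^sub>C g x)) (at x within S)"
    by (intro has_derivative_scaleC D D')
  have "cblinear (\<lambda>h. f x *\<^sub>C D' h + D h *\<^sub>C g x)"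
    by (intro cblinear_plus cblinear_compose[OF D'(1) cblinear_scaleC_const]
        cblinear_compose[OF D(1) cblinear_scaleC_left])
  with d show "\<exists>D. cblinear D \<and> ((\<lambda>x. f x *\<^sub>C g x) has_derivative D) (at x within S)" by blast
qed

lemma cholomorphic_on_mult:
  fixes f g :: "'a::complex_hilbert_space \<Rightarrow> complex"
  shows "cholomorphic_on f S \<Longrightarrow> cholomorphic_on g S \<Longrightarrow> cholomorphic_on (\<lambda>x. f x * g x) S"
  using cholomorphic_on_scaleC[of f S g] by simp

lemma cblinear_complex: 
  assumes "cblinear (D::complex \<Rightarrow> 'a::complex_hilbert_space)" shows "D c = c *\<^sub>C D 1"
  using cblinear_scaleC[OF assms, of c 1] by simp

text \<open>The bridge to one-variable analysis: vector-valued maps are tested on discs and against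
  functionals such as \<open>\<lambda>x. cinner x w\<close>, and the result is an ordinary
  holomorphic function.\<close>

lemma cholomorphic_on_complex_iff:
  fixes f :: "complex \<Rightarrow> complex"
  shows "cholomorphic_on f S \<longleftrightarrow> f holomorphic_on S"
proof
  assume f: "cholomorphic_on f S"
  show "f holomorphic_on S"
    unfolding holomorphic_on_def field_differentiable_def has_field_derivative_def
  proof
    fix x assume "x \<in> S"
    with f obtain D where D: "cblinear D" "(f has_derivative D) (at x within S)"
      by (rule cholomorphic_onD)
    have "D = (*) (D 1)"
      by (rule ext) (metis cblinear_complex[OF D(1)] scaleC_complex mult.commute)
    with D(2) show "\<exists>f'. (f has_derivative (*) f') (at x within S)" by (intro exI[of _ "D 1"]) simp
  qed
next
  assume f: "f holomorphic_on S"
  show "cholomorphic_on f S"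
  proof (rule cholomorphic_onI)
    fix x assume "x \<in> S"
    with f obtain f' where "(f has_derivative (*) f') (at x within S)"
      unfolding holomorphic_on_def field_differentiable_def has_field_derivative_def by blast
    moreover have "(*) f' = (*\<^sub>C) f'" by (rule ext) simp
    then have "cblinear (\<lambda>h::complex. f' * h)" by (simp only: cblinear_scaleC_const)
    ultimately show "\<exists>D. cblinear D \<and> (f has_derivative D) (at x within S)" by blast
  qed
qed

lemmas cholomorphic_on_intros = cholomorphic_on_id cholomorphic_on_const cholomorphic_on_add
  cholomorphic_on_diff cholomorphic_on_scaleC cholomorphic_on_mult

lemma cholomorphic_on_cblinear_compose:
  "cholomorphic_on f S \<Longrightarrow> cblinear L \<Longrightarrow> cholomorphic_on (\<lambda>x. L (f x)) S"
  by (rule cholomorphic_on_compose[where T = UNIV]) (auto intro: cholomorphic_on_cblinear)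

lemma cholomorphic_on_affine: "cholomorphic_on (\<lambda>\<zeta>. x + \<zeta> *\<^sub>C v) S"
  by (intro cholomorphic_on_intros)

section \<open>Estimates for holomorphic maps\<close>

lemma cholomorphic_slice:
  assumes "cholomorphic_on f S" "cblinear L" "\<And>\<zeta>. \<zeta> \<in> U \<Longrightarrow> x + \<zeta> *\<^sub>C v \<in> S"
  shows "(\<lambda>\<zeta>. L (f (x + \<zeta> *\<^sub>C v)) :: complex) holomorphic_on U"
  unfolding cholomorphic_on_complex_iff[symmetric] using assms
  by (intro cholomorphic_on_cblinear_compose[OF cholomorphic_on_compose[OF cholomorphic_on_affine assms(1)] assms(2)]) auto

lemma cholomorphic_cinner:
  assumes "cholomorphic_on (F::complex \<Rightarrow> 'a::complex_hilbert_space) U"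
  shows "(\<lambda>\<zeta>. cinner (F \<zeta>) w) holomorphic_on U"
  unfolding cholomorphic_on_complex_iff[symmetric]
  by (intro cholomorphic_on_cblinear_compose[OF assms] cblinear_cinner)

text \<open>\<open>k\<close> is \<open>h\<close> followed by the Cayley transform of the right half
  plane that sends \<open>h 0\<close> to the origin. The Schwarz lemma for \<open>k\<close>, read
  for real parts only, is the pair of Harnack inequalities.\<close>

lemma Harnack_aux:
  assumes h: "h holomorphic_on ball 0 1" "\<And>z. cmod z < 1 \<Longrightarrow> Re (h z) > 0" and z: "cmod z < 1"
  shows "(1 - cmod z) * Re (h z) \<le> (1 + cmod z) * Re (h 0)"
    and "(1 - cmod z) * Re (h 0) \<le> (1 + cmod z) * Re (h z)"
proof -
  define k where "k w = (h w - h 0) / (h w + cnj (h 0))" for w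
  have nz: "h w + cnj (h 0) \<noteq> 0" if "cmod w < 1" for w
    using h(2)[OF that] h(2)[of 0] by (auto simp: complex_eq_iff)
  have sq: "(cmod (h w + cnj (h 0)))\<^sup>2 - (cmod (h w - h 0))\<^sup>2 = 4 * Re (h w) * Re (h 0)" for w
    unfolding cmod_power2 by (simp add: power2_eq_square algebra_simps)
  have k1: "cmod (k w) < 1" if "cmod w < 1" for w
  proof -
    have "4 * Re (h w) * Re (h 0) > 0" using h(2)[OF that] h(2)[of 0] by simp
    then have "(cmod (h w - h 0))\<^sup>2 < (cmod (h w + cnj (h 0)))\<^sup>2" using sq[of w] by linarith
    then have "cmod (h w - h 0) < cmod (h w + cnj (h 0))" by (simp add: power2_less_imp_less)
    then show ?thesis by (simp add: k_def norm_divide divide_simps)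
  qed
  have "k holomorphic_on ball 0 1"
    unfolding k_def using nz by (intro holomorphic_intros h(1)) auto
  then have "cmod (k z) \<le> cmod z"
    by (rule Schwarz_Lemma(1)) (use k1 z in \<open>auto simp: k_def[of 0]\<close>)
  then have "cmod (h z - h 0) \<le> cmod z * cmod (h z + cnj (h 0))"
    using nz[OF z] pos_divide_le_eq[of "cmod (h z + cnj (h 0))"] unfolding k_def norm_divide by simp
  then have *: "(cmod (h z - h 0))\<^sup>2 \<le> (cmod z)\<^sup>2 * (cmod (h z + cnj (h 0)))\<^sup>2"
    by (metis norm_ge_zero power_mono power_mult_distrib)
  have r: "(cmod z)\<^sup>2 \<le> 1" using z by (simp add: power_le_one)
  \<comment> \<open>The imaginary part occurs on the right with a factor at most 1, so it can be
    cancelled.\<close>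
  have "(Re (h z) - Re (h 0))\<^sup>2 + (Im (h z) - Im (h 0))\<^sup>2
      \<le> (cmod z)\<^sup>2 * (Re (h z) + Re (h 0))\<^sup>2 + (cmod z)\<^sup>2 * (Im (h z) - Im (h 0))\<^sup>2"
    using * by (simp add: cmod_power2 algebra_simps)
  moreover have "(cmod z)\<^sup>2 * (Im (h z) - Im (h 0))\<^sup>2 \<le> 1 * (Im (h z) - Im (h 0))\<^sup>2"
    using r by (intro mult_right_mono) auto
  ultimately have "(Re (h z) - Re (h 0))\<^sup>2 \<le> (cmod z * (Re (h z) + Re (h 0)))\<^sup>2"
    by (simp add: power_mult_distrib)
  then have "\<bar>Re (h z) - Re (h 0)\<bar> \<le> cmod z * (Re (h z) + Re (h 0))"
    using h(2)[OF z] h(2)[of 0] abs_le_square_iff[of "Re (h z) - Re (h 0)" "cmod z * (Re (h z) + Re (h 0))"]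
    by (simp add: abs_mult)
  then have "\<bar>Re (h z) - Re (h 0)\<bar> \<le> cmod z * Re (h z) + cmod z * Re (h 0)"
    by (simp only: distrib_left)
  then show "(1 - cmod z) * Re (h z) \<le> (1 + cmod z) * Re (h 0)"
    "(1 - cmod z) * Re (h 0) \<le> (1 + cmod z) * Re (h z)"
    unfolding left_diff_distrib distrib_right by linarith+
qed

text \<open>The strict case applied to \<open>h + e\<close>; then \<open>e\<close> tends to 0 from
  the right.\<close>

lemma Harnack:
  assumes h: "h holomorphic_on ball 0 1" "\<And>z. cmod z < 1 \<Longrightarrow> Re (h z) \<ge> 0" and z: "cmod z < 1"
  shows "(1 - cmod z) * Re (h z) \<le> (1 + cmod z) * Re (h 0)"
    and "(1 - cmod z) * Re (h 0) \<le> (1 + cmod z) * Re (h z)"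
proof -
  have *: "(1 - cmod z) * (Re (h z) + e) \<le> (1 + cmod z) * (Re (h 0) + e) \<and>
    (1 - cmod z) * (Re (h 0) + e) \<le> (1 + cmod z) * (Re (h z) + e)" if "e > 0" for e
  proof -
    have "(\<lambda>z. h z + of_real e) holomorphic_on ball 0 1" by (intro holomorphic_intros h(1))
    moreover have "\<And>z. cmod z < 1 \<Longrightarrow> Re (h z + of_real e) > 0" using h(2) that by (simp add: add_nonneg_pos)
    ultimately show ?thesis using Harnack_aux[of "\<lambda>z. h z + of_real e" z] z by simp
  qed
  have **: "a \<le> b" if "\<And>e::real. e > 0 \<Longrightarrow> a + c * e \<le> b + d * e" for a b c d :: real
  proof -
    have "((\<lambda>e. a + c * e) \<longlongrightarrow> a + c * 0) (at_right 0)" "((\<lambda>e. b + d * e) \<longlongrightarrow> b + d * 0) (at_right 0)"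
      by (intro tendsto_intros)+
    then show ?thesis
      by (intro tendsto_le[of "at_right 0" "\<lambda>e. b + d * e" b "\<lambda>e. a + c * e" a])
         (auto simp: eventually_at_filter that)
  qed
  show "(1 - cmod z) * Re (h z) \<le> (1 + cmod z) * Re (h 0)"
    by (rule **[of _ "1 - cmod z" _ "1 + cmod z"]) (use * in \<open>simp add: algebra_simps\<close>)
  show "(1 - cmod z) * Re (h 0) \<le> (1 + cmod z) * Re (h z)"
    by (rule **[of _ "1 - cmod z" _ "1 + cmod z"]) (use * in \<open>simp add: algebra_simps\<close>)
qed

text \<open>Only the component of \<open>F\<close> in the direction of \<open>F z\<close> matters at
  \<open>z\<close>, and for that scalar function the classical Schwarz lemma applies.\<close>

lemma Schwarz_hilbert:
  fixes F :: "complex \<Rightarrow> 'a::complex_hilbert_space"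
  assumes F: "cholomorphic_on F (ball 0 R)" "F 0 = 0" "\<And>z. cmod z < R \<Longrightarrow> norm (F z) \<le> M"
    and z: "cmod z < R"
  shows "norm (F z) * R \<le> M * cmod z"
proof (cases "F z = 0")
  case True
  have "0 \<le> M" using F(3)[OF z] norm_ge_zero order_trans by blast
  then show ?thesis using True by simp
next
  case False
  then have z0: "z \<noteq> 0" using F by auto
  have R: "R > 0" using z by (meson norm_ge_zero le_less_trans)
  define w where "w = F z /\<^sub>R norm (F z)"
  have w: "norm w = 1" using False by (simp add: w_def)
  \<comment> \<open>The scalar lemma wants values strictly inside the unit disc, hence the division
    by an arbitrary \<open>M'\<close> above \<open>M\<close>.\<close>
  have "norm (F z) * R / cmod z \<le> M"
  proof (rule dense_ge)
    fix M' assume M': "M < M'"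
    have "M \<ge> 0" using F(3)[OF z] norm_ge_zero order_trans by blast
    then have M'0: "M' > 0" using M' by simp
    define h where "h \<zeta> = cinner (F (of_real R * \<zeta>)) w / of_real M'" for \<zeta>
    have inR: "cmod (of_real R * \<zeta>) < R" if "cmod \<zeta> < 1" for \<zeta>
      using that R by (simp add: norm_mult)
    have "(\<lambda>\<zeta>. cinner (F (of_real R * \<zeta>)) w) holomorphic_on ball 0 1"
      using inR by (intro holomorphic_on_compose_gen[OF _ cholomorphic_cinner[OF F(1)], unfolded o_def])
         (auto intro!: holomorphic_intros)
    then have "h holomorphic_on ball 0 1"
      unfolding h_def using M'0 by (intro holomorphic_intros) auto
    moreover have "cmod (h \<zeta>) < 1" if "cmod \<zeta> < 1" for \<zeta>
    proof -
      have "cmod (cinner (F (of_real R * \<zeta>)) w) \<le> norm (F (of_real R * \<zeta>))"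
        using norm_cinner_le[of "F (of_real R * \<zeta>)" w] w by simp
      also have "\<dots> \<le> M" using F(3)[OF inR[OF that]] .
      finally show ?thesis using M' M'0 by (simp add: h_def norm_divide)
    qed
    moreover have "cmod (z / of_real R) < 1" using z R by (simp add: norm_divide)
    moreover have "h 0 = 0" using F(2) by (simp add: h_def)
    ultimately have "cmod (h (z / of_real R)) \<le> cmod (z / of_real R)" by (intro Schwarz_Lemma(1)) auto
    moreover have "cinner (F z) w = of_real (norm (F z))"
      using False by (simp add: w_def scaleR_scaleC cinner_scaleC_right cinner_self power2_eq_square)
    then have "h (z / of_real R) = of_real (norm (F z) / M')"
      using R by (simp add: h_def)
    ultimately have "norm (F z) / M' \<le> cmod z / R"
      using R M'0 by (simp add: norm_divide)
    then show "norm (F z) * R / cmod z \<le> M'" using R M'0 z0 by (simp add: field_simps)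
  qed
  then show ?thesis using z0 by (simp add: field_simps)
qed

text \<open>The Schwarz lemma delivers bounds of the form \<open>K * t\<close> along a ray; this
  converts them into bounds for the derivative in the direction of the ray.\<close>

lemma derivative_norm_bound:
  fixes f :: "'a::real_normed_vector \<Rightarrow> 'b::real_normed_vector"
  assumes D: "(f has_derivative D) (at x)" and L: "bounded_linear L" and "\<delta> > 0"
    and b: "\<And>t. 0 < t \<Longrightarrow> t < \<delta> \<Longrightarrow> norm (L (f (x + t *\<^sub>R v) - f x)) \<le> K * t"
  shows "norm (L (D v)) \<le> K"
proof -
  interpret L: bounded_linear L by (rule L)
  interpret D: bounded_linear D by (rule has_derivative_bounded_linear[OF D])
  have "((\<lambda>t. x + t *\<^sub>R v) has_derivative (\<lambda>t. t *\<^sub>R v)) (at 0)"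
    by (auto intro!: derivative_eq_intros)
  moreover have "(f has_derivative D) (at (x + 0 *\<^sub>R v))" using D by simp
  ultimately have "((\<lambda>t. f (x + t *\<^sub>R v)) has_derivative (\<lambda>t. D (t *\<^sub>R v))) (at 0)"
    by (rule has_derivative_compose[of "\<lambda>t. x + t *\<^sub>R v" "\<lambda>t. t *\<^sub>R v" 0 UNIV f D])
  then have "((\<lambda>t. L (f (x + t *\<^sub>R v))) has_derivative (\<lambda>t. L (D (t *\<^sub>R v)))) (at 0)"
    using L.has_derivative by blast
  then have "((\<lambda>t. norm (L (f (x + t *\<^sub>R v)) - L (f x) - t *\<^sub>R L (D v)) / norm t) \<longlongrightarrow> 0) (at 0)"
    unfolding has_derivative_at by (simp add: L.scaleR D.scaleR)
  then have "((\<lambda>t. K + norm (L (f (x + t *\<^sub>R v)) - L (f x) - t *\<^sub>R L (D v)) / norm t) \<longlongrightarrow> K + 0) (at_right 0)"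
    by (rule tendsto_add[OF tendsto_const tendsto_within_subset[OF _ subset_UNIV]])
  then have "norm (L (D v)) \<le> K + 0"
  proof (rule tendsto_lowerbound)
    have "\<forall>\<^sub>F t in at_right 0. 0 < t \<and> t < \<delta>"
      using \<open>\<delta> > 0\<close> by (auto simp: eventually_at_right_field)
    then show "\<forall>\<^sub>F t in at_right 0. norm (L (D v))
        \<le> K + norm (L (f (x + t *\<^sub>R v)) - L (f x) - t *\<^sub>R L (D v)) / norm t"
    proof eventually_elim
      case (elim t)
      let ?d = "L (f (x + t *\<^sub>R v)) - L (f x)"
      have "t * norm (L (D v)) = norm (t *\<^sub>R L (D v))" using elim by simp
      also have "\<dots> \<le> norm ?d + norm (?d - t *\<^sub>R L (D v))"
        using norm_triangle_ineq4[of ?d "?d - t *\<^sub>R L (D v)"] by simp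
      also have "norm ?d \<le> K * t" using b[of t] elim by (simp add: L.diff)
      finally show ?case using elim by (simp add: field_simps)
    qed
  qed simp
  then show ?thesis by simp
qed

text \<open>Applied to slices, the Schwarz lemma replaces Cauchy's estimates; the constant is irrelevant.\<close>

lemma Cauchy_estimate:
  fixes f :: "'a::complex_hilbert_space \<Rightarrow> 'b::complex_hilbert_space"
  assumes f: "cholomorphic_on f (ball x R)" "\<And>y. y \<in> ball x R \<Longrightarrow> norm (f y) \<le> M"
    and D: "(f has_derivative D) (at x)" and R: "R > 0"
  shows "norm (D v) \<le> 2 * M / R * norm v"
proof (cases "v = 0")
  case True
  then show ?thesis using linear_0[OF has_derivative_linear[OF D]] by simp
next
  case False
  define u where "u = v /\<^sub>R norm v"
  have u: "norm u = 1" using False by (simp add: u_def)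
  \<comment> \<open>Subtracting the value at the centre makes the slice vanish at 0 and doubles its
    bound, whence the factor 2.\<close>
  define F where "F \<zeta> = f (x + \<zeta> *\<^sub>C u) - f x" for \<zeta>
  have inb: "x + \<zeta> *\<^sub>C u \<in> ball x R" if "cmod \<zeta> < R" for \<zeta>
    using that u by (simp add: dist_norm)
  have F: "cholomorphic_on F (ball 0 R)"
    unfolding F_def using inb
    by (intro cholomorphic_on_diff cholomorphic_on_const cholomorphic_on_compose[OF cholomorphic_on_affine f(1)]) auto
  have Fb: "norm (F \<zeta>) \<le> 2 * M" if "cmod \<zeta> < R" for \<zeta>
    using norm_triangle_ineq4[of "f (x + \<zeta> *\<^sub>C u)" "f x"] f(2)[OF inb[OF that]] f(2)[of x] R
    by (simp add: F_def)
  have "norm ((\<lambda>y. y) (D u)) \<le> 2 * M / R"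
  proof (rule derivative_norm_bound[OF D bounded_linear_ident R])
    fix t :: real assume t: "0 < t" "t < R"
    have "norm (F (of_real t)) * R \<le> 2 * M * cmod (of_real t)"
      by (rule Schwarz_hilbert[OF F _ Fb]) (use t in \<open>auto simp: F_def\<close>)
    then show "norm (f (x + t *\<^sub>R u) - f x) \<le> 2 * M / R * t"
      using t R by (simp add: F_def scaleR_scaleC field_simps)
  qed
  moreover have "D v = norm v *\<^sub>R D u"
    using False linear_cmul[OF has_derivative_linear[OF D], of "norm v" u] by (simp add: u_def)
  ultimately show ?thesis
    using mult_left_mono[of "norm (D u)" "2 * M / R" "norm v"] by (simp add: mult.commute)
qed

text \<open>Harnack for \<open>1 - cinner (F \<zeta>) (F 0)\<close>. Twice its real part dominates
  the squared distance of \<open>F \<zeta>\<close> from \<open>F 0\<close>, because both vectors lie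
  in the closed unit ball.\<close>

lemma hilbert_near_constant:
  fixes F :: "complex \<Rightarrow> 'a::complex_hilbert_space"
  assumes F: "cholomorphic_on F (ball 0 1)" "\<And>z. cmod z < 1 \<Longrightarrow> norm (F z) \<le> 1" and z: "cmod z < 1"
  shows "(1 - cmod z) * (norm (F z - F 0))\<^sup>2 \<le> 2 * (1 + cmod z) * (1 - (norm (F 0))\<^sup>2)"
proof -
  define h where "h \<zeta> = 1 - cinner (F \<zeta>) (F 0)" for \<zeta>
  have hol: "h holomorphic_on ball 0 1"
    unfolding h_def by (intro holomorphic_intros cholomorphic_cinner F(1))
  have f0: "norm (F 0) \<le> 1" using F(2)[of 0] by simp
  have "Re (h \<zeta>) \<ge> 0" if "cmod \<zeta> < 1" for \<zeta>
  proof -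
    have "Re (cinner (F \<zeta>) (F 0)) \<le> norm (F \<zeta>) * norm (F 0)"
      using norm_cinner_le[of "F \<zeta>" "F 0"] complex_Re_le_cmod order_trans by blast
    also have "\<dots> \<le> 1 * 1" using F(2)[OF that] f0 by (intro mult_mono) auto
    finally show ?thesis by (simp add: h_def)
  qed
  note H = Harnack(1)[OF hol this z]
  have "(norm (F z - F 0))\<^sup>2 = (norm (F z))\<^sup>2 + (norm (F 0))\<^sup>2 - 2 * Re (cinner (F z) (F 0))"
    by (simp add: power2_norm_eq_inner inner_diff_left inner_diff_right inner_commute flip: inner_eq_Re_cinner)
  also have "\<dots> \<le> 2 * Re (h z)"
  proof -
    have "(norm (F z))\<^sup>2 \<le> 1" "(norm (F 0))\<^sup>2 \<le> 1" using F(2)[OF z] f0 by (auto simp: power_le_one)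
    then show ?thesis by (simp add: h_def)
  qed
  finally have "(1 - cmod z) * (norm (F z - F 0))\<^sup>2 \<le> (1 - cmod z) * (2 * Re (h z))"
    using z by (intro mult_left_mono) auto
  also have "\<dots> \<le> 2 * ((1 + cmod z) * Re (h 0))" using H by simp
  also have "Re (h 0) = 1 - (norm (F 0))\<^sup>2" by (simp add: h_def cinner_self)
  finally show ?thesis by (simp only: mult.assoc)
qed

text \<open>Harnack for the component of \<open>F\<close> along \<open>F z\<close>. The bound is
  linear in the distance to the unit sphere, so it can be iterated along a chain of discs.\<close>

lemma hilbert_Schwarz_Pick:
  fixes F :: "complex \<Rightarrow> 'a::complex_hilbert_space"
  assumes F: "cholomorphic_on F (ball 0 1)" "\<And>z. cmod z < 1 \<Longrightarrow> norm (F z) \<le> 1" and z: "cmod z < 1"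
  shows "(1 - cmod z) * (1 - norm (F 0)) \<le> (1 + cmod z) * (1 - norm (F z))"
proof -
  define w where "w = F z /\<^sub>R norm (F z)"
  have w: "norm w \<le> 1" by (cases "F z = 0") (simp_all add: w_def)
  define h where "h \<zeta> = 1 - cinner (F \<zeta>) w" for \<zeta>
  have hol: "h holomorphic_on ball 0 1"
    unfolding h_def by (intro holomorphic_intros cholomorphic_cinner F(1))
  have le: "Re (cinner (F \<zeta>) w) \<le> norm (F \<zeta>)" if "cmod \<zeta> < 1" for \<zeta>
  proof -
    have "Re (cinner (F \<zeta>) w) \<le> norm (F \<zeta>) * norm w"
      using norm_cinner_le[of "F \<zeta>" w] complex_Re_le_cmod order_trans by blast
    also have "\<dots> \<le> norm (F \<zeta>) * 1" using w by (intro mult_left_mono) auto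
    finally show ?thesis by simp
  qed
  have "Re (h \<zeta>) \<ge> 0" if "cmod \<zeta> < 1" for \<zeta>
    using le[OF that] F(2)[OF that] by (simp add: h_def)
  note H = Harnack(2)[OF hol this z]
  have "Re (cinner (F z) w) = norm (F z)"
    by (cases "F z = 0") (simp_all add: w_def scaleR_scaleC cinner_scaleC_right cinner_self power2_eq_square)
  then have 1: "Re (h z) = 1 - norm (F z)" by (simp add: h_def)
  have "(1 - cmod z) * (1 - norm (F 0)) \<le> (1 - cmod z) * Re (h 0)"
    using le[of 0] z by (intro mult_left_mono) (auto simp: h_def)
  with H 1 show ?thesis by simp
qed

text \<open>For points of the half ball, Cauchy estimates on balls of radius \<open>R / 2\<close>
  turn the uniform Cauchy property of the maps into one for the derivatives; complex homogeneity of
  the derivative then passes to the limit.\<close>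

lemma cholomorphic_limit:
  fixes f :: "nat \<Rightarrow> 'a::complex_hilbert_space \<Rightarrow> 'b::complex_hilbert_space"
  assumes hol: "\<And>n. n \<ge> N \<Longrightarrow> cholomorphic_on (f n) (ball x0 R)" and R: "R > 0"
    and cau: "\<And>e. e > 0 \<Longrightarrow> \<exists>M. \<forall>m\<ge>M. \<forall>n\<ge>M. \<forall>x\<in>ball x0 R. norm (f m x - f n x) \<le> e"
    and lim: "\<And>x. x \<in> ball x0 R \<Longrightarrow> (\<lambda>n. f n x) \<longlonglongrightarrow> g x"
  shows "cholomorphic_on g (ball x0 (R / 2))"
proof -
  define S where "S = ball x0 (R / 2)"
  define F where "F n = f (n + N)" for n
  have SR: "S \<subseteq> ball x0 R" using R by (auto simp: S_def)
  have ex: "\<exists>D. cblinear D \<and> (F n has_derivative D) (at x)" if "x \<in> S" for n x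
  proof -
    have "x \<in> ball x0 R" using that SR by blast
    then obtain D where "cblinear D" "(f (n + N) has_derivative D) (at x)"
      using cholomorphic_on_openD[OF hol[of "n + N"] open_ball] by auto
    then show ?thesis unfolding F_def by blast
  qed
  define D where "D n x = (SOME D. cblinear D \<and> (F n has_derivative D) (at x))" for n x
  have D: "cblinear (D n x)" "(F n has_derivative D n x) (at x)" if "x \<in> S" for n x
    using someI_ex[OF ex[OF that, of n]] unfolding D_def by blast+
  have cD: "\<exists>M. \<forall>m\<ge>M. \<forall>n\<ge>M. \<forall>x\<in>S. \<forall>h. norm (D m x h - D n x h) \<le> e * norm h" if "e > 0" for e
  proof -
    have "e * R / 4 > 0" using that R by simp
    then obtain M where M: "\<And>m n x. m \<ge> M \<Longrightarrow> n \<ge> M \<Longrightarrow> x \<in> ball x0 R \<Longrightarrow> norm (f m x - f n x) \<le> e * R / 4"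
      using cau[of "e * R / 4"] by blast
    have "norm (D m x h - D n x h) \<le> e * norm h" if m: "m \<ge> M" "n \<ge> M" and x: "x \<in> S" for m n x h
    proof -
      have sub: "ball x (R / 2) \<subseteq> ball x0 R"
      proof
        fix y assume "y \<in> ball x (R / 2)"
        then show "y \<in> ball x0 R" using x dist_triangle[of x0 y x] by (simp add: S_def)
      qed
      have "norm (D m x h - D n x h) \<le> 2 * (e * R / 4) / (R / 2) * norm h"
      proof (rule Cauchy_estimate[of "\<lambda>y. F m y - F n y" x "R / 2"])
        show "cholomorphic_on (\<lambda>y. F m y - F n y) (ball x (R / 2))"
          unfolding F_def by (intro cholomorphic_on_diff cholomorphic_on_subset[OF hol sub]) auto
        show "norm (F m y - F n y) \<le> e * R / 4" if "y \<in> ball x (R / 2)" for y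
          unfolding F_def using M[of "m + N" "n + N" y] m that sub by auto
        show "((\<lambda>y. F m y - F n y) has_derivative (\<lambda>h. D m x h - D n x h)) (at x)"
          by (intro has_derivative_diff D x)
      qed (use R in auto)
      also have "2 * (e * R / 4) / (R / 2) = e" using R by (simp add: field_simps)
      finally show ?thesis .
    qed
    then show ?thesis by blast
  qed
  have "\<exists>l. (\<lambda>n. D n x h) \<longlonglongrightarrow> l" if x: "x \<in> S" for x h
  proof -
    have "Cauchy (\<lambda>n. D n x h)"
    proof (rule CauchyI)
      fix e :: real assume "e > 0"
      have h1: "norm h + 1 > 0" by (simp add: add_nonneg_pos)
      with \<open>e > 0\<close> have "e / (norm h + 1) > 0" by simp
      from cD[OF this] obtain M where M: "\<forall>m\<ge>M. \<forall>n\<ge>M. \<forall>x\<in>S. \<forall>k. norm (D m x k - D n x k) \<le> e / (norm h + 1) * norm k"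
        by blast
      have "e / (norm h + 1) * norm h < e"
        using \<open>e > 0\<close> h1 by (simp add: field_simps)
      then show "\<exists>M. \<forall>m\<ge>M. \<forall>n\<ge>M. norm (D m x h - D n x h) < e"
        using M x by (meson le_less_trans)
    qed
    then show ?thesis by (simp add: Cauchy_convergent_iff convergent_def)
  qed
  then obtain g' where g': "\<And>x h. x \<in> S \<Longrightarrow> (\<lambda>n. D n x h) \<longlonglongrightarrow> g' x h" by metis
  have "\<exists>g. \<forall>x\<in>S. (\<lambda>n. F n x) \<longlonglongrightarrow> g x \<and> (g has_derivative g' x) (at x within S)"
  proof (rule has_derivative_sequence[where ?x0.0 = x0 and l = "g x0"])
    show "convex S" by (simp add: S_def)
    show "(F n has_derivative D n x) (at x within S)" if "x \<in> S" for n x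
      using D(2)[OF that] by (rule has_derivative_at_withinI)
    show "x0 \<in> S" using R by (simp add: S_def)
    show "(\<lambda>n. F n x0) \<longlonglongrightarrow> g x0"
      unfolding F_def using LIMSEQ_ignore_initial_segment[OF lim[of x0]] R by simp
    fix e :: real assume "e > 0"
    then obtain M where M: "\<And>m n x h. m \<ge> M \<Longrightarrow> n \<ge> M \<Longrightarrow> x \<in> S \<Longrightarrow> norm (D m x h - D n x h) \<le> e * norm h"
      using cD by meson
    have "norm (D n x h - g' x h) \<le> e * norm h" if "n \<ge> M" "x \<in> S" for n x h
    proof (rule LIMSEQ_le_const2)
      show "(\<lambda>m. norm (D n x h - D m x h)) \<longlonglongrightarrow> norm (D n x h - g' x h)"
        by (intro tendsto_intros g' that)
      show "\<exists>N. \<forall>m\<ge>N. norm (D n x h - D m x h) \<le> e * norm h" using M that by blast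
    qed
    then show "\<forall>\<^sub>F n in sequentially. \<forall>x\<in>S. \<forall>h. norm (D n x h - g' x h) \<le> e * norm h"
      unfolding eventually_sequentially by blast
  qed
  then obtain g0 where g0: "\<And>x. x \<in> S \<Longrightarrow> (\<lambda>n. F n x) \<longlonglongrightarrow> g0 x"
    "\<And>x. x \<in> S \<Longrightarrow> (g0 has_derivative g' x) (at x within S)" by blast
  have eq: "g0 x = g x" if "x \<in> S" for x
  proof (rule LIMSEQ_unique[OF g0(1)[OF that]])
    show "(\<lambda>n. F n x) \<longlonglongrightarrow> g x"
      unfolding F_def using lim[of x] that SR by (intro LIMSEQ_ignore_initial_segment) auto
  qed
  have "cholomorphic_on g0 S"
  proof (rule cholomorphic_onI)
    fix x assume x: "x \<in> S"
    have "g' x (c *\<^sub>C h) = c *\<^sub>C g' x h" for c h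
    proof (rule LIMSEQ_unique[OF g'[OF x]])
      have "(\<lambda>n. c *\<^sub>C D n x h) \<longlonglongrightarrow> c *\<^sub>C g' x h" by (intro tendsto_intros g' x)
      then show "(\<lambda>n. D n x (c *\<^sub>C h)) \<longlonglongrightarrow> c *\<^sub>C g' x h"
        by (simp add: cblinear_scaleC[OF D(1)[OF x]])
    qed
    then have "cblinear (g' x)"
      unfolding cblinear_def using g0(2)[OF x] has_derivative_bounded_linear by blast
    then show "\<exists>D. cblinear D \<and> (g0 has_derivative D) (at x within S)" using g0(2)[OF x] by blast
  qed
  then show ?thesis using eq cholomorphic_on_cong unfolding S_def by blast
qed

section \<open>Maps close to the identity\<close>

text \<open>Solving \<open>D x = y\<close> is finding a fixed point of
  \<open>\<lambda>x. x - D x + y\<close>, a contraction with constant 1/2 by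
  \<open>near\<close>.\<close>

lemma cblinear_near_id_inverse:
  fixes D :: "'a::complex_hilbert_space \<Rightarrow> 'a"
  assumes D: "cblinear D" and near: "\<And>v. norm (D v - v) \<le> norm v / 2"
  shows "\<exists>D'. cblinear D' \<and> D' \<circ> D = id \<and> (\<forall>v. norm (D' v) \<le> 2 * norm v)"
proof -
  have lower: "norm v \<le> 2 * norm (D v)" for v
    using near[of v] norm_triangle_ineq2[of v "v - D v"] by (simp add: norm_minus_commute)
  have "\<exists>!x. D x = y" for y
  proof -
    have "\<exists>!x. x - D x + y = x"
    proof (rule banach_fix_type[of "1/2"])
      show "\<forall>x z. dist (x - D x + y) (z - D z + y) \<le> 1 / 2 * dist x z"
      proof (intro allI)
        fix x z
        have "dist (x - D x + y) (z - D z + y) = norm (D (x - z) - (x - z))"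
          by (simp add: dist_norm cblinear_diff[OF D] norm_minus_commute algebra_simps)
        then show "dist (x - D x + y) (z - D z + y) \<le> 1 / 2 * dist x z"
          using near[of "x - z"] by (simp add: dist_norm)
      qed
    qed auto
    moreover have "x - D x + y = x \<longleftrightarrow> D x = y" for x by (auto simp: algebra_simps)
    ultimately show ?thesis by simp
  qed
  then obtain D' where D': "\<And>y. D (D' y) = y" and uniq: "\<And>x y. D x = y \<Longrightarrow> x = D' y" by metis
  have "cblinear D'"
  proof (rule cblinearI)
    show "D' (x + y) = D' x + D' y" for x y
      by (rule uniq[symmetric]) (simp add: cblinear_add[OF D] D')
    show "D' (c *\<^sub>C x) = c *\<^sub>C D' x" for c x
      by (rule uniq[symmetric]) (simp add: cblinear_scaleC[OF D] D')
    show "norm (D' x) \<le> 2 * norm x" for x using lower[of "D' x"] D' by simp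
  qed
  moreover have "D' \<circ> D = id" using uniq by (auto simp: fun_eq_iff)
  moreover have "norm (D' x) \<le> 2 * norm x" for x using lower[of "D' x"] D' by simp
  ultimately show ?thesis by blast
qed

text \<open>A quantitative inverse function theorem. Everything follows from \<open>f x - x\<close>
  being 1/2-Lipschitz on the convex set \<open>X\<close>; in particular the radius of solvability is
  explicit, which later gives both surjectivity of the limit map and the image of the adapted
  chart.\<close>

lemma near_identity:
  fixes f :: "'a::complex_hilbert_space \<Rightarrow> 'a"
  assumes X: "open X" "convex X" and f: "cholomorphic_on f X"
    and near: "\<And>x D v. x \<in> X \<Longrightarrow> (f has_derivative D) (at x) \<Longrightarrow> norm (D v - v) \<le> norm v / 2"
  shows near_identity_Lipschitz:
      "\<And>x y. x \<in> X \<Longrightarrow> y \<in> X \<Longrightarrow> norm ((f x - x) - (f y - y)) \<le> norm (x - y) / 2" (is "PROP ?L")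
    and near_identity_inj: "inj_on f X"
    and near_identity_solve: "\<And>x e y. cball x e \<subseteq> X \<Longrightarrow> norm (y - f x) \<le> e / 2 \<Longrightarrow> y \<in> f ` cball x e"
      (is "PROP ?S")
    and near_identity_open: "open (f ` X)"
    and near_identity_inverse: "cholomorphic_on (inv_into X f) (f ` X)"
proof -
  have "\<exists>D. cblinear D \<and> (f has_derivative D) (at x)" if "x \<in> X" for x
    using cholomorphic_on_openD[OF f X(1) that] by blast
  then obtain D where D: "\<And>x. x \<in> X \<Longrightarrow> cblinear (D x)" "\<And>x. x \<in> X \<Longrightarrow> (f has_derivative D x) (at x)"
    by metis
  show L: "PROP ?L"
  proof -
    fix x y assume xy: "x \<in> X" "y \<in> X"
    have "norm ((f x - x) - (f y - y)) \<le> 1 / 2 * norm (x - y)"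
    proof (rule differentiable_bound[OF X(2) _ _ xy, where f' = "\<lambda>x v. D x v - v" and f = "\<lambda>x. f x - x"])
      show "((\<lambda>x. f x - x) has_derivative (\<lambda>v. D x v - v)) (at x within X)" if "x \<in> X" for x
        by (intro has_derivative_diff has_derivative_at_withinI[OF D(2)] has_derivative_ident that)
      show "onorm (\<lambda>v. D x v - v) \<le> 1 / 2" if "x \<in> X" for x
        by (rule onorm_bound) (use near[OF that D(2)[OF that]] in auto)
    qed
    then show "norm ((f x - x) - (f y - y)) \<le> norm (x - y) / 2" by simp
  qed
  have lower: "norm (x - y) \<le> 2 * norm (f x - f y)" if "x \<in> X" "y \<in> X" for x y
  proof -
    have "norm (x - y) \<le> norm (f x - f y) + norm ((f x - x) - (f y - y))"
      using norm_triangle_ineq4[of "f x - f y" "(f x - x) - (f y - y)"] by (simp add: algebra_simps)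
    with L[OF that] show ?thesis by simp
  qed
  show inj: "inj_on f X"
  proof (rule inj_onI)
    fix x y assume "x \<in> X" "y \<in> X" "f x = f y"
    then show "x = y" using lower[of x y] by simp
  qed
  show S: "PROP ?S"
  proof -
    fix x e y assume sub: "cball x e \<subseteq> X" and y: "norm (y - f x) \<le> e / 2"
    have e: "e \<ge> 0" using y norm_ge_zero[of "y - f x"] by linarith
    \<comment> \<open>Half of \<open>e\<close> pays for the Lipschitz constant 1/2 and the other
      half for the distance of \<open>y\<close> from \<open>f x\<close>, so the closed ball is
      mapped into itself.\<close>
    have "\<exists>!z. z \<in> cball x e \<and> z - f z + y = z"
    proof (rule Banach_fix[of "cball x e" "1/2" "\<lambda>z. z - f z + y"])
      show "complete (cball x e)" by (simp add: complete_eq_closed)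
      show "(\<lambda>z. z - f z + y) ` cball x e \<subseteq> cball x e"
      proof safe
        fix z assume z: "z \<in> cball x e"
        have "norm (x - (z - f z + y)) \<le> norm ((f z - z) - (f x - x)) + norm (y - f x)"
          using norm_triangle_ineq4[of "(f z - z) - (f x - x)" "y - f x"] by (simp add: algebra_simps)
        also have "norm ((f z - z) - (f x - x)) \<le> norm (z - x) / 2"
          using z e sub by (intro L) auto
        also have "norm (z - x) \<le> e" using z by (simp add: dist_norm norm_minus_commute)
        finally show "z - f z + y \<in> cball x e" using y by (simp add: dist_norm)
      qed
      fix z z' assume "z \<in> cball x e" "z' \<in> cball x e"
      then have "norm ((f z - z) - (f z' - z')) \<le> norm (z - z') / 2" using sub by (intro L) auto
      moreover have "norm (z - f z + y - (z' - f z' + y)) = norm ((f z - z) - (f z' - z'))"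
        by (subst norm_minus_commute) (simp add: algebra_simps)
      ultimately show "dist (z - f z + y) (z' - f z' + y) \<le> 1 / 2 * dist z z'"
        by (simp add: dist_norm)
    qed (use e in auto)
    then obtain z where "z \<in> cball x e" "z - f z + y = z" by auto
    then have "z \<in> cball x e" "f z = y" by (simp_all add: algebra_simps)
    then show "y \<in> f ` cball x e" by blast
  qed
  show op: "open (f ` X)"
  proof (subst open_contains_ball, safe)
    fix x assume "x \<in> X"
    then obtain e where e: "e > 0" "cball x e \<subseteq> X" using X(1) open_contains_cball by blast
    have "y \<in> f ` X" if "y \<in> ball (f x) (e / 2)" for y
      using S[OF e(2), of y] that e by (force simp: dist_norm norm_minus_commute)
    then show "\<exists>e>0. ball (f x) e \<subseteq> f ` X" using e by (intro exI[of _ "e / 2"]) auto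
  qed
  let ?g = "inv_into X f"
  show "cholomorphic_on ?g (f ` X)"
  proof (rule cholomorphic_onI)
    fix y assume y: "y \<in> f ` X"
    then have gX: "?g y \<in> X" "f (?g y) = y" by (auto simp: inv_into_into f_inv_into_f)
    obtain D' where D': "cblinear D'" "D' \<circ> D (?g y) = id"
      using cblinear_near_id_inverse[OF D(1)[OF gX(1)] near[OF gX(1) D(2)[OF gX(1)]]] by blast
    have "continuous_on (f ` X) ?g"
    proof (rule continuous_on_iff[THEN iffD2], intro ballI allI impI)
      fix y e assume "y \<in> f ` X" and e: "(e::real) > 0"
      have "dist (?g y') (?g y) \<le> 2 * dist y' y" if "y' \<in> f ` X" for y'
        using lower[of "?g y'" "?g y"] that \<open>y \<in> f ` X\<close>
        by (simp add: dist_norm inv_into_into f_inv_into_f)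
      then show "\<exists>d>0. \<forall>x'\<in>f ` X. dist x' y < d \<longrightarrow> dist (?g x') (?g y) < e"
        using e by (intro exI[of _ "e / 2"]) fastforce
    qed
    then have "continuous (at y) ?g" using op y continuous_on_eq_continuous_at by blast
    then have "(?g has_derivative D') (at y)"
      using D(2)[OF gX(1)] cblinear_bounded[OF D'(1)] D'(2) op y
      by (intro has_derivative_inverse_basic[where f = f and T = "f ` X" and g = ?g and y = y
            and f' = "D (?g y)" and g' = D'])
         (auto simp: f_inv_into_f)
    then show "\<exists>D. cblinear D \<and> (?g has_derivative D) (at y within f ` X)"
      using D'(1) has_derivative_at_withinI by blast
  qed
qed

section \<open>Orthonormal coordinates for an equivalent inner product\<close>

text \<open>The real part of a Hermitian form, recovered below as \<open>B\<close>. Positivity is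
  kept apart because the polarised Levi form, which is only known to be positive on the complex
  tangent space, is also treated as an instance.\<close>

locale invariant_form =
  fixes R :: "'e::complex_hilbert_space \<Rightarrow> 'e \<Rightarrow> real"
  assumes R_add: "R (x + y) z = R x z + R y z"
    and R_scaleR: "R (r *\<^sub>R x) y = r * R x y"
    and R_sym: "R x y = R y x"
    and R_ii: "R (\<i> *\<^sub>C x) (\<i> *\<^sub>C y) = R x y"
begin

definition B :: "'e \<Rightarrow> 'e \<Rightarrow> complex" where "B x y = Complex (R x y) (R x (\<i> *\<^sub>C y))"

lemma R_ii': "R (\<i> *\<^sub>C x) y = - R x (\<i> *\<^sub>C y)"
proof -
  have "R (\<i> *\<^sub>C x) y = R (\<i> *\<^sub>C \<i> *\<^sub>C x) (\<i> *\<^sub>C y)" by (simp only: R_ii)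
  also have "\<dots> = R ((-1) *\<^sub>R x) (\<i> *\<^sub>C y)" by (simp only: scaleC_ii_ii scaleR_minus1_left)
  finally show ?thesis by (simp only: R_scaleR)
qed

lemma R_minus: "R (- x) y = - R x y" "R x (- y) = - R x y"
  using R_scaleR[of "-1" x y] R_scaleR[of "-1" y x] R_sym[of x "-y"] R_sym[of x y] by simp_all

lemma B_add: "B (x + y) z = B x z + B y z"
  by (simp add: B_def R_add complex_eq_iff)

lemma B_scaleC: "B (a *\<^sub>C x) y = a * B x y"
  by (simp add: scaleC_complex_decomp[of a x] B_def R_add R_scaleR R_ii' R_minus complex_eq_iff)

lemma B_commute: "B x y = cnj (B y x)"
  using R_ii'[of x y] by (simp add: B_def complex_eq_iff R_sym[of x y] R_sym[of x "\<i> *\<^sub>C y"] R_sym[of y "\<i> *\<^sub>C x"])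

lemma B_zero [simp]: "B 0 x = 0" "B x 0 = 0"
  using B_scaleC[of 0 0 x] B_commute[of x 0] by auto

lemma B_add_right: "B x (y + z) = B x y + B x z"
  using B_commute[of x "y + z"] B_commute[of x y] B_commute[of x z] by (simp add: B_add)

lemma B_scaleC_right: "B x (a *\<^sub>C y) = cnj a * B x y"
  using B_commute[of x "a *\<^sub>C y"] B_commute[of x y] by (simp add: B_scaleC)

lemma B_diff: "B (x - y) z = B x z - B y z"
  using B_add[of "x - y" y z] by simp

lemma B_sum: "B (sum f A) z = (\<Sum>i\<in>A. B (f i) z)"
  by (induction A rule: infinite_finite_induct) (auto simp: B_add)

lemma B_sum_right: "B z (sum f A) = (\<Sum>i\<in>A. B z (f i))"
  by (induction A rule: infinite_finite_induct) (auto simp: B_add_right)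

lemma Re_B: "Re (B x y) = R x y" by (simp add: B_def)

lemma B_diff_right: "B z (x - y) = B z x - B z y"
  using B_add_right[of z "x - y" y] by simp

lemma B_self: "B x x = of_real (R x x)"
  using B_commute[of x x] by (simp add: B_def complex_eq_iff)

end

locale equivalent_inner = invariant_form R
  for R :: "'e::{complex_hilbert_space, second_countable_topology} \<Rightarrow> 'e \<Rightarrow> real" +
  fixes c K :: real
  assumes c_pos: "c > 0" and R_lower: "c * (norm x)\<^sup>2 \<le> R x x" and R_upper: "R x x \<le> K * (norm x)\<^sup>2"
begin

lemma R_nonneg: "R x x \<ge> 0"
  using R_lower[of x] c_pos by (meson order_trans mult_nonneg_nonneg less_imp_le zero_le_power2)

lemma R_zero_iff: "R x x = 0 \<longleftrightarrow> x = 0"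
proof
  assume "R x x = 0"
  then have "(norm x)\<^sup>2 \<le> 0" using R_lower[of x] c_pos by (simp add: mult_le_0_iff)
  then show "x = 0" by simp
next
  assume "x = 0"
  then show "R x x = 0" using R_lower[of x] R_upper[of x] by simp
qed

text \<open>Gram-Schmidt with respect to \<open>R\<close>. A vector that depends on its predecessors
  is not discarded: its residual is 0, and the convention that the inverse of 0 is 0 makes the
  output 0 as well. So the nonzero outputs are orthonormal and the indices stay aligned with those
  of \<open>d\<close>.\<close>

function gs :: "(nat \<Rightarrow> 'e) \<Rightarrow> nat \<Rightarrow> 'e" where
  "gs d n = (let x = d n - (\<Sum>k<n. B (d n) (gs d k) *\<^sub>C gs d k) in x /\<^sub>R sqrt (R x x))"
  by auto
termination by (relation "Wellfounded.measure snd") auto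

declare gs.simps [simp del]

definition res :: "(nat \<Rightarrow> 'e) \<Rightarrow> nat \<Rightarrow> 'e" where
  "res d n = d n - (\<Sum>k<n. B (d n) (gs d k) *\<^sub>C gs d k)"

lemma gs_res: "gs d n = complex_of_real (1 / sqrt (R (res d n) (res d n))) *\<^sub>C res d n"
  by (subst gs.simps) (simp add: Let_def res_def scaleR_scaleC divide_inverse)

lemma gs_self: "B (gs d n) (gs d n) = (if gs d n = 0 then 0 else 1)"
proof (cases "res d n = 0")
  case False
  define \<rho> where "\<rho> = sqrt (R (res d n) (res d n))"
  have pos: "\<rho> > 0" using False R_nonneg[of "res d n"] R_zero_iff[of "res d n"] by (simp add: \<rho>_def less_le)
  have "R (res d n) (res d n) = \<rho>\<^sup>2" using R_nonneg by (simp add: \<rho>_def)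
  then have "B (gs d n) (gs d n) = of_real (1 / \<rho> * (1 / \<rho> * \<rho>\<^sup>2))"
    using pos by (simp only: gs_res \<rho>_def[symmetric] B_scaleC B_scaleC_right complex_cnj_complex_of_real) (simp add: B_self)
  also have "\<dots> = 1" using pos by (simp add: power2_eq_square)
  finally have "B (gs d n) (gs d n) = 1" .
  then show ?thesis by auto
qed (simp add: gs_res)

lemma gs_orthogonal: "m < n \<Longrightarrow> B (gs d n) (gs d m) = 0"
proof (induction n arbitrary: m rule: less_induct)
  case (less n)
  have orth: "B (gs d k) (gs d m) = 0" if "k < n" "k \<noteq> m" for k
  proof (cases "k < m")
    case True
    then show ?thesis using less.IH[OF less.prems True] B_commute[of "gs d k" "gs d m"] by simp
  next
    case False
    then show ?thesis using less.IH[OF that(1), of m] that by simp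
  qed
  have "B (res d n) (gs d m) = B (d n) (gs d m) - (\<Sum>k<n. B (d n) (gs d k) * B (gs d k) (gs d m))"
    by (simp add: res_def B_diff B_sum B_scaleC)
  also have "(\<Sum>k<n. B (d n) (gs d k) * B (gs d k) (gs d m))
      = (\<Sum>k<n. if k = m then B (d n) (gs d m) * B (gs d m) (gs d m) else 0)"
    by (rule sum.cong) (use orth in auto)
  also have "\<dots> = B (d n) (gs d m)" using less.prems by (simp add: gs_self)
  finally show ?case by (simp add: gs_res B_scaleC)
qed

lemma gs_orthogonal': "m \<noteq> n \<Longrightarrow> B (gs d n) (gs d m) = 0"
  using gs_orthogonal[of m n d] gs_orthogonal[of n m d] B_commute[of "gs d n" "gs d m"]
  by (cases m n rule: linorder_cases) auto

text \<open>With orthogonality this makes the coefficients of \<open>d n\<close> vanish beyond the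
  index \<open>n\<close>, so that coordinates followed by summation is a finite, exact operation on
  the dense sequence.\<close>

lemma gs_expand: "d n = (\<Sum>k<Suc n. B (d n) (gs d k) *\<^sub>C gs d k)"
proof -
  have "B (d n) (gs d n) *\<^sub>C gs d n = res d n"
  proof (cases "res d n = 0")
    case True
    then show ?thesis by (simp add: gs_res)
  next
    case False
    define \<rho> where "\<rho> = sqrt (R (res d n) (res d n))"
    have pos: "\<rho> > 0" using False R_nonneg[of "res d n"] R_zero_iff[of "res d n"] by (simp add: \<rho>_def less_le)
    have \<rho>2: "R (res d n) (res d n) = \<rho>\<^sup>2" using R_nonneg by (simp add: \<rho>_def)
    have "B (d n) (gs d n) = B (res d n) (gs d n) + (\<Sum>k<n. B (d n) (gs d k) * B (gs d k) (gs d n))"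
      by (simp add: res_def B_diff B_sum B_scaleC)
    also have "(\<Sum>k<n. B (d n) (gs d k) * B (gs d k) (gs d n)) = 0"
      by (intro sum.neutral) (simp add: gs_orthogonal')
    also have "B (res d n) (gs d n) + 0 = of_real (1 / \<rho> * \<rho>\<^sup>2)"
      using pos by (simp only: gs_res \<rho>_def[symmetric] B_scaleC_right B_self \<rho>2 complex_cnj_complex_of_real) simp
    also have "1 / \<rho> * \<rho>\<^sup>2 = \<rho>" using pos by (simp add: power2_eq_square)
    finally have "B (d n) (gs d n) = of_real \<rho>" .
    then show ?thesis
      unfolding gs_res \<rho>_def[symmetric] scaleC_scaleC using pos by simp
  qed
  then show ?thesis by (simp add: res_def)
qed

lemma gs_sum_norm:
  assumes "finite A"
  shows "R (\<Sum>k\<in>A. a k *\<^sub>C gs d k) (\<Sum>k\<in>A. a k *\<^sub>C gs d k)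
    = (\<Sum>k\<in>A. if gs d k = 0 then 0 else (cmod (a k))\<^sup>2)"
proof -
  have "B (\<Sum>k\<in>A. a k *\<^sub>C gs d k) (\<Sum>k\<in>A. a k *\<^sub>C gs d k)
      = (\<Sum>k\<in>A. \<Sum>l\<in>A. a k * (cnj (a l) * B (gs d k) (gs d l)))"
    unfolding B_sum by (intro sum.cong refl) (simp add: B_sum_right B_scaleC B_scaleC_right sum_distrib_left mult.left_commute)
  also have "\<dots> = (\<Sum>k\<in>A. \<Sum>l\<in>A. if l = k then a k * (cnj (a k) * B (gs d k) (gs d k)) else 0)"
    by (intro sum.cong refl) (auto simp: gs_orthogonal')
  also have "\<dots> = (\<Sum>k\<in>A. a k * (cnj (a k) * B (gs d k) (gs d k)))" using assms by simp
  also have "\<dots> = of_real (\<Sum>k\<in>A. if gs d k = 0 then 0 else (cmod (a k))\<^sup>2)"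
    unfolding of_real_sum by (rule sum.cong) (auto simp: gs_self complex_norm_square[symmetric])
  finally have "complex_of_real (R (\<Sum>k\<in>A. a k *\<^sub>C gs d k) (\<Sum>k\<in>A. a k *\<^sub>C gs d k))
      = of_real (\<Sum>k\<in>A. if gs d k = 0 then 0 else (cmod (a k))\<^sup>2)" by (simp only: B_self)
  then show ?thesis by (simp only: of_real_eq_iff)
qed

lemma B_zero_coeff: "gs d k = 0 \<Longrightarrow> B x (gs d k) = 0" by simp

text \<open>Kept as an equality: it gives Bessel's inequality at once, and Parseval's identity when
  the partial sums are known to converge.\<close>

lemma gs_Bessel:
  "R (x - (\<Sum>k<n. B x (gs d k) *\<^sub>C gs d k)) (x - (\<Sum>k<n. B x (gs d k) *\<^sub>C gs d k))
    = R x x - (\<Sum>k<n. (cmod (B x (gs d k)))\<^sup>2)"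
proof -
  define p where "p = (\<Sum>k<n. B x (gs d k) *\<^sub>C gs d k)"
  define q where "q = (\<Sum>k<n. (cmod (B x (gs d k)))\<^sup>2)"
  have "R p p = q"
    unfolding p_def q_def gs_sum_norm[OF finite_lessThan] by (intro sum.cong refl) auto
  then have 1: "B p p = of_real q" by (simp add: B_self)
  have 2: "B x p = of_real q"
    unfolding p_def q_def B_sum_right of_real_sum
    by (intro sum.cong refl) (simp only: B_scaleC_right complex_norm_square mult.commute)
  then have 3: "B p x = of_real q" using B_commute[of p x] by simp
  have "complex_of_real (R (x - p) (x - p)) = of_real (R x x) - of_real q"
    unfolding B_self[symmetric] B_diff B_diff_right 1 2 3 by simp
  then have "R (x - p) (x - p) = R x x - q"
    unfolding of_real_diff[symmetric] of_real_eq_iff .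
  then show ?thesis unfolding p_def q_def .
qed

text \<open>\<open>T\<close> lists the Gram-Schmidt coefficients of a dense sequence and
  \<open>S\<close> sums the series. \<open>S\<close> is only a left inverse, since \<open>T\<close>
  never reaches the coordinates whose Gram-Schmidt vector is 0. The identity
  \<open>S (T x) = x\<close> holds on the dense sequence and extends by continuity; convergence of
  the series then upgrades Bessel to Parseval.\<close>

theorem orthonormal_coordinates:
  "\<exists>(T :: 'e \<Rightarrow> ell2) S. cblinear T \<and> cblinear S \<and> (\<forall>x. S (T x) = x) \<and> (\<forall>x. (norm (T x))\<^sup>2 = R x x)"
proof -
  obtain D :: "'e set" where D: "countable D" "\<And>X. open X \<Longrightarrow> X \<noteq> {} \<Longrightarrow> \<exists>x\<in>D. x \<in> X"
    using countable_dense_exists by blast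
  have "D \<noteq> {}" using D(2)[of UNIV] by auto
  define d where "d = from_nat_into D"
  have dense: "closure (range d) = UNIV"
  proof -
    have "x \<in> closure (range d)" for x
      unfolding closure_approachable
    proof (intro allI impI)
      fix e :: real assume "e > 0"
      then obtain y where "y \<in> D" "y \<in> ball x e" using D(2)[of "ball x e"] by auto
      then show "\<exists>y\<in>range d. dist y x < e"
        using range_from_nat_into[OF \<open>D \<noteq> {}\<close> D(1)] by (auto simp: d_def dist_commute intro!: bexI[of _ y])
    qed
    then show ?thesis by blast
  qed
  define g where "g = gs d"
  have bessel: "(\<Sum>k<n. (cmod (B x (g k)))\<^sup>2) \<le> R x x" for x n
    using gs_Bessel[where x = x and n = n and d = d] R_nonneg[of "x - (\<Sum>k<n. B x (gs d k) *\<^sub>C gs d k)"] by (simp add: g_def)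
  have sq: "summable (\<lambda>k. (cmod (B x (g k)))\<^sup>2)" for x
    by (rule bounded_imp_summable[where B = "R x x"])
       (use bessel[of x "Suc _"] in \<open>auto simp: lessThan_Suc_atMost\<close>)
  define T where "T x = Abs_ell2 (\<lambda>k. B x (g k))" for x
  have nthT: "ell2_nth (T x) k = B x (g k)" for x k
    unfolding T_def by (simp add: ell2_nth_Abs[OF sq])
  have normT: "(norm (T x))\<^sup>2 = (\<Sum>k. (cmod (B x (g k)))\<^sup>2)" for x
    by (simp add: norm_ell2_sq nthT)
  have normT_le: "(norm (T x))\<^sup>2 \<le> R x x" for x
    unfolding normT by (rule suminf_le_const[OF sq bessel])
  have cT: "cblinear T"
  proof (rule cblinearI[where K = "sqrt \<bar>K\<bar>"])
    show "T (x + y) = T x + T y" for x y by (rule ell2_eqI) (simp add: nthT B_add)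
    show "T (a *\<^sub>C x) = a *\<^sub>C T x" for a x by (rule ell2_eqI) (simp add: nthT B_scaleC)
    fix x
    have "(norm (T x))\<^sup>2 \<le> K * (norm x)\<^sup>2" using normT_le R_upper order_trans by blast
    also have "\<dots> \<le> \<bar>K\<bar> * (norm x)\<^sup>2" by (intro mult_right_mono) auto
    finally have "(norm (T x))\<^sup>2 \<le> (sqrt \<bar>K\<bar> * norm x)\<^sup>2" by (simp add: power_mult_distrib)
    then show "norm (T x) \<le> sqrt \<bar>K\<bar> * norm x" by (rule power2_le_imp_le) simp
  qed
  have fin: "(norm (\<Sum>k\<in>A. a k *\<^sub>C g k))\<^sup>2 \<le> (\<Sum>k\<in>A. (cmod (a k))\<^sup>2) / c" if "finite A" for a A
  proof -
    have "c * (norm (\<Sum>k\<in>A. a k *\<^sub>C g k))\<^sup>2 \<le> (\<Sum>k\<in>A. if g k = 0 then 0 else (cmod (a k))\<^sup>2)"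
      using R_lower[of "\<Sum>k\<in>A. a k *\<^sub>C g k"] gs_sum_norm[OF that, of a d] by (simp add: g_def)
    also have "\<dots> \<le> (\<Sum>k\<in>A. (cmod (a k))\<^sup>2)" by (intro sum_mono) auto
    finally show ?thesis using c_pos by (simp add: field_simps)
  qed
  have sumS: "summable (\<lambda>k. ell2_nth y k *\<^sub>C g k)" for y
    unfolding summable_Cauchy
  proof (intro allI impI)
    fix e :: real assume "e > 0"
    then have "c * e\<^sup>2 > 0" using c_pos by simp
    then obtain N where N: "\<And>m n. m \<ge> N \<Longrightarrow> norm (\<Sum>k\<in>{m..<n}. (cmod (ell2_nth y k))\<^sup>2) < c * e\<^sup>2"
      using ell2_summable[of y] unfolding summable_Cauchy by blast
    have "norm (\<Sum>k\<in>{m..<n}. ell2_nth y k *\<^sub>C g k) < e" if "m \<ge> N" for m n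
    proof -
      have "(norm (\<Sum>k\<in>{m..<n}. ell2_nth y k *\<^sub>C g k))\<^sup>2 \<le> (\<Sum>k\<in>{m..<n}. (cmod (ell2_nth y k))\<^sup>2) / c"
        by (rule fin) simp
      also have "\<dots> < e\<^sup>2" using N[OF that, of n] c_pos by (simp add: field_simps)
      finally show ?thesis using \<open>e > 0\<close> by (intro power2_less_imp_less[of _ e]) auto
    qed
    then show "\<exists>N. \<forall>m\<ge>N. \<forall>n. norm (\<Sum>k\<in>{m..<n}. ell2_nth y k *\<^sub>C g k) < e" by blast
  qed
  define S where "S y = (\<Sum>k. ell2_nth y k *\<^sub>C g k)" for y
  have cS: "cblinear S"
  proof (rule cblinearI[where K = "sqrt (1 / c)"])
    show "S (x + y) = S x + S y" for x y
      unfolding S_def by (simp add: scaleC_add_left suminf_add[OF sumS sumS])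
    show "S (a *\<^sub>C x) = a *\<^sub>C S x" for a x
      unfolding S_def bounded_linear.suminf[OF cblinear_bounded[OF cblinear_scaleC_const] sumS]
      by (simp add: scaleC_scaleC)
    fix y
    show "norm (S y) \<le> sqrt (1 / c) * norm y"
    proof (rule LIMSEQ_le_const2)
      show "(\<lambda>n. norm (\<Sum>k<n. ell2_nth y k *\<^sub>C g k)) \<longlonglongrightarrow> norm (S y)"
        unfolding S_def by (intro tendsto_norm summable_LIMSEQ sumS)
      have "norm (\<Sum>k<n. ell2_nth y k *\<^sub>C g k) \<le> sqrt (1 / c) * norm y" for n
      proof (rule power2_le_imp_le)
        have "(norm (\<Sum>k<n. ell2_nth y k *\<^sub>C g k))\<^sup>2 \<le> (\<Sum>k<n. (cmod (ell2_nth y k))\<^sup>2) / c"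
          by (rule fin) simp
        also have "(\<Sum>k<n. (cmod (ell2_nth y k))\<^sup>2) \<le> (norm y)\<^sup>2"
          unfolding norm_ell2_sq by (intro sum_le_suminf ell2_summable) auto
        finally show "(norm (\<Sum>k<n. ell2_nth y k *\<^sub>C g k))\<^sup>2 \<le> (sqrt (1 / c) * norm y)\<^sup>2"
          using c_pos by (simp add: power_mult_distrib divide_right_mono)
      qed (use c_pos in auto)
      then show "\<exists>N. \<forall>n\<ge>N. norm (\<Sum>k<n. ell2_nth y k *\<^sub>C g k) \<le> sqrt (1 / c) * norm y" by blast
    qed
  qed
  have STd: "S (T (d n)) = d n" for n
  proof -
    have z: "B (d n) (g k) = 0" if "k \<notin> {..<Suc n}" for k
    proof -
      have "B (d n) (g k) = B (\<Sum>j<Suc n. B (d n) (gs d j) *\<^sub>C gs d j) (gs d k)"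
        unfolding g_def gs_expand[symmetric] ..
      also have "\<dots> = (\<Sum>j<Suc n. B (d n) (gs d j) * B (gs d j) (gs d k))"
        unfolding B_sum B_scaleC ..
      also have "\<dots> = 0" using that by (intro sum.neutral) (auto simp: gs_orthogonal')
      finally show ?thesis .
    qed
    have "S (T (d n)) = (\<Sum>k<Suc n. ell2_nth (T (d n)) k *\<^sub>C g k)"
      unfolding S_def by (intro suminf_finite) (auto simp: nthT z)
    also have "\<dots> = d n" unfolding nthT g_def by (rule gs_expand[symmetric])
    finally show ?thesis .
  qed
  have ST: "S (T x) = x" for x
  proof -
    have "closed {x. S (T x) = x}"
      by (intro closed_Collect_eq continuous_on_id linear_continuous_on cblinear_bounded cblinear_compose[OF cT cS])
    then have "closure (range d) \<subseteq> {x. S (T x) = x}"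
      by (intro closure_minimal) (auto simp: STd)
    then show ?thesis using dense by blast
  qed
  have "(norm (T x))\<^sup>2 = R x x" for x
  proof -
    define p where "p n = (\<Sum>k<n. B x (g k) *\<^sub>C g k)" for n
    have "p \<longlonglongrightarrow> x"
      using summable_LIMSEQ[OF sumS[of "T x"]] ST[of x] unfolding S_def nthT p_def by simp
    then have "(\<lambda>n. K * (norm (x - p n))\<^sup>2) \<longlonglongrightarrow> K * (norm (x - x))\<^sup>2" by (intro tendsto_intros)
    then have lim0: "(\<lambda>n. K * (norm (x - p n))\<^sup>2) \<longlonglongrightarrow> 0" by simp
    have "(\<lambda>n. R (x - p n) (x - p n)) \<longlonglongrightarrow> 0"
      by (rule tendsto_sandwich[OF _ _ tendsto_const lim0])
         (intro always_eventually allI R_nonneg R_upper)+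
    then have "(\<lambda>n. R x x - (\<Sum>k<n. (cmod (B x (g k)))\<^sup>2)) \<longlonglongrightarrow> 0"
      unfolding p_def g_def gs_Bessel .
    moreover have "(\<lambda>n. R x x - (\<Sum>k<n. (cmod (B x (g k)))\<^sup>2)) \<longlonglongrightarrow> R x x - (norm (T x))\<^sup>2"
      unfolding normT by (intro tendsto_intros summable_LIMSEQ sq)
    ultimately show ?thesis using LIMSEQ_unique by fastforce
  qed
  with cT cS ST show ?thesis by blast
qed

end

section \<open>A maximum principle without compactness\<close>

text \<open>The supremum \<open>\<phi>\<close> of the affine functions of \<open>e\<close> with
  slopes \<open>w i\<close> is convex. A point \<open>e\<close> where \<open>\<phi>\<close> minus a
  paraboloid is almost maximal is a point where the paraboloid nearly touches \<open>\<phi>\<close>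
  from above. An index that almost realises \<open>\<phi> e\<close> gives an affine minorant
  squeezed under that paraboloid, so its slope must be close to the gradient
  \<open>(2 * K) *\<^sub>R e\<close>.\<close>

lemma perturbation_step:
  fixes u :: "'i \<Rightarrow> real" and w :: "'i \<Rightarrow> 'e::real_inner"
  assumes A: "A \<noteq> {}" and u: "\<And>i. i \<in> A \<Longrightarrow> u i \<le> M" and w: "\<And>i. i \<in> A \<Longrightarrow> norm (w i) \<le> R"
    and \<nu>: "\<nu> > 0" and \<gamma>: "\<gamma> > 0"
  shows "\<exists>e w0 \<eta>. norm e \<le> \<nu> \<and> \<eta> > 0 \<and>
    (\<forall>i\<in>A. u i + inner (w i) e \<ge> (SUP j\<in>A. u j + inner (w j) e) - \<eta> \<longrightarrow> norm (w i - w0) \<le> \<gamma>)"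
proof -
  have R: "R \<ge> 0" using A w by (meson ex_in_conv norm_ge_zero order_trans)
  define \<phi> where "\<phi> e = (SUP j\<in>A. u j + inner (w j) e)" for e
  have wi: "inner (w i) e \<le> R * norm e" if "i \<in> A" for i e
    using norm_cauchy_schwarz[of "w i" e] mult_right_mono[OF w[OF that], of "norm e"] by auto
  have bdd: "bdd_above ((\<lambda>j. u j + inner (w j) e) ` A)" for e
    using u wi by (intro bdd_aboveI[of _ "M + R * norm e"]) (auto intro: add_mono)
  have up: "u i + inner (w i) e \<le> \<phi> e" if "i \<in> A" for i e
    unfolding \<phi>_def by (intro cSUP_upper that bdd)
  have \<phi>M: "\<phi> e \<le> M + R * norm e" for e
    unfolding \<phi>_def using A u wi by (intro cSUP_least) (auto intro: add_mono)
  have \<phi>0: "\<phi> e \<le> \<phi> 0 + R * norm e" for e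
  proof -
    have "u i + inner (w i) e \<le> \<phi> 0 + R * norm e" if "i \<in> A" for i
      using up[OF that, of 0] wi[OF that, of e] by simp
    then show ?thesis unfolding \<phi>_def[of e] using A by (intro cSUP_least)
  qed
  \<comment> \<open>Steep enough that the quadratic penalty outweighs the growth
    \<open>R * norm e\<close> of \<open>\<phi>\<close> beyond radius \<open>\<nu>\<close>, which
    confines the almost maximiser to that radius.\<close>
  define K where "K = (R + 1) / \<nu>"
  have K: "K > 0" using R \<nu> by (simp add: K_def)
  define \<eta> where "\<eta> = min \<nu> (\<gamma>\<^sup>2 / (8 * K)) / 1"
  have \<eta>: "\<eta> > 0" "\<eta> \<le> \<nu>" "8 * K * \<eta> \<le> \<gamma>\<^sup>2"
    using \<nu> \<gamma> K by (auto simp: \<eta>_def min_def field_simps)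
  define \<psi> where "\<psi> e = \<phi> e - K * (norm e)\<^sup>2" for e
  have \<psi>b: "\<psi> e \<le> M + R\<^sup>2 / K" for e
  proof -
    have "0 \<le> (K * norm e - R)\<^sup>2 + R * K * norm e" using R K by auto
    then have "R * norm e * K \<le> K\<^sup>2 * (norm e)\<^sup>2 + R\<^sup>2" by (simp add: power2_eq_square algebra_simps)
    then have "R * norm e \<le> K * (norm e)\<^sup>2 + R\<^sup>2 / K" using K by (simp add: field_simps power2_eq_square)
    then show ?thesis using \<phi>M[of e] by (simp add: \<psi>_def)
  qed
  then have bdd\<psi>: "bdd_above (range \<psi>)" by (intro bdd_aboveI[of _ "M + R\<^sup>2 / K"]) auto
  have "\<exists>e. \<psi> e > (SUP e. \<psi> e) - \<eta>"
    using less_cSUP_iff[OF _ bdd\<psi>, of "(SUP e. \<psi> e) - \<eta>"] \<eta> by auto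
  then obtain e where e0: "\<psi> e > (SUP e. \<psi> e) - \<eta>" by blast
  have e: "\<psi> e' \<le> \<psi> e + \<eta>" for e'
    using e0 cSUP_upper[OF _ bdd\<psi>, of e'] by simp
  have "norm e \<le> \<nu>"
  proof (rule ccontr)
    assume "\<not> norm e \<le> \<nu>"
    then have ne: "norm e > \<nu>" by simp
    have "K * (norm e)\<^sup>2 \<le> R * norm e + \<eta>" using e[of 0] \<phi>0[of e] by (simp add: \<psi>_def)
    also have "\<dots> < (R + 1) * norm e" using ne \<eta>(2) by (simp add: algebra_simps)
    also have "\<dots> = K * (\<nu> * norm e)" using \<nu> by (simp add: K_def)
    also have "\<dots> \<le> K * (norm e)\<^sup>2" using ne K \<nu>
      using mult_right_mono[of \<nu> "norm e" "norm e"] by (intro mult_left_mono) (auto simp: power2_eq_square)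
    finally show False by simp
  qed
  moreover have "norm (w i - (2 * K) *\<^sub>R e) \<le> \<gamma>"
    if i: "i \<in> A" "u i + inner (w i) e \<ge> \<phi> e - \<eta>" for i
  proof -
    define v where "v = w i - (2 * K) *\<^sub>R e"
    \<comment> \<open>The displacement that maximises the gap
      \<open>inner v h - K * (norm h)\<^sup>2\<close> between minorant and paraboloid.\<close>
    define h where "h = (1 / (2 * K)) *\<^sub>R v"
    have "u i + inner (w i) (e + h) \<le> \<phi> (e + h)" by (rule up[OF i(1)])
    also have "\<dots> \<le> \<phi> e + K * ((norm (e + h))\<^sup>2 - (norm e)\<^sup>2) + \<eta>"
      using e[of "e + h"] by (simp add: \<psi>_def algebra_simps)
    also have "(norm (e + h))\<^sup>2 - (norm e)\<^sup>2 = 2 * inner e h + (norm h)\<^sup>2"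
      by (simp add: power2_norm_eq_inner inner_add_left inner_add_right inner_commute)
    finally have "inner (w i) h \<le> 2 * \<eta> + K * (2 * inner e h + (norm h)\<^sup>2)"
      using i(2) by (simp add: inner_add_right)
    then have "inner v h \<le> 2 * \<eta> + K * (norm h)\<^sup>2"
      by (simp add: v_def inner_diff_left algebra_simps)
    moreover have "inner v h = (norm v)\<^sup>2 / (2 * K)" by (simp add: h_def power2_norm_eq_inner)
    moreover have "K * (norm h)\<^sup>2 = (norm v)\<^sup>2 / (4 * K)"
      using K by (simp add: h_def power_mult_distrib power_divide power2_eq_square field_simps)
    ultimately have "(norm v)\<^sup>2 / (4 * K) \<le> 2 * \<eta>" by (simp add: field_simps)
    then have "(norm v)\<^sup>2 \<le> 8 * K * \<eta>" using K by (simp add: field_simps)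
    also have "\<dots> \<le> \<gamma>\<^sup>2" by (rule \<eta>(3))
    finally have "norm v \<le> \<gamma>" using \<gamma> by (intro power2_le_imp_le[of "norm v" \<gamma>]) auto
    then show ?thesis unfolding v_def .
  qed
  ultimately show ?thesis using \<eta>(1) unfolding \<phi>_def by blast
qed

text \<open>A form of Stegall's variational principle in Hilbert space.\<close>

lemma strong_perturbed_maximum:
  fixes u :: "'i \<Rightarrow> real" and w :: "'i \<Rightarrow> 'e::{real_inner,complete_space}"
  assumes A: "A \<noteq> {}" and u: "\<And>i. i \<in> A \<Longrightarrow> u i \<le> M" and w: "\<And>i. i \<in> A \<Longrightarrow> norm (w i) \<le> R"
    and \<nu>: "\<nu> > 0"
  shows "\<exists>e. norm e \<le> \<nu> \<and> (\<forall>s. (\<forall>n. s n \<in> A) \<longrightarrow>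
    (\<lambda>n::nat. u (s n) + inner (w (s n)) e) \<longlonglongrightarrow> (SUP j\<in>A. u j + inner (w j) e) \<longrightarrow> Cauchy (\<lambda>n. w (s n)))"
proof -
  have R: "R \<ge> 0" using A w by (meson ex_in_conv norm_ge_zero order_trans)
  define \<phi> where "\<phi> e = (SUP j\<in>A. u j + inner (w j) e)" for e
  have wi: "\<bar>inner (w i) e\<bar> \<le> R * norm e" if "i \<in> A" for i e
    using Cauchy_Schwarz_ineq2[of "w i" e] mult_right_mono[OF w[OF that], of "norm e"] by auto
  have bdd: "bdd_above ((\<lambda>j. u j + inner (w j) e) ` A)" for e
    by (intro bdd_aboveI[of _ "M + R * norm e"]) (use u wi abs_le_D1 in \<open>fastforce intro: add_mono\<close>)
  have up: "u i + inner (w i) e \<le> \<phi> e" if "i \<in> A" for i e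
    unfolding \<phi>_def by (intro cSUP_upper that bdd)
  have \<phi>lip: "\<phi> e \<le> \<phi> e' + R * norm (e - e')" for e e'
  proof -
    have "u i + inner (w i) e \<le> \<phi> e' + R * norm (e - e')" if "i \<in> A" for i
      using up[OF that, of e'] wi[OF that, of "e - e'"] by (simp add: inner_diff_right abs_le_iff)
    then show ?thesis unfolding \<phi>_def[of e] using A by (intro cSUP_least)
  qed
  define P where "P = (\<lambda>(n::nat) (E::'e, \<delta>::real). \<delta> > 0 \<and> (n = 0 \<longrightarrow> E = 0 \<and> \<delta> = \<nu> / 2))"
  \<comment> \<open>Later perturbations move \<open>E'\<close> by at most
    \<open>2 * \<delta>'\<close> in total. This changes \<open>\<phi>\<close> and each affine
    function by at most \<open>2 * R * \<delta>'\<close>, so the slack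
    \<open>8 * (R + 1) * \<delta>'\<close> still covers almost maximisers for the limit
    perturbation.\<close>
  define Q where "Q = (\<lambda>(n::nat) (E::'e, \<delta>::real) (E', \<delta>'). norm (E' - E) \<le> \<delta> \<and> \<delta>' \<le> \<delta> / 2 \<and>
    (\<exists>w0. \<forall>i\<in>A. u i + inner (w i) E' \<ge> \<phi> E' - 8 * (R + 1) * \<delta>' \<longrightarrow> norm (w i - w0) \<le> 1 / (real n + 1)))"
  have "\<exists>f. \<forall>n. P n (f n) \<and> Q n (f n) (f (Suc n))"
  proof (rule dependent_nat_choice)
    show "\<exists>x. P 0 x" unfolding P_def using \<nu> by (intro exI[of _ "(0, \<nu> / 2)"]) simp
    fix x n assume Pn: "P n x"
    obtain E \<delta> where x: "x = (E, \<delta>)" by (cases x)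
    have \<delta>: "\<delta> > 0" using Pn by (simp add: x P_def)
    have "\<exists>e w0 \<eta>. norm e \<le> \<delta> \<and> \<eta> > 0 \<and>
      (\<forall>i\<in>A. (u i + inner (w i) E) + inner (w i) e \<ge> (SUP j\<in>A. (u j + inner (w j) E) + inner (w j) e) - \<eta>
        \<longrightarrow> norm (w i - w0) \<le> 1 / (real n + 1))"
      using A w \<delta> up[of _ E] by (intro perturbation_step[where M = "\<phi> E" and R = R]) auto
    then obtain e w0 \<eta> where e: "norm e \<le> \<delta>" "\<eta> > 0"
      "\<And>i. i \<in> A \<Longrightarrow> u i + inner (w i) (E + e) \<ge> \<phi> (E + e) - \<eta> \<Longrightarrow> norm (w i - w0) \<le> 1 / (real n + 1)"
      unfolding \<phi>_def by (auto simp: inner_add_right add.assoc)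
    define \<delta>' where "\<delta>' = min (\<delta> / 2) (\<eta> / (8 * (R + 1)))"
    have \<delta>': "\<delta>' > 0" "\<delta>' \<le> \<delta> / 2" "8 * (R + 1) * \<delta>' \<le> \<eta>"
    proof -
      have "8 * (R + 1) * \<delta>' \<le> 8 * (R + 1) * (\<eta> / (8 * (R + 1)))"
        using R unfolding \<delta>'_def by (intro mult_left_mono) auto
      also have "\<dots> = \<eta>" using R by (simp add: field_simps)
      finally show "8 * (R + 1) * \<delta>' \<le> \<eta>" .
    next
      show "\<delta>' \<le> \<delta> / 2" unfolding \<delta>'_def by (rule min.cobounded1)
    qed (use \<delta> e(2) R in \<open>auto simp: \<delta>'_def\<close>)
    have "P (Suc n) (E + e, \<delta>')" using \<delta>' by (simp add: P_def)
    moreover have "Q n x (E + e, \<delta>')"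
      using e(1) \<delta>' e(3) by (fastforce simp: Q_def x)
    ultimately show "\<exists>y. P (Suc n) y \<and> Q n x y" by blast
  qed
  then obtain f where f: "\<And>n. P n (f n)" "\<And>n. Q n (f n) (f (Suc n))" by blast
  define E where "E n = fst (f n)" for n
  define \<delta> where "\<delta> n = snd (f n)" for n
  have fE: "f n = (E n, \<delta> n)" for n by (simp add: E_def \<delta>_def)
  have \<delta>p: "\<delta> n > 0" for n using f(1)[of n] by (simp add: fE P_def)
  have E0: "E 0 = 0" "\<delta> 0 = \<nu> / 2" using f(1)[of 0] by (auto simp: fE P_def)
  have ES: "norm (E (Suc n) - E n) \<le> \<delta> n" "\<delta> (Suc n) \<le> \<delta> n / 2" for n
    using f(2)[of n] by (auto simp: fE Q_def)
  have EQ: "\<exists>w0. \<forall>i\<in>A. u i + inner (w i) (E (Suc n)) \<ge> \<phi> (E (Suc n)) - 8 * (R + 1) * \<delta> (Suc n)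
      \<longrightarrow> norm (w i - w0) \<le> 1 / (real n + 1)" for n
    using f(2)[of n] by (auto simp: fE Q_def)
  have Ediff: "norm (E (n + k) - E n) \<le> 2 * \<delta> n - 2 * \<delta> (n + k)" for n k
  proof (induction k)
    case (Suc k)
    have "norm (E (n + Suc k) - E n) \<le> norm (E (n + k) - E n) + norm (E (Suc (n + k)) - E (n + k))"
      using norm_triangle_ineq[of "E (n + k) - E n" "E (Suc (n + k)) - E (n + k)"] by simp
    also have "\<dots> \<le> 2 * \<delta> n - 2 * \<delta> (n + k) + \<delta> (n + k)" using Suc ES(1)[of "n + k"] by linarith
    also have "\<dots> \<le> 2 * \<delta> n - 2 * \<delta> (n + Suc k)" using ES(2)[of "n + k"] by simp
    finally show ?case .
  qed simp
  have \<delta>small: "\<delta> n \<le> \<nu> / 2 * (1 / 2) ^ n" for n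
  proof (induction n)
    case (Suc n)
    then show ?case using ES(2)[of n] by simp
  qed (simp add: E0)
  have \<delta>lim: "\<delta> \<longlonglongrightarrow> 0"
  proof (rule tendsto_sandwich[where f = "\<lambda>_. 0" and h = "\<lambda>n. \<nu> / 2 * (1 / 2) ^ n"])
    show "(\<lambda>n. \<nu> / 2 * (1 / 2) ^ n) \<longlonglongrightarrow> 0" by (intro tendsto_mult_right_zero LIMSEQ_power_zero) auto
  qed (use \<delta>small less_imp_le[OF \<delta>p] in \<open>auto intro!: always_eventually\<close>)
  have "Cauchy E"
  proof (rule metric_CauchyI)
    fix r :: real assume "r > 0"
    then obtain N where N: "\<And>n. n \<ge> N \<Longrightarrow> \<delta> n < r / 4"
      using \<delta>lim \<delta>p order_tendstoD(2)[OF \<delta>lim, of "r / 4"] by (auto simp: eventually_sequentially)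
    have "norm (E m - E N) < r / 2" if "m \<ge> N" for m
      using Ediff[of N "m - N"] \<delta>p[of m] N[of N] that by simp
    then have "dist (E m) (E N) < r / 2" if "m \<ge> N" for m using that by (simp add: dist_norm)
    then have "dist (E m) (E n) < r" if "m \<ge> N" "n \<ge> N" for m n
      using that dist_triangle_half_l[of "E m" "E N" r "E n"] by blast
    then show "\<exists>N. \<forall>m\<ge>N. \<forall>n\<ge>N. dist (E m) (E n) < r" by blast
  qed
  then obtain e where e: "E \<longlonglongrightarrow> e" using Cauchy_convergent convergent_def by blast
  have Ee: "norm (e - E n) \<le> 2 * \<delta> n" for n
  proof (rule LIMSEQ_le_const2)
    show "(\<lambda>k. norm (E k - E n)) \<longlonglongrightarrow> norm (e - E n)" by (intro tendsto_intros e)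
    have "norm (E k - E n) \<le> 2 * \<delta> n" if "k \<ge> n" for k
      using Ediff[of n "k - n"] \<delta>p[of k] that by simp
    then show "\<exists>N. \<forall>k\<ge>N. norm (E k - E n) \<le> 2 * \<delta> n" by blast
  qed
  have "norm e \<le> \<nu>" using Ee[of 0] by (simp add: E0)
  moreover have "Cauchy (\<lambda>n. w (s n))"
    if s: "\<And>n. s n \<in> A" and lim: "(\<lambda>n. u (s n) + inner (w (s n)) e) \<longlonglongrightarrow> \<phi> e" for s :: "nat \<Rightarrow> 'i"
  proof (rule metric_CauchyI)
    fix r :: real assume "r > 0"
    then obtain n :: nat where n: "1 / (real n + 1) < r / 2"
      by (metis half_gt_zero nat_approx_posE of_nat_Suc add.commute)
    let ?d = "\<delta> (Suc n)" and ?E = "E (Suc n)"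
    obtain w0 where w0: "\<And>i. i \<in> A \<Longrightarrow> u i + inner (w i) ?E \<ge> \<phi> ?E - 8 * (R + 1) * ?d
        \<Longrightarrow> norm (w i - w0) \<le> 1 / (real n + 1)"
      using EQ[of n] by blast
    have "\<forall>\<^sub>F k in sequentially. u (s k) + inner (w (s k)) e > \<phi> e - ?d"
      using \<delta>p[of "Suc n"] by (intro order_tendstoD(1)[OF lim]) auto
    then obtain N where N: "\<And>k. k \<ge> N \<Longrightarrow> u (s k) + inner (w (s k)) e > \<phi> e - ?d"
      by (auto simp: eventually_sequentially)
    have near: "dist (w (s k)) w0 < r / 2" if "k \<ge> N" for k
    proof -
      have "\<phi> ?E \<le> \<phi> e + R * (2 * ?d)"
        using \<phi>lip[of ?E e] mult_left_mono[OF Ee[of "Suc n"] R] by (simp add: norm_minus_commute)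
      moreover have "inner (w (s k)) e \<le> inner (w (s k)) ?E + R * (2 * ?d)"
        using wi[OF s, of k "e - ?E"] mult_left_mono[OF Ee[of "Suc n"] R] by (simp add: inner_diff_right)
      ultimately have "u (s k) + inner (w (s k)) ?E \<ge> \<phi> ?E - R * (4 * ?d) - ?d"
        using N[OF that] by linarith
      moreover have "R * (4 * ?d) + ?d \<le> 8 * (R + 1) * ?d"
        using R \<delta>p[of "Suc n"] by (simp add: algebra_simps)
      ultimately have "norm (w (s k) - w0) \<le> 1 / (real n + 1)" by (intro w0 s) linarith
      then show ?thesis using n by (simp add: dist_norm)
    qed
    have "dist (w (s k)) (w (s l)) < r" if "k \<ge> N" "l \<ge> N" for k l
      using dist_triangle_half_l[OF near[OF that(1)] near[OF that(2)]] .
    then show "\<exists>N. \<forall>m\<ge>N. \<forall>n\<ge>N. dist (w (s m)) (w (s n)) < r" by blast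
  qed
  ultimately show ?thesis unfolding \<phi>_def by blast
qed

text \<open>A perturbation of \<open>cmod K\<close> by a small real functional of \<open>w\<close>
  makes \<open>w\<close> converge along a maximising sequence; bounded parameters converge anyway,
  so \<open>bd\<close> places the limit in the interior of \<open>A\<close>. There the perturbed
  function is the real part of a holomorphic function at its maximum, hence locally constant. The
  conclusion is about \<open>w\<close> and \<open>cmod K\<close> separately, because a maximiser is
  strong: equality of the maximum forces equality of \<open>w\<close>.\<close>

lemma strong_maximum_principle:
  fixes w :: "complex \<Rightarrow> 'e::complex_hilbert_space" and K :: "complex \<Rightarrow> complex"
  assumes C: "open C" "cholomorphic_on w C" "K holomorphic_on C"
    and A: "A \<subseteq> C" "bounded A"
    and R: "\<And>\<zeta>. \<zeta> \<in> A \<Longrightarrow> norm (w \<zeta>) \<le> R" and M: "\<And>\<zeta>. \<zeta> \<in> A \<Longrightarrow> cmod (K \<zeta>) \<le> M"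
    and m: "m \<ge> 0" "\<zeta>0 \<in> A" "cmod (K \<zeta>0) > m"
    and bd: "\<And>s z v. (\<And>n. s n \<in> A \<and> cmod (K (s n)) > m) \<Longrightarrow> s \<longlonglongrightarrow> z \<Longrightarrow> (\<lambda>n::nat. w (s n)) \<longlonglongrightarrow> v
      \<Longrightarrow> \<exists>r>0. ball z r \<subseteq> A"
  shows "\<exists>z r. r > 0 \<and> ball z r \<subseteq> A \<and> cmod (K z) > m \<and>
    (\<forall>\<zeta>\<in>ball z r. w \<zeta> = w z \<and> cmod (K \<zeta>) = cmod (K z))"
proof -
  have R0: "R \<ge> 0" using R[OF m(2)] norm_ge_zero order_trans by blast
  \<comment> \<open>A quarter of the available gap: the perturbation costs \<open>\<kappa>\<close>
    at \<open>\<zeta>0\<close> and at an almost maximiser, the approximation of the supremum another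
    \<open>\<kappa>\<close>, and \<open>cmod K\<close> still exceeds \<open>m\<close>.\<close>
  define \<kappa> where "\<kappa> = (cmod (K \<zeta>0) - m) / 4"
  have \<kappa>: "\<kappa> > 0" "cmod (K \<zeta>0) = m + 4 * \<kappa>" using m(3) by (auto simp: \<kappa>_def field_simps)
  have "A \<noteq> {}" using m(2) by blast
  have "\<kappa> / (R + 1) > 0" using \<kappa> R0 by (simp add: add_nonneg_pos)
  from strong_perturbed_maximum[where u = "\<lambda>\<zeta>. cmod (K \<zeta>)" and w = w and A = A, OF \<open>A \<noteq> {}\<close> M R this]
  obtain e where e: "norm e \<le> \<kappa> / (R + 1)" and strong: "\<And>s. (\<And>n. s n \<in> A) \<Longrightarrow>
    (\<lambda>n::nat. cmod (K (s n)) + inner (w (s n)) e) \<longlonglongrightarrow> (SUP j\<in>A. cmod (K j) + inner (w j) e) \<Longrightarrow> Cauchy (\<lambda>n. w (s n))"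
    by blast
  define u where "u \<zeta> = cmod (K \<zeta>) + inner (w \<zeta>) e" for \<zeta>
  define S where "S = (SUP j\<in>A. u j)"
  have we: "\<bar>inner (w \<zeta>) e\<bar> \<le> \<kappa>" if "\<zeta> \<in> A" for \<zeta>
  proof -
    have "\<bar>inner (w \<zeta>) e\<bar> \<le> norm (w \<zeta>) * norm e" by (rule Cauchy_Schwarz_ineq2)
    also have "\<dots> \<le> R * (\<kappa> / (R + 1))" using R[OF that] e R0 by (intro mult_mono) auto
    also have "\<dots> \<le> \<kappa>" using R0 \<kappa> by (simp add: field_simps)
    finally show ?thesis .
  qed
  have bdd: "bdd_above (u ` A)"
    using M we by (intro bdd_aboveI[of _ "M + \<kappa>"]) (fastforce simp: u_def intro: add_mono)
  have up: "u \<zeta> \<le> S" if "\<zeta> \<in> A" for \<zeta> unfolding S_def by (intro cSUP_upper that bdd)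
  have S: "S \<ge> m + 3 * \<kappa>" using up[OF m(2)] we[OF m(2)] \<kappa>(2) by (auto simp: u_def)
  have "\<exists>\<zeta>\<in>A. u \<zeta> > S - min \<kappa> (1 / (real n + 1))" for n
  proof -
    have "S - min \<kappa> (1 / (real n + 1)) < (SUP j\<in>A. u j)" using \<kappa> by (simp add: S_def min_def)
    then show ?thesis using less_cSUP_iff[OF \<open>A \<noteq> {}\<close> bdd] by blast
  qed
  then obtain s where s: "\<And>n. s n \<in> A" "\<And>n. u (s n) > S - min \<kappa> (1 / (real n + 1))" by metis
  have slim: "(\<lambda>n. u (s n)) \<longlonglongrightarrow> S"
  proof (rule tendsto_sandwich)
    show "(\<lambda>n. S - 1 / (real n + 1)) \<longlonglongrightarrow> S"
      using tendsto_diff[OF tendsto_const LIMSEQ_inverse_real_of_nat, of S] by (simp add: inverse_eq_divide add.commute)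
    show "\<forall>\<^sub>F n in sequentially. S - 1 / (real n + 1) \<le> u (s n)"
      using s(2) by (intro always_eventually allI) (smt (verit))
    show "\<forall>\<^sub>F n in sequentially. u (s n) \<le> S" using up s(1) by (intro always_eventually) blast
  qed auto
  have "Cauchy (\<lambda>n. w (s n))" using strong[of s, OF s(1)] slim unfolding u_def S_def by simp
  then obtain v where v: "(\<lambda>n. w (s n)) \<longlonglongrightarrow> v" using Cauchy_convergent convergent_def by blast
  have "bounded (range s)" by (rule bounded_subset[OF A(2)]) (use s(1) in auto)
  then obtain z \<sigma> where \<sigma>: "strict_mono \<sigma>" "(s \<circ> \<sigma>) \<longlonglongrightarrow> z" using bounded_imp_convergent_subsequence by blast
  have sK: "cmod (K (s n)) > m" for n
    using s(2)[of n] we[OF s(1)[of n]] S \<kappa>(1) by (auto simp: u_def min_def split: if_splits)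
  have "\<exists>r>0. ball z r \<subseteq> A"
    by (rule bd[of "s \<circ> \<sigma>" z v]) (use s(1) sK \<sigma>(2) LIMSEQ_subseq_LIMSEQ[OF v \<sigma>(1)] in \<open>auto simp: o_def\<close>)
  then obtain r where r: "r > 0" "ball z r \<subseteq> A" by blast
  then have zA: "z \<in> A" by auto
  have "isCont u z"
  proof -
    have "isCont K z" using holomorphic_on_imp_continuous_on[OF C(3)] C(1) A(1) zA by (auto simp: continuous_on_eq_continuous_at)
    moreover have "isCont w z" using cholomorphic_on_continuous[OF C(2)] C(1) A(1) zA by (auto simp: continuous_on_eq_continuous_at)
    ultimately show ?thesis unfolding u_def by (intro continuous_intros)
  qed
  then have "(\<lambda>n. u ((s \<circ> \<sigma>) n)) \<longlonglongrightarrow> u z" using isCont_tendsto_compose \<sigma>(2) by fast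
  moreover have "(\<lambda>n. u ((s \<circ> \<sigma>) n)) \<longlonglongrightarrow> S" using LIMSEQ_subseq_LIMSEQ[OF slim \<sigma>(1)] by (simp add: o_def)
  ultimately have uz: "u z = S" using LIMSEQ_unique by blast
  have Kz: "cmod (K z) > m" using uz S we[OF zA] \<kappa>(1) by (auto simp: u_def)
  then have Kz0: "K z \<noteq> 0" using m(1) by auto
  \<comment> \<open>The phase is chosen so that the real part of \<open>q\<close> lies below
    \<open>u\<close> with equality at \<open>z\<close>; thus \<open>exp \<circ> q\<close> has
    maximal modulus at \<open>z\<close>.\<close>
  define q where "q \<zeta> = K \<zeta> * cnj (sgn (K z)) + cinner (w \<zeta>) e" for \<zeta>
  have q: "q holomorphic_on ball z r"
    unfolding q_def using C(2,3) A(1) r(2)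
    by (intro holomorphic_intros cholomorphic_cinner holomorphic_on_subset[OF C(3)] cholomorphic_on_subset[OF C(2)]) auto
  have sg: "cmod (sgn (K z)) = 1" using Kz0 by (simp add: norm_sgn)
  have qu: "Re (q \<zeta>) \<le> u \<zeta>" for \<zeta>
    using complex_Re_le_cmod[of "K \<zeta> * cnj (sgn (K z))"] sg by (simp add: q_def u_def norm_mult inner_eq_Re_cinner)
  have "K z * cnj (sgn (K z)) = of_real (cmod (K z))"
    using Kz0 complex_norm_square[of "K z"] by (simp add: sgn_eq field_simps power2_eq_square)
  then have qz: "Re (q z) = S" using uz by (simp add: q_def u_def inner_eq_Re_cinner)
  have "(\<lambda>\<zeta>. exp (q \<zeta>)) constant_on ball z r"
  proof (rule maximum_modulus_principle[where U = "ball z r" and \<xi> = z])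
    show "(\<lambda>\<zeta>. exp (q \<zeta>)) holomorphic_on ball z r" using q by (intro holomorphic_intros)
    fix \<zeta> assume "\<zeta> \<in> ball z r"
    then have "Re (q \<zeta>) \<le> S" using qu[of \<zeta>] up[of \<zeta>] r(2) by auto
    then show "norm (exp (q \<zeta>)) \<le> norm (exp (q z))" by (simp add: norm_exp_eq_Re qz)
  qed (use r in auto)
  then obtain c where c: "\<And>\<zeta>. \<zeta> \<in> ball z r \<Longrightarrow> exp (q \<zeta>) = c" unfolding constant_on_def by blast
  have qconst: "Re (q \<zeta>) = S" if "\<zeta> \<in> ball z r" for \<zeta>
  proof -
    have "norm (exp (q \<zeta>)) = norm (exp (q z))" using c[OF that] c[of z] r(1) by simp
    then show ?thesis by (simp add: norm_exp_eq_Re qz)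
  qed
  have u\<zeta>: "u \<zeta> = S" if "\<zeta> \<in> ball z r" for \<zeta>
    using qconst[OF that] qu[of \<zeta>] up[of \<zeta>] that r(2) by force
  have w\<zeta>: "w \<zeta> = w z" if "\<zeta> \<in> ball z r" for \<zeta>
  proof -
    \<comment> \<open>Both points are exact maximisers, so the alternating sequence is maximising;
      its image under \<open>w\<close> converges only if the two values agree.\<close>
    define t where "t n = (if even n then \<zeta> else z)" for n :: nat
    have "Cauchy (\<lambda>n. w (t n))"
    proof (rule strong)
      show "t n \<in> A" for n using that zA r(2) by (auto simp: t_def)
      have "u (t n) = S" for n using u\<zeta>[OF that] uz by (simp add: t_def)
      then show "(\<lambda>n. cmod (K (t n)) + inner (w (t n)) e) \<longlonglongrightarrow> (SUP j\<in>A. cmod (K j) + inner (w j) e)"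
        unfolding u_def S_def by simp
    qed
    then obtain l where l: "(\<lambda>n. w (t n)) \<longlonglongrightarrow> l" using Cauchy_convergent convergent_def by blast
    have "(\<lambda>n. w (t (2 * n))) \<longlonglongrightarrow> l" "(\<lambda>n. w (t (2 * n + 1))) \<longlonglongrightarrow> l"
      using LIMSEQ_subseq_LIMSEQ[OF l, of "\<lambda>n. 2 * n"] LIMSEQ_subseq_LIMSEQ[OF l, of "\<lambda>n. 2 * n + 1"]
      by (auto simp: strict_mono_def o_def)
    then have "(\<lambda>n::nat. w \<zeta>) \<longlonglongrightarrow> l" "(\<lambda>n::nat. w z) \<longlonglongrightarrow> l" by (simp_all add: t_def)
    then show ?thesis by (metis LIMSEQ_const_iff)
  qed
  have "cmod (K \<zeta>) = cmod (K z)" if "\<zeta> \<in> ball z r" for \<zeta>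
    using u\<zeta>[OF that] w\<zeta>[OF that] uz by (simp add: u_def)
  with r Kz w\<zeta> show ?thesis by blast
qed

text \<open>Turns the outcome of the strong maximum principle into a contradiction: when
  \<open>w\<close> is locally constant, a divided difference with pole \<open>z1\<close> has a
  constant numerator, and its modulus can be constant only if \<open>cmod (\<zeta> - z1)\<close>
  is.\<close>

lemma not_const_quotient:
  fixes z z1 :: complex
  assumes r: "r > 0" and M: "M > 0" and eq: "\<And>\<zeta>. \<zeta> \<in> ball z r \<Longrightarrow> \<zeta> \<noteq> z1 \<Longrightarrow> c = M * cmod (\<zeta> - z1)"
  shows False
proof (cases "z = z1")
  case True
  have "c = M * cmod ((z1 + of_real (r / 2)) - z1)" "c = M * cmod ((z1 + of_real (r / 4)) - z1)"
    using r by (intro eq; simp add: True dist_norm)+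
  then have "M * (r / 2) = M * (r / 4)" using r by (simp del: of_real_divide)
  then show False using r M by simp
next
  case False
  define d where "d = sgn (z - z1)"
  have d: "cmod d = 1" "z - z1 = of_real (cmod (z - z1)) * d" using False by (auto simp: d_def norm_sgn) (simp add: sgn_eq)
  define \<zeta> where "\<zeta> = z + of_real (r / 2) * d"
  have \<zeta>: "\<zeta> - z1 = of_real (cmod (z - z1) + r / 2) * d"
    using d(2) by (simp add: \<zeta>_def algebra_simps)
  have n: "cmod (\<zeta> - z1) = cmod (z - z1) + r / 2"
    unfolding \<zeta> norm_mult d(1) using r by (simp del: of_real_add)
  have "c = M * cmod (z - z1)" using r False by (intro eq) auto
  moreover have "c = M * cmod (\<zeta> - z1)"
  proof (rule eq)
    show "\<zeta> \<in> ball z r" using r d(1) by (simp add: \<zeta>_def dist_norm norm_mult)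
    have "cmod (\<zeta> - z1) > 0" unfolding n using r by (simp add: add_nonneg_pos)
    then show "\<zeta> \<noteq> z1" by auto
  qed
  ultimately have "M * cmod (z - z1) = M * (cmod (z - z1) + r / 2)" unfolding n by linarith
  then show False using r M by simp
qed

definition divided_difference :: "(complex \<Rightarrow> complex) \<Rightarrow> complex \<Rightarrow> complex \<Rightarrow> complex"
  where "divided_difference h a z = (if z = a then deriv h a else (h z - h a) / (z - a))"

lemma divided_difference_holomorphic:
  "h holomorphic_on C \<Longrightarrow> open C \<Longrightarrow> divided_difference h a holomorphic_on C"
  unfolding divided_difference_def using pole_lemma_open[of h C a] by simp

text \<open>For divided differences: compactness takes care of a neighbourhood of the pole, and a
  crude bound of the rest, where the denominator is bounded below.\<close>

lemma bounded_on_split: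
  fixes K :: "complex \<Rightarrow> complex"
  assumes "continuous_on (cball a d) K" and "\<And>\<zeta>. \<zeta> \<in> A \<Longrightarrow> dist a \<zeta> \<ge> d \<Longrightarrow> cmod (K \<zeta>) \<le> M"
  shows "\<exists>M'. \<forall>\<zeta>\<in>A. cmod (K \<zeta>) \<le> M'"
proof -
  have "bounded (K ` cball a d)" using assms(1) by (intro compact_imp_bounded compact_continuous_image) auto
  then obtain B where B: "\<And>\<zeta>. \<zeta> \<in> cball a d \<Longrightarrow> cmod (K \<zeta>) \<le> B" unfolding bounded_iff by blast
  have "cmod (K \<zeta>) \<le> max B M" if "\<zeta> \<in> A" for \<zeta>
    using B[of \<zeta>] assms(2)[OF that] by (cases "dist a \<zeta> \<le> d") (auto simp: le_max_iff_disj)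
  then show ?thesis by blast
qed

text \<open>The set where a bounded map \<open>w\<close> is defined has no boundary point at which \<open>w\<close> fails to have
  a limit along every approaching sequence: the maximum principle for divided differences makes
  \<open>w\<close> Lipschitz.\<close>

lemma no_wild_boundary:
  fixes w :: "complex \<Rightarrow> 'e::complex_hilbert_space"
  assumes O: "open O'" "O' \<noteq> {}" "O' \<subseteq> ball 0 t" and w: "cholomorphic_on w O'"
    and R: "\<And>\<zeta>. \<zeta> \<in> O' \<Longrightarrow> norm (w \<zeta>) \<le> R"
    and jump: "\<And>s z v. (\<And>n. s n \<in> O') \<Longrightarrow> s \<longlonglongrightarrow> z \<Longrightarrow> z \<in> ball 0 t \<Longrightarrow> (\<lambda>n::nat. w (s n)) \<longlonglongrightarrow> v \<Longrightarrow> z \<in> O'"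
  shows "O' = ball 0 t"
proof -
  have R0: "R \<ge> 0" using O(2) R by (meson ex_in_conv norm_ge_zero order_trans)
  \<comment> \<open>If the estimate fails, the divided difference of one component of
    \<open>w\<close> with pole \<open>\<zeta>1\<close> is large at \<open>\<zeta>2\<close>, and its
    maximum over \<open>cball 0 t'\<close> can be approached neither on the outer circle nor at a
    boundary point of \<open>O'\<close>.\<close>
  have lip: "norm (w \<zeta>2 - w \<zeta>1) \<le> 2 * (R + 1) / (t' - t'') * cmod (\<zeta>2 - \<zeta>1)"
    if \<zeta>: "\<zeta>1 \<in> O'" "\<zeta>2 \<in> O'" "cmod \<zeta>1 \<le> t''" "cmod \<zeta>2 \<le> t''" and t: "t'' < t'" "t' < t" for \<zeta>1 \<zeta>2 t' t''
  proof (rule ccontr)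
    assume neg: "\<not> ?thesis"
    \<comment> \<open>Strictly above \<open>2 * R / (t' - t'')\<close>, which bounds the divided
      difference on the circle of radius \<open>t'\<close>.\<close>
    define m where "m = 2 * (R + 1) / (t' - t'')"
    have m: "m > 0" using R0 t by (simp add: m_def add_nonneg_pos)
    have mR: "2 * R / (t' - t'') < m" using t by (simp add: m_def divide_strict_right_mono)
    have neg': "norm (w \<zeta>2 - w \<zeta>1) > m * cmod (\<zeta>2 - \<zeta>1)" using neg unfolding m_def by simp
    have "0 \<le> m * cmod (\<zeta>2 - \<zeta>1)" using m by simp
    with neg' have ne: "w \<zeta>2 \<noteq> w \<zeta>1" "\<zeta>2 \<noteq> \<zeta>1" by auto
    define x where "x = sgn (w \<zeta>2 - w \<zeta>1)"
    have x: "norm x = 1" using ne by (simp add: x_def norm_sgn)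
    define h where "h \<zeta> = cinner (w \<zeta>) x" for \<zeta>
    have h: "h holomorphic_on O'" unfolding h_def by (rule cholomorphic_cinner[OF w])
    define K where "K = divided_difference h \<zeta>1"
    have K: "K holomorphic_on O'" unfolding K_def by (rule divided_difference_holomorphic[OF h O(1)])
    have hd: "cmod (h \<zeta> - h \<zeta>') \<le> norm (w \<zeta> - w \<zeta>')" for \<zeta> \<zeta>'
      using norm_cinner_le[of "w \<zeta> - w \<zeta>'" x] x by (simp add: h_def cinner_diff_left)
    have far: "cmod (K \<zeta>) \<le> 2 * R / d" if "\<zeta> \<in> O'" "d \<le> cmod (\<zeta> - \<zeta>1)" "d > 0" for \<zeta> d
    proof -
      have "cmod (h \<zeta> - h \<zeta>1) \<le> 2 * R"
        using hd[of \<zeta> \<zeta>1] norm_triangle_ineq4[of "w \<zeta>" "w \<zeta>1"] R[OF that(1)] R[OF \<zeta>(1)] by linarith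
      moreover have "\<zeta> \<noteq> \<zeta>1" using that by auto
      ultimately show ?thesis using that R0
        by (auto simp: K_def divided_difference_def norm_divide intro!: frac_le)
    qed
    obtain d where d: "d > 0" "cball \<zeta>1 d \<subseteq> O'" using O(1) \<zeta>(1) open_contains_cball by blast
    have "\<exists>M. \<forall>\<zeta>\<in>O' \<inter> cball 0 t'. cmod (K \<zeta>) \<le> M"
      using far[of _ d] d K
      by (intro bounded_on_split[of \<zeta>1 d K _ "2 * R / d"])
         (auto simp: dist_norm norm_minus_commute intro: holomorphic_on_imp_continuous_on holomorphic_on_subset)
    then obtain M where M: "\<And>\<zeta>. \<zeta> \<in> O' \<inter> cball 0 t' \<Longrightarrow> cmod (K \<zeta>) \<le> M" by blast
    have "\<exists>z r. r > 0 \<and> ball z r \<subseteq> O' \<inter> cball 0 t' \<and> cmod (K z) > m \<and>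
      (\<forall>\<zeta>\<in>ball z r. w \<zeta> = w z \<and> cmod (K \<zeta>) = cmod (K z))"
    proof (rule strong_maximum_principle[OF O(1) w K])
      show "bounded (O' \<inter> cball 0 t')" by (intro bounded_Int) auto
      show "\<zeta>2 \<in> O' \<inter> cball 0 t'" using \<zeta> t by auto
      have "cinner (w \<zeta>2 - w \<zeta>1) x = of_real (norm (w \<zeta>2 - w \<zeta>1))"
        using ne by (simp add: x_def sgn_div_norm scaleR_scaleC cinner_scaleC_right cinner_self power2_eq_square)
      then have "cmod (K \<zeta>2) = norm (w \<zeta>2 - w \<zeta>1) / cmod (\<zeta>2 - \<zeta>1)"
        using ne by (simp add: K_def divided_difference_def h_def norm_divide flip: cinner_diff_left)
      then show "cmod (K \<zeta>2) > m"
        using neg' ne by (simp add: pos_less_divide_eq)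
      fix s z v assume s: "\<And>n::nat. s n \<in> O' \<inter> cball 0 t' \<and> cmod (K (s n)) > m" "s \<longlonglongrightarrow> z" "(\<lambda>n. w (s n)) \<longlonglongrightarrow> v"
      have "z \<in> cball 0 t'" using closed_sequentially[OF closed_cball, of s 0 t' z] s by auto
      then have z: "z \<in> O'" "cmod z \<le> t'" using jump[of s z v] s t by auto
      have "isCont K z" using holomorphic_on_imp_continuous_on[OF K] O(1) z(1) by (auto simp: continuous_on_eq_continuous_at)
      from isCont_tendsto_compose[OF this s(2)]
      have "(\<lambda>n. cmod (K (s n))) \<longlonglongrightarrow> cmod (K z)" by (rule tendsto_norm)
      then have mK: "m \<le> cmod (K z)" by (rule LIMSEQ_le_const) (use s(1) in \<open>auto intro: less_imp_le\<close>)
      have "cmod z \<noteq> t'"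
      proof
        assume "cmod z = t'"
        then have "t' - t'' \<le> cmod (z - \<zeta>1)" using norm_triangle_ineq2[of z \<zeta>1] \<zeta>(3) by linarith
        then have "cmod (K z) \<le> 2 * R / (t' - t'')" using far[OF z(1)] t by simp
        then show False using mK mR by linarith
      qed
      then have "z \<in> O' \<inter> ball 0 t'" using z by auto
      moreover have "open (O' \<inter> ball 0 t')" using O(1) by auto
      ultimately obtain r where "r > 0" "ball z r \<subseteq> O' \<inter> ball 0 t'" using open_contains_ball by blast
      then show "\<exists>r>0. ball z r \<subseteq> O' \<inter> cball 0 t'" by (intro exI[of _ r]) auto
    qed (use R M m in auto)
    then obtain z r where r: "r > 0" "ball z r \<subseteq> O' \<inter> cball 0 t'" "cmod (K z) > m"
      "\<And>\<zeta>. \<zeta> \<in> ball z r \<Longrightarrow> w \<zeta> = w z \<and> cmod (K \<zeta>) = cmod (K z)" by blast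
    have Kz: "cmod (K z) > 0" by (rule less_trans[OF m r(3)])
    have "cmod (h z - h \<zeta>1) = cmod (K z) * cmod (\<zeta> - \<zeta>1)" if "\<zeta> \<in> ball z r" "\<zeta> \<noteq> \<zeta>1" for \<zeta>
    proof -
      have wz: "w \<zeta> = w z" and Kz': "cmod (K z) = cmod (K \<zeta>)" using r(4)[OF that(1)] by simp_all
      have "cmod (K \<zeta>) = cmod ((h z - h \<zeta>1) / (\<zeta> - \<zeta>1))"
        using that(2) wz by (simp add: K_def divided_difference_def h_def)
      then show ?thesis unfolding Kz' using that(2) by (simp add: norm_divide)
    qed
    then show False using not_const_quotient[OF r(1) Kz] by blast
  qed
  have "closedin (top_of_set (ball 0 t)) O'"
    unfolding closedin_limpt
  proof (intro conjI allI impI)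
    show "O' \<subseteq> ball 0 t" by (rule O(3))
    fix l assume "l islimpt O' \<and> l \<in> ball 0 t"
    then obtain s where s: "\<forall>n. s n \<in> O'" "s \<longlonglongrightarrow> l" and l: "l \<in> ball 0 t"
      unfolding islimpt_sequential by blast
    define t'' where "t'' = (cmod l + t) / 2"
    define t' where "t' = (t'' + t) / 2"
    have t: "cmod l < t''" "t'' < t'" "t' < t" using l by (auto simp: t'_def t''_def)
    define L where "L = 2 * (R + 1) / (t' - t'')"
    have L: "L > 0" using R0 t by (simp add: L_def add_nonneg_pos)
    have "\<forall>\<^sub>F n in sequentially. cmod (s n) < t''"
      using t(1) by (intro order_tendstoD(2)[OF tendsto_norm[OF s(2)]])
    then obtain N where N: "\<And>n. n \<ge> N \<Longrightarrow> cmod (s n) < t''" by (auto simp: eventually_sequentially)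
    have "Cauchy (\<lambda>n. w (s n))"
    proof (rule CauchyI)
      fix e :: real assume "e > 0"
      then have "e / L > 0" using L by simp
      then obtain N' where N': "\<And>m n. m \<ge> N' \<Longrightarrow> n \<ge> N' \<Longrightarrow> norm (s m - s n) < e / L"
        using CauchyD[OF LIMSEQ_imp_Cauchy[OF s(2)], of "e / L"] by blast
      have "norm (w (s m) - w (s n)) < e" if "m \<ge> max N N'" "n \<ge> max N N'" for m n
      proof -
        have "norm (w (s m) - w (s n)) \<le> L * cmod (s m - s n)"
          unfolding L_def using s(1) that t by (intro lip less_imp_le[OF N]) auto
        also have "\<dots> < e" using N'[of m n] that L by (simp add: field_simps)
        finally show ?thesis .
      qed
      then show "\<exists>M. \<forall>m\<ge>M. \<forall>n\<ge>M. norm (w (s m) - w (s n)) < e" by blast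
    qed
    then obtain v where "(\<lambda>n. w (s n)) \<longlonglongrightarrow> v" using Cauchy_convergent convergent_def by blast
    then show "l \<in> O'" using jump[of s l v] s l by blast
  qed
  moreover have "openin (top_of_set (ball 0 t)) O'" using O(1,3) by (simp add: openin_open_eq)
  ultimately show ?thesis
    using connected_clopen[of "ball (0::complex) t"] O(2) by auto
qed

text \<open>Localisation of analytic discs near a strictly pseudoconvex boundary point, read in a chart. Here
  \<open>w\<close> is the chart composed with the disc, \<open>C\<close> is the set of parameters at which the disc is in
  the domain of the chart, and \<open>\<mu>\<close> is a local peak functional. Since the manifold need not be a regular
  space, the disc may leave the domain of the chart without \<open>w\<close> reaching the sphere of radius \<open>R\<close>;
  hypothesis \<open>jump\<close> is all that the Hausdorff property gives.\<close>

lemma disc_localisation: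
  fixes c Mb R :: real
  assumes c: "c > 0" and Mb: "Mb > 0" and R: "R > 0"
  shows "\<exists>r1>0. \<exists>r0>0. r1 < R \<and> r0 < 1 \<and> (\<forall>C (w :: complex \<Rightarrow> 'e::complex_hilbert_space) \<mu>.
    open C \<longrightarrow> C \<subseteq> ball 0 1 \<longrightarrow> 0 \<in> C \<longrightarrow> cholomorphic_on w C \<longrightarrow> (\<forall>\<zeta>\<in>C. norm (w \<zeta>) < R) \<longrightarrow>
    cblinear \<mu> \<longrightarrow> (\<forall>v. cmod (\<mu> v) \<le> Mb * norm v) \<longrightarrow> (\<forall>\<zeta>\<in>C. c * (norm (w \<zeta>))\<^sup>2 \<le> Re (\<mu> (w \<zeta>))) \<longrightarrow>
    (\<forall>s z v. (\<forall>n::nat. s n \<in> C) \<longrightarrow> s \<longlonglongrightarrow> z \<longrightarrow> cmod z < 1 \<longrightarrow> (\<lambda>n. w (s n)) \<longlonglongrightarrow> v \<longrightarrow> norm v < R \<longrightarrow> z \<in> C) \<longrightarrow>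
    norm (w 0) \<le> r1 / 2 \<longrightarrow> ball 0 r0 \<subseteq> C \<and> (\<forall>\<zeta>\<in>ball 0 r0. norm (w \<zeta>) \<le> r1))"
proof -
  \<comment> \<open>At norm \<open>r1\<close> the peak functional is at most a quarter of its lower
    bound \<open>c * R\<^sup>2\<close> at norm \<open>R\<close>. This separation is what the
    exponential weight exploits.\<close>
  define r1 where "r1 = min (R / 2) (c * R\<^sup>2 / (4 * Mb))"
  have r1: "r1 > 0" "r1 < R" "Mb * r1 \<le> c * R\<^sup>2 / 4"
  proof -
    show "r1 > 0" "r1 < R" using c Mb R by (auto simp: r1_def min_def)
    have "Mb * r1 \<le> Mb * (c * R\<^sup>2 / (4 * Mb))" using Mb unfolding r1_def by (intro mult_left_mono) auto
    then show "Mb * r1 \<le> c * R\<^sup>2 / 4" using Mb by simp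
  qed
  \<comment> \<open>With this value \<open>A * c * R\<^sup>2 / 2\<close> equals
    \<open>8 * R / r1\<close>, so that \<open>1 + x \<le> exp x\<close> suffices to make the weight
    at norm \<open>R\<close> negligible against \<open>l\<close>.\<close>
  define A where "A = 16 / (c * R * r1)"
  have A: "A > 0" using c R r1 by (simp add: A_def)
  \<comment> \<open>A lower bound for the weighted increment of \<open>w\<close> at a point of norm
    \<open>r1\<close>, given that the centre has norm at most \<open>r1 / 2\<close>.\<close>
  define l where "l = r1 / 2 * exp (- A * Mb * r1)"
  have l: "l > 0" using r1 by (simp add: l_def)
  have lA: "2 * R * exp (- A * c * R\<^sup>2) < l / 2"
  proof -
    have "16 * R / r1 = A * c * R\<^sup>2" using c R r1 by (simp add: A_def power2_eq_square)
    have "8 * R / r1 < 1 + A * (c * R\<^sup>2 / 2)" using c R r1 by (simp add: A_def power2_eq_square field_simps)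
    also have "\<dots> \<le> exp (A * (c * R\<^sup>2 / 2))" by (rule exp_ge_add_one_self)
    finally have "8 * R < r1 * exp (A * (c * R\<^sup>2 / 2))" using r1 by (simp add: field_simps)
    then have "8 * R * exp (- A * c * R\<^sup>2) < r1 * exp (A * (c * R\<^sup>2 / 2)) * exp (- A * c * R\<^sup>2)"
      by (intro mult_strict_right_mono) auto
    also have "\<dots> = r1 * exp (A * (c * R\<^sup>2 / 2) - A * c * R\<^sup>2)" by (simp add: mult.assoc mult_exp_exp)
    also have "\<dots> \<le> r1 * exp (- A * Mb * r1)"
    proof -
      have "A * (Mb * r1) \<le> A * (c * R\<^sup>2 / 4)" using r1(3) A by (intro mult_left_mono) auto
      also have "\<dots> \<le> A * (c * R\<^sup>2 / 2)" using A c by (intro mult_left_mono) auto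
      finally have "A * (c * R\<^sup>2 / 2) - A * c * R\<^sup>2 \<le> - A * Mb * r1" by (simp add: field_simps)
      then show ?thesis using r1(1) by (intro mult_left_mono) auto
    qed
    finally show ?thesis by (simp add: l_def)
  qed
  \<comment> \<open>Small enough that the level \<open>m = l / (2 * t0)\<close> used below, for any
    \<open>t0 \<le> r0\<close>, exceeds \<open>4 * R\<close>, the bound of \<open>K\<close> on the
    circle of radius 1/2.\<close>
  define r0 where "r0 = min (1 / 4) (l / (10 * R))"
  have r0: "r0 > 0" "r0 \<le> 1 / 4" "10 * R * r0 \<le> l"
  proof -
    show "r0 > 0" "r0 \<le> 1 / 4" using l R by (auto simp: r0_def)
    have "10 * R * r0 \<le> 10 * R * (l / (10 * R))" using R unfolding r0_def by (intro mult_left_mono) auto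
    then show "10 * R * r0 \<le> l" using R by simp
  qed
  have main: "ball 0 r0 \<subseteq> C \<and> (\<forall>\<zeta>\<in>ball 0 r0. norm (w \<zeta>) \<le> r1)"
    if C: "open C" "C \<subseteq> ball 0 1" "0 \<in> C" and w: "cholomorphic_on w C" "\<And>\<zeta>. \<zeta> \<in> C \<Longrightarrow> norm (w \<zeta>) < R"
      and \<mu>: "cblinear \<mu>" "\<And>v. cmod (\<mu> v) \<le> Mb * norm v" "\<And>\<zeta>. \<zeta> \<in> C \<Longrightarrow> c * (norm (w \<zeta>))\<^sup>2 \<le> Re (\<mu> (w \<zeta>))"
      and jump: "\<And>s z v. (\<And>n::nat. s n \<in> C) \<Longrightarrow> s \<longlonglongrightarrow> z \<Longrightarrow> cmod z < 1 \<Longrightarrow> (\<lambda>n. w (s n)) \<longlonglongrightarrow> v \<Longrightarrow> norm v < R \<Longrightarrow> z \<in> C"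
      and w0: "norm (w 0) \<le> r1 / 2"
    for C and w :: "complex \<Rightarrow> 'e" and \<mu>
  proof -
    \<comment> \<open>Only the component of 0 is used: elsewhere in \<open>C\<close> a disc that
      left the chart may have come back, and a path from the centre is needed for the intermediate
      value argument.\<close>
    define C0 where "C0 t = connected_component_set (C \<inter> ball 0 t) 0" for t :: real
    define G where "G = {t. 0 < t \<and> t < 1 \<and> (\<exists>\<zeta>\<in>C0 t. norm (w \<zeta>) \<ge> r1)}"
    have C0sub: "C0 t \<subseteq> C \<inter> ball 0 t" for t unfolding C0_def by (rule connected_component_subset)
    have C0open: "open (C0 t)" for t unfolding C0_def using C(1) by (intro open_connected_component open_Int) auto
    have C00: "0 \<in> C0 t" if "t > 0" for t unfolding C0_def using C(3) that by (simp add: connected_component_refl)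
    have small: "ball 0 t \<subseteq> C \<and> (\<forall>\<zeta>\<in>ball 0 t. norm (w \<zeta>) < r1)" if t: "0 < t" "t < 1" "t \<notin> G" for t
    proof -
      have lt: "norm (w \<zeta>) < r1" if "\<zeta> \<in> C0 t" for \<zeta> using t that by (auto simp: G_def not_le)
      have "C0 t = ball 0 t"
      proof (rule no_wild_boundary[where R = r1])
        show "cholomorphic_on w (C0 t)" using w(1) C0sub cholomorphic_on_subset by blast
        fix s z v assume s: "\<And>n::nat. s n \<in> C0 t" "s \<longlonglongrightarrow> z" "z \<in> ball 0 t" "(\<lambda>n. w (s n)) \<longlonglongrightarrow> v"
        have "norm v \<le> r1"
          using lt[OF s(1)] by (intro LIMSEQ_le_const2[OF tendsto_norm[OF s(4)]]) (auto intro: less_imp_le)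
        then have "z \<in> C" using s C0sub t r1 by (intro jump[of s z v]) auto
        then have "z \<in> C \<inter> ball 0 t" using s by simp
        moreover have "open (C \<inter> ball 0 t)" using C(1) by auto
        ultimately obtain e where e: "e > 0" "ball z e \<subseteq> C \<inter> ball 0 t" using open_contains_ball by blast
        obtain n where "s n \<in> ball z e"
          using s(2) e(1) by (metis LIMSEQ_def dist_commute mem_ball order_refl)
        then have "connected_component (C \<inter> ball 0 t) (s n) z"
          using e by (intro connected_component_of_subset[OF _ e(2)] connected_componentI[of "ball z e"]) auto
        moreover have "connected_component (C \<inter> ball 0 t) 0 (s n)" using s(1)[of n] by (simp add: C0_def)
        ultimately show "z \<in> C0 t" using connected_component_trans by (fastforce simp: C0_def)
      qed (use C0open C00[OF t(1)] C0sub lt in \<open>auto intro: less_imp_le\<close>)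
      then show ?thesis using C0sub lt by blast
    qed
    \<comment> \<open>Otherwise the first bad radius \<open>t0\<close> is positive. Below it the
      disc stays within norm \<open>r1\<close>, and just beyond it the norm \<open>r1\<close> is
      attained; comparing these two facts at the single scale \<open>t0\<close> gives the
      contradiction.\<close>
    have "r0 \<notin> G"
    proof
      assume r0G: "r0 \<in> G"
      define t0 where "t0 = Inf G"
      have bddG: "bdd_below G" by (rule bdd_belowI[of _ 0]) (auto simp: G_def)
      have t0le: "t0 \<le> r0" unfolding t0_def by (rule cInf_lower[OF r0G bddG])
      obtain e where e: "e > 0" "\<And>\<zeta>. \<zeta> \<in> ball 0 e \<Longrightarrow> \<zeta> \<in> C \<and> norm (w \<zeta>) < r1"
      proof -
        have "isCont w 0" using cholomorphic_on_continuous[OF w(1)] C by (auto simp: continuous_on_eq_continuous_at)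
        then have "(\<lambda>\<zeta>. norm (w \<zeta>)) \<midarrow>0\<rightarrow> norm (w 0)" by (intro tendsto_norm) (simp add: isCont_def)
        moreover have "norm (w 0) < r1" using w0 r1 by simp
        ultimately have "\<forall>\<^sub>F \<zeta> in at 0. norm (w \<zeta>) < r1" by (rule order_tendstoD)
        then obtain d where d: "d > 0" "\<And>\<zeta>. \<zeta> \<noteq> 0 \<Longrightarrow> dist \<zeta> 0 < d \<Longrightarrow> norm (w \<zeta>) < r1"
          unfolding eventually_at by blast
        obtain d' where d': "d' > 0" "ball 0 d' \<subseteq> C" using C open_contains_ball by blast
        show ?thesis
          by (rule that[of "min d d'"]) (use d d' \<open>norm (w 0) < r1\<close> in \<open>auto, metis\<close>)
      qed
      have "e \<le> t" if "t \<in> G" for t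
      proof (rule ccontr)
        assume "\<not> e \<le> t"
        then have "norm (w \<zeta>) < r1" if "\<zeta> \<in> C0 t" for \<zeta> using e(2) C0sub that by fastforce
        then show False using \<open>t \<in> G\<close> by (fastforce simp: G_def)
      qed
      then have "e \<le> t0" unfolding t0_def using r0G by (intro cInf_greatest) auto
      then have t0: "t0 > 0" using e(1) by linarith
      have inner: "\<zeta> \<in> C \<and> norm (w \<zeta>) < r1" if \<zeta>t0: "cmod \<zeta> < t0" for \<zeta>
      proof -
        obtain t where t: "cmod \<zeta> < t" "t < t0" using dense[OF \<zeta>t0] by blast
        have "t \<notin> G"
        proof
          assume "t \<in> G"
          then have "t0 \<le> t" unfolding t0_def by (rule cInf_lower[OF _ bddG])
          then show False using t(2) by simp
        qed
        moreover have "0 < t" using t norm_ge_zero[of \<zeta>] by linarith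
        ultimately have "ball 0 t \<subseteq> C \<and> (\<forall>\<zeta>\<in>ball 0 t. norm (w \<zeta>) < r1)"
          using t t0le r0 by (intro small) auto
        then show ?thesis using t by auto
      qed
      \<comment> \<open>The factor 2 keeps the point where norm \<open>r1\<close> is attained at
        distance less than \<open>2 * t0\<close> from the centre, so the quotient by
        \<open>\<zeta>\<close> there exceeds \<open>l / (2 * t0)\<close>.\<close>
      obtain t where t: "t \<in> G" "t < 2 * t0"
        using cInf_lessD[of G "2 * t0"] r0G t0 unfolding t0_def by auto
      then obtain \<zeta>a where \<zeta>a: "\<zeta>a \<in> C0 t" "norm (w \<zeta>a) \<ge> r1" by (auto simp: G_def)
      have "connected ((\<lambda>\<zeta>. norm (w \<zeta>)) ` C0 t)"
        using cholomorphic_on_continuous[OF w(1)] C0sub unfolding C0_def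
        by (intro connected_continuous_image continuous_on_norm connected_connected_component)
           (auto intro: continuous_on_subset)
      moreover have "norm (w 0) \<in> (\<lambda>\<zeta>. norm (w \<zeta>)) ` C0 t" using C00 t by (auto simp: G_def)
      moreover have "norm (w \<zeta>a) \<in> (\<lambda>\<zeta>. norm (w \<zeta>)) ` C0 t" using \<zeta>a by auto
      ultimately have "r1 \<in> (\<lambda>\<zeta>. norm (w \<zeta>)) ` C0 t"
        using w0 r1 \<zeta>a(2) by (intro connectedD_interval[of _ "norm (w 0)" "norm (w \<zeta>a)" r1]) auto
      then obtain \<zeta>' where \<zeta>': "\<zeta>' \<in> C0 t" "norm (w \<zeta>') = r1" by auto
      have \<zeta>'C: "\<zeta>' \<in> C" "cmod \<zeta>' < t" using subsetD[OF C0sub \<zeta>'(1)] by auto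
      have \<zeta>'0: "\<zeta>' \<noteq> 0" using \<zeta>'(2) w0 r1 by auto
      define a where "a = w 0"
      define x where "x = sgn (w \<zeta>' - a)"
      have wa: "norm (w \<zeta>' - a) \<ge> r1 / 2" using norm_triangle_ineq2[of "w \<zeta>'" a] \<zeta>'(2) w0 by (simp add: a_def)
      then have ne: "w \<zeta>' \<noteq> a" using r1 by auto
      have x: "norm x = 1" using ne by (simp add: x_def norm_sgn)
      define h where "h \<zeta> = cinner (w \<zeta>) x" for \<zeta>
      \<comment> \<open>The quotient by \<open>\<zeta>\<close> is large at the first exit from norm
        \<open>r1\<close>, while the exponential of the peak functional makes the function small
        wherever \<open>w\<close> is near the sphere of radius \<open>R\<close>.\<close>
      define K where "K \<zeta> = exp (- of_real A * \<mu> (w \<zeta>)) * divided_difference h 0 \<zeta>" for \<zeta>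
      have hol\<mu>: "(\<lambda>\<zeta>. \<mu> (w \<zeta>)) holomorphic_on C"
        unfolding cholomorphic_on_complex_iff[symmetric] by (rule cholomorphic_on_cblinear_compose[OF w(1) \<mu>(1)])
      have K: "K holomorphic_on C"
      proof -
        have "h holomorphic_on C" unfolding h_def by (rule cholomorphic_cinner[OF w(1)])
        moreover have "(\<lambda>\<zeta>. exp (- of_real A * \<mu> (w \<zeta>))) holomorphic_on C"
          by (intro holomorphic_on_exp' holomorphic_on_mult holomorphic_on_const hol\<mu>)
        ultimately show ?thesis
          unfolding K_def by (intro holomorphic_on_mult divided_difference_holomorphic C(1))
      qed
      have dd: "divided_difference h 0 \<zeta> = cinner (w \<zeta> - a) x / \<zeta>" if "\<zeta> \<noteq> 0" for \<zeta>
        using that by (simp add: divided_difference_def h_def a_def cinner_diff_left)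
      have Kb: "cmod (K \<zeta>) \<le> exp (- A * c * (norm (w \<zeta>))\<^sup>2) * (2 * R / d)"
        if "\<zeta> \<in> C" "d \<le> cmod \<zeta>" "d > 0" for \<zeta> d
      proof -
        have \<zeta>0: "\<zeta> \<noteq> 0" using that by auto
        have "cmod (cinner (w \<zeta> - a) x) \<le> norm (w \<zeta> - a)" using norm_cinner_le[of "w \<zeta> - a" x] x by simp
        also have "\<dots> \<le> 2 * R"
          using norm_triangle_ineq4[of "w \<zeta>" a] w(2)[OF that(1)] w(2)[OF C(3)] by (simp add: a_def)
        finally have "cmod (divided_difference h 0 \<zeta>) \<le> 2 * R / d"
          using that R unfolding dd[OF \<zeta>0] norm_divide by (intro frac_le) auto
        moreover have "cmod (exp (- of_real A * \<mu> (w \<zeta>))) \<le> exp (- A * c * (norm (w \<zeta>))\<^sup>2)"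
          using \<mu>(3)[OF that(1)] A by (simp add: norm_exp_eq_Re mult.assoc)
        ultimately show ?thesis unfolding K_def norm_mult by (intro mult_mono) auto
      qed
      have Kb': "cmod (K \<zeta>) \<le> 2 * R / d" if "\<zeta> \<in> C" "d \<le> cmod \<zeta>" "d > 0" for \<zeta> d
      proof -
        have "exp (- A * c * (norm (w \<zeta>))\<^sup>2) * (2 * R / d) \<le> 1 * (2 * R / d)"
          using A c R that by (intro mult_right_mono) auto
        then show ?thesis using Kb[OF that] by simp
      qed
      define m where "m = l / (2 * t0)"
      have m: "m > 0" using l t0 by (simp add: m_def)
      have m4: "4 * R < m"
      proof -
        have "4 * R * (2 * t0) < l" proof -
          have "8 * R * t0 \<le> 8 * R * r0" using R by (intro mult_left_mono t0le) auto
          moreover have "R * r0 > 0" using R r0 by simp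
          ultimately show ?thesis using r0(3) by linarith
        qed
        then show ?thesis using t0 by (simp add: m_def field_simps)
      qed
      define A0 where "A0 = C \<inter> cball 0 (1 / 2)"
      have "cball 0 (t0 / 2) \<subseteq> C" using inner t0 by auto
      then have "\<exists>M. \<forall>\<zeta>\<in>A0. cmod (K \<zeta>) \<le> M"
        using Kb'[of _ "t0 / 2"] t0 K
        by (intro bounded_on_split[of 0 "t0 / 2" K _ "2 * R / (t0 / 2)"])
           (auto simp: A0_def intro: holomorphic_on_imp_continuous_on holomorphic_on_subset)
      then obtain M where M: "\<And>\<zeta>. \<zeta> \<in> A0 \<Longrightarrow> cmod (K \<zeta>) \<le> M" by blast
      have "\<exists>z r. r > 0 \<and> ball z r \<subseteq> A0 \<and> cmod (K z) > m \<and>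
        (\<forall>\<zeta>\<in>ball z r. w \<zeta> = w z \<and> cmod (K \<zeta>) = cmod (K z))"
      proof (rule strong_maximum_principle[OF C(1) w(1) K])
        show "bounded A0" unfolding A0_def by (intro bounded_Int) auto
        show "A0 \<subseteq> C" by (auto simp: A0_def)
        show "norm (w \<zeta>) \<le> R" if "\<zeta> \<in> A0" for \<zeta> using w(2)[of \<zeta>] that by (auto simp: A0_def)
        show "\<zeta>' \<in> A0" using \<zeta>'C t t0le r0 by (auto simp: A0_def)
        show "cmod (K \<zeta>') > m"
        proof -
          have "cinner (w \<zeta>' - a) x = of_real (norm (w \<zeta>' - a))"
            using ne by (simp add: x_def sgn_div_norm scaleR_scaleC cinner_scaleC_right cinner_self power2_eq_square)
          then have 1: "cmod (divided_difference h 0 \<zeta>') = norm (w \<zeta>' - a) / cmod \<zeta>'"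
            using dd[OF \<zeta>'0] by (simp add: norm_divide)
          have "Re (\<mu> (w \<zeta>')) \<le> Mb * r1" using \<mu>(2)[of "w \<zeta>'"] \<zeta>'(2) complex_Re_le_cmod order_trans by metis
          then have "exp (- A * Mb * r1) \<le> cmod (exp (- of_real A * \<mu> (w \<zeta>')))"
            using A by (simp add: norm_exp_eq_Re mult.assoc)
          then have "exp (- A * Mb * r1) * (r1 / 2 / cmod \<zeta>') \<le> cmod (K \<zeta>')"
            unfolding K_def norm_mult 1 using wa r1 by (intro mult_mono divide_right_mono) auto
          then have "l / cmod \<zeta>' \<le> cmod (K \<zeta>')" by (simp add: l_def mult.commute)
          moreover have "l / (2 * t0) < l / cmod \<zeta>'"
            using \<zeta>'C t \<zeta>'0 l t0 by (intro divide_strict_left_mono) auto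
          ultimately show ?thesis by (simp add: m_def)
        qed
        fix s z v assume s: "\<And>n::nat. s n \<in> A0 \<and> cmod (K (s n)) > m" "s \<longlonglongrightarrow> z" "(\<lambda>n. w (s n)) \<longlonglongrightarrow> v"
        have sC: "s n \<in> C" for n using s(1) by (auto simp: A0_def)
        have z12: "z \<in> cball 0 (1 / 2)"
          using closed_sequentially[OF closed_cball, of s 0 "1/2" z] s by (auto simp: A0_def)
        have vR: "norm v \<le> R"
          using w(2)[OF sC] by (intro LIMSEQ_le_const2[OF tendsto_norm[OF s(3)]]) (auto intro: less_imp_le)
        \<comment> \<open>Near the outer sphere the norm exceeds \<open>r1\<close>, so the parameter
          has modulus at least \<open>t0\<close>, and there the weight brings \<open>K\<close> below
          the level \<open>m\<close>. With this excluded, \<open>jump\<close> applies to every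
          remaining limit.\<close>
        have "norm v \<noteq> R"
        proof
          assume v: "norm v = R"
          have "\<forall>\<^sub>F n in sequentially. norm (w (s n)) > r1"
            using r1 v by (intro order_tendstoD(1)[OF tendsto_norm[OF s(3)]]) auto
          then have "\<forall>\<^sub>F n in sequentially. m \<le> exp (- A * c * (norm (w (s n)))\<^sup>2) * (2 * R / t0)"
          proof eventually_elim
            case (elim n)
            then have "\<not> cmod (s n) < t0" using inner[of "s n"] by auto
            then show ?case using Kb[OF sC, of t0 n] t0 s(1)[of n] by force
          qed
          moreover have "(\<lambda>n. exp (- A * c * (norm (w (s n)))\<^sup>2) * (2 * R / t0)) \<longlonglongrightarrow> exp (- A * c * (norm v)\<^sup>2) * (2 * R / t0)"
            by (intro tendsto_intros s(3))
          ultimately have "m \<le> exp (- A * c * R\<^sup>2) * (2 * R / t0)"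
            using tendsto_lowerbound[OF _ _ sequentially_bot] v by fastforce
          also have "\<dots> < l / 2 / t0" using lA t0 by (simp add: field_simps)
          finally show False by (simp add: m_def)
        qed
        then have zC: "z \<in> C" using vR sC s z12 by (intro jump[of s z v]) auto
        have "isCont K z" using holomorphic_on_imp_continuous_on[OF K] C(1) zC by (auto simp: continuous_on_eq_continuous_at)
        from isCont_tendsto_compose[OF this s(2)]
        have "(\<lambda>n. cmod (K (s n))) \<longlonglongrightarrow> cmod (K z)" by (rule tendsto_norm)
        then have mK: "m \<le> cmod (K z)" by (rule LIMSEQ_le_const) (use s(1) in \<open>auto intro: less_imp_le\<close>)
        have "cmod z \<noteq> 1 / 2" using Kb'[OF zC, of "1/2"] mK m4 by auto
        then have "z \<in> C \<inter> ball 0 (1 / 2)" using zC z12 by auto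
        moreover have "open (C \<inter> ball 0 (1 / 2))" using C(1) by auto
        ultimately obtain r where "r > 0" "ball z r \<subseteq> C \<inter> ball 0 (1 / 2)" using open_contains_ball by blast
        then show "\<exists>r>0. ball z r \<subseteq> A0" by (intro exI[of _ r]) (auto simp: A0_def)
      qed (use M m in auto)
      then obtain z r where r: "r > 0" "ball z r \<subseteq> A0" "cmod (K z) > m"
        "\<And>\<zeta>. \<zeta> \<in> ball z r \<Longrightarrow> w \<zeta> = w z \<and> cmod (K \<zeta>) = cmod (K z)" by blast
      have Kz: "cmod (K z) > 0" by (rule less_trans[OF m r(3)])
      have "cmod (exp (- of_real A * \<mu> (w z)) * cinner (w z - a) x) = cmod (K z) * cmod (\<zeta> - 0)"
        if "\<zeta> \<in> ball z r" "\<zeta> \<noteq> 0" for \<zeta>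
      proof -
        have wz: "w \<zeta> = w z" and Kz': "cmod (K z) = cmod (K \<zeta>)" using r(4)[OF that(1)] by simp_all
        have "cmod (K \<zeta>) = cmod (exp (- of_real A * \<mu> (w z)) * (cinner (w z - a) x / \<zeta>))"
          unfolding K_def dd[OF that(2)] wz ..
        then show ?thesis unfolding Kz' using that(2) by (simp add: norm_divide norm_mult)
      qed
      then show False using not_const_quotient[OF r(1) Kz] by blast
    qed
    then show ?thesis using small[of r0] r0 by (auto intro: less_imp_le)
  qed
  show ?thesis
  proof (rule exI[of _ r1], intro conjI r1(1), rule exI[of _ r0], intro conjI r0(1) r1(2), goal_cases)
    case 1
    show ?case using r0 by simp
  next
    case 2
    show ?case
    proof (intro allI impI, goal_cases)
      case (1 C w \<mu>)
      show ?case by (rule main) (use 1 in \<open>blast+\<close>)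
    qed
  qed
qed

section \<open>Holomorphic maps between manifolds\<close>

lemma is_chartD:
  assumes "is_chart (U, \<kappa>)"
  shows "open U" "open (\<kappa> ` U)" "inj_on \<kappa> U" "continuous_on U \<kappa>" "continuous_on (\<kappa> ` U) (inv_into U \<kappa>)"
proof -
  from assms obtain \<psi> where o: "open U" "open (\<kappa> ` U)" and h: "homeomorphism U (\<kappa> ` U) \<kappa> \<psi>"
    by (auto simp: is_chart_def)
  show "open U" "open (\<kappa> ` U)" by (rule o)+
  show inj: "inj_on \<kappa> U" using h by (metis homeomorphism_def inj_on_inverseI)
  show "continuous_on U \<kappa>" using h by (simp add: homeomorphism_def)
  have "\<psi> z = inv_into U \<kappa> z" if "z \<in> \<kappa> ` U" for z
    using that h inj by (auto simp: homeomorphism_def inv_into_f_f)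
  then show "continuous_on (\<kappa> ` U) (inv_into U \<kappa>)"
    using h continuous_on_cong by (metis homeomorphism_def)
qed

lemma chart_open_image:
  assumes "is_chart (U, \<kappa>)" "open A" "A \<subseteq> U"
  shows "open (\<kappa> ` A)"
proof -
  have "\<kappa> ` A = \<kappa> ` U \<inter> inv_into U \<kappa> -` A"
    using is_chartD(3)[OF assms(1)] assms(3) by (auto simp: inv_into_f_f subset_iff)
  then show ?thesis
    using continuous_open_preimage[OF is_chartD(5)[OF assms(1)] is_chartD(2)[OF assms(1)] assms(2)] by simp
qed

lemma chart_open_preimage:
  assumes "is_chart (U, \<kappa>)" "open B"
  shows "open {x \<in> U. \<kappa> x \<in> B}"
proof -
  have "{x \<in> U. \<kappa> x \<in> B} = U \<inter> \<kappa> -` B" by auto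
  then show ?thesis
    using continuous_open_preimage[OF is_chartD(4)[OF assms(1)] is_chartD(1)[OF assms(1)] assms(2)] by simp
qed

lemma manifold_chart: "complex_manifold \<A> \<Longrightarrow> c \<in> \<A> \<Longrightarrow> is_chart c"
  by (simp add: complex_manifold_def)

lemma manifold_cover:
  assumes "complex_manifold \<A>"
  obtains U \<kappa> where "(U, \<kappa>) \<in> \<A>" "x \<in> U"
proof -
  have "x \<in> (\<Union>c\<in>\<A>. fst c)" using assms by (simp add: complex_manifold_def)
  then show ?thesis using that by auto
qed

lemma hilbert_atlas_iff: "(U, \<kappa>) \<in> hilbert_atlas \<longleftrightarrow> U = UNIV \<and> \<kappa> = id"
  by (auto simp: hilbert_atlas_def)

lemma complex_manifold_hilbert_atlas: "complex_manifold (hilbert_atlas :: ('a::complex_hilbert_space, 'a) chart set)"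
proof -
  have "is_chart (UNIV, id :: 'a \<Rightarrow> 'a)"
    unfolding is_chart_def by (auto intro!: exI[of _ id] simp: homeomorphism_def)
  moreover have "holomorphic_transition (UNIV, id :: 'a \<Rightarrow> 'a) (UNIV, id)"
    unfolding holomorphic_transition_def using cholomorphic_on_id[of UNIV]
    by (simp add: inv_id id_def o_def)
  ultimately show ?thesis unfolding complex_manifold_def hilbert_atlas_def by simp
qed

lemma holomorphic_mapI:
  assumes "continuous_on S f"
    "\<And>U \<kappa> V \<mu>. (U, \<kappa>) \<in> \<A> \<Longrightarrow> (V, \<mu>) \<in> \<B> \<Longrightarrow>
      cholomorphic_on (\<lambda>z. \<mu> (f (inv_into U \<kappa> z))) (\<kappa> ` (U \<inter> S \<inter> f -` V))"
  shows "holomorphic_map \<A> \<B> f S"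
  using assms unfolding holomorphic_map_def by (auto simp: o_def)

lemma holomorphic_mapD:
  assumes "holomorphic_map \<A> \<B> f S"
  shows "continuous_on S f"
    and "(U, \<kappa>) \<in> \<A> \<Longrightarrow> (V, \<mu>) \<in> \<B> \<Longrightarrow>
      cholomorphic_on (\<lambda>z. \<mu> (f (inv_into U \<kappa> z))) (\<kappa> ` (U \<inter> S \<inter> f -` V))"
  using assms unfolding holomorphic_map_def by (auto simp: o_def)

lemma holomorphic_map_subset:
  assumes "holomorphic_map \<A> \<B> f S" "T \<subseteq> S"
  shows "holomorphic_map \<A> \<B> f T"
  using assms(2) by (intro holomorphic_mapI continuous_on_subset[OF holomorphic_mapD(1)[OF assms(1)]]
      cholomorphic_on_subset[OF holomorphic_mapD(2)[OF assms(1)]]) auto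

lemma holomorphic_map_hilbert_iff:
  "holomorphic_map hilbert_atlas hilbert_atlas f S \<longleftrightarrow> cholomorphic_on f S"
proof
  assume "holomorphic_map hilbert_atlas hilbert_atlas f S"
  from holomorphic_mapD(2)[OF this, of UNIV id UNIV id] show "cholomorphic_on f S"
    by (simp add: hilbert_atlas_iff inv_id)
next
  assume "cholomorphic_on f S"
  then show "holomorphic_map hilbert_atlas hilbert_atlas f S"
    by (intro holomorphic_mapI) (auto simp: hilbert_atlas_iff inv_id cholomorphic_on_continuous)
qed

lemma holomorphic_map_local:
  assumes A: "complex_manifold \<A>"
    and loc: "\<And>x. x \<in> S \<Longrightarrow> \<exists>N. open N \<and> x \<in> N \<and> holomorphic_map \<A> \<B> f (S \<inter> N)"
  shows "holomorphic_map \<A> \<B> f S"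
proof (rule holomorphic_mapI)
  show "continuous_on S f"
    unfolding continuous_on_eq_continuous_within
  proof
    fix x assume x: "x \<in> S"
    then obtain N where N: "open N" "x \<in> N" "holomorphic_map \<A> \<B> f (S \<inter> N)" using loc by blast
    then have "continuous (at x within (S \<inter> N)) f"
      using holomorphic_mapD(1)[OF N(3)] x by (auto simp: continuous_on_eq_continuous_within)
    moreover have "at x within (S \<inter> N) = at x within S" by (rule at_within_nhd[OF N(2,1)]) auto
    ultimately show "continuous (at x within S) f" by simp
  qed
  fix U \<kappa> V \<mu> assume c: "(U, \<kappa>) \<in> \<A>" "(V, \<mu>) \<in> \<B>"
  note ch = manifold_chart[OF A c(1)]
  show "cholomorphic_on (\<lambda>z. \<mu> (f (inv_into U \<kappa> z))) (\<kappa> ` (U \<inter> S \<inter> f -` V))"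
  proof (rule cholomorphic_on_local)
    fix z assume "z \<in> \<kappa> ` (U \<inter> S \<inter> f -` V)"
    then obtain x where x: "x \<in> U" "x \<in> S" "z = \<kappa> x" by auto
    then obtain N where N: "open N" "x \<in> N" "holomorphic_map \<A> \<B> f (S \<inter> N)" using loc by blast
    have "open (\<kappa> ` (U \<inter> N))" using ch N(1) is_chartD(1)[OF ch] by (intro chart_open_image) auto
    moreover have "\<kappa> ` (U \<inter> S \<inter> f -` V) \<inter> \<kappa> ` (U \<inter> N) \<subseteq> \<kappa> ` (U \<inter> (S \<inter> N) \<inter> f -` V)"
      using is_chartD(3)[OF ch] by (auto simp: inj_on_def)
    then have "cholomorphic_on (\<lambda>z. \<mu> (f (inv_into U \<kappa> z))) (\<kappa> ` (U \<inter> S \<inter> f -` V) \<inter> \<kappa> ` (U \<inter> N))"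
      by (rule cholomorphic_on_subset[OF holomorphic_mapD(2)[OF N(3) c]])
    ultimately show "\<exists>V'. open V' \<and> z \<in> V' \<and> cholomorphic_on (\<lambda>z. \<mu> (f (inv_into U \<kappa> z))) (\<kappa> ` (U \<inter> S \<inter> f -` V) \<inter> V')"
      using x N by (intro exI[of _ "\<kappa> ` (U \<inter> N)"]) auto
  qed
qed

lemma holomorphic_map_compose:
  assumes A: "complex_manifold \<A>" and B: "complex_manifold \<B>"
    and f: "holomorphic_map \<A> \<B> f S" and g: "holomorphic_map \<B> \<C> g T"
    and S: "open S" and fS: "f ` S \<subseteq> T"
  shows "holomorphic_map \<A> \<C> (\<lambda>x. g (f x)) S"
proof (rule holomorphic_mapI)
  show "continuous_on S (\<lambda>x. g (f x))"
    by (rule continuous_on_compose2[OF holomorphic_mapD(1)[OF g] holomorphic_mapD(1)[OF f] fS])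
  fix U \<kappa> W \<omega> assume c: "(U, \<kappa>) \<in> \<A>" "(W, \<omega>) \<in> \<C>"
  note ch = manifold_chart[OF A c(1)]
  let ?Z = "\<kappa> ` (U \<inter> S \<inter> (\<lambda>x. g (f x)) -` W)"
  show "cholomorphic_on (\<lambda>z. \<omega> (g (f (inv_into U \<kappa> z)))) ?Z"
  proof (rule cholomorphic_on_local)
    fix z assume "z \<in> ?Z"
    then obtain x where x: "x \<in> U" "x \<in> S" "z = \<kappa> x" by auto
    obtain V \<mu> where V: "(V, \<mu>) \<in> \<B>" "f x \<in> V" using manifold_cover[OF B] .
    note chV = manifold_chart[OF B V(1)]
    \<comment> \<open>The part of the source chart that \<open>f\<close> maps into one chart of the
      middle manifold, so that the composition can be read through that chart.\<close>
    define N where "N = U \<inter> (S \<inter> f -` V)"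
    have "open N"
      unfolding N_def using is_chartD(1)[OF ch] is_chartD(1)[OF chV]
      by (intro open_Int continuous_open_preimage[OF holomorphic_mapD(1)[OF f] S]) auto
    then have oN: "open (\<kappa> ` N)" by (intro chart_open_image[OF ch]) (auto simp: N_def)
    have inv: "inv_into U \<kappa> (\<kappa> y) = y" if "y \<in> U" for y using is_chartD(3)[OF ch] that by simp
    have "cholomorphic_on (\<lambda>z. \<omega> (g (inv_into V \<mu> (\<mu> (f (inv_into U \<kappa> z)))))) (?Z \<inter> \<kappa> ` N)"
    proof (rule cholomorphic_on_compose[OF cholomorphic_on_subset[OF holomorphic_mapD(2)[OF f c(1) V(1)]] holomorphic_mapD(2)[OF g V(1) c(2)]])
      show "?Z \<inter> \<kappa> ` N \<subseteq> \<kappa> ` (U \<inter> S \<inter> f -` V)" by (auto simp: N_def)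
      show "(\<lambda>z. \<mu> (f (inv_into U \<kappa> z))) ` (?Z \<inter> \<kappa> ` N) \<subseteq> \<mu> ` (V \<inter> T \<inter> g -` W)"
      proof (rule image_subsetI)
        fix z assume "z \<in> ?Z \<inter> \<kappa> ` N"
        then obtain y y' where y: "y \<in> U" "y \<in> S" "g (f y) \<in> W" "z = \<kappa> y" "y' \<in> N" "\<kappa> y = \<kappa> y'" by auto
        then have "y \<in> N" using is_chartD(3)[OF ch] by (auto simp: inj_on_def N_def)
        then have "f y \<in> V \<inter> T \<inter> g -` W" using y(2,3) fS by (auto simp: N_def)
        then show "\<mu> (f (inv_into U \<kappa> z)) \<in> \<mu> ` (V \<inter> T \<inter> g -` W)"
          unfolding y(4) inv[OF y(1)] by (rule imageI)
      qed
    qed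
    from this have "cholomorphic_on (\<lambda>z. \<omega> (g (f (inv_into U \<kappa> z)))) (?Z \<inter> \<kappa> ` N)"
    proof (rule cholomorphic_on_cong[where g = "\<lambda>z. \<omega> (g (f (inv_into U \<kappa> z)))"])
      fix z assume "z \<in> ?Z \<inter> \<kappa> ` N"
      then obtain y where "y \<in> N" "z = \<kappa> y" by auto
      then have "f (inv_into U \<kappa> z) \<in> V" by (simp add: N_def inv)
      then show "\<omega> (g (inv_into V \<mu> (\<mu> (f (inv_into U \<kappa> z))))) = \<omega> (g (f (inv_into U \<kappa> z)))"
        using is_chartD(3)[OF chV] by simp
    qed
    then show "\<exists>V'. open V' \<and> z \<in> V' \<and> cholomorphic_on (\<lambda>z. \<omega> (g (f (inv_into U \<kappa> z)))) (?Z \<inter> V')"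
      using oN x V(2) by (intro exI[of _ "\<kappa> ` N"]) (auto simp: N_def)
  qed
qed

lemma holomorphic_map_cong:
  assumes A: "complex_manifold \<A>" and f: "holomorphic_map \<A> \<B> f S" and eq: "\<And>x. x \<in> S \<Longrightarrow> f x = g x"
  shows "holomorphic_map \<A> \<B> g S"
proof (rule holomorphic_mapI)
  show "continuous_on S g" using holomorphic_mapD(1)[OF f] eq continuous_on_cong[of S S f g] by simp
  fix U \<kappa> V \<mu> assume c: "(U, \<kappa>) \<in> \<A>" "(V, \<mu>) \<in> \<B>"
  note inj = is_chartD(3)[OF manifold_chart[OF A c(1)]]
  have e: "U \<inter> S \<inter> g -` V = U \<inter> S \<inter> f -` V" using eq by auto
  show "cholomorphic_on (\<lambda>z. \<mu> (g (inv_into U \<kappa> z))) (\<kappa> ` (U \<inter> S \<inter> g -` V))"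
    unfolding e
  proof (rule cholomorphic_on_cong[OF holomorphic_mapD(2)[OF f c]])
    fix z assume "z \<in> \<kappa> ` (U \<inter> S \<inter> f -` V)"
    then obtain x where x: "x \<in> U" "x \<in> S" "z = \<kappa> x" by blast
    show "\<mu> (f (inv_into U \<kappa> z)) = \<mu> (g (inv_into U \<kappa> z))"
      unfolding x(3) inv_into_f_f[OF inj x(1)] eq[OF x(2)] ..
  qed
qed

lemma holomorphic_chart_atlas: "complex_manifold \<A> \<Longrightarrow> c \<in> \<A> \<Longrightarrow> holomorphic_chart \<A> c"
  by (simp add: complex_manifold_def holomorphic_chart_def)

lemma holomorphic_chart_map:
  assumes "holomorphic_chart \<A> (W, \<kappa>)"
  shows "holomorphic_map \<A> hilbert_atlas \<kappa> W"
proof (rule holomorphic_mapI)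
  have ch: "is_chart (W, \<kappa>)" using assms by (simp add: holomorphic_chart_def)
  then show "continuous_on W \<kappa>" by (rule is_chartD)
  fix U \<kappa>' V and \<mu> :: "'b \<Rightarrow> 'b" assume c: "(U, \<kappa>') \<in> \<A>" "(V, \<mu>) \<in> hilbert_atlas"
  then have "cholomorphic_on (\<kappa> \<circ> inv_into U \<kappa>') (\<kappa>' ` (U \<inter> W))"
    using assms by (auto simp: holomorphic_chart_def holomorphic_transition_def)
  then show "cholomorphic_on (\<lambda>z. \<mu> (\<kappa> (inv_into U \<kappa>' z))) (\<kappa>' ` (U \<inter> W \<inter> \<kappa> -` V))"
    using c(2) by (simp add: hilbert_atlas_iff o_def)
qed

lemma holomorphic_chart_inv_map:
  assumes "holomorphic_chart \<A> (W, \<kappa>)"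
  shows "holomorphic_map hilbert_atlas \<A> (inv_into W \<kappa>) (\<kappa> ` W)"
proof (rule holomorphic_mapI)
  have ch: "is_chart (W, \<kappa>)" using assms by (simp add: holomorphic_chart_def)
  then show "continuous_on (\<kappa> ` W) (inv_into W \<kappa>)" by (rule is_chartD)
  fix U V \<mu> and \<kappa>' :: "'b \<Rightarrow> 'b" assume c: "(U, \<kappa>') \<in> hilbert_atlas" "(V, \<mu>) \<in> \<A>"
  then have "cholomorphic_on (\<mu> \<circ> inv_into W \<kappa>) (\<kappa> ` (W \<inter> V))"
    using assms by (auto simp: holomorphic_chart_def holomorphic_transition_def)
  moreover have "\<kappa> ` W \<inter> inv_into W \<kappa> -` V = \<kappa> ` (W \<inter> V)" using is_chartD(3)[OF ch] by auto
  ultimately show "cholomorphic_on (\<lambda>z. \<mu> (inv_into W \<kappa> (inv_into U \<kappa>' z))) (\<kappa>' ` (U \<inter> \<kappa> ` W \<inter> inv_into W \<kappa> -` V))"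
    using c(1) by (simp add: hilbert_atlas_iff inv_id o_def)
qed

section \<open>Analytic discs\<close>

definition disc_in :: "('x::t2_space, 'e::complex_hilbert_space) chart set \<Rightarrow> 'x set \<Rightarrow> (complex \<Rightarrow> 'x) \<Rightarrow> bool"
  where "disc_in \<A> \<Omega> f \<longleftrightarrow> holomorphic_map hilbert_atlas \<A> f (ball 0 1) \<and> f ` ball 0 1 \<subseteq> \<Omega>"

lemma disc_in_compose:
  assumes A: "complex_manifold \<A>" and B: "complex_manifold \<B>"
    and f: "disc_in \<A> \<Omega> f" and g: "holomorphic_map \<A> \<B> g \<Omega>" "g ` \<Omega> \<subseteq> \<Omega>'"
  shows "disc_in \<B> \<Omega>' (\<lambda>\<zeta>. g (f \<zeta>))"
proof -
  have "holomorphic_map hilbert_atlas \<B> (\<lambda>\<zeta>. g (f \<zeta>)) (ball 0 1)"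
    by (rule holomorphic_map_compose[where f = f and g = g and T = \<Omega>, OF complex_manifold_hilbert_atlas A _ g(1) open_ball])
       (use f in \<open>simp_all add: disc_in_def\<close>)
  moreover have "(\<lambda>\<zeta>. g (f \<zeta>)) ` ball 0 1 \<subseteq> \<Omega>'" using f g(2) unfolding disc_in_def by fast
  ultimately show ?thesis by (simp add: disc_in_def)
qed

lemma disc_in_hilbert:
  assumes A: "complex_manifold \<A>"
    and h: "holomorphic_map hilbert_atlas \<A> h D" "h ` D \<subseteq> \<Omega>"
    and k: "cholomorphic_on k (ball 0 1)" "k ` ball 0 1 \<subseteq> D"
  shows "disc_in \<A> \<Omega> (\<lambda>\<zeta>. h (k \<zeta>))"
proof -
  have "holomorphic_map hilbert_atlas hilbert_atlas k (ball 0 1)" using k(1) by (simp add: holomorphic_map_hilbert_iff)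
  from holomorphic_map_compose[where f = k and g = h and T = D, OF complex_manifold_hilbert_atlas complex_manifold_hilbert_atlas this h(1) open_ball k(2)]
  have "holomorphic_map hilbert_atlas \<A> (\<lambda>\<zeta>. h (k \<zeta>)) (ball 0 1)" .
  moreover have "(\<lambda>\<zeta>. h (k \<zeta>)) ` ball 0 1 \<subseteq> \<Omega>" using k(2) h(2) by fast
  ultimately show ?thesis by (simp add: disc_in_def)
qed

lemma disc_in_affine:
  assumes A: "complex_manifold \<A>" and f: "disc_in \<A> \<Omega> f" and "\<And>\<zeta>. cmod \<zeta> < 1 \<Longrightarrow> cmod (a + \<zeta> * b) < 1"
  shows "disc_in \<A> \<Omega> (\<lambda>\<zeta>. f (a + \<zeta> * b))"
proof (rule disc_in_hilbert[where h = f and D = "ball 0 1" and k = "\<lambda>\<zeta>. a + \<zeta> * b", OF A])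
  show "holomorphic_map hilbert_atlas \<A> f (ball 0 1)" "f ` ball 0 1 \<subseteq> \<Omega>" using f by (simp_all add: disc_in_def)
  show "cholomorphic_on (\<lambda>\<zeta>. a + \<zeta> * b) (ball 0 1)" using cholomorphic_on_affine[of a b] by simp
  show "(\<lambda>\<zeta>. a + \<zeta> * b) ` ball 0 1 \<subseteq> ball 0 1" using assms(3) by auto
qed

text \<open>Holomorphic self-maps of \<open>\<Omega>\<close> carry these sets into each other, so
  estimates for chains starting near \<open>p\<close> can be pulled back to chains starting at
  \<open>q\<close>. The bound 1/2 on each link keeps a fixed margin to the unit circle.\<close>

primrec reach :: "('x::t2_space, 'e::complex_hilbert_space) chart set \<Rightarrow> 'x set \<Rightarrow> 'x \<Rightarrow> nat \<Rightarrow> 'x set" where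
  "reach \<A> \<Omega> q 0 = {q}"
| "reach \<A> \<Omega> q (Suc k) = {f \<zeta> |f \<zeta>. disc_in \<A> \<Omega> f \<and> f 0 \<in> reach \<A> \<Omega> q k \<and> cmod \<zeta> \<le> 1 / 2}"

lemma reach_compose:
  assumes A: "complex_manifold \<A>" and g: "holomorphic_map \<A> \<A> g \<Omega>" "g ` \<Omega> \<subseteq> \<Omega>"
  shows "x \<in> reach \<A> \<Omega> q k \<Longrightarrow> g x \<in> reach \<A> \<Omega> (g q) k"
proof (induction k arbitrary: x)
  case (Suc k)
  then obtain f \<zeta> where f: "disc_in \<A> \<Omega> f" "f 0 \<in> reach \<A> \<Omega> q k" "cmod \<zeta> \<le> 1 / 2" "x = f \<zeta>" by auto
  then have "disc_in \<A> \<Omega> (\<lambda>\<zeta>. g (f \<zeta>)) \<and> g (f 0) \<in> reach \<A> \<Omega> (g q) k \<and> cmod \<zeta> \<le> 1 / 2"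
    using disc_in_compose[OF A A f(1) g] Suc.IH[OF f(2)] by simp
  then show ?case unfolding f(4) reach.simps mem_Collect_eq by (intro exI[of _ "\<lambda>\<zeta>. g (f \<zeta>)"] exI[of _ \<zeta>]) simp
qed simp

lemma reach_subset: "q \<in> \<Omega> \<Longrightarrow> reach \<A> \<Omega> q k \<subseteq> \<Omega>"
  by (cases k) (auto simp: disc_in_def)

text \<open>Rescaling a chart to the unit ball turns straight complex discs into analytic discs in
  \<open>\<Omega>\<close> with explicit parameters.\<close>

lemma chart_ball:
  assumes A: "complex_manifold (\<A> :: ('x::t2_space, 'e::complex_hilbert_space) chart set)" and \<Omega>: "open \<Omega>" "x \<in> \<Omega>"
  obtains h :: "'e::complex_hilbert_space \<Rightarrow> 'x::t2_space" and k N where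
    "holomorphic_map hilbert_atlas \<A> h (ball 0 1)" "h ` ball 0 1 \<subseteq> \<Omega>" "h 0 = x"
    "holomorphic_map \<A> hilbert_atlas k N" "N = h ` ball 0 1" "open N" "\<And>z. z \<in> ball 0 1 \<Longrightarrow> k (h z) = z"
    "\<And>B. open B \<Longrightarrow> B \<subseteq> ball 0 1 \<Longrightarrow> open (h ` B)"
proof -
  obtain U \<kappa> where U: "(U, \<kappa>) \<in> \<A>" "x \<in> U" using manifold_cover[OF A] .
  note ch = manifold_chart[OF A U(1)] and hc = holomorphic_chart_atlas[OF A U(1)]
  have "open (\<kappa> ` (U \<inter> \<Omega>))" using is_chartD(1)[OF ch] \<Omega> by (intro chart_open_image[OF ch]) auto
  then obtain r where r: "r > 0" "ball (\<kappa> x) r \<subseteq> \<kappa> ` (U \<inter> \<Omega>)"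
    using open_contains_ball U(2) \<Omega>(2) by (metis IntI imageI)
  define a where "a z = \<kappa> x + of_real r *\<^sub>C z" for z
  define b where "b z = of_real (1 / r) *\<^sub>C (z - \<kappa> x)" for z
  define h where "h z = inv_into U \<kappa> (a z)" for z
  define k where "k y = b (\<kappa> y)" for y
  have ab: "a (b z) = z" "b (a z) = z" for z
    using r(1) by (auto simp: a_def b_def scaleC_scaleC simp flip: of_real_mult)
  have aball: "a z \<in> ball (\<kappa> x) r" if "z \<in> ball 0 1" for z
    using that r(1) by (simp add: a_def dist_norm)
  have bball: "b z \<in> ball 0 1" if "z \<in> ball (\<kappa> x) r" for z
    using that r(1) by (simp add: b_def dist_norm norm_minus_commute norm_divide pos_divide_less_eq)
  have cha: "cholomorphic_on a X" for X unfolding a_def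
    by (intro cholomorphic_on_add cholomorphic_on_const cholomorphic_on_scaleC cholomorphic_on_id)
  have chb: "cholomorphic_on b X" for X unfolding b_def
    by (intro cholomorphic_on_diff cholomorphic_on_const cholomorphic_on_scaleC cholomorphic_on_id)
  have sub: "ball (\<kappa> x) r \<subseteq> \<kappa> ` U" using r(2) by auto
  have hU: "h z \<in> U \<inter> \<Omega>" "\<kappa> (h z) = a z" if zb: "z \<in> ball 0 1" for z
  proof -
    obtain y where y: "y \<in> U \<inter> \<Omega>" "a z = \<kappa> y" using aball[OF zb] r(2) by blast
    then show "h z \<in> U \<inter> \<Omega>" "\<kappa> (h z) = a z" using is_chartD(3)[OF ch] by (auto simp: h_def)
  qed
  have hB: "h ` B = {y \<in> U. \<kappa> y \<in> a ` B}" if "B \<subseteq> ball 0 1" for B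
  proof safe
    fix z assume "z \<in> B"
    then show "h z \<in> U" "\<kappa> (h z) \<in> a ` B" using hU[of z] that by auto
  next
    fix y z assume "y \<in> U" "\<kappa> y = a z" "z \<in> B"
    then have "h z = y" using is_chartD(3)[OF ch] by (simp add: h_def flip: \<open>\<kappa> y = a z\<close>)
    then show "y \<in> h ` B" using \<open>z \<in> B\<close> by auto
  qed
  have op: "open (h ` B)" if "open B" "B \<subseteq> ball 0 1" for B
  proof -
    have "a ` B = b -` B"
    proof (intro set_eqI iffI)
      fix z assume "z \<in> b -` B"
      then have "a (b z) \<in> a ` B" by simp
      then show "z \<in> a ` B" by (simp add: ab)
    qed (auto simp: ab)
    moreover have "open (b -` B)"
      using cholomorphic_on_continuous[OF chb[of UNIV]] that(1) by (simp add: continuous_on_open_vimage)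
    ultimately show ?thesis unfolding hB[OF that(2)] by (intro chart_open_preimage[OF ch]) simp
  qed
  show ?thesis
  proof (rule that[of h k "h ` ball 0 1"])
    show "holomorphic_map hilbert_atlas \<A> h (ball 0 1)"
      unfolding h_def
      by (rule holomorphic_map_compose[OF complex_manifold_hilbert_atlas complex_manifold_hilbert_atlas _ holomorphic_chart_inv_map[OF hc]])
         (use cha aball sub in \<open>auto simp: holomorphic_map_hilbert_iff\<close>)
    show "h ` ball 0 1 \<subseteq> \<Omega>" using hU by auto
    show "h 0 = x" using U(2) is_chartD(3)[OF ch] by (simp add: h_def a_def)
    show "holomorphic_map \<A> hilbert_atlas k (h ` ball 0 1)"
      unfolding k_def
    proof (rule holomorphic_map_compose[where f = \<kappa> and g = b and T = UNIV, OF A complex_manifold_hilbert_atlas])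
      show "holomorphic_map \<A> hilbert_atlas \<kappa> (h ` ball 0 1)"
        using hU by (intro holomorphic_map_subset[OF holomorphic_chart_map[OF hc]]) auto
      show "holomorphic_map hilbert_atlas hilbert_atlas b UNIV" by (simp add: holomorphic_map_hilbert_iff chb)
    qed (auto intro: op)
    show "k (h z) = z" if "z \<in> ball 0 1" for z using hU(2)[OF that] by (simp add: k_def ab)
  qed (use op in auto)
qed

text \<open>In a small chart ball any two points are joined by a single disc, one at its centre and
  the other at parameter 1/2. So the reachable set is open and closed in the connected set
  \<open>\<Omega>\<close>.\<close>

lemma reach_cover:
  assumes A: "complex_manifold (\<A> :: ('x::t2_space, 'e::complex_hilbert_space) chart set)"
    and \<Omega>: "open \<Omega>" "connected \<Omega>" "q \<in> \<Omega>"
  shows "\<Omega> \<subseteq> (\<Union>k. reach \<A> \<Omega> q k)"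
proof -
  define S where "S = (\<Union>k. reach \<A> \<Omega> q k)"
  have S\<Omega>: "S \<subseteq> \<Omega>" using reach_subset[OF \<Omega>(3)] by (auto simp: S_def)
  have step: "\<exists>N. open N \<and> x \<in> N \<and> N \<subseteq> \<Omega> \<and> (\<forall>y\<in>N. y \<in> S \<longleftrightarrow> x \<in> S)" if x: "x \<in> \<Omega>" for x
  proof -
    obtain h :: "'e \<Rightarrow> 'x" and k N where h: "holomorphic_map hilbert_atlas \<A> h (ball 0 1)" "h ` ball 0 1 \<subseteq> \<Omega>" "h 0 = x"
      "\<And>B. open B \<Longrightarrow> B \<subseteq> ball 0 1 \<Longrightarrow> open (h ` B)"
      using chart_ball[OF A \<Omega>(1) x] by metis
    have move: "h z' \<in> S" if zS: "h z \<in> S" and z: "norm z < 1 / 8" "norm z' < 1 / 8" for z z'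
    proof -
      obtain n where n: "h z \<in> reach \<A> \<Omega> q n" using zS by (auto simp: S_def)
      \<comment> \<open>Passes through \<open>z\<close> at 0 and \<open>z'\<close> at 1/2. With both
        norms below 1/8 it stays within norm 5/8.\<close>
      define d where "d \<zeta> = z + \<zeta> *\<^sub>C (2 *\<^sub>R (z' - z))" for \<zeta>
      have "norm (d \<zeta>) < 1" if "cmod \<zeta> < 1" for \<zeta>
      proof -
        have 1: "norm (d \<zeta>) \<le> norm z + cmod \<zeta> * (2 * norm (z' - z))"
          unfolding d_def using norm_triangle_ineq[of z "\<zeta> *\<^sub>C (2 *\<^sub>R (z' - z))"] by simp
        have "cmod \<zeta> * (2 * norm (z' - z)) \<le> 1 * (2 * (norm z' + norm z))"
          using that norm_triangle_ineq4[of z' z] by (intro mult_mono) auto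
        with 1 have "norm (d \<zeta>) \<le> norm z + 1 * (2 * (norm z' + norm z))"
          by (meson add_left_mono order_trans)
        also have "\<dots> < 1 / 8 + 1 * (2 * (1 / 8 + 1 / 8))"
          using z by (intro add_strict_mono mult_strict_left_mono) auto
        finally show ?thesis by simp
      qed
      then have "disc_in \<A> \<Omega> (\<lambda>\<zeta>. h (d \<zeta>))"
        by (intro disc_in_hilbert[OF A h(1,2)]) (auto simp: d_def[abs_def] intro: cholomorphic_on_affine)
      moreover have "h (d 0) \<in> reach \<A> \<Omega> q n" using n by (simp add: d_def)
      moreover have "d (1 / 2) = z'" by (simp add: d_def scaleR_scaleC scaleC_scaleC)
      ultimately have "h z' \<in> reach \<A> \<Omega> q (Suc n)"
        by (auto intro!: exI[of _ "\<lambda>\<zeta>. h (d \<zeta>)"] exI[of _ "1 / 2"])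
      then show ?thesis unfolding S_def by blast
    qed
    have "open (h ` ball 0 (1 / 8))" by (rule h(4)) auto
    moreover have "y \<in> S \<longleftrightarrow> x \<in> S" if y: "y \<in> h ` ball 0 (1 / 8)" for y
    proof -
      obtain z where z: "norm z < 1 / 8" "y = h z" using y by auto
      then show ?thesis using move[of z 0] move[of 0 z] h(3) by auto
    qed
    moreover have "h ` ball 0 (1 / 8) \<subseteq> \<Omega>" using h(2) by auto
    moreover have "x \<in> h ` ball 0 (1 / 8)" using h(3) by force
    ultimately show ?thesis by blast
  qed
  have "open S"
  proof (subst open_subopen, intro ballI)
    fix x assume x: "x \<in> S"
    obtain N where "open N" "x \<in> N" "\<forall>y\<in>N. y \<in> S \<longleftrightarrow> x \<in> S" using step[OF subsetD[OF S\<Omega> x]] by auto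
    then show "\<exists>T. open T \<and> x \<in> T \<and> T \<subseteq> S" using x by (intro exI[of _ N]) auto
  qed
  moreover have "open (\<Omega> - S)"
  proof (subst open_subopen, intro ballI)
    fix x assume x: "x \<in> \<Omega> - S"
    obtain N where N: "open N" "x \<in> N" "N \<subseteq> \<Omega>" "\<And>y. y \<in> N \<Longrightarrow> y \<in> S \<longleftrightarrow> x \<in> S"
      using step[OF DiffD1[OF x]] by metis
    have "N \<subseteq> \<Omega> - S" using N(3) N(4) x by blast
    then show "\<exists>T. open T \<and> x \<in> T \<and> T \<subseteq> \<Omega> - S" using N(1,2) by blast
  qed
  moreover have "q \<in> S" unfolding S_def by (rule UN_I[of 0]) auto
  ultimately have "S \<inter> \<Omega> = {} \<or> (\<Omega> - S) \<inter> \<Omega> = {}"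
    by (intro connectedD[OF \<Omega>(2)]) auto
  then have "\<Omega> - S = {}" using \<open>q \<in> S\<close> \<Omega>(3) by blast
  then show ?thesis unfolding S_def by blast
qed

section \<open>Localisation of discs at a boundary point\<close>

definition localises :: "('x::t2_space, 'e::complex_hilbert_space) chart set \<Rightarrow> 'x set \<Rightarrow> 'x \<Rightarrow> real \<Rightarrow> bool"
  where "localises \<A> \<Omega> p r \<longleftrightarrow> (\<forall>U. open U \<longrightarrow> p \<in> U \<longrightarrow>
    (\<exists>V. open V \<and> p \<in> V \<and> (\<forall>f. disc_in \<A> \<Omega> f \<longrightarrow> f 0 \<in> V \<longrightarrow> (\<forall>\<zeta>. cmod \<zeta> < r \<longrightarrow> f \<zeta> \<in> U))))"

text \<open>\<open>disc_localisation\<close> keeps the disc inside the chart on a fixed radius.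
  There the peak functional along the disc has nonnegative real part, Harnack bounds it by its value
  at the centre, and \<open>peak\<close> converts this into smallness of the disc itself.\<close>

lemma localises_near_peak:
  fixes \<A> :: "('x::t2_space, 'e::complex_hilbert_space) chart set"
  assumes A: "complex_manifold \<A>" and hc: "holomorphic_chart \<A> (W, \<kappa>)" and p: "p \<in> W" "\<kappa> p = 0"
    and R: "R > 0" "ball 0 R \<subseteq> \<kappa> ` W" and \<mu>: "cblinear \<mu>" and c: "c > 0"
    and peak: "\<And>x. x \<in> \<Omega> \<Longrightarrow> x \<in> W \<Longrightarrow> norm (\<kappa> x) < R \<Longrightarrow> c * (norm (\<kappa> x))\<^sup>2 \<le> Re (\<mu> (\<kappa> x))"
  shows "\<exists>\<theta>>0. localises \<A> \<Omega> p \<theta>"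
proof -
  have ch: "is_chart (W, \<kappa>)" using hc by (simp add: holomorphic_chart_def)
  note inj = is_chartD(3)[OF ch]
  obtain Mb where Mb: "Mb > 0" "\<And>v. cmod (\<mu> v) \<le> Mb * norm v" using cblinear_bound[OF \<mu>] by blast
  obtain r1 r0 where r: "r1 > 0" "r0 > 0" "r1 < R" "r0 < 1" and loc: "\<forall>C (w :: complex \<Rightarrow> 'e) \<mu>.
    open C \<longrightarrow> C \<subseteq> ball 0 1 \<longrightarrow> 0 \<in> C \<longrightarrow> cholomorphic_on w C \<longrightarrow> (\<forall>\<zeta>\<in>C. norm (w \<zeta>) < R) \<longrightarrow>
    cblinear \<mu> \<longrightarrow> (\<forall>v. cmod (\<mu> v) \<le> Mb * norm v) \<longrightarrow> (\<forall>\<zeta>\<in>C. c * (norm (w \<zeta>))\<^sup>2 \<le> Re (\<mu> (w \<zeta>))) \<longrightarrow>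
    (\<forall>s z v. (\<forall>n::nat. s n \<in> C) \<longrightarrow> s \<longlonglongrightarrow> z \<longrightarrow> cmod z < 1 \<longrightarrow> (\<lambda>n. w (s n)) \<longlonglongrightarrow> v \<longrightarrow> norm v < R \<longrightarrow> z \<in> C) \<longrightarrow>
    norm (w 0) \<le> r1 / 2 \<longrightarrow> ball 0 r0 \<subseteq> C \<and> (\<forall>\<zeta>\<in>ball 0 r0. norm (w \<zeta>) \<le> r1)"
    using disc_localisation[where 'e = 'e, OF c Mb(1) R(1)] by (elim exE conjE) (rule that)
  have "localises \<A> \<Omega> p (r0 / 2)"
    unfolding localises_def
  proof (intro allI impI)
    fix U assume U: "open U" "p \<in> U"
    have "open (\<kappa> ` (W \<inter> U))" using is_chartD(1)[OF ch] U by (intro chart_open_image[OF ch]) auto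
    moreover have "0 \<in> \<kappa> ` (W \<inter> U)" using p U by (metis IntI imageI)
    ultimately obtain \<delta> where \<delta>: "\<delta> > 0" "ball 0 \<delta> \<subseteq> \<kappa> ` (W \<inter> U)" using open_contains_ball by blast
    have inU: "x \<in> U" if "x \<in> W" "norm (\<kappa> x) < \<delta>" for x
    proof -
      have "\<kappa> x \<in> \<kappa> ` (W \<inter> U)" using that \<delta>(2) by auto
      then show ?thesis using inj that(1) by (auto simp: inj_on_def)
    qed
    \<comment> \<open>The last term anticipates Harnack on the half disc: it makes
      \<open>4 * Mb * \<delta>'\<close> at most \<open>c * \<delta>\<^sup>2\<close>.\<close>
    define \<delta>' where "\<delta>' = min R (min (r1 / 2) (c * \<delta>\<^sup>2 / (4 * Mb)))"
    have \<delta>': "\<delta>' > 0" "\<delta>' \<le> R" "\<delta>' \<le> r1 / 2" "\<delta>' \<le> c * \<delta>\<^sup>2 / (4 * Mb)"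
      using R r c \<delta> Mb(1) by (auto simp: \<delta>'_def)
    define V where "V = {x \<in> W. \<kappa> x \<in> ball 0 \<delta>'}"
    have "f \<zeta> \<in> U" if f: "disc_in \<A> \<Omega> f" "f 0 \<in> V" and \<zeta>: "cmod \<zeta> < r0 / 2" for f \<zeta>
    proof -
      have fh: "holomorphic_map hilbert_atlas \<A> f (ball 0 1)" and f\<Omega>: "\<And>\<zeta>. cmod \<zeta> < 1 \<Longrightarrow> f \<zeta> \<in> \<Omega>"
        using f(1) by (auto simp: disc_in_def)
      define C where "C = ball 0 1 \<inter> f -` {x \<in> W. \<kappa> x \<in> ball 0 R}"
      define w where "w \<zeta> = \<kappa> (f \<zeta>)" for \<zeta>
      have oC: "open C"
        unfolding C_def
        by (intro continuous_open_preimage holomorphic_mapD(1)[OF fh] chart_open_preimage[OF ch]) auto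
      have wC: "f \<zeta> \<in> W" "norm (w \<zeta>) < R" "cmod \<zeta> < 1" if "\<zeta> \<in> C" for \<zeta>
        using that by (auto simp: C_def w_def)
      have "holomorphic_map hilbert_atlas hilbert_atlas w C"
        unfolding w_def
        by (rule holomorphic_map_compose[where f = f and g = \<kappa> and T = W, OF complex_manifold_hilbert_atlas A
              holomorphic_map_subset[OF fh] holomorphic_chart_map[OF hc] oC])
           (auto simp: C_def)
      then have hw: "cholomorphic_on w C" by (simp add: holomorphic_map_hilbert_iff)
      have C0: "0 \<in> C" "norm (w 0) < \<delta>'" using f(2) \<delta>' by (auto simp: C_def V_def w_def)
      have "ball 0 r0 \<subseteq> C \<and> (\<forall>\<zeta>\<in>ball 0 r0. norm (w \<zeta>) \<le> r1)"
      proof (rule loc[THEN spec, THEN spec, THEN spec, THEN mp, THEN mp, THEN mp, THEN mp, THEN mp, THEN mp, THEN mp, THEN mp, THEN mp, THEN mp])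
        show "open C" "0 \<in> C" "cholomorphic_on w C" "cblinear \<mu>" by (rule oC C0(1) hw \<mu>)+
        show "C \<subseteq> ball 0 1" by (auto simp: C_def)
        show "\<forall>\<zeta>\<in>C. norm (w \<zeta>) < R" using wC by blast
        show "\<forall>v. cmod (\<mu> v) \<le> Mb * norm v" using Mb(2) by blast
        show "\<forall>\<zeta>\<in>C. c * (norm (w \<zeta>))\<^sup>2 \<le> Re (\<mu> (w \<zeta>))"
          using wC f\<Omega> peak unfolding w_def by blast
        show "norm (w 0) \<le> r1 / 2" using C0(2) \<delta>'(3) by linarith
        \<comment> \<open>A limit of norm below \<open>R\<close> is the coordinate of a point of
          \<open>W\<close>. The disc converges to that point and to \<open>f z\<close>, and limits
          are unique in a Hausdorff space.\<close>
        show "\<forall>s z v. (\<forall>n::nat. s n \<in> C) \<longrightarrow> s \<longlonglongrightarrow> z \<longrightarrow> cmod z < 1 \<longrightarrow> (\<lambda>n. w (s n)) \<longlonglongrightarrow> v \<longrightarrow> norm v < R \<longrightarrow> z \<in> C"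
        proof (intro allI impI)
          fix s z v assume s: "\<forall>n::nat. s n \<in> C" "s \<longlonglongrightarrow> z" "cmod z < 1" "(\<lambda>n. w (s n)) \<longlonglongrightarrow> v" "norm v < R"
          have v: "v \<in> \<kappa> ` W" using s(5) R(2) by auto
          have "isCont (inv_into W \<kappa>) v"
            using is_chartD(5)[OF ch] is_chartD(2)[OF ch] v continuous_on_eq_continuous_at by blast
          from isCont_tendsto_compose[OF this s(4)]
          have "(\<lambda>n. inv_into W \<kappa> (w (s n))) \<longlonglongrightarrow> inv_into W \<kappa> v" .
          moreover have "inv_into W \<kappa> (w (s n)) = f (s n)" for n
            using wC(1)[of "s n"] s(1) inj by (simp add: w_def)
          ultimately have 1: "(\<lambda>n. f (s n)) \<longlonglongrightarrow> inv_into W \<kappa> v" by simp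
          have "isCont f z"
            using holomorphic_mapD(1)[OF fh] s(3) by (auto simp: continuous_on_eq_continuous_at)
          from isCont_tendsto_compose[OF this s(2)] have "(\<lambda>n. f (s n)) \<longlonglongrightarrow> f z" .
          then have "f z = inv_into W \<kappa> v" using 1 LIMSEQ_unique by blast
          then have "f z \<in> W" "\<kappa> (f z) = v" using v by (auto simp: inv_into_into f_inv_into_f)
          then show "z \<in> C" using s by (auto simp: C_def)
        qed
      qed
      then have bC: "ball 0 r0 \<subseteq> C" by blast
      define h where "h z = \<mu> (w (of_real r0 * z))" for z
      have inC: "of_real r0 * z \<in> C" if "cmod z < 1" for z
        using bC that r(2) by (auto simp: norm_mult subset_iff)
      have "h holomorphic_on ball 0 1"
        unfolding h_def cholomorphic_on_complex_iff[symmetric] using inC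
        by (intro cholomorphic_on_cblinear_compose[OF _ \<mu>] cholomorphic_on_compose[OF _ hw] cholomorphic_on_mult
            cholomorphic_on_const cholomorphic_on_id) auto
      moreover have pk: "c * (norm (w \<zeta>))\<^sup>2 \<le> Re (\<mu> (w \<zeta>))" if "\<zeta> \<in> C" for \<zeta>
        using peak wC[OF that] f\<Omega> unfolding w_def by blast
      then have "Re (h z) \<ge> 0" if "cmod z < 1" for z
        unfolding h_def using inC[OF that] c by (meson order_trans mult_nonneg_nonneg less_imp_le zero_le_power2)
      ultimately have H: "(1 - cmod z) * Re (h z) \<le> (1 + cmod z) * Re (h 0)" if "cmod z < 1" for z
        by (intro Harnack(1)) (use that in auto)
      define z where "z = \<zeta> / of_real r0"
      have z: "cmod z < 1 / 2" "of_real r0 * z = \<zeta>" using \<zeta> r(2) by (auto simp: z_def norm_divide field_simps)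
      have h0: "Re (h 0) \<le> Mb * norm (w 0)" "0 \<le> Re (h 0)"
        using Mb(2)[of "w 0"] complex_Re_le_cmod[of "h 0"] \<open>\<And>z. cmod z < 1 \<Longrightarrow> Re (h z) \<ge> 0\<close>[of 0] by (auto simp: h_def)
      have hz: "Re (h z) \<ge> 0" using \<open>\<And>z. cmod z < 1 \<Longrightarrow> Re (h z) \<ge> 0\<close>[of z] z by simp
      have "1 / 2 * Re (h z) \<le> (1 - cmod z) * Re (h z)" using z hz by (intro mult_right_mono) auto
      also have "\<dots> \<le> (1 + cmod z) * Re (h 0)" using H z by simp
      also have "\<dots> \<le> 2 * (Mb * norm (w 0))" using z h0 by (intro mult_mono) auto
      finally have "c * (norm (w \<zeta>))\<^sup>2 \<le> 4 * Mb * norm (w 0)"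
        using pk[of \<zeta>] inC[of z] z by (simp add: h_def)
      also have "\<dots> < 4 * Mb * \<delta>'" using C0(2) Mb(1) by simp
      also have "\<dots> \<le> c * \<delta>\<^sup>2" using \<delta>'(4) Mb(1) by (simp add: field_simps)
      finally have "norm (w \<zeta>) < \<delta>" using c \<delta>(1) by (intro power2_less_imp_less[of _ \<delta>]) auto
      moreover have "f \<zeta> \<in> W" using wC(1)[of \<zeta>] inC[of z] z by simp
      ultimately show ?thesis by (intro inU) (simp_all add: w_def)
    qed
    moreover have "open V" unfolding V_def by (rule chart_open_preimage[OF ch]) simp
    moreover have "p \<in> V" using p \<delta>' by (simp add: V_def)
    ultimately show "\<exists>V. open V \<and> p \<in> V \<and> (\<forall>f. disc_in \<A> \<Omega> f \<longrightarrow> f 0 \<in> V \<longrightarrow> (\<forall>\<zeta>. cmod \<zeta> < r0 / 2 \<longrightarrow> f \<zeta> \<in> U))"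
      by blast
  qed
  then show ?thesis using r(2) by (intro exI[of _ "r0 / 2"]) simp
qed

text \<open>A disc recentred at a point of modulus at most \<open>r\<close> and shrunk by the factor
  \<open>1 - r\<close> is again a disc. So the known radius \<open>\<theta>\<close> can be spent
  repeatedly, each time moving outward by \<open>s\<close>, until radius \<open>r\<close> is
  covered.\<close>

lemma localises_all:
  assumes A: "complex_manifold \<A>" and \<theta>: "\<theta> > 0" "localises \<A> \<Omega> p \<theta>" and r: "0 < r" "r < 1"
  shows "localises \<A> \<Omega> p r"
proof -
  define s where "s = \<theta> * (1 - r) / 2"
  have s: "s > 0" using \<theta> r by (simp add: s_def)
  have step: "\<forall>U. open U \<longrightarrow> p \<in> U \<longrightarrow> (\<exists>V. open V \<and> p \<in> V \<and>
      (\<forall>f. disc_in \<A> \<Omega> f \<longrightarrow> f 0 \<in> V \<longrightarrow> (\<forall>\<zeta>. cmod \<zeta> \<le> r \<longrightarrow> cmod \<zeta> \<le> real n * s \<longrightarrow> f \<zeta> \<in> U)))" for n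
  proof (induction n)
    case 0
    then show ?case by auto
  next
    case (Suc n)
    show ?case
    proof (intro allI impI)
      fix U assume "open U" "p \<in> U"
      then obtain V1 where V1: "open V1" "p \<in> V1"
        "\<And>f \<zeta>. disc_in \<A> \<Omega> f \<Longrightarrow> f 0 \<in> V1 \<Longrightarrow> cmod \<zeta> < \<theta> \<Longrightarrow> f \<zeta> \<in> U"
        using \<theta>(2) unfolding localises_def by meson
      then obtain V2 where V2: "open V2" "p \<in> V2"
        "\<And>f \<zeta>. disc_in \<A> \<Omega> f \<Longrightarrow> f 0 \<in> V2 \<Longrightarrow> cmod \<zeta> \<le> r \<Longrightarrow> cmod \<zeta> \<le> real n * s \<Longrightarrow> f \<zeta> \<in> V1"
        using Suc.IH by meson
      have "f \<zeta> \<in> U" if f: "disc_in \<A> \<Omega> f" "f 0 \<in> V2" and \<zeta>: "cmod \<zeta> \<le> r" "cmod \<zeta> \<le> real (Suc n) * s" for f \<zeta>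
      proof -
        \<comment> \<open>The intermediate centre \<open>\<zeta>'\<close> divides the ray to
          \<open>\<zeta>\<close> so that it is covered by the previous stage and the last step has
          length at most \<open>s\<close>.\<close>
        define t where "t = real n / real (Suc n)"
        have t: "0 \<le> t" "t \<le> 1" "t * real (Suc n) = real n" "(1 - t) * real (Suc n) = 1"
          by (auto simp: t_def field_simps)
        define \<zeta>' where "\<zeta>' = of_real t * \<zeta>"
        have n': "cmod \<zeta>' = t * cmod \<zeta>" using t by (simp add: \<zeta>'_def norm_mult)
        have "t * cmod \<zeta> \<le> 1 * cmod \<zeta>" using t by (intro mult_right_mono) auto
        then have z1: "cmod \<zeta>' \<le> r" using \<zeta>(1) n' by simp
        have "t * cmod \<zeta> \<le> t * (real (Suc n) * s)" using t \<zeta>(2) by (intro mult_left_mono) auto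
        also have "\<dots> = real n * s" using t(3) by (simp only: mult.assoc[symmetric])
        finally have z2: "cmod \<zeta>' \<le> real n * s" using n' by simp
        define g where "g z = f (\<zeta>' + z * of_real (1 - r))" for z
        have "cmod (\<zeta>' + z * of_real (1 - r)) < 1" if "cmod z < 1" for z
        proof -
          have "cmod (\<zeta>' + z * of_real (1 - r)) \<le> cmod \<zeta>' + cmod z * (1 - r)"
            using norm_triangle_ineq[of \<zeta>' "z * of_real (1 - r)"] r by (simp add: norm_mult del: of_real_diff)
          also have "cmod z * (1 - r) < 1 * (1 - r)" using that r by (intro mult_strict_right_mono) auto
          finally show ?thesis using z1 by simp
        qed
        then have "disc_in \<A> \<Omega> g" unfolding g_def by (rule disc_in_affine[OF A f(1)])
        moreover have "g 0 \<in> V1" using V2(3)[OF f z1 z2] by (simp add: g_def)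
        moreover have "cmod ((\<zeta> - \<zeta>') / of_real (1 - r)) < \<theta>"
        proof -
          have "\<zeta> - \<zeta>' = of_real (1 - t) * \<zeta>" by (simp add: \<zeta>'_def algebra_simps)
          then have "cmod (\<zeta> - \<zeta>') = (1 - t) * cmod \<zeta>" using t by (simp add: norm_mult del: of_real_diff)
          also have "\<dots> \<le> (1 - t) * (real (Suc n) * s)" using t \<zeta>(2) by (intro mult_left_mono) auto
          also have "\<dots> = s" using t(4) by (simp only: mult.assoc[symmetric] mult_1)
          also have "\<dots> < \<theta> * (1 - r)" using \<theta> r by (simp add: s_def)
          finally show ?thesis using r by (simp add: norm_divide pos_divide_less_eq del: of_real_diff)
        qed
        ultimately have "g ((\<zeta> - \<zeta>') / of_real (1 - r)) \<in> U" by (rule V1(3))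
        moreover have "(\<zeta> - \<zeta>') / of_real (1 - r) * of_real (1 - r) = \<zeta> - \<zeta>'"
        proof -
          have "complex_of_real (1 - r) \<noteq> 0" using r by (simp del: of_real_diff)
          then show ?thesis by (simp del: of_real_diff)
        qed
        ultimately show ?thesis by (simp add: g_def del: of_real_diff)
      qed
      then show "\<exists>V. open V \<and> p \<in> V \<and>
        (\<forall>f. disc_in \<A> \<Omega> f \<longrightarrow> f 0 \<in> V \<longrightarrow> (\<forall>\<zeta>. cmod \<zeta> \<le> r \<longrightarrow> cmod \<zeta> \<le> real (Suc n) * s \<longrightarrow> f \<zeta> \<in> U))"
        using V2(1,2) by blast
    qed
  qed
  obtain n :: nat where n: "1 / s < real n" using reals_Archimedean2 by blast
  then have n: "r \<le> real n * s" using s r by (simp add: field_simps)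
  show ?thesis
    unfolding localises_def
  proof (intro allI impI)
    fix U assume "open U" "p \<in> U"
    then obtain V where "open V" "p \<in> V"
      "\<forall>f. disc_in \<A> \<Omega> f \<longrightarrow> f 0 \<in> V \<longrightarrow> (\<forall>\<zeta>. cmod \<zeta> \<le> r \<longrightarrow> cmod \<zeta> \<le> real n * s \<longrightarrow> f \<zeta> \<in> U)"
      using step[of n] by meson
    then show "\<exists>V. open V \<and> p \<in> V \<and> (\<forall>f. disc_in \<A> \<Omega> f \<longrightarrow> f 0 \<in> V \<longrightarrow> (\<forall>\<zeta>. cmod \<zeta> < r \<longrightarrow> f \<zeta> \<in> U))"
      using n by (intro exI[of _ V]) force
  qed
qed

text \<open>One application of localisation for each link; since a link ends at modulus at most 1/2,
  radius 3/4 is ample.\<close>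

lemma localises_reach:
  assumes loc: "localises \<A> \<Omega> p (3 / 4)"
  shows "\<forall>U. open U \<longrightarrow> p \<in> U \<longrightarrow> (\<exists>V. open V \<and> p \<in> V \<and> (\<forall>x\<in>V. reach \<A> \<Omega> x k \<subseteq> U))"
proof (induction k)
  case 0
  then show ?case by auto
next
  case (Suc k)
  show ?case
  proof (intro allI impI)
    fix U assume "open U" "p \<in> U"
    then obtain V1 where V1: "open V1" "p \<in> V1"
      "\<And>f \<zeta>. disc_in \<A> \<Omega> f \<Longrightarrow> f 0 \<in> V1 \<Longrightarrow> cmod \<zeta> < 3 / 4 \<Longrightarrow> f \<zeta> \<in> U"
      using loc unfolding localises_def by meson
    then obtain V2 where V2: "open V2" "p \<in> V2" "\<And>x. x \<in> V2 \<Longrightarrow> reach \<A> \<Omega> x k \<subseteq> V1" using Suc.IH by meson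
    have "reach \<A> \<Omega> x (Suc k) \<subseteq> U" if "x \<in> V2" for x
    proof
      fix y assume "y \<in> reach \<A> \<Omega> x (Suc k)"
      then obtain f \<zeta> where f: "disc_in \<A> \<Omega> f" "f 0 \<in> reach \<A> \<Omega> x k" "cmod \<zeta> \<le> 1 / 2" "y = f \<zeta>" by auto
      then show "y \<in> U" using V2(3)[OF that] V1(3)[OF f(1), of \<zeta>] by auto
    qed
    then show "\<exists>V. open V \<and> p \<in> V \<and> (\<forall>x\<in>V. reach \<A> \<Omega> x (Suc k) \<subseteq> U)" using V2(1,2) by blast
  qed
qed

section \<open>Local normal form at a strongly pseudoconvex boundary point\<close>

lemma blinfun2_bound: "\<bar>blinfun_apply (blinfun_apply Q v) w\<bar> \<le> norm Q * norm v * norm w"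
proof -
  have "\<bar>blinfun_apply (blinfun_apply Q v) w\<bar> \<le> norm (blinfun_apply Q v) * norm w"
    using norm_blinfun[of "blinfun_apply Q v" w] by simp
  also have "\<dots> \<le> norm Q * norm v * norm w" by (intro mult_right_mono norm_blinfun) auto
  finally show ?thesis .
qed

lemma del_form_bound: "cmod (del_form L v) \<le> norm L * norm v"
proof -
  have "cmod (of_real (blinfun_apply L v) - \<i> * of_real (blinfun_apply L (\<i> *\<^sub>C v)))
      \<le> \<bar>blinfun_apply L v\<bar> + \<bar>blinfun_apply L (\<i> *\<^sub>C v)\<bar>"
    using norm_triangle_ineq4[of "complex_of_real (blinfun_apply L v)" "\<i> * of_real (blinfun_apply L (\<i> *\<^sub>C v))"]
    by (simp add: norm_mult)
  also have "\<dots> \<le> norm L * norm v + norm L * norm v"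
    using norm_blinfun[of L v] norm_blinfun[of L "\<i> *\<^sub>C v"] by (intro add_mono) simp_all
  finally show ?thesis by (simp add: del_form_def norm_mult mult.commute)
qed

lemma cblinear_del_form: "cblinear (del_form L)"
proof (rule cblinearI[where K = "norm L"])
  fix x y :: 'a and c :: complex
  show "del_form L (x + y) = del_form L x + del_form L y"
    by (simp add: del_form_def scaleC_add_right blinfun.add_right algebra_simps add_divide_distrib diff_divide_distrib)
  show "del_form L (c *\<^sub>C x) = c *\<^sub>C del_form L x"
  proof -
    have "c *\<^sub>C \<i> *\<^sub>C x = Re c *\<^sub>R (\<i> *\<^sub>C x) - Im c *\<^sub>R x"
      by (subst scaleC_complex_decomp) simp
    moreover have "\<i> *\<^sub>C c *\<^sub>C x = c *\<^sub>C \<i> *\<^sub>C x" by (simp add: scaleC_scaleC mult.commute)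
    ultimately show ?thesis
      by (simp add: del_form_def scaleC_complex_decomp[of c x] scaleC_add_right scaleC_scaleR_commute
          blinfun.add_right blinfun.diff_right blinfun.scaleR_right complex_eq_iff algebra_simps)
  qed
  show "norm (del_form L x) \<le> norm L * norm x" by (rule del_form_bound)
qed

lemma Re_del_form: "blinfun_apply L v = 2 * Re (del_form L v)"
  by (simp add: del_form_def)

lemma del_form_diff: "del_form L v - del_form L' v = del_form (L - L') v"
  by (simp add: del_form_def blinfun.diff_left algebra_simps diff_divide_distrib)

text \<open>Second order expansion with the Hessian frozen at \<open>z0\<close> but the base point
  \<open>b\<close> varying. The uniformity in \<open>b\<close> is what later allows pinching at all
  boundary points near \<open>p\<close> with the same quadratic form.\<close>

lemma C2_Taylor:
  assumes C2: "C2_with_derivs \<rho> d\<rho> d2\<rho> U" and U: "open U" "z0 \<in> U" and \<epsilon>: "\<epsilon> > 0"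
  shows "\<exists>\<delta>>0. ball z0 \<delta> \<subseteq> U \<and> (\<forall>b\<in>ball z0 \<delta>. \<forall>z\<in>ball z0 \<delta>.
    norm (d\<rho> z - d\<rho> b - blinfun_apply (d2\<rho> z0) (z - b)) \<le> \<epsilon> * norm (z - b) \<and>
    \<bar>\<rho> z - \<rho> b - blinfun_apply (d\<rho> b) (z - b) - blinfun_apply (blinfun_apply (d2\<rho> z0) (z - b)) (z - b) / 2\<bar>
      \<le> \<epsilon> * (norm (z - b))\<^sup>2)"
proof -
  define Q where "Q = d2\<rho> z0"
  have d1: "\<And>z. z \<in> U \<Longrightarrow> (\<rho> has_derivative blinfun_apply (d\<rho> z)) (at z)"
    and d2: "\<And>z. z \<in> U \<Longrightarrow> (d\<rho> has_derivative blinfun_apply (d2\<rho> z)) (at z)" and c2: "continuous_on U d2\<rho>"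
    using C2 by (auto simp: C2_with_derivs_def)
  obtain \<delta>1 where \<delta>1: "\<delta>1 > 0" "ball z0 \<delta>1 \<subseteq> U" using U open_contains_ball by blast
  obtain \<delta>2 where \<delta>2: "\<delta>2 > 0" "\<And>z. z \<in> U \<Longrightarrow> dist z z0 < \<delta>2 \<Longrightarrow> dist (d2\<rho> z) Q < \<epsilon>"
    using c2 U(2) \<epsilon> unfolding continuous_on_iff Q_def by metis
  define \<delta> where "\<delta> = min \<delta>1 \<delta>2"
  have \<delta>: "\<delta> > 0" "ball z0 \<delta> \<subseteq> U" using \<delta>1 \<delta>2 by (auto simp: \<delta>_def)
  have near: "norm (d2\<rho> z - Q) \<le> \<epsilon>" if "z \<in> ball z0 \<delta>" for z
    using \<delta>2(2)[of z] that \<delta>(2) by (auto simp: \<delta>_def dist_norm norm_minus_commute intro: less_imp_le)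
  have first: "norm (d\<rho> z - d\<rho> b - blinfun_apply Q (z - b)) \<le> \<epsilon> * norm (z - b)"
    if "b \<in> ball z0 \<delta>" "z \<in> ball z0 \<delta>" for b z
  proof -
    have "norm ((d\<rho> z - blinfun_apply Q z) - (d\<rho> b - blinfun_apply Q b)) \<le> \<epsilon> * norm (z - b)"
    proof (rule differentiable_bound[where S = "ball z0 \<delta>" and f = "\<lambda>z. d\<rho> z - blinfun_apply Q z"
          and f' = "\<lambda>z v. blinfun_apply (d2\<rho> z) v - blinfun_apply Q v"])
      show "((\<lambda>z. d\<rho> z - blinfun_apply Q z) has_derivative (\<lambda>v. blinfun_apply (d2\<rho> z) v - blinfun_apply Q v))
          (at z within ball z0 \<delta>)" if "z \<in> ball z0 \<delta>" for z
        using that \<delta>(2)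
        by (intro has_derivative_diff has_derivative_at_withinI[OF d2] bounded_linear_imp_has_derivative blinfun.bounded_linear_right) auto
      show "onorm (\<lambda>v. blinfun_apply (d2\<rho> z) v - blinfun_apply Q v) \<le> \<epsilon>" if "z \<in> ball z0 \<delta>" for z
        using near[OF that] by (simp add: norm_blinfun.rep_eq[symmetric] minus_blinfun.rep_eq[symmetric])
    qed (use that in auto)
    then show ?thesis by (simp add: blinfun.diff_right algebra_simps)
  qed
  have second: "\<bar>\<rho> z - \<rho> b - blinfun_apply (d\<rho> b) (z - b) - blinfun_apply (blinfun_apply Q (z - b)) (z - b) / 2\<bar>
      \<le> \<epsilon> * (norm (z - b))\<^sup>2" if b: "b \<in> ball z0 \<delta>" and z: "z \<in> ball z0 \<delta>" for b z
  proof -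
    define v where "v = z - b"
    \<comment> \<open>The restriction to the segment minus its quadratic model; the first order
      estimate bounds its derivative.\<close>
    define g where "g t = \<rho> (b + t *\<^sub>R v) - t * blinfun_apply (d\<rho> b) v - t\<^sup>2 * (blinfun_apply (blinfun_apply Q v) v / 2)" for t
    have inb: "b + t *\<^sub>R v \<in> ball z0 \<delta>" if "t \<in> {0..1}" for t
    proof -
      have "(1 - t) *\<^sub>R b + t *\<^sub>R z \<in> ball z0 \<delta>"
        using b z that by (intro convexD[OF convex_ball]) auto
      moreover have "(1 - t) *\<^sub>R b + t *\<^sub>R z = b + t *\<^sub>R v" by (simp add: v_def algebra_simps)
      ultimately show ?thesis by simp
    qed
    have "norm (g 1 - g 0) \<le> (\<epsilon> * (norm v)\<^sup>2) * norm (1 - 0 :: real)"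
    proof (rule differentiable_bound[where S = "{0..1}" and f' = "\<lambda>t h. h * (blinfun_apply (d\<rho> (b + t *\<^sub>R v)) v
          - blinfun_apply (d\<rho> b) v - t * blinfun_apply (blinfun_apply Q v) v)"])
      fix t :: real assume t: "t \<in> {0..1}"
      have "((\<lambda>t. b + t *\<^sub>R v) has_derivative (\<lambda>h. h *\<^sub>R v)) (at t)" by (auto intro!: derivative_eq_intros)
      moreover have "(\<rho> has_derivative blinfun_apply (d\<rho> (b + t *\<^sub>R v))) (at (b + t *\<^sub>R v))"
        using inb[OF t] \<delta>(2) by (intro d1) auto
      ultimately have 1: "((\<lambda>t. \<rho> (b + t *\<^sub>R v)) has_derivative (\<lambda>h. blinfun_apply (d\<rho> (b + t *\<^sub>R v)) (h *\<^sub>R v))) (at t)"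
        by (rule has_derivative_compose[where f = "\<lambda>t. b + t *\<^sub>R v" and g = \<rho>])
      have 2: "(g has_derivative (\<lambda>h. blinfun_apply (d\<rho> (b + t *\<^sub>R v)) (h *\<^sub>R v) - h * blinfun_apply (d\<rho> b) v
          - (2 * t * h) * (blinfun_apply (blinfun_apply Q v) v / 2))) (at t)"
        unfolding g_def by (rule derivative_eq_intros 1 refl | simp add: mult.left_commute)+
      have eq: "(\<lambda>h. blinfun_apply (d\<rho> (b + t *\<^sub>R v)) (h *\<^sub>R v) - h * blinfun_apply (d\<rho> b) v
          - (2 * t * h) * (blinfun_apply (blinfun_apply Q v) v / 2))
        = (\<lambda>h. h * (blinfun_apply (d\<rho> (b + t *\<^sub>R v)) v - blinfun_apply (d\<rho> b) v - t * blinfun_apply (blinfun_apply Q v) v))"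
        by (simp add: fun_eq_iff blinfun.scaleR_right algebra_simps)
      show "(g has_derivative (\<lambda>h. h * (blinfun_apply (d\<rho> (b + t *\<^sub>R v)) v
          - blinfun_apply (d\<rho> b) v - t * blinfun_apply (blinfun_apply Q v) v))) (at t within {0..1})"
        using 2 unfolding eq by (rule has_derivative_at_withinI)
      let ?D = "d\<rho> (b + t *\<^sub>R v) - d\<rho> b - blinfun_apply Q (t *\<^sub>R v)"
      have "norm ?D \<le> \<epsilon> * norm (t *\<^sub>R v)" using first[OF b inb[OF t]] by simp
      also have "\<dots> \<le> \<epsilon> * norm v" using t \<epsilon> by (intro mult_left_mono) (auto simp: mult_left_le_one_le)
      finally have "norm ?D * norm v \<le> \<epsilon> * norm v * norm v" by (intro mult_right_mono) auto
      then have "\<bar>blinfun_apply ?D v\<bar> \<le> \<epsilon> * (norm v)\<^sup>2"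
        using norm_blinfun[of ?D v] by (simp add: power2_eq_square)
      moreover have "blinfun_apply ?D v = blinfun_apply (d\<rho> (b + t *\<^sub>R v)) v - blinfun_apply (d\<rho> b) v - t * blinfun_apply (blinfun_apply Q v) v"
        by (simp add: blinfun.diff_left blinfun.scaleR_right blinfun.scaleR_left)
      ultimately show "onorm (\<lambda>h. h * (blinfun_apply (d\<rho> (b + t *\<^sub>R v)) v
          - blinfun_apply (d\<rho> b) v - t * blinfun_apply (blinfun_apply Q v) v)) \<le> \<epsilon> * (norm v)\<^sup>2"
        by (intro onorm_bound) (auto simp: abs_mult mult.commute intro!: mult_left_mono)
    qed auto
    then show ?thesis by (simp add: g_def v_def)
  qed
  show ?thesis using \<delta> first second unfolding Q_def by blast
qed

text \<open>The Levi form is positive only on the kernel of \<open>lam\<close>. Multiplying the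
  defining function by \<open>1 + 2 * Re (m v)\<close> adds \<open>4 * Re (lam v) * Re (m v)\<close>
  to its quadratic part, and a suitable \<open>m\<close> removes the mixed Levi terms and sets the
  coefficient in the direction \<open>e\<close> to 1. What remains is a positive definite Hermitian
  form, realised as \<open>(norm (T v))\<^sup>2\<close>, plus the real part of the complex bilinear
  form \<open>q\<close>, which a change of coordinates can remove.\<close>

lemma quadratic_normal_form:
  fixes lam :: "'e::{complex_hilbert_space, second_countable_topology} \<Rightarrow> complex" and Q :: "'e \<Rightarrow>\<^sub>L 'e \<Rightarrow>\<^sub>L real"
  assumes lam: "cblinear lam" "lam u \<noteq> 0"
    and levi: "C > 0" "\<forall>v. lam v = 0 \<longrightarrow> C * (norm v)\<^sup>2 \<le> levi_form Q v"
  shows "\<exists>e m q (T :: 'e \<Rightarrow> ell2) S. lam e = -1 \<and> cblinear m \<and> cblinear T \<and> cblinear S \<and> (\<forall>x. S (T x) = x) \<and>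
    (\<forall>x. cblinear (q x)) \<and> (\<forall>x y. q x y = q y x) \<and> (\<exists>K. \<forall>x y. cmod (q x y) \<le> K * norm x * norm y) \<and>
    (\<forall>v. (norm (T v))\<^sup>2 = (cmod (lam v))\<^sup>2 + (norm (T (v + lam v *\<^sub>C e)))\<^sup>2) \<and>
    (\<forall>v. blinfun_apply (blinfun_apply Q v) v / 2 + 4 * Re (lam v) * Re (m v) = Re (q v v) + (norm (T v))\<^sup>2)"
proof -
  \<comment> \<open>The symmetrisation agrees with \<open>Q\<close> on the diagonal; polarising it
    gives a Hermitian form \<open>L\<close> whose diagonal is the Levi form.\<close>
  define b where "b v w = (blinfun_apply (blinfun_apply Q v) w + blinfun_apply (blinfun_apply Q w) v) / 2" for v w
  have b_add: "b (x + y) z = b x z + b y z" for x y z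
    by (simp add: b_def blinfun.add_left blinfun.add_right add_divide_distrib)
  have b_scale: "b (r *\<^sub>R x) y = r * b x y" for r x y
    by (simp add: b_def blinfun.scaleR_left blinfun.scaleR_right algebra_simps)
  have b_sym: "b x y = b y x" for x y by (simp add: b_def)
  have b_minus: "b (- x) y = - b x y" "b x (- y) = - b x y" for x y
    using b_scale[of "-1" x y] b_scale[of "-1" y x] b_sym[of x "-y"] b_sym[of x y] by simp_all
  have b_bound: "\<bar>b x y\<bar> \<le> norm Q * norm x * norm y" for x y
    using blinfun2_bound[of Q x y] blinfun2_bound[of Q y x] by (simp add: b_def mult.commute mult.left_commute)
  define L where "L v w = (b v w + b (\<i> *\<^sub>C v) (\<i> *\<^sub>C w)) / 4" for v w
  interpret L: invariant_form L
  proof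
    fix x y z :: 'e and r :: real
    show "L (x + y) z = L x z + L y z" by (simp add: L_def b_add scaleC_add_right add_divide_distrib)
    show "L (r *\<^sub>R x) y = r * L x y" by (simp add: L_def b_scale scaleC_scaleR_commute algebra_simps add_divide_distrib)
    show "L x y = L y x" by (simp add: L_def b_sym)
    show "L (\<i> *\<^sub>C x) (\<i> *\<^sub>C y) = L x y" by (simp add: L_def b_minus)
  qed
  have L_levi: "L v v = levi_form Q v" for v by (simp add: L_def b_def levi_form_def)
  have L_bound: "\<bar>L x y\<bar> \<le> norm Q * norm x * norm y" for x y
    using b_bound[of x y] b_bound[of "\<i> *\<^sub>C x" "\<i> *\<^sub>C y"] by (simp add: L_def)
  \<comment> \<open>The sign makes \<open>e\<close> point into the domain: the real derivative is
    \<open>2 * Re (lam v)\<close>, hence -2 in this direction.\<close>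
  define e where "e = (- 1 / lam u) *\<^sub>C u"
  have e: "lam e = -1" using lam(2) by (simp add: e_def cblinear_scaleC[OF lam(1)] cblinear_minus[OF lam(1)])
  define \<mu> where "\<mu> v = - lam v" for v
  have \<mu>: "cblinear \<mu>" "\<mu> e = 1" using cblinear_uminus[OF lam(1)] e by (simp_all add: \<mu>_def[abs_def])
  define \<pi> where "\<pi> v = v - \<mu> v *\<^sub>C e" for v
  have \<pi>: "cblinear \<pi>" unfolding \<pi>_def
    by (intro cblinear_sub cblinear_id cblinear_compose[OF \<mu>(1) cblinear_scaleC_left])
  have \<mu>\<pi>: "\<mu> (\<pi> v) = 0" for v by (simp add: \<pi>_def cblinear_simps[OF \<mu>(1)] \<mu>(2))
  have \<pi>\<pi>: "\<pi> (\<pi> v) = \<pi> v" for v by (simp add: \<pi>_def[of "\<pi> v"] \<mu>\<pi>)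
  \<comment> \<open>The form to be reached: the Levi form on the complex tangent space, and the unit
    form on the line spanned by \<open>e\<close>, orthogonal to each other.\<close>
  define R where "R v w = L (\<pi> v) (\<pi> w) + Re (\<mu> v * cnj (\<mu> w))" for v w
  obtain K\<pi> where K\<pi>: "K\<pi> > 0" "\<And>v. norm (\<pi> v) \<le> K\<pi> * norm v" using cblinear_bound[OF \<pi>] by blast
  obtain K\<mu> where K\<mu>: "K\<mu> > 0" "\<And>v. cmod (\<mu> v) \<le> K\<mu> * norm v" using cblinear_bound[OF \<mu>(1)] by blast
  have Rvv: "R v v = L (\<pi> v) (\<pi> v) + (cmod (\<mu> v))\<^sup>2" for v
    unfolding R_def complex_norm_square[symmetric] by simp
  define c where "c = 1 / (2 / C + 2 * (norm e)\<^sup>2 + 1)"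
  have pos: "2 / C + 2 * (norm e)\<^sup>2 + 1 > 0" using levi(1) by (intro add_nonneg_pos) auto
  have R_low: "c * (norm v)\<^sup>2 \<le> R v v" for v
  proof -
    have "lam (\<pi> v) = 0" using \<mu>\<pi>[of v] by (simp add: \<mu>_def)
    then have 1: "C * (norm (\<pi> v))\<^sup>2 + (cmod (\<mu> v))\<^sup>2 \<le> R v v" using levi(2)[rule_format, of "\<pi> v"] by (simp add: Rvv L_levi)
    have "norm v \<le> norm (\<pi> v) + cmod (\<mu> v) * norm e"
      using norm_triangle_ineq[of "\<pi> v" "\<mu> v *\<^sub>C e"] by (simp add: \<pi>_def)
    then have "(norm v)\<^sup>2 \<le> (norm (\<pi> v) + cmod (\<mu> v) * norm e)\<^sup>2" by (intro power_mono) auto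
    also have "\<dots> \<le> 2 * (norm (\<pi> v))\<^sup>2 + 2 * ((cmod (\<mu> v))\<^sup>2 * (norm e)\<^sup>2)"
      using sum_squares_bound[of "norm (\<pi> v)" "cmod (\<mu> v) * norm e"] unfolding power2_sum power_mult_distrib by linarith
    also have "\<dots> \<le> (2 / C) * R v v + (2 * (norm e)\<^sup>2) * R v v"
    proof (rule add_mono)
      have "C * (norm (\<pi> v))\<^sup>2 \<le> R v v" using 1 zero_le_power2[of "cmod (\<mu> v)"] by linarith
      then show "2 * (norm (\<pi> v))\<^sup>2 \<le> (2 / C) * R v v" using levi(1) by (simp add: field_simps)
      have "0 \<le> C * (norm (\<pi> v))\<^sup>2" using levi(1) by simp
      then have "(cmod (\<mu> v))\<^sup>2 \<le> R v v" using 1 by linarith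
      then have "(2 * (norm e)\<^sup>2) * (cmod (\<mu> v))\<^sup>2 \<le> (2 * (norm e)\<^sup>2) * R v v" by (intro mult_left_mono) auto
      then show "2 * ((cmod (\<mu> v))\<^sup>2 * (norm e)\<^sup>2) \<le> (2 * (norm e)\<^sup>2) * R v v" by (simp add: mult.commute mult.left_commute)
    qed
    also have "\<dots> \<le> (2 / C + 2 * (norm e)\<^sup>2 + 1) * R v v"
    proof -
      have "0 \<le> C * (norm (\<pi> v))\<^sup>2 + (cmod (\<mu> v))\<^sup>2" using levi(1) by simp
      then have "R v v \<ge> 0" using 1 by linarith
      then show ?thesis by (simp add: algebra_simps)
    qed
    finally show ?thesis using pos by (simp add: c_def field_simps)
  qed
  have R_up: "R v v \<le> (norm Q * K\<pi>\<^sup>2 + K\<mu>\<^sup>2) * (norm v)\<^sup>2" for v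
  proof -
    have "L (\<pi> v) (\<pi> v) \<le> norm Q * norm (\<pi> v) * norm (\<pi> v)" using L_bound[of "\<pi> v" "\<pi> v"] by linarith
    also have "\<dots> \<le> norm Q * (K\<pi> * norm v) * (K\<pi> * norm v)"
      using K\<pi> by (intro mult_mono mult_left_mono) auto
    finally have 1: "L (\<pi> v) (\<pi> v) \<le> norm Q * (K\<pi> * norm v) * (K\<pi> * norm v)" .
    have "(cmod (\<mu> v))\<^sup>2 \<le> (K\<mu> * norm v)\<^sup>2" using K\<mu> by (intro power_mono) auto
    with 1 show ?thesis by (simp add: Rvv power2_eq_square algebra_simps)
  qed
  interpret R: equivalent_inner R c "norm Q * K\<pi>\<^sup>2 + K\<mu>\<^sup>2"
  proof
    fix x y z :: 'e and r :: real
    show "R (x + y) z = R x z + R y z"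
      by (simp add: R_def cblinear_add[OF \<pi>] cblinear_add[OF \<mu>(1)] L.R_add algebra_simps)
    show "R (r *\<^sub>R x) y = r * R x y"
      by (simp add: R_def cblinear_scaleR[OF \<pi>] cblinear_scaleR[OF \<mu>(1)] L.R_scaleR algebra_simps)
    show "R x y = R y x" by (simp add: R_def L.R_sym mult.commute)
    show "R (\<i> *\<^sub>C x) (\<i> *\<^sub>C y) = R x y"
      by (simp add: R_def cblinear_scaleC[OF \<pi>] cblinear_scaleC[OF \<mu>(1)] L.R_ii algebra_simps)
    show "c > 0" using pos by (simp add: c_def)
    show "c * (norm x)\<^sup>2 \<le> R x x" by (rule R_low)
    show "R x x \<le> (norm Q * K\<pi>\<^sup>2 + K\<mu>\<^sup>2) * (norm x)\<^sup>2" by (rule R_up)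
  qed
  obtain T :: "'e \<Rightarrow> ell2" and S where T: "cblinear T" "cblinear S" "\<And>x. S (T x) = x" "\<And>x. (norm (T x))\<^sup>2 = R x x"
    using R.orthonormal_coordinates by blast
  \<comment> \<open>Solved for by comparing \<open>L v v + 2 * Re (lam v * cnj (m v))\<close> with
    \<open>R v v\<close>: the first term cancels the mixed Levi terms, the second replaces
    \<open>L e e\<close> by 1.\<close>
  define m where "m v = L.B (\<pi> v) e + (of_real (L e e) - 1) / 2 * \<mu> v" for v
  have LB_bound: "cmod (L.B x e) \<le> 2 * norm Q * norm e * norm x" for x
  proof -
    have "cmod (L.B x e) \<le> \<bar>L x e\<bar> + \<bar>L x (\<i> *\<^sub>C e)\<bar>"
      using cmod_le[of "L.B x e"] by (simp add: L.B_def)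
    then show ?thesis using L_bound[of x e] L_bound[of x "\<i> *\<^sub>C e"] by (simp add: mult.commute mult.left_commute)
  qed
  have cB: "cblinear (\<lambda>x. L.B x e)"
    by (rule cblinearI[where K = "2 * norm Q * norm e"]) (auto simp: L.B_add L.B_scaleC LB_bound)
  have m: "cblinear m"
    unfolding m_def
    using cblinear_plus[OF cblinear_compose[OF \<pi> cB] cblinear_compose[OF \<mu>(1) cblinear_scaleC_const[of "(of_real (L e e) - 1) / 2"]]]
    by simp
  \<comment> \<open>The complex bilinear part of the Hessian: \<open>Q v v / 2\<close> is the Levi
    form plus \<open>Re (q0 v v)\<close>. The remaining part \<open>2 * Re (lam v * m v)\<close> of
    the correction is complex bilinear too and is absorbed in \<open>q\<close>.\<close>
  define q0 where "q0 v w = Complex ((b v w - b (\<i> *\<^sub>C v) (\<i> *\<^sub>C w)) / 4) (- (b v (\<i> *\<^sub>C w) + b (\<i> *\<^sub>C v) w) / 4)" for v w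
  define q where "q v w = q0 v w + lam v * m w + lam w * m v" for v w
  have q0_sym: "q0 v w = q0 w v" for v w by (simp add: q0_def b_sym add.commute)
  have q0_add: "q0 (x + y) z = q0 x z + q0 y z" for x y z
    by (simp add: q0_def b_add scaleC_add_right complex_eq_iff add_divide_distrib diff_divide_distrib)
  have q0_scaleR: "q0 (r *\<^sub>R x) y = of_real r * q0 x y" for r x y
    by (simp add: q0_def b_scale scaleC_scaleR_commute complex_eq_iff algebra_simps add_divide_distrib diff_divide_distrib)
  have q0_ii: "q0 (\<i> *\<^sub>C x) y = \<i> * q0 x y" for x y
    by (simp add: q0_def b_minus complex_eq_iff) (simp add: field_simps)
  have q0_scaleC: "q0 (a *\<^sub>C x) y = a * q0 x y" for a x y
    by (subst scaleC_complex_decomp, simp add: q0_add q0_scaleR q0_ii complex_eq_iff algebra_simps)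
  have q0_bound: "cmod (q0 x y) \<le> norm Q * norm x * norm y" for x y
  proof -
    define N where "N = norm Q * norm x * norm y"
    have N: "\<bar>b x y\<bar> \<le> N" "\<bar>b (\<i> *\<^sub>C x) (\<i> *\<^sub>C y)\<bar> \<le> N" "\<bar>b x (\<i> *\<^sub>C y)\<bar> \<le> N" "\<bar>b (\<i> *\<^sub>C x) y\<bar> \<le> N"
      using b_bound[of x y] b_bound[of "\<i> *\<^sub>C x" "\<i> *\<^sub>C y"] b_bound[of x "\<i> *\<^sub>C y"] b_bound[of "\<i> *\<^sub>C x" y]
      by (simp_all add: N_def)
    have "\<bar>Re (q0 x y)\<bar> \<le> N / 2" "\<bar>Im (q0 x y)\<bar> \<le> N / 2"
      using N unfolding q0_def by (auto simp: abs_le_iff)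
    then show ?thesis using cmod_le[of "q0 x y"] unfolding N_def by linarith
  qed
  obtain Km where Km: "Km > 0" "\<And>v. cmod (m v) \<le> Km * norm v" using cblinear_bound[OF m] by blast
  have lamb: "cmod (lam v) \<le> K\<mu> * norm v" for v using K\<mu>(2)[of v] by (simp add: \<mu>_def)
  have q_sym: "q x y = q y x" for x y by (simp add: q_def q0_sym algebra_simps)
  have q_bound: "cmod (q x y) \<le> (norm Q + 2 * K\<mu> * Km) * norm x * norm y" for x y
  proof -
    have "cmod (q x y) \<le> cmod (q0 x y) + cmod (lam x) * cmod (m y) + cmod (lam y) * cmod (m x)"
      unfolding q_def using norm_triangle_ineq[of "q0 x y + lam x * m y" "lam y * m x"] norm_triangle_ineq[of "q0 x y" "lam x * m y"]
      by (simp add: norm_mult)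
    also have "\<dots> \<le> norm Q * norm x * norm y + (K\<mu> * norm x) * (Km * norm y) + (K\<mu> * norm y) * (Km * norm x)"
      using K\<mu>(1) Km by (intro add_mono q0_bound mult_mono lamb) auto
    finally show ?thesis by (simp add: algebra_simps)
  qed
  have q_lin: "cblinear (q x)" for x
  proof (rule cblinearI[where K = "(norm Q + 2 * K\<mu> * Km) * norm x"])
    show "q x (y + z) = q x y + q x z" for y z
      unfolding q_sym[of x] unfolding q_def by (simp add: q0_add cblinear_add[OF lam(1)] cblinear_add[OF m] algebra_simps)
    show "q x (a *\<^sub>C y) = a *\<^sub>C q x y" for a y
      unfolding q_sym[of x] unfolding q_def by (simp add: q0_scaleC cblinear_scaleC[OF lam(1)] cblinear_scaleC[OF m] algebra_simps)
    show "norm (q x y) \<le> (norm Q + 2 * K\<mu> * Km) * norm x * norm y" for y by (rule q_bound)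
  qed
  have "blinfun_apply (blinfun_apply Q v) v / 2 + 4 * Re (lam v) * Re (m v) = Re (q v v) + (norm (T v))\<^sup>2" for v
  proof -
    have 1: "blinfun_apply (blinfun_apply Q v) v / 2 = L v v + Re (q0 v v)"
      by (simp add: L_def q0_def b_def field_simps)
    have Bvv: "L.B v v = L.B (\<pi> v) (\<pi> v) + cnj (\<mu> v) * L.B (\<pi> v) e + cnj (cnj (\<mu> v) * L.B (\<pi> v) e) + \<mu> v * cnj (\<mu> v) * L.B e e"
    proof -
      have v: "v = \<pi> v + \<mu> v *\<^sub>C e" by (simp add: \<pi>_def)
      have "L.B v v = L.B (\<pi> v + \<mu> v *\<^sub>C e) (\<pi> v + \<mu> v *\<^sub>C e)" using v by simp
      then show ?thesis
        using L.B_commute[of e "\<pi> v"]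
        by (simp add: L.B_add L.B_add_right L.B_scaleC L.B_scaleC_right algebra_simps)
    qed
    have "Re (\<mu> v * cnj (\<mu> v) * L.B e e) = (cmod (\<mu> v))\<^sup>2 * L e e"
      unfolding L.B_self complex_norm_square[symmetric] of_real_mult[symmetric] Re_complex_of_real ..
    then have 2: "L v v = L (\<pi> v) (\<pi> v) + 2 * Re (cnj (\<mu> v) * L.B (\<pi> v) e) + (cmod (\<mu> v))\<^sup>2 * L e e"
      using arg_cong[OF Bvv, of Re] by (simp add: L.Re_B)
    have gen: "Re (- M * cnj (X + (of_real a - 1) / 2 * M)) * 2 = - 2 * Re (cnj M * X) - (a - 1) * (cmod M)\<^sup>2" for M X a
      unfolding cmod_power2 by (simp add: power2_eq_square field_simps)
    have 3: "Re (lam v * cnj (m v)) * 2 = - 2 * Re (cnj (\<mu> v) * L.B (\<pi> v) e) - (L e e - 1) * (cmod (\<mu> v))\<^sup>2"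
      using gen[of "\<mu> v" "L.B (\<pi> v) e" "L e e"] unfolding m_def by (simp add: \<mu>_def)
    have 4: "4 * Re (lam v) * Re (m v) = 2 * Re (lam v * m v) + 2 * Re (lam v * cnj (m v))" by simp
    have 5: "Re (q v v) = Re (q0 v v) + 2 * Re (lam v * m v)" by (simp add: q_def)
    have 6: "(L e e - 1) * (cmod (\<mu> v))\<^sup>2 = (cmod (\<mu> v))\<^sup>2 * L e e - (cmod (\<mu> v))\<^sup>2"
      by (simp add: algebra_simps)
    show ?thesis unfolding T(4) Rvv 5 using 1 2 3 4 6 by linarith
  qed
  moreover have "(norm (T v))\<^sup>2 = (cmod (lam v))\<^sup>2 + (norm (T (v + lam v *\<^sub>C e)))\<^sup>2" for v
  proof -
    have "v + lam v *\<^sub>C e = \<pi> v" by (simp add: \<pi>_def \<mu>_def)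
    then show ?thesis by (simp add: T(4) Rvv \<mu>\<pi> \<pi>\<pi>) (simp add: \<mu>_def)
  qed
  ultimately show ?thesis
    using e m T(1-3) q_lin q_sym q_bound
    by (intro exI[of _ e] exI[of _ m] exI[of _ q] exI[of _ T] exI[of _ S] conjI allI) blast+
qed

text \<open>To be read with base point \<open>z0 + y\<close> and moving point
  \<open>z0 + y + v\<close>: \<open>\<Delta>\<close> is the difference of their coordinates under
  \<open>z \<mapsto> (z - z0) - q (z - z0) (z - z0) / 2 *\<^sub>C e\<close>, \<open>lb\<close> is
  the complex differential at the base point, and \<open>r\<close> is the value of the defining
  function at the moving point. The functional \<open>\<nu>\<close> is such that
  \<open>- lam + \<nu>\<close> equals \<open>- lb\<close> composed with the inverse of the
  differential of the coordinates at the base point, so the linear terms match exactly and only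
  quadratic errors are left.\<close>

lemma pinching_estimate:
  fixes lam lb m :: "'e::complex_hilbert_space \<Rightarrow> complex" and T :: "'e \<Rightarrow> ell2"
    and q :: "'e \<Rightarrow> 'e \<Rightarrow> complex" and Q :: "'e \<Rightarrow> real"
  assumes lin: "cblinear lam" "cblinear lb" "cblinear T" "\<And>x. cblinear (q x)"
    and K: "K \<ge> 1" "\<And>x y. cmod (q x y) \<le> K * norm x * norm y" "\<And>v. cmod (m v) \<le> K * norm v"
      "\<And>v. norm (T v) \<le> K * norm v" "\<And>v. norm v \<le> K * norm (T v)" "norm e \<le> K" "\<And>v. \<bar>Q v\<bar> \<le> K * (norm v)\<^sup>2"
    and e: "lam e = -1"
    and nf: "\<And>v. Q v / 2 + 4 * Re (lam v) * Re (m v) = Re (q v v) + (norm (T v))\<^sup>2"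
    and s: "s > 0" "100 * K ^ 8 * s \<le> \<epsilon>" "\<epsilon> \<le> 1"
    and y: "norm y \<le> s" and v: "norm v \<le> s"
    and lb: "\<And>u. cmod (lb u - lam u) \<le> s * norm u"
    and r: "\<bar>r - 2 * Re (lb v) - Q v / 2\<bar> \<le> s * (norm v)\<^sup>2"
  defines "\<Delta> \<equiv> v - (q y v + q v v / 2) *\<^sub>C e"
    and "\<nu> \<equiv> \<lambda>u. lam u - lb u - q y u * (lb e / (1 - q y e))"
  shows "cblinear \<nu>" and "\<And>u. cmod (\<nu> u) \<le> \<epsilon> * norm u"
    and "(1 + \<epsilon>) * (norm (T \<Delta>))\<^sup>2 < 2 * Re (- lam \<Delta> + \<nu> \<Delta>) \<Longrightarrow> r < 0"
    and "r < 0 \<Longrightarrow> (1 - \<epsilon>) * (norm (T \<Delta>))\<^sup>2 < 2 * Re (- lam \<Delta> + \<nu> \<Delta>)"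
proof -
  have Kp: "K ^ i \<le> K ^ 8" if "i \<le> 8" for i using K(1) that by (rule power_increasing[rotated])
  have K8: "K ^ 8 * s \<le> 1 / 100" using s by linarith
  have Ks: "K ^ i * s \<le> 1 / 100" if "i \<le> 8" for i
    using mult_right_mono[OF Kp[OF that], of s] K8 s(1) by linarith
  have K0: "K > 0" using K(1) by simp
  have s1: "s \<le> 1 / 100" using Ks[of 0] by simp
  have Ks1: "K * s \<le> 1 / 100" using Ks[of 1] by simp
  have ye: "cmod (q y e) \<le> K\<^sup>2 * s"
  proof -
    have "cmod (q y e) \<le> K * norm y * norm e" by (rule K)
    also have "\<dots> \<le> K * s * K" using y K K0 s(1) by (intro mult_mono mult_left_mono) auto
    finally show ?thesis by (simp add: power2_eq_square mult.commute mult.left_commute)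
  qed
  have ye2: "cmod (q y e) \<le> 1 / 2" using ye Ks[of 2] by simp
  have D: "cmod (1 - q y e) \<ge> 1 / 2" using norm_triangle_ineq2[of 1 "q y e"] ye2 by simp
  then have D0: "1 - q y e \<noteq> 0" by auto
  \<comment> \<open>Since \<open>lam e = -1\<close>, the quotient is -1 up to an error of order
    \<open>s\<close>; \<open>g\<close> is that error.\<close>
  define g where "g = lb e / (1 - q y e) + 1"
  have g: "cmod g \<le> 4 * K\<^sup>2 * s"
  proof -
    have "g = ((lb e - lam e) - q y e) / (1 - q y e)" using D0 e by (simp add: g_def field_simps)
    then have "cmod g = cmod ((lb e - lam e) - q y e) / cmod (1 - q y e)" by (simp add: norm_divide)
    also have "\<dots> \<le> (s * K + K\<^sup>2 * s) / (1 / 2)"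
    proof (rule frac_le)
      have "cmod (lb e - lam e) \<le> s * K" using lb[of e] mult_left_mono[OF K(6), of s] s(1) by linarith
      then show "cmod ((lb e - lam e) - q y e) \<le> s * K + K\<^sup>2 * s"
        using ye norm_triangle_ineq4[of "lb e - lam e" "q y e"] by linarith
    qed (use D s K0 in auto)
    also have "\<dots> \<le> 4 * K\<^sup>2 * s"
    proof -
      have "s * K \<le> K\<^sup>2 * s" using K(1) s(1) K0 by (simp add: power2_eq_square)
      moreover have "(s * K + K\<^sup>2 * s) / (1 / 2) = 2 * (s * K) + 2 * (K\<^sup>2 * s)" by simp
      ultimately show ?thesis by linarith
    qed
    finally show ?thesis .
  qed
  have lbe: "cmod (lb e / (1 - q y e)) \<le> 2"
  proof -
    have "lb e / (1 - q y e) = g - 1" by (simp add: g_def)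
    then show ?thesis using g Ks[of 2] norm_triangle_ineq4[of g 1] by simp
  qed
  show "cblinear \<nu>"
  proof -
    have "cblinear (\<lambda>u. q y u * (lb e / (1 - q y e)))"
      using cblinear_compose[OF lin(4)[of y] cblinear_scaleC_left[of "lb e / (1 - q y e)"]] by simp
    then show ?thesis unfolding \<nu>_def by (intro cblinear_sub lin)
  qed
  show "cmod (\<nu> u) \<le> \<epsilon> * norm u" for u
  proof -
    have "cmod (\<nu> u) \<le> cmod (lam u - lb u) + cmod (q y u) * cmod (lb e / (1 - q y e))"
      unfolding \<nu>_def using norm_triangle_ineq4[of "lam u - lb u" "q y u * (lb e / (1 - q y e))"]
      by (simp only: norm_mult)
    also have "\<dots> \<le> s * norm u + (K * s * norm u) * 2"
    proof (intro add_mono mult_mono lbe)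
      show "cmod (lam u - lb u) \<le> s * norm u" using lb[of u] by (simp add: norm_minus_commute)
      have "cmod (q y u) \<le> K * norm y * norm u" by (rule K)
      also have "\<dots> \<le> K * s * norm u" using y K0 by (intro mult_right_mono mult_left_mono) auto
      finally show "cmod (q y u) \<le> K * s * norm u" .
    qed (use K0 s in auto)
    also have "\<dots> = (s + 2 * (K * s)) * norm u" by (simp add: algebra_simps)
    also have "\<dots> \<le> \<epsilon> * norm u"
    proof (rule mult_right_mono)
      have "s \<le> K ^ 8 * s" "K * s \<le> K ^ 8 * s"
        using mult_right_mono[OF Kp[of 0], of s] mult_right_mono[OF Kp[of 1], of s] s(1) by simp_all
      moreover have "K ^ 8 * s \<ge> 0" using K0 s(1) by simp
      ultimately show "s + 2 * (K * s) \<le> \<epsilon>" using s(2) by simp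
    qed auto
    finally show ?thesis .
  qed
  define bq where "bq = q v v"
  define cc where "cc = q y v + bq / 2"
  have \<Delta>: "\<Delta> = v - cc *\<^sub>C e" by (simp add: \<Delta>_def cc_def bq_def)
  have \<mu>b: "- lam \<Delta> + \<nu> \<Delta> = - lb v - bq / 2 + bq / 2 * g"
  proof -
    have "lb \<Delta> = lb v - cc * lb e" by (simp add: \<Delta> cblinear_diff[OF lin(2)] cblinear_scaleC[OF lin(2)])
    moreover have "q y \<Delta> = q y v - cc * q y e" by (simp add: \<Delta> cblinear_diff[OF lin(4)] cblinear_scaleC[OF lin(4)])
    ultimately have "- lam \<Delta> + \<nu> \<Delta> = - lb v + cc * lb e - (q y v - cc * q y e) * (lb e / (1 - q y e))"
      by (simp add: \<nu>_def)
    also have "\<dots> = - lb v + (cc - q y v) * (lb e / (1 - q y e))"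
    proof -
      define h where "h = lb e / (1 - q y e)"
      have h: "lb e = h * (1 - q y e)" using D0 by (simp add: h_def)
      show ?thesis unfolding h_def[symmetric] by (subst h) (simp add: algebra_simps)
    qed
    also have "lb e / (1 - q y e) = g - 1" by (simp add: g_def)
    finally show ?thesis by (simp add: cc_def algebra_simps)
  qed
  have nv: "norm v * norm v = (norm v)\<^sup>2" by (simp add: power2_eq_square)
  have bqb: "cmod bq \<le> K * (norm v)\<^sup>2" using K(2)[of v v] by (simp add: bq_def power2_eq_square mult.assoc)
  have ccb: "cmod cc \<le> 2 * (K * s) * norm v"
  proof -
    have "cmod (q y v) \<le> K * norm y * norm v" by (rule K)
    also have "\<dots> \<le> K * s * norm v" using y K0 by (intro mult_right_mono mult_left_mono) auto
    finally have 1: "cmod (q y v) \<le> K * s * norm v" .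
    have "cmod bq \<le> K * norm v * norm v" unfolding bq_def by (rule K)
    also have "\<dots> \<le> K * s * norm v" using v K0 by (intro mult_right_mono mult_left_mono) auto
    finally have "cmod bq \<le> K * s * norm v" .
    moreover have "0 \<le> K * s * norm v" using K0 s by simp
    moreover have "cmod (bq / 2) = cmod bq / 2" by (simp add: norm_divide)
    ultimately have "cmod (bq / 2) \<le> K * s * norm v" by linarith
    then show ?thesis unfolding cc_def using 1 norm_triangle_ineq[of "q y v" "bq / 2"] by linarith
  qed
  have T\<Delta>: "T \<Delta> = T v - cc *\<^sub>C T e" by (simp add: \<Delta> cblinear_diff[OF lin(3)] cblinear_scaleC[OF lin(3)])
  have Te: "norm (T e) \<le> K * K" using K(4)[of e] mult_left_mono[OF K(6), of K] K0 by linarith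
  have dT: "norm (cc *\<^sub>C T e) \<le> 2 * (K ^ 3 * s) * norm v"
  proof -
    have "norm (cc *\<^sub>C T e) \<le> (2 * (K * s) * norm v) * (K * K)"
      unfolding norm_scaleC using K0 s by (intro mult_mono ccb Te) auto
    then show ?thesis by (simp add: power3_eq_cube mult_ac)
  qed
  have sqd: "\<bar>(norm (T \<Delta>))\<^sup>2 - (norm (T v))\<^sup>2\<bar> \<le> 8 * (K ^ 6 * s) * (norm v)\<^sup>2"
  proof -
    have "\<bar>(norm (T \<Delta>))\<^sup>2 - (norm (T v))\<^sup>2\<bar> = \<bar>norm (T \<Delta>) - norm (T v)\<bar> * (norm (T \<Delta>) + norm (T v))"
      by (simp add: power2_eq_square square_diff_square_factored abs_mult mult.commute)
    also have "\<dots> \<le> (2 * (K ^ 3 * s) * norm v) * (4 * K ^ 3 * norm v)"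
    proof (rule mult_mono)
      show "\<bar>norm (T \<Delta>) - norm (T v)\<bar> \<le> 2 * (K ^ 3 * s) * norm v"
        using norm_triangle_ineq3[of "T \<Delta>" "T v"] dT by (simp add: T\<Delta>)
      have "norm (T \<Delta>) \<le> norm (T v) + norm (cc *\<^sub>C T e)" unfolding T\<Delta> by (rule norm_triangle_ineq4)
      moreover have "K * norm v \<le> K ^ 3 * norm v" using power_increasing[of 1 3 K] K(1) by (intro mult_right_mono) auto
      moreover have "K ^ 3 * s * norm v \<le> K ^ 3 * norm v" using s1 s(1) K0 by (intro mult_right_mono) auto
      ultimately show "norm (T \<Delta>) + norm (T v) \<le> 4 * K ^ 3 * norm v"
        using K(4)[of v] dT by linarith
    qed (use K0 s in auto)
    also have "\<dots> = 8 * (K ^ 6 * s) * (norm v)\<^sup>2"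
    proof -
      have "K ^ 6 = K ^ 3 * K ^ 3" by (simp flip: power_add)
      then show ?thesis by (simp add: power2_eq_square mult_ac)
    qed
    finally show ?thesis .
  qed
  \<comment> \<open>The multiplier of the normal form. It is positive, so \<open>r * M\<close> has
    the sign of \<open>r\<close>.\<close>
  define M where "M = 1 + 2 * Re (m v)"
  have mv: "\<bar>Re (m v)\<bar> \<le> K * norm v" using K(3)[of v] abs_Re_le_cmod[of "m v"] by linarith
  have Kv: "K * norm v \<le> K * s" using v K0 by (intro mult_left_mono) auto
  have M: "M > 0" "\<bar>M\<bar> \<le> 2" using mv Kv Ks1 by (auto simp: M_def)
  define E1 where "E1 = r - 2 * Re (lb v) - Q v / 2"
  have E3: "\<bar>r * M - (2 * Re (lb v) + Re bq + (norm (T v))\<^sup>2)\<bar> \<le> 8 * (K\<^sup>2 * s) * (norm v)\<^sup>2"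
  proof -
    have "r * M - (2 * Re (lb v) + Re bq + (norm (T v))\<^sup>2)
        = E1 * M + 4 * (Re (lb v - lam v) * Re (m v)) + Q v * Re (m v)"
      using nf[of v] by (simp add: E1_def M_def bq_def algebra_simps)
    also have "\<bar>\<dots>\<bar> \<le> \<bar>E1\<bar> * \<bar>M\<bar> + 4 * (\<bar>Re (lb v - lam v)\<bar> * \<bar>Re (m v)\<bar>) + \<bar>Q v\<bar> * \<bar>Re (m v)\<bar>"
      unfolding abs_mult[symmetric] by linarith
    also have "\<dots> \<le> (s * (norm v)\<^sup>2) * 2 + 4 * ((s * norm v) * (K * norm v)) + (K * (norm v)\<^sup>2) * (K * s)"
    proof (intro add_mono mult_mono mult_left_mono)
      show "\<bar>E1\<bar> \<le> s * (norm v)\<^sup>2" using r by (simp add: E1_def)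
      show "\<bar>Re (lb v - lam v)\<bar> \<le> s * norm v" using lb[of v] abs_Re_le_cmod[of "lb v - lam v"] by linarith
      show "\<bar>Re (m v)\<bar> \<le> K * s" using mv Kv by linarith
    qed (use K mv M K0 s in auto)
    also have "\<dots> = (2 * s + 4 * (K * s) + K\<^sup>2 * s) * (norm v)\<^sup>2"
      by (simp add: power2_eq_square algebra_simps)
    also have "\<dots> \<le> 8 * (K\<^sup>2 * s) * (norm v)\<^sup>2"
    proof (rule mult_right_mono)
      have "1 * s \<le> K\<^sup>2 * s" "K * s \<le> K\<^sup>2 * s"
        using mult_right_mono[OF power_increasing[of 0 2 K], of s] mult_right_mono[OF power_increasing[of 1 2 K], of s] K(1) s(1) by simp_all
      then show "2 * s + 4 * (K * s) + K\<^sup>2 * s \<le> 8 * (K\<^sup>2 * s)" using s(1) by linarith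
    qed auto
    finally show ?thesis .
  qed
  have bqg: "\<bar>Re (bq * g)\<bar> \<le> 4 * (K ^ 3 * s) * (norm v)\<^sup>2"
  proof -
    have "\<bar>Re (bq * g)\<bar> \<le> cmod bq * cmod g" using abs_Re_le_cmod[of "bq * g"] by (simp add: norm_mult)
    also have "\<dots> \<le> (K * (norm v)\<^sup>2) * (4 * K\<^sup>2 * s)" using K0 by (intro mult_mono bqb g) auto
    finally show ?thesis by (simp add: power3_eq_cube power2_eq_square algebra_simps)
  qed
  have total: "\<bar>r * M - ((norm (T \<Delta>))\<^sup>2 - 2 * Re (- lam \<Delta> + \<nu> \<Delta>))\<bar> \<le> 20 * (K ^ 6 * s) * (norm v)\<^sup>2"
  proof -
    have 2: "2 * Re (- lam \<Delta> + \<nu> \<Delta>) = - 2 * Re (lb v) - Re bq + Re (bq * g)" unfolding \<mu>b by simp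
    have "K\<^sup>2 * s * (norm v)\<^sup>2 \<le> K ^ 6 * s * (norm v)\<^sup>2" "K ^ 3 * s * (norm v)\<^sup>2 \<le> K ^ 6 * s * (norm v)\<^sup>2"
      using mult_right_mono[OF power_increasing[of 2 6 K], of s] mult_right_mono[OF power_increasing[of 3 6 K], of s] K(1) s(1)
      by (simp_all add: mult_right_mono)
    then show ?thesis using E3 bqg sqd unfolding 2 by linarith
  qed
  have "norm v \<le> 2 * norm \<Delta>"
  proof -
    have "norm (cc *\<^sub>C e) \<le> (2 * (K * s) * norm v) * K"
      unfolding norm_scaleC using K0 s K(6) by (intro mult_mono ccb) auto
    also have "\<dots> = 2 * (K\<^sup>2 * s) * norm v" by (simp add: power2_eq_square)
    also have "\<dots> \<le> 1 / 2 * norm v" using Ks[of 2] by (intro mult_right_mono) auto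
    finally show ?thesis using norm_triangle_ineq2[of v "cc *\<^sub>C e"] by (simp add: \<Delta>)
  qed
  then have "norm v \<le> 2 * (K * norm (T \<Delta>))" using K(5)[of \<Delta>] by linarith
  then have "(norm v)\<^sup>2 \<le> (2 * (K * norm (T \<Delta>)))\<^sup>2" by (intro power_mono) auto
  then have v2: "(norm v)\<^sup>2 \<le> 4 * K\<^sup>2 * (norm (T \<Delta>))\<^sup>2" by (simp add: power_mult_distrib)
  \<comment> \<open>Expressing the error through \<open>T \<Delta>\<close> instead of
    \<open>v\<close> costs a further \<open>K\<^sup>2\<close>, which explains the power 8 in the
    bound on \<open>s\<close>.\<close>
  have "20 * (K ^ 6 * s) * (norm v)\<^sup>2 \<le> 20 * (K ^ 6 * s) * (4 * K\<^sup>2 * (norm (T \<Delta>))\<^sup>2)"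
    using K0 s by (intro mult_left_mono v2) auto
  also have "\<dots> = 80 * (K ^ 8 * s) * (norm (T \<Delta>))\<^sup>2"
  proof -
    have "K ^ 8 = K ^ 6 * K\<^sup>2" by (simp flip: power_add)
    then show ?thesis by (simp only: mult_ac)
  qed
  also have "\<dots> \<le> \<epsilon> * (norm (T \<Delta>))\<^sup>2"
  proof (rule mult_right_mono)
    have "0 \<le> K ^ 8 * s" using K0 s by simp
    then show "80 * (K ^ 8 * s) \<le> \<epsilon>" using s(2) by linarith
  qed auto
  finally have fin: "\<bar>r * M - ((norm (T \<Delta>))\<^sup>2 - 2 * Re (- lam \<Delta> + \<nu> \<Delta>))\<bar> \<le> \<epsilon> * (norm (T \<Delta>))\<^sup>2"
    using total by linarith
  show "r < 0" if "(1 + \<epsilon>) * (norm (T \<Delta>))\<^sup>2 < 2 * Re (- lam \<Delta> + \<nu> \<Delta>)"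
  proof -
    have "r * M < 0" using fin that by (simp add: algebra_simps)
    then show ?thesis using M(1) by (simp add: mult_less_0_iff)
  qed
  show "(1 - \<epsilon>) * (norm (T \<Delta>))\<^sup>2 < 2 * Re (- lam \<Delta> + \<nu> \<Delta>)" if "r < 0"
  proof -
    have "r * M < 0" using M(1) that by (simp add: mult_less_0_iff)
    then show ?thesis using fin by (simp add: algebra_simps)
  qed
qed

section \<open>Charts adapted to the boundary\<close>

lemma holomorphic_chart_change:
  assumes A: "complex_manifold \<A>" and hc: "holomorphic_chart \<A> (W, \<kappa>)" and X: "open X" "X \<subseteq> \<kappa> ` W"
    and \<Phi>: "cholomorphic_on \<Phi> X" "inj_on \<Phi> X" "open (\<Phi> ` X)" "cholomorphic_on (inv_into X \<Phi>) (\<Phi> ` X)"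
  shows "holomorphic_chart \<A> ({x \<in> W. \<kappa> x \<in> X}, \<lambda>x. \<Phi> (\<kappa> x))"
proof -
  have ch: "is_chart (W, \<kappa>)" using hc by (simp add: holomorphic_chart_def)
  note inj = is_chartD(3)[OF ch]
  define W' where "W' = {x \<in> W. \<kappa> x \<in> X}"
  define \<psi> where "\<psi> y = inv_into W \<kappa> (inv_into X \<Phi> y)" for y
  have im: "\<kappa> ` W' = X" using X(2) by (auto simp: W'_def)
  have im': "(\<lambda>x. \<Phi> (\<kappa> x)) ` W' = \<Phi> ` X" using im by auto
  have inj': "inj_on (\<lambda>x. \<Phi> (\<kappa> x)) W'"
    using inj \<Phi>(2) by (auto simp: inj_on_def W'_def)
  have \<psi>f: "\<psi> (\<Phi> (\<kappa> x)) = x" if "x \<in> W'" for x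
    using that inj \<Phi>(2) by (simp add: \<psi>_def W'_def)
  have inv: "inv_into W' (\<lambda>x. \<Phi> (\<kappa> x)) y = \<psi> y" if y: "y \<in> \<Phi> ` X" for y
  proof -
    obtain x where x: "x \<in> W'" "y = \<Phi> (\<kappa> x)" using y im' by blast
    show ?thesis unfolding x(2) \<psi>f[OF x(1)] by (rule inv_into_f_f[OF inj' x(1)])
  qed
  have invX: "inv_into X \<Phi> y \<in> X" if "y \<in> \<Phi> ` X" for y using that by (rule inv_into_into)
  have "is_chart (W', \<lambda>x. \<Phi> (\<kappa> x))"
    unfolding is_chart_def
  proof (simp only: prod.case im', intro conjI exI[of _ \<psi>] homeomorphismI)
    show "open W'" unfolding W'_def by (rule chart_open_preimage[OF ch X(1)])
    show "open (\<Phi> ` X)" by (rule \<Phi>(3))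
    show "continuous_on W' (\<lambda>x. \<Phi> (\<kappa> x))"
      by (rule continuous_on_compose2[OF cholomorphic_on_continuous[OF \<Phi>(1)] continuous_on_subset[OF is_chartD(4)[OF ch]]])
         (auto simp: W'_def)
    show "continuous_on (\<Phi> ` X) \<psi>"
      unfolding \<psi>_def
      by (rule continuous_on_compose2[OF is_chartD(5)[OF ch] cholomorphic_on_continuous[OF \<Phi>(4)]])
         (use invX X(2) in blast)
    show "(\<lambda>x. \<Phi> (\<kappa> x)) ` W' \<subseteq> \<Phi> ` X" using im' by simp
    show "\<psi> ` \<Phi> ` X \<subseteq> W'" unfolding im'[symmetric] using \<psi>f by auto
    show "\<psi> (\<Phi> (\<kappa> x)) = x" if "x \<in> W'" for x by (rule \<psi>f[OF that])
    show "\<Phi> (\<kappa> (\<psi> y)) = y" if "y \<in> \<Phi> ` X" for y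
    proof -
      obtain x where x: "x \<in> W'" "y = \<Phi> (\<kappa> x)" using \<open>y \<in> \<Phi> ` X\<close> im' by blast
      show ?thesis unfolding x(2) \<psi>f[OF x(1)] ..
    qed
  qed
  moreover have "holomorphic_transition (W', \<lambda>x. \<Phi> (\<kappa> x)) (U, \<kappa>')" if c: "(U, \<kappa>') \<in> \<A>" for U \<kappa>'
  proof -
    have t: "cholomorphic_on (\<lambda>z. \<kappa>' (inv_into W \<kappa> z)) (\<kappa> ` (W \<inter> U))"
      using hc c by (auto simp: holomorphic_chart_def holomorphic_transition_def o_def)
    have sub: "(\<lambda>x. \<Phi> (\<kappa> x)) ` (W' \<inter> U) \<subseteq> \<Phi> ` X" using im' by blast
    have "cholomorphic_on (\<lambda>y. \<kappa>' (inv_into W \<kappa> (inv_into X \<Phi> y))) ((\<lambda>x. \<Phi> (\<kappa> x)) ` (W' \<inter> U))"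
    proof (rule cholomorphic_on_compose[OF cholomorphic_on_subset[OF \<Phi>(4) sub] t])
      show "inv_into X \<Phi> ` (\<lambda>x. \<Phi> (\<kappa> x)) ` (W' \<inter> U) \<subseteq> \<kappa> ` (W \<inter> U)"
        using \<Phi>(2) by (auto simp: W'_def)
    qed
    then have "cholomorphic_on (\<lambda>y. \<kappa>' (inv_into W' (\<lambda>x. \<Phi> (\<kappa> x)) y)) ((\<lambda>x. \<Phi> (\<kappa> x)) ` (W' \<inter> U))"
    proof (rule cholomorphic_on_cong)
      fix y assume "y \<in> (\<lambda>x. \<Phi> (\<kappa> x)) ` (W' \<inter> U)"
      then have "y \<in> \<Phi> ` X" using sub by blast
      then show "\<kappa>' (inv_into W \<kappa> (inv_into X \<Phi> y)) = \<kappa>' (inv_into W' (\<lambda>x. \<Phi> (\<kappa> x)) y)"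
        by (simp add: inv \<psi>_def)
    qed
    then show ?thesis by (simp add: holomorphic_transition_def o_def)
  qed
  moreover have "holomorphic_transition (U, \<kappa>') (W', \<lambda>x. \<Phi> (\<kappa> x))" if c: "(U, \<kappa>') \<in> \<A>" for U \<kappa>'
  proof -
    have t: "cholomorphic_on (\<lambda>z. \<kappa> (inv_into U \<kappa>' z)) (\<kappa>' ` (U \<inter> W))"
      using hc c by (auto simp: holomorphic_chart_def holomorphic_transition_def o_def)
    have sub: "\<kappa>' ` (U \<inter> W') \<subseteq> \<kappa>' ` (U \<inter> W)" by (auto simp: W'_def)
    have "(\<lambda>z. \<kappa> (inv_into U \<kappa>' z)) ` \<kappa>' ` (U \<inter> W') \<subseteq> X"
      using is_chartD(3)[OF manifold_chart[OF A c]] by (auto simp: W'_def)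
    from cholomorphic_on_compose[OF cholomorphic_on_subset[OF t sub] \<Phi>(1) this]
    show ?thesis by (simp add: holomorphic_transition_def o_def)
  qed
  ultimately show ?thesis unfolding holomorphic_chart_def W'_def[symmetric] by auto
qed

text \<open>At every boundary point \<open>x\<close> near \<open>p\<close> the domain is pinched
  between two balls through \<open>x\<close> in the same coordinates and the same norm; only the
  small tilt \<open>\<nu>\<close> of the normal depends on \<open>x\<close>. Having one norm for all
  \<open>x\<close> is what later lets all squeezing maps share the same unit ball.\<close>

theorem adapted_chart:
  fixes \<A> :: "('x::t2_space, 'e::{complex_hilbert_space, second_countable_topology}) chart set"
  assumes A: "complex_manifold \<A>" and spc: "strongly_pseudoconvex_at \<A> \<Omega> p" and pf: "p \<in> frontier \<Omega>"
  shows "\<exists>W \<kappa> (T :: 'e \<Rightarrow> ell2) S mu e. holomorphic_chart \<A> (W, \<kappa>) \<and> p \<in> W \<and> \<kappa> p = 0 \<and>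
    cblinear T \<and> cblinear S \<and> (\<forall>x. S (T x) = x) \<and> cblinear mu \<and> mu e = 1 \<and>
    (\<forall>v. (norm (T v))\<^sup>2 = (cmod (mu v))\<^sup>2 + (norm (T (v - mu v *\<^sub>C e)))\<^sup>2) \<and>
    (\<forall>\<epsilon>. 0 < \<epsilon> \<longrightarrow> \<epsilon> \<le> 1 \<longrightarrow> (\<exists>\<delta>>0. ball 0 \<delta> \<subseteq> \<kappa> ` W \<and>
      (\<forall>x\<in>frontier \<Omega> \<inter> W. norm (\<kappa> x) < \<delta> \<longrightarrow> (\<exists>\<nu>. cblinear \<nu> \<and> (\<forall>v. cmod (\<nu> v) \<le> \<epsilon> * norm v) \<and>
        (\<forall>y\<in>W. norm (\<kappa> y) < \<delta> \<longrightarrow>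
          ((1 + \<epsilon>) * (norm (T (\<kappa> y - \<kappa> x)))\<^sup>2 < 2 * Re (mu (\<kappa> y - \<kappa> x) + \<nu> (\<kappa> y - \<kappa> x)) \<longrightarrow> y \<in> \<Omega>) \<and>
          (y \<in> \<Omega> \<longrightarrow> (1 - \<epsilon>) * (norm (T (\<kappa> y - \<kappa> x)))\<^sup>2 < 2 * Re (mu (\<kappa> y - \<kappa> x) + \<nu> (\<kappa> y - \<kappa> x))))))))"
proof -
  obtain W \<kappa>0 U \<rho> d\<rho> d2\<rho> C where hc: "holomorphic_chart \<A> (W, \<kappa>0)" and pW: "p \<in> W"
    and U: "open U" "\<kappa>0 p \<in> U" "U \<subseteq> \<kappa>0 ` W" and C2: "C2_with_derivs \<rho> d\<rho> d2\<rho> U"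
    and neg: "\<kappa>0 ` (\<Omega> \<inter> W) \<inter> U = {z \<in> U. \<rho> z < 0}"
    and zero: "\<kappa>0 ` (frontier \<Omega> \<inter> W) \<inter> U = {z \<in> U. \<rho> z = 0}"
    and nz: "\<forall>z \<in> \<kappa>0 ` (frontier \<Omega> \<inter> W) \<inter> U. d\<rho> z \<noteq> 0"
    and levi: "C > 0" "\<forall>v. del_form (d\<rho> (\<kappa>0 p)) v = 0 \<longrightarrow> levi_form (d2\<rho> (\<kappa>0 p)) v \<ge> C * (norm v)\<^sup>2"
    using spc unfolding strongly_pseudoconvex_at_def by (elim exE conjE) (rule that)
  have ch: "is_chart (W, \<kappa>0)" using hc by (simp add: holomorphic_chart_def)
  note inj0 = is_chartD(3)[OF ch]
  define z0 where "z0 = \<kappa>0 p"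
  have z0: "z0 \<in> \<kappa>0 ` (frontier \<Omega> \<inter> W) \<inter> U" using pf pW U(2) by (auto simp: z0_def)
  define Q where "Q = d2\<rho> z0"
  define lam where "lam = del_form (d\<rho> z0)"
  have lam: "cblinear lam" unfolding lam_def by (rule cblinear_del_form)
  have "\<exists>u. lam u \<noteq> 0"
  proof (rule ccontr)
    assume "\<not> ?thesis"
    then have "d\<rho> z0 = 0" by (intro blinfun_eqI) (simp add: Re_del_form[of "d\<rho> z0"] lam_def)
    then show False using nz z0 by blast
  qed
  then obtain u where u: "lam u \<noteq> 0" by blast
  have "\<forall>v. lam v = 0 \<longrightarrow> C * (norm v)\<^sup>2 \<le> levi_form Q v"
    using levi(2) by (simp add: lam_def Q_def z0_def)
  from quadratic_normal_form[OF lam u levi(1) this]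
  obtain e m q and T :: "'e \<Rightarrow> ell2" and S where *: "lam e = -1 \<and> cblinear m \<and> cblinear T \<and> cblinear S \<and> (\<forall>x. S (T x) = x) \<and>
    (\<forall>x. cblinear (q x)) \<and> (\<forall>x y. q x y = q y x) \<and> (\<exists>K. \<forall>x y. cmod (q x y) \<le> K * norm x * norm y) \<and>
    (\<forall>v. (norm (T v))\<^sup>2 = (cmod (lam v))\<^sup>2 + (norm (T (v + lam v *\<^sub>C e)))\<^sup>2) \<and>
    (\<forall>v. blinfun_apply (blinfun_apply Q v) v / 2 + 4 * Re (lam v) * Re (m v) = Re (q v v) + (norm (T v))\<^sup>2)"
    by (elim exE) (rule that)
  then have e: "lam e = -1" and m: "cblinear m" and T': "cblinear T" "cblinear S"
    and q1: "\<forall>x. cblinear (q x)" and q2: "\<forall>x y. q x y = q y x" and ST: "\<forall>x. S (T x) = x"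
    and qK: "\<exists>K. \<forall>x y. cmod (q x y) \<le> K * norm x * norm y"
    and Tl: "\<forall>v. (norm (T v))\<^sup>2 = (cmod (lam v))\<^sup>2 + (norm (T (v + lam v *\<^sub>C e)))\<^sup>2"
    and nf: "\<forall>v. blinfun_apply (blinfun_apply Q v) v / 2 + 4 * Re (lam v) * Re (m v) = Re (q v v) + (norm (T v))\<^sup>2"
    by blast+
  note Tl = Tl[rule_format] and nf = nf[rule_format] and q = q1[rule_format] q2[rule_format] and T = T' ST[rule_format]
  obtain Kq where Kq: "\<And>x y. cmod (q x y) \<le> Kq * norm x * norm y" using qK by blast
  obtain Km where Km: "Km > 0" "\<And>v. cmod (m v) \<le> Km * norm v" using cblinear_bound[OF m] by blast
  obtain KT where KT: "KT > 0" "\<And>v. norm (T v) \<le> KT * norm v" using cblinear_bound[OF T(1)] by blast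
  obtain KS where KS: "KS > 0" "\<And>v. norm (S v) \<le> KS * norm v" using cblinear_bound[OF T(2)] by blast
  define K where "K = 1 + \<bar>Kq\<bar> + Km + KT + KS + norm e + norm Q"
  have K1: "K \<ge> 1" and Kle: "Kq \<le> K" "Km \<le> K" "KT \<le> K" "KS \<le> K" "norm e \<le> K" "norm Q \<le> K"
    using Km(1) KT(1) KS(1) norm_ge_zero[of e] norm_ge_zero[of Q] unfolding K_def by linarith+
  have KqK: "cmod (q x y) \<le> K * norm x * norm y" for x y
    using Kq[of x y] mult_right_mono[OF mult_right_mono[OF Kle(1), of "norm x"], of "norm y"] by simp
  have KmK: "cmod (m v) \<le> K * norm v" for v using Km(2)[of v] mult_right_mono[OF Kle(2), of "norm v"] by simp
  have KTK: "norm (T v) \<le> K * norm v" for v using KT(2)[of v] mult_right_mono[OF Kle(3), of "norm v"] by simp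
  have KSK: "norm v \<le> K * norm (T v)" for v
    using KS(2)[of "T v"] mult_right_mono[OF Kle(4), of "norm (T v)"] T(3)[of v] by simp
  have KQK: "\<bar>blinfun_apply (blinfun_apply Q v) v\<bar> \<le> K * (norm v)\<^sup>2" for v
    using blinfun2_bound[of Q v v] mult_right_mono[OF Kle(6), of "(norm v)\<^sup>2"] by (simp add: power2_eq_square mult.assoc)
  have bbq: "bounded_bilinear q"
  proof
    fix x y z :: 'e and r :: real
    show "q (x + y) z = q x z + q y z" unfolding q(2)[of _ z] by (rule cblinear_add[OF q(1)])
    show "q x (y + z) = q x y + q x z" by (rule cblinear_add[OF q(1)])
    show "q (r *\<^sub>R x) y = r *\<^sub>R q x y" unfolding q(2)[of _ y] by (rule cblinear_scaleR[OF q(1)])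
    show "q x (r *\<^sub>R y) = r *\<^sub>R q x y" by (rule cblinear_scaleR[OF q(1)])
    show "\<exists>K. \<forall>x y. norm (q x y) \<le> norm x * norm y * K"
      using KqK by (intro exI[of _ K]) (simp add: mult.commute mult.left_commute)
  qed
  obtain rU where rU: "rU > 0" "ball z0 rU \<subseteq> U" using U(1) z0 open_contains_ball by blast
  \<comment> \<open>On this ball the derivative of the quadratic coordinate change differs from the
    identity by at most 1/2.\<close>
  define rX where "rX = min rU (1 / (2 * K\<^sup>2))"
  have rX: "rX > 0" "rX \<le> rU" "K\<^sup>2 * rX \<le> 1 / 2"
  proof -
    show "rX > 0" "rX \<le> rU" using rU K1 by (auto simp: rX_def)
    have "K\<^sup>2 * rX \<le> K\<^sup>2 * (1 / (2 * K\<^sup>2))" unfolding rX_def by (intro mult_left_mono) auto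
    then show "K\<^sup>2 * rX \<le> 1 / 2" using K1 by simp
  qed
  define X where "X = ball z0 rX"
  have XU: "X \<subseteq> U" using rU rX by (auto simp: X_def)
  have z0X: "z0 \<in> X" using rX by (simp add: X_def)
  \<comment> \<open>Because \<open>lam e = -1\<close>, the subtracted term shifts
    \<open>2 * Re (lam v)\<close> by exactly \<open>Re (q v v)\<close>, which removes the complex
    bilinear part of the normal form.\<close>
  define \<Phi> where "\<Phi> z = (z - z0) - (1 / 2 * q (z - z0) (z - z0)) *\<^sub>C e" for z
  define D where "D z v = v - q (z - z0) v *\<^sub>C e" for z v
  have cD: "cblinear (D z)" for z
    unfolding D_def by (intro cblinear_sub cblinear_id cblinear_compose[OF q(1) cblinear_scaleC_left])
  have d\<Phi>: "(\<Phi> has_derivative D z) (at z)" for z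
  proof -
    have 0: "((\<lambda>z. z - z0) has_derivative (\<lambda>h. h)) (at z)" by (auto intro!: derivative_eq_intros)
    from bounded_bilinear.FDERIV[OF bbq 0 0]
    have "((\<lambda>z. q (z - z0) (z - z0)) has_derivative (\<lambda>h. q (z - z0) h + q h (z - z0))) (at z)" .
    then have "((\<lambda>z. 1 / 2 * q (z - z0) (z - z0)) has_derivative (\<lambda>h. 1 / 2 * (q (z - z0) h + q h (z - z0)))) (at z)"
      by (rule has_derivative_mult_right)
    moreover have "(\<lambda>h. 1 / 2 * (q (z - z0) h + q h (z - z0))) = q (z - z0)"
      by (simp add: fun_eq_iff q(2)[of _ "z - z0"])
    ultimately have "((\<lambda>z. 1 / 2 * q (z - z0) (z - z0)) has_derivative q (z - z0)) (at z)" by simp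
    from bounded_linear.has_derivative[OF cblinear_bounded[OF cblinear_scaleC_left[of e]] this]
    have "((\<lambda>z. (1 / 2 * q (z - z0) (z - z0)) *\<^sub>C e) has_derivative (\<lambda>h. q (z - z0) h *\<^sub>C e)) (at z)" .
    from has_derivative_diff[OF 0 this] show ?thesis unfolding \<Phi>_def[abs_def] D_def[abs_def] .
  qed
  have h\<Phi>: "cholomorphic_on \<Phi> X"
    using cD d\<Phi> has_derivative_at_withinI by (intro cholomorphic_onI) blast
  have near: "norm (D' v - v) \<le> norm v / 2" if "x \<in> X" "(\<Phi> has_derivative D') (at x)" for x D' v
  proof -
    have "D' = D x" by (rule has_derivative_unique[OF that(2) d\<Phi>])
    then have "norm (D' v - v) = cmod (q (x - z0) v) * norm e" by (simp add: D_def)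
    also have "\<dots> \<le> (K * rX * norm v) * K"
    proof (intro mult_mono Kle)
      have "norm (x - z0) \<le> rX" using that(1) by (simp add: X_def dist_norm norm_minus_commute)
      then have "K * norm (x - z0) * norm v \<le> K * rX * norm v" using K1 by (intro mult_right_mono mult_left_mono) auto
      then show "cmod (q (x - z0) v) \<le> K * rX * norm v" using KqK[of "x - z0" v] by linarith
    qed (use K1 rX in auto)
    also have "\<dots> = (K\<^sup>2 * rX) * norm v" by (simp add: power2_eq_square)
    also have "\<dots> \<le> (1 / 2) * norm v" by (intro mult_right_mono rX) auto
    finally show ?thesis by simp
  qed
  have oX: "open X" "convex X" by (simp_all add: X_def)
  have nL: "norm ((\<Phi> x - x) - (\<Phi> y - y)) \<le> norm (x - y) / 2" if "x \<in> X" "y \<in> X" for x y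
    by (rule near_identity_Lipschitz[OF oX h\<Phi> _ that]) (rule near)
  have nI: "inj_on \<Phi> X" by (rule near_identity_inj[OF oX h\<Phi>]) (rule near)
  have nS: "y \<in> \<Phi> ` cball x r" if "cball x r \<subseteq> X" "norm (y - \<Phi> x) \<le> r / 2" for x y r
    by (rule near_identity_solve[OF oX h\<Phi> _ that]) (rule near)
  have nO: "open (\<Phi> ` X)" by (rule near_identity_open[OF oX h\<Phi>]) (rule near)
  have nV: "cholomorphic_on (inv_into X \<Phi>) (\<Phi> ` X)" by (rule near_identity_inverse[OF oX h\<Phi>]) (rule near)
  have \<Phi>0: "\<Phi> z0 = 0" using cblinear_zero[OF q(1)[of 0]] by (simp add: \<Phi>_def)
  have low: "norm (z - z0) \<le> 2 * norm (\<Phi> z)" if "z \<in> X" for z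
    using nL[OF that z0X] norm_triangle_ineq2[of "z - z0" "\<Phi> z"]
    by (simp add: \<Phi>0 norm_minus_commute algebra_simps)
  define W' where "W' = {x \<in> W. \<kappa>0 x \<in> X}"
  define \<kappa> where "\<kappa> x = \<Phi> (\<kappa>0 x)" for x
  have XW: "X \<subseteq> \<kappa>0 ` W" using XU U(3) by blast
  have hc': "holomorphic_chart \<A> (W', \<kappa>)"
    unfolding W'_def \<kappa>_def
    by (rule holomorphic_chart_change[OF A hc oX(1) XW h\<Phi> nI nO nV])
  have im: "\<kappa> ` W' = \<Phi> ` X"
  proof -
    have "\<kappa>0 ` W' = X" using XW by (auto simp: W'_def)
    then show ?thesis unfolding \<kappa>_def by (metis image_image)
  qed
  have mu: "cblinear (\<lambda>v. - lam v)" by (rule cblinear_uminus[OF lam])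
  have main: "\<exists>\<delta>>0. ball 0 \<delta> \<subseteq> \<kappa> ` W' \<and>
      (\<forall>x\<in>frontier \<Omega> \<inter> W'. norm (\<kappa> x) < \<delta> \<longrightarrow> (\<exists>\<nu>. cblinear \<nu> \<and> (\<forall>v. cmod (\<nu> v) \<le> \<epsilon> * norm v) \<and>
        (\<forall>y\<in>W'. norm (\<kappa> y) < \<delta> \<longrightarrow>
          ((1 + \<epsilon>) * (norm (T (\<kappa> y - \<kappa> x)))\<^sup>2 < 2 * Re (- lam (\<kappa> y - \<kappa> x) + \<nu> (\<kappa> y - \<kappa> x)) \<longrightarrow> y \<in> \<Omega>) \<and>
          (y \<in> \<Omega> \<longrightarrow> (1 - \<epsilon>) * (norm (T (\<kappa> y - \<kappa> x)))\<^sup>2 < 2 * Re (- lam (\<kappa> y - \<kappa> x) + \<nu> (\<kappa> y - \<kappa> x))))))"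
    if \<epsilon>: "0 < \<epsilon>" "\<epsilon> \<le> 1" for \<epsilon>
  proof -
    define s where "s = \<epsilon> / (100 * K ^ 8)"
    have s: "s > 0" "100 * K ^ 8 * s \<le> \<epsilon>" using \<epsilon> K1 by (auto simp: s_def)
    obtain \<delta>T where \<delta>T: "\<delta>T > 0" "ball z0 \<delta>T \<subseteq> U" and Tay1: "\<And>b z. b \<in> ball z0 \<delta>T \<Longrightarrow> z \<in> ball z0 \<delta>T \<Longrightarrow>
        norm (d\<rho> z - d\<rho> b - blinfun_apply (d2\<rho> z0) (z - b)) \<le> s * norm (z - b)"
      and Tay2: "\<And>b z. b \<in> ball z0 \<delta>T \<Longrightarrow> z \<in> ball z0 \<delta>T \<Longrightarrow>
        \<bar>\<rho> z - \<rho> b - blinfun_apply (d\<rho> b) (z - b) - blinfun_apply (blinfun_apply (d2\<rho> z0) (z - b)) (z - b) / 2\<bar>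
          \<le> s * (norm (z - b))\<^sup>2"
      using C2_Taylor[OF C2 U(1) _ s(1), of z0] U(2) unfolding z0_def by blast
    have s1: "s \<le> 1"
    proof -
      have "1 \<le> 100 * K ^ 8" using one_le_power[OF K1, of 8] by linarith
      then have "1 * s \<le> (100 * K ^ 8) * s" using s(1) by (intro mult_right_mono) auto
      then show ?thesis using s(2) \<epsilon>(2) by linarith
    qed
    \<comment> \<open>A point with coordinate of norm less than \<open>\<delta>\<close> is within
      \<open>2 * \<delta>\<close> of \<open>z0\<close>. The bounds ensure, in this order, that the
      coordinate ball is covered, that both points lie in the Taylor ball, and that displacements
      and the variation of the differential are at most \<open>s\<close>.\<close>
    define \<delta> where "\<delta> = min (rX / 4) (min (\<delta>T / 4) (s / (8 * (K + 1))))"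
    have K10: "K + 1 > 0" using K1 by simp
    have \<delta>: "\<delta> > 0" "\<delta> \<le> rX / 4" "\<delta> \<le> \<delta>T / 4" "\<delta> \<le> s / (8 * (K + 1))"
      proof -
      have "s / (8 * (K + 1)) > 0" using s K10 by simp
      then show "\<delta> > 0" "\<delta> \<le> rX / 4" "\<delta> \<le> \<delta>T / 4" "\<delta> \<le> s / (8 * (K + 1))"
        using rX \<delta>T unfolding \<delta>_def by linarith+
    qed
    have \<delta>s: "8 * ((K + 1) * \<delta>) \<le> s" using \<delta>(4) K10 by (simp add: field_simps)
    have "2 * \<delta> \<le> (K + 1) * \<delta>" using K1 \<delta>(1) by (intro mult_right_mono) auto
    then have \<delta>s': "16 * \<delta> \<le> s" using \<delta>s by linarith
    have "ball 0 \<delta> \<subseteq> \<kappa> ` W'"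
    proof
      fix y :: 'e assume "y \<in> ball 0 \<delta>"
      then have "norm (y - \<Phi> z0) \<le> (rX / 2) / 2" using \<delta>(2) by (simp add: \<Phi>0)
      moreover have "cball z0 (rX / 2) \<subseteq> X" using rX by (auto simp: X_def)
      ultimately have "y \<in> \<Phi> ` cball z0 (rX / 2)" by (intro nS)
      then show "y \<in> \<kappa> ` W'" unfolding im using \<open>cball z0 (rX / 2) \<subseteq> X\<close> by blast
    qed
    moreover have "\<exists>\<nu>. cblinear \<nu> \<and> (\<forall>v. cmod (\<nu> v) \<le> \<epsilon> * norm v) \<and>
        (\<forall>y\<in>W'. norm (\<kappa> y) < \<delta> \<longrightarrow>
          ((1 + \<epsilon>) * (norm (T (\<kappa> y - \<kappa> x)))\<^sup>2 < 2 * Re (- lam (\<kappa> y - \<kappa> x) + \<nu> (\<kappa> y - \<kappa> x)) \<longrightarrow> y \<in> \<Omega>) \<and>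
          (y \<in> \<Omega> \<longrightarrow> (1 - \<epsilon>) * (norm (T (\<kappa> y - \<kappa> x)))\<^sup>2 < 2 * Re (- lam (\<kappa> y - \<kappa> x) + \<nu> (\<kappa> y - \<kappa> x))))"
      if x: "x \<in> frontier \<Omega> \<inter> W'" "norm (\<kappa> x) < \<delta>" for x
    proof -
      define b where "b = \<kappa>0 x"
      have bX: "b \<in> X" "\<kappa> x = \<Phi> b" using x(1) by (auto simp: W'_def b_def \<kappa>_def)
      have bz0: "norm (b - z0) \<le> 2 * \<delta>" using low[OF bX(1)] x(2) bX(2) by simp
      have bT: "b \<in> ball z0 \<delta>T" using bz0 \<delta>(1,3) by (simp add: dist_norm norm_minus_commute)
      have "b \<in> \<kappa>0 ` (frontier \<Omega> \<inter> W) \<inter> U" using x(1) bX(1) XU by (auto simp: W'_def b_def)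
      then have \<rho>b: "\<rho> b = 0" using zero by blast
      define lb where "lb = del_form (d\<rho> b)"
      have lb: "cblinear lb" unfolding lb_def by (rule cblinear_del_form)
      have lbd: "cmod (lb w - lam w) \<le> s * norm w" for w
      proof -
        have "norm (d\<rho> b - d\<rho> z0) \<le> norm (d\<rho> b - d\<rho> z0 - blinfun_apply (d2\<rho> z0) (b - z0)) + norm (blinfun_apply (d2\<rho> z0) (b - z0))"
          using norm_triangle_ineq[of "d\<rho> b - d\<rho> z0 - blinfun_apply (d2\<rho> z0) (b - z0)" "blinfun_apply (d2\<rho> z0) (b - z0)"] by simp
        also have "\<dots> \<le> s * norm (b - z0) + norm Q * norm (b - z0)"
          unfolding Q_def using \<delta>T by (intro add_mono Tay1 bT norm_blinfun) simp
        also have "\<dots> \<le> 1 * (2 * \<delta>) + K * (2 * \<delta>)"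
          using s1 s(1) K1 by (intro add_mono mult_mono bz0 Kle) auto
        also have "\<dots> \<le> s" using \<delta>s s(1) by (simp add: algebra_simps)
        finally have "norm (d\<rho> b - d\<rho> z0) \<le> s" .
        then have "norm (d\<rho> b - d\<rho> z0) * norm w \<le> s * norm w" by (intro mult_right_mono) auto
        then show ?thesis
          using del_form_bound[of "d\<rho> b - d\<rho> z0" w] unfolding lb_def lam_def del_form_diff by linarith
      qed
      define \<nu> where "\<nu> w = lam w - lb w - q (b - z0) w * (lb e / (1 - q (b - z0) e))" for w
      have bs: "norm (b - z0) \<le> s" using bz0 \<delta>s' \<delta>(1) by linarith
      have est: "cblinear \<nu> \<and> (\<forall>w. cmod (\<nu> w) \<le> \<epsilon> * norm w) \<and>
          ((1 + \<epsilon>) * (norm (T (\<kappa> y - \<kappa> x)))\<^sup>2 < 2 * Re (- lam (\<kappa> y - \<kappa> x) + \<nu> (\<kappa> y - \<kappa> x)) \<longrightarrow> y \<in> \<Omega>) \<and>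
          (y \<in> \<Omega> \<longrightarrow> (1 - \<epsilon>) * (norm (T (\<kappa> y - \<kappa> x)))\<^sup>2 < 2 * Re (- lam (\<kappa> y - \<kappa> x) + \<nu> (\<kappa> y - \<kappa> x)))"
        if y: "y \<in> W'" "norm (\<kappa> y) < \<delta>" for y
      proof -
        define z where "z = \<kappa>0 y"
        have zX: "z \<in> X" "\<kappa> y = \<Phi> z" using y(1) by (auto simp: W'_def z_def \<kappa>_def)
        have zz0: "norm (z - z0) \<le> 2 * \<delta>" using low[OF zX(1)] y(2) zX(2) by simp
        have zT: "z \<in> ball z0 \<delta>T" using zz0 \<delta>(1,3) by (simp add: dist_norm norm_minus_commute)
        define v where "v = z - b"
        have vs: "norm v \<le> s"
          using norm_triangle_ineq4[of "z - z0" "b - z0"] zz0 bz0 \<delta>s' \<delta>(1) by (simp add: v_def)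
        have r: "\<bar>\<rho> z - 2 * Re (lb v) - blinfun_apply (blinfun_apply Q v) v / 2\<bar> \<le> s * (norm v)\<^sup>2"
          using Tay2[OF bT zT] unfolding \<rho>b v_def[symmetric] Q_def[symmetric] lb_def Re_del_form[of "d\<rho> b" v] by simp
        have \<Delta>: "\<kappa> y - \<kappa> x = v - (q (b - z0) v + q v v / 2) *\<^sub>C e"
        proof -
          have zv: "z - z0 = (b - z0) + v" by (simp add: v_def)
          have "q (z - z0) (z - z0) = q (b - z0) (b - z0) + 2 * q (b - z0) v + q v v"
            unfolding zv using q(2)[of v "b - z0"]
            by (simp add: bounded_bilinear.add_left[OF bbq] bounded_bilinear.add_right[OF bbq])
          then have *: "1 / 2 * q (z - z0) (z - z0) = 1 / 2 * q (b - z0) (b - z0) + (q (b - z0) v + q v v / 2)"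
            by (simp add: field_simps)
          show ?thesis unfolding zX(2) bX(2) \<Phi>_def * scaleC_add_left by (simp add: v_def)
        qed
        note pe = pinching_estimate[OF lam lb T(1) q(1) K1 KqK KmK KTK KSK Kle(5) KQK e nf s \<epsilon>(2) bs vs lbd r,
            folded \<nu>_def[abs_def] \<Delta>]
        have iff: "\<rho> z < 0 \<longleftrightarrow> y \<in> \<Omega>"
        proof
          assume "\<rho> z < 0"
          then have "z \<in> \<kappa>0 ` (\<Omega> \<inter> W)" using neg zX(1) XU by blast
          then obtain y' where "y' \<in> \<Omega>" "y' \<in> W" "\<kappa>0 y' = \<kappa>0 y" unfolding z_def by auto
          then show "y \<in> \<Omega>" using inj0 y(1) by (auto simp: inj_on_def W'_def)
        next
          assume "y \<in> \<Omega>"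
          then have "z \<in> \<kappa>0 ` (\<Omega> \<inter> W) \<inter> U" using y(1) zX(1) XU by (auto simp: W'_def z_def)
          then show "\<rho> z < 0" using neg by blast
        qed
        have "cmod (\<nu> w) \<le> \<epsilon> * norm w" for w using pe(2)[of w] by (simp only: \<nu>_def)
        moreover have "y \<in> \<Omega>" if "(1 + \<epsilon>) * (norm (T (\<kappa> y - \<kappa> x)))\<^sup>2 < 2 * Re (- lam (\<kappa> y - \<kappa> x) + \<nu> (\<kappa> y - \<kappa> x))"
          using pe(3) that unfolding iff \<nu>_def by blast
        moreover have "(1 - \<epsilon>) * (norm (T (\<kappa> y - \<kappa> x)))\<^sup>2 < 2 * Re (- lam (\<kappa> y - \<kappa> x) + \<nu> (\<kappa> y - \<kappa> x))" if "y \<in> \<Omega>"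
          using pe(4) that unfolding iff \<nu>_def by blast
        ultimately show ?thesis using pe(1) by blast
      qed
      have "x \<in> W'" using x by simp
      from est[OF this x(2)] have "cblinear \<nu>" "\<forall>w. cmod (\<nu> w) \<le> \<epsilon> * norm w" by simp_all
      then show ?thesis using est by (intro exI[of _ \<nu>] conjI ballI impI) blast+
    qed
    ultimately show ?thesis using \<delta>(1) by (intro exI[of _ \<delta>]) simp
  qed
  have "p \<in> W'" "\<kappa> p = 0" using pW z0X \<Phi>0 by (auto simp: W'_def z0_def \<kappa>_def)
  moreover have "\<forall>v. (norm (T v))\<^sup>2 = (cmod (- lam v))\<^sup>2 + (norm (T (v - (- lam v) *\<^sub>C e)))\<^sup>2"
    unfolding norm_minus_cancel scaleC_minus_left diff_minus_eq_add using Tl by (rule allI)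
  moreover have "- lam e = 1" using e by simp
  moreover have "\<forall>x. S (T x) = x" using T(3) by (rule allI)
  ultimately have "holomorphic_chart \<A> (W', \<kappa>) \<and> p \<in> W' \<and> \<kappa> p = 0 \<and>
    cblinear T \<and> cblinear S \<and> (\<forall>x. S (T x) = x) \<and> cblinear (\<lambda>v. - lam v) \<and> - lam e = 1 \<and>
    (\<forall>v. (norm (T v))\<^sup>2 = (cmod (- lam v))\<^sup>2 + (norm (T (v - (- lam v) *\<^sub>C e)))\<^sup>2)"
    using hc' T(1,2) mu by (intro conjI)
  then show ?thesis
  proof (intro exI[of _ W'] exI[of _ \<kappa>] exI[of _ T] exI[of _ S] exI[of _ "\<lambda>v. - lam v"] exI[of _ e], elim conjE, intro conjI)
    show "\<forall>\<epsilon>. 0 < \<epsilon> \<longrightarrow> \<epsilon> \<le> 1 \<longrightarrow> (\<exists>\<delta>>0. ball 0 \<delta> \<subseteq> \<kappa> ` W' \<and>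
      (\<forall>x\<in>frontier \<Omega> \<inter> W'. norm (\<kappa> x) < \<delta> \<longrightarrow> (\<exists>\<nu>. cblinear \<nu> \<and> (\<forall>v. cmod (\<nu> v) \<le> \<epsilon> * norm v) \<and>
        (\<forall>y\<in>W'. norm (\<kappa> y) < \<delta> \<longrightarrow>
          ((1 + \<epsilon>) * (norm (T (\<kappa> y - \<kappa> x)))\<^sup>2 < 2 * Re (- lam (\<kappa> y - \<kappa> x) + \<nu> (\<kappa> y - \<kappa> x)) \<longrightarrow> y \<in> \<Omega>) \<and>
          (y \<in> \<Omega> \<longrightarrow> (1 - \<epsilon>) * (norm (T (\<kappa> y - \<kappa> x)))\<^sup>2 < 2 * Re (- lam (\<kappa> y - \<kappa> x) + \<nu> (\<kappa> y - \<kappa> x)))))))"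
      by (intro allI impI) (rule main)
  qed assumption+
qed

section \<open>Squeezing onto the ball\<close>

lemma cholomorphic_on_inverse:
  fixes f :: "'a::complex_hilbert_space \<Rightarrow> complex"
  assumes "cholomorphic_on f S" "\<And>x. x \<in> S \<Longrightarrow> f x \<noteq> 0"
  shows "cholomorphic_on (\<lambda>x. inverse (f x)) S"
proof (rule cholomorphic_on_compose[OF assms(1)])
  show "cholomorphic_on inverse (- {0} :: complex set)"
    unfolding cholomorphic_on_complex_iff by (intro holomorphic_intros) auto
qed (use assms(2) in auto)

text \<open>In the coordinates \<open>v = A (w - b)\<close>, \<open>\<zeta> = mu v\<close>, \<open>u = v - \<zeta> e\<close>, the ball
  \<open>c (|\<zeta>|\<^sup>2 + |u|\<^sup>2) < 2 Re \<zeta>\<close> lies in the Siegel domain \<open>c |u|\<^sup>2 < 2 Re \<zeta>\<close>, and \<open>\<sigma>\<close> is the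
  Cayley transform of the latter that sends \<open>(\<tau>, 0)\<close> to the origin.\<close>

lemma ball_squeeze:
  fixes T :: "'e::complex_hilbert_space \<Rightarrow> ell2" and mu nu :: "'e \<Rightarrow> complex" and b e :: 'e
  assumes T: "cblinear T" and mu: "cblinear mu" "mu e = 1" and nu: "cblinear nu" "cmod (nu e) \<le> 1 / 2"
    and Tn: "\<And>v. (norm (T v))\<^sup>2 = (cmod (mu v))\<^sup>2 + (norm (T (v - mu v *\<^sub>C e)))\<^sup>2"
    and r: "0 < r" "r < 1" and \<epsilon>: "\<epsilon> = (1 - r\<^sup>2) / 8" and t: "0 < t" "t < (1 - r\<^sup>2) / 72"
  defines "A \<equiv> \<lambda>v. v + nu v *\<^sub>C e"
  defines "Bm \<equiv> {w. (1 - \<epsilon>) * (norm (T (A (w - b))))\<^sup>2 < 2 * Re (mu (A (w - b)))}"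
  shows "\<exists>\<sigma> \<theta>. \<sigma> (b + t *\<^sub>R e) = 0 \<and> cholomorphic_on \<sigma> Bm \<and> (\<forall>w\<in>Bm. norm (T (\<sigma> w)) < 1) \<and>
    cholomorphic_on \<theta> {y. norm (T y) < r} \<and>
    (\<forall>y. norm (T y) < r \<longrightarrow> (1 + \<epsilon>) * (norm (T (A (\<theta> y - b))))\<^sup>2 < 2 * Re (mu (A (\<theta> y - b))) \<and>
      (norm (T (A (\<theta> y - b))))\<^sup>2 \<le> 6 * t / (1 - r) \<and> \<sigma> (\<theta> y) = y) \<and>
    (\<forall>w\<in>Bm. norm (T (\<sigma> w)) < r \<longrightarrow> \<theta> (\<sigma> w) = w)"
proof -
  have r2: "r\<^sup>2 < 1" "0 < r\<^sup>2" using r by (auto simp: power_less_one_iff)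
  have \<epsilon>0: "0 < \<epsilon>" "\<epsilon> \<le> 1 / 8" using r2 by (auto simp: \<epsilon>)
  have A: "cblinear A"
    unfolding A_def by (intro cblinear_plus cblinear_id cblinear_compose[OF nu(1) cblinear_scaleC_left])
  define n where "n = 1 + nu e"
  have n: "cmod n \<ge> 1 / 2" "cmod n \<le> 3 / 2" "Re n \<ge> 1 / 2"
    using norm_triangle_ineq2[of 1 "- nu e"] norm_triangle_ineq[of 1 "nu e"] nu(2) abs_Re_le_cmod[of "nu e"]
    by (auto simp: n_def)
  have n0: "n \<noteq> 0" using n by auto
  \<comment> \<open>The inverse of the rank one perturbation \<open>A\<close> of the
    identity.\<close>
  define A' where "A' u = u - (nu u / n) *\<^sub>C e" for u
  have A': "cblinear A'"
  proof -
    have "cblinear (\<lambda>u. (nu u / n) *\<^sub>C e)"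
      using cblinear_compose[OF nu(1) cblinear_scaleC_left[of "(1 / n) *\<^sub>C e"]] by (simp add: scaleC_scaleC)
    then show ?thesis unfolding A'_def by (intro cblinear_sub cblinear_id)
  qed
  have AA': "A (A' u) = u" for u
  proof -
    have "nu (A' u) = nu u - (nu u / n) * nu e" by (simp add: A'_def cblinear_diff[OF nu(1)] cblinear_scaleC[OF nu(1)])
    also have "\<dots> = nu u / n" using n0 by (simp add: field_simps) (simp add: n_def algebra_simps)
    finally show ?thesis by (simp add: A_def) (simp add: A'_def)
  qed
  have A'A: "A' (A u) = u" for u
  proof -
    have "nu (A u) = nu u * n" by (simp add: A_def n_def cblinear_add[OF nu(1)] cblinear_scaleC[OF nu(1)] algebra_simps)
    then show ?thesis using n0 by (simp add: A'_def) (simp add: A_def)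
  qed
  \<comment> \<open>The normal coordinate of the centre: \<open>A\<close> maps
    \<open>t *\<^sub>R e\<close> to \<open>\<tau> *\<^sub>C e\<close>. It is not real because of the
    tilt.\<close>
  define \<tau> where "\<tau> = of_real t * n"
  have \<tau>0: "\<tau> \<noteq> 0" using n0 t by (simp add: \<tau>_def)
  have \<tau>n: "cmod \<tau> \<le> 3 / 2 * t" using n(2) t by (simp add: \<tau>_def norm_mult)
  \<comment> \<open>The bounds on \<open>n\<close> give \<open>a \<ge> 2 / (9 * t)\<close>; the
    constant 72 in the hypothesis on \<open>t\<close> is what makes this larger than
    \<open>16 / (1 - r\<^sup>2)\<close>.\<close>
  define a where "a = Re (1 / \<tau>)"
  have a: "a \<ge> 2 / (9 * t)"
  proof -
    have "a = Re n / (t * (cmod n)\<^sup>2)"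
    proof -
      have 1: "a = Re \<tau> / (cmod \<tau>)\<^sup>2" by (simp add: a_def Re_divide cmod_power2)
      have 2: "Re \<tau> = t * Re n" "cmod \<tau> = t * cmod n" using t by (simp_all add: \<tau>_def norm_mult)
      show ?thesis unfolding 1 2 power_mult_distrib power2_eq_square[of t] using t by simp
    qed
    moreover have "(1 / 2) / (t * (9 / 4)) \<le> Re n / (t * (cmod n)\<^sup>2)"
    proof (rule frac_le)
      have "(cmod n)\<^sup>2 \<le> (3 / 2)\<^sup>2" using n(2) by (intro power_mono) auto
      then show "t * (cmod n)\<^sup>2 \<le> t * (9 / 4)" using t by (intro mult_left_mono) (auto simp: power2_eq_square)
      show "0 < t * (cmod n)\<^sup>2" using t n0 by simp
    qed (use n in auto)
    ultimately show ?thesis by simp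
  qed
  have a_pos: "a > 0" using a t by (smt (verit) divide_pos_pos)
  have a_big: "16 / (1 - r\<^sup>2) < a"
  proof -
    have "16 * (9 * t) < 2 * (1 - r\<^sup>2)" using t by simp
    then have "16 / (1 - r\<^sup>2) < 2 / (9 * t)" using t r2 by (simp add: divide_simps mult.commute)
    then show ?thesis using a by linarith
  qed
  \<comment> \<open>Chosen so that the inequality
    \<open>(1 - \<epsilon>) |u|\<^sup>2 < 2 Re \<zeta>\<close>, valid on the outer ball, becomes
    \<open>c\<^sup>2 |u|\<^sup>2 < 4 a Re \<zeta>\<close>, the right side being the defect in the
    identity for \<open>den\<close>.\<close>
  define c where "c = sqrt (2 * (1 - \<epsilon>) * a)"
  have c: "c > 0" "c\<^sup>2 = 2 * (1 - \<epsilon>) * a" using a_pos \<epsilon>0 by (auto simp: c_def)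
  define den where "den \<zeta> = 1 + \<zeta> / cnj \<tau>" for \<zeta>
  \<comment> \<open>The computation behind the Cayley transform with an arbitrary, not necessarily
    real, centre.\<close>
  have den: "(cmod (den \<zeta>))\<^sup>2 - (cmod (1 - \<zeta> / \<tau>))\<^sup>2 = 4 * a * Re \<zeta>" for \<zeta>
  proof -
    define x where "x = 1 / \<tau>"
    have eq: "den \<zeta> = 1 + \<zeta> * cnj x" "1 - \<zeta> / \<tau> = 1 - \<zeta> * x" by (simp_all add: den_def x_def)
    show ?thesis unfolding eq a_def x_def[symmetric] cmod_power2 by (simp add: power2_eq_square algebra_simps)
  qed
  define \<sigma> where "\<sigma> w = (let v = A (w - b); \<zeta> = mu v in
    inverse (den \<zeta>) *\<^sub>C ((1 - \<zeta> / \<tau>) *\<^sub>C e + of_real c *\<^sub>C (v - \<zeta> *\<^sub>C e)))" for w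
  \<comment> \<open>Solving \<open>y1 = (1 - \<zeta> / \<tau>) / den \<zeta>\<close> for
    \<open>\<zeta>\<close> gives \<open>(1 - y1) / d y1\<close>.\<close>
  define d where "d y1 = 1 / \<tau> + y1 / cnj \<tau>" for y1
  define \<theta> where "\<theta> y = b + A' (((1 - mu y) * inverse (d (mu y))) *\<^sub>C e
    + (of_real (2 * a / c) * inverse (d (mu y))) *\<^sub>C (y - mu y *\<^sub>C e))" for y
  have mu_u: "mu (v - mu v *\<^sub>C e) = 0" for v by (simp add: cblinear_diff[OF mu(1)] cblinear_scaleC[OF mu(1)] mu(2))
  have mu_comb: "mu (\<alpha> *\<^sub>C e + \<beta> *\<^sub>C (v - mu v *\<^sub>C e)) = \<alpha>" for \<alpha> \<beta> v
    by (simp add: cblinear_add[OF mu(1)] cblinear_scaleC[OF mu(1)] mu_u mu(2))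
  have T_comb: "(norm (T (\<alpha> *\<^sub>C e + \<beta> *\<^sub>C (v - mu v *\<^sub>C e))))\<^sup>2 = (cmod \<alpha>)\<^sup>2 + (cmod \<beta>)\<^sup>2 * (norm (T (v - mu v *\<^sub>C e)))\<^sup>2" for \<alpha> \<beta> v
    unfolding Tn[of "\<alpha> *\<^sub>C e + \<beta> *\<^sub>C (v - mu v *\<^sub>C e)"] mu_comb
    by (simp add: cblinear_scaleC[OF T] power_mult_distrib)
  have Tmu: "cmod (mu y) \<le> norm (T y)" for y
  proof (rule power2_le_imp_le)
    show "(cmod (mu y))\<^sup>2 \<le> (norm (T y))\<^sup>2" unfolding Tn[of y] by simp
  qed auto
  have Re_pos: "Re (mu (A (w - b))) > 0" if "w \<in> Bm" for w
  proof -
    have "0 \<le> (1 - \<epsilon>) * (norm (T (A (w - b))))\<^sup>2" using \<epsilon>0 by simp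
    then show ?thesis using that unfolding Bm_def by simp
  qed
  have den0: "den \<zeta> \<noteq> 0" if "Re \<zeta> > 0" for \<zeta>
  proof
    assume "den \<zeta> = 0"
    then have "4 * a * Re \<zeta> \<le> 0" using den[of \<zeta>] zero_le_power2[of "cmod (1 - \<zeta> / \<tau>)"] by (simp only: norm_zero power2_eq_square mult_zero_left)
    then show False using a_pos that by (simp add: mult_le_0_iff)
  qed
  have d0: "d y1 \<noteq> 0" "cmod (d y1) \<ge> (1 - r) / cmod \<tau>" if "cmod y1 < r" for y1
  proof -
    have "cmod (1 / \<tau>) - cmod (y1 / cnj \<tau>) \<le> cmod (d y1)"
      unfolding d_def using norm_triangle_ineq2[of "1 / \<tau>" "- (y1 / cnj \<tau>)"] by simp
    then have *: "(1 - cmod y1) / cmod \<tau> \<le> cmod (d y1)" by (simp add: norm_divide diff_divide_distrib)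
    moreover have "(1 - r) / cmod \<tau> \<le> (1 - cmod y1) / cmod \<tau>" using that by (intro divide_right_mono) auto
    ultimately show "cmod (d y1) \<ge> (1 - r) / cmod \<tau>" by linarith
    moreover have "(1 - r) / cmod \<tau> > 0" using r \<tau>0 by simp
    ultimately show "d y1 \<noteq> 0" by auto
  qed
  have hA: "cholomorphic_on (\<lambda>w. A (w - b)) S'" for S'
    by (intro cholomorphic_on_cblinear_compose[OF _ A] cholomorphic_on_diff cholomorphic_on_id cholomorphic_on_const)
  have hmu: "cholomorphic_on (\<lambda>w. mu (A (w - b))) S'" for S'
    by (rule cholomorphic_on_cblinear_compose[OF hA mu(1)])
  have hden: "cholomorphic_on (\<lambda>w. den (mu (A (w - b)))) S'" for S'
    unfolding den_def divide_inverse
    by (rule cholomorphic_on_add[OF cholomorphic_on_const cholomorphic_on_mult[OF hmu cholomorphic_on_const]])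
  have sig_hol: "cholomorphic_on \<sigma> Bm"
    unfolding \<sigma>_def Let_def
  proof (rule cholomorphic_on_scaleC[OF cholomorphic_on_inverse[OF hden] cholomorphic_on_add[OF cholomorphic_on_scaleC cholomorphic_on_scaleC]])
    show "den (mu (A (w - b))) \<noteq> 0" if "w \<in> Bm" for w by (rule den0[OF Re_pos[OF that]])
    show "cholomorphic_on (\<lambda>w. 1 - mu (A (w - b)) / \<tau>) Bm"
      unfolding divide_inverse
      by (rule cholomorphic_on_diff[OF cholomorphic_on_const cholomorphic_on_mult[OF hmu cholomorphic_on_const]])
    show "cholomorphic_on (\<lambda>w. A (w - b) - mu (A (w - b)) *\<^sub>C e) Bm"
      by (rule cholomorphic_on_diff[OF hA cholomorphic_on_scaleC[OF hmu cholomorphic_on_const]])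
  qed (rule cholomorphic_on_const)+
  have \<sigma>_alt: "\<sigma> w = (inverse (den \<zeta>) * (1 - \<zeta> / \<tau>)) *\<^sub>C e + (inverse (den \<zeta>) * of_real c) *\<^sub>C (v - mu v *\<^sub>C e)"
    if "v = A (w - b)" "\<zeta> = mu v" for w v \<zeta>
    unfolding \<sigma>_def Let_def using that by (simp add: scaleC_add_right scaleC_scaleC)
  have sig_ball: "norm (T (\<sigma> w)) < 1" if w: "w \<in> Bm" for w
  proof -
    define v where "v = A (w - b)"
    define \<zeta> where "\<zeta> = mu v"
    have pos: "Re \<zeta> > 0" using Re_pos[OF w] by (simp add: v_def \<zeta>_def)
    have dz: "den \<zeta> \<noteq> 0" by (rule den0[OF pos])
    have "(norm (T (\<sigma> w)))\<^sup>2 = (cmod (inverse (den \<zeta>) * (1 - \<zeta> / \<tau>)))\<^sup>2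
        + (cmod (inverse (den \<zeta>) * of_real c))\<^sup>2 * (norm (T (v - mu v *\<^sub>C e)))\<^sup>2"
      unfolding \<sigma>_alt[OF v_def \<zeta>_def] by (rule T_comb)
    also have "\<dots> = ((cmod (1 - \<zeta> / \<tau>))\<^sup>2 + c\<^sup>2 * (norm (T (v - mu v *\<^sub>C e)))\<^sup>2) / (cmod (den \<zeta>))\<^sup>2"
      using c(1) by (simp add: norm_mult norm_inverse power_mult_distrib power_inverse divide_inverse distrib_left mult_ac)
    also have "\<dots> < 1"
    proof -
      have "(1 - \<epsilon>) * (norm (T (v - mu v *\<^sub>C e)))\<^sup>2 \<le> (1 - \<epsilon>) * (norm (T v))\<^sup>2"
        using \<epsilon>0 Tn[of v] by (intro mult_left_mono) auto
      also have "\<dots> < 2 * Re \<zeta>" using w by (simp add: Bm_def v_def \<zeta>_def)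
      finally have "2 * a * ((1 - \<epsilon>) * (norm (T (v - mu v *\<^sub>C e)))\<^sup>2) < 2 * a * (2 * Re \<zeta>)"
        using a_pos by simp
      then have "c\<^sup>2 * (norm (T (v - mu v *\<^sub>C e)))\<^sup>2 < 4 * a * Re \<zeta>"
        unfolding c(2) by (simp only: mult.assoc mult.left_commute[of "1 - \<epsilon>" a])
      then have "(cmod (1 - \<zeta> / \<tau>))\<^sup>2 + c\<^sup>2 * (norm (T (v - mu v *\<^sub>C e)))\<^sup>2 < (cmod (den \<zeta>))\<^sup>2"
        using den[of \<zeta>] by linarith
      then show ?thesis using dz by simp
    qed
    finally show ?thesis using power_less_imp_less_base[of "norm (T (\<sigma> w))" 2 1] by simp
  qed
  have \<theta>v: "A (\<theta> y - b) = ((1 - mu y) * inverse (d (mu y))) *\<^sub>C e + (of_real (2 * a / c) * inverse (d (mu y))) *\<^sub>C (y - mu y *\<^sub>C e)" for y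
    by (simp add: \<theta>_def AA')
  have \<theta>mu: "mu (A (\<theta> y - b)) = (1 - mu y) * inverse (d (mu y))" for y
    unfolding \<theta>v by (rule mu_comb)
  have a2: "1 / \<tau> + 1 / cnj \<tau> = of_real (2 * a)"
    using complex_add_cnj[of "1 / \<tau>"] by (simp add: a_def)
  have den\<theta>: "den ((1 - y1) * inverse (d y1)) = of_real (2 * a) * inverse (d y1)" if "cmod y1 < r" for y1
  proof -
    have "den ((1 - y1) * inverse (d y1)) = (d y1 + (1 - y1) / cnj \<tau>) * inverse (d y1)"
      using d0(1)[OF that] by (simp add: den_def distrib_right)
    also have "d y1 + (1 - y1) / cnj \<tau> = 1 / \<tau> + 1 / cnj \<tau>" by (simp add: d_def diff_divide_distrib)
    finally show ?thesis unfolding a2 .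
  qed
  have th: "(1 + \<epsilon>) * (norm (T (A (\<theta> y - b))))\<^sup>2 < 2 * Re (mu (A (\<theta> y - b)))"
    "(norm (T (A (\<theta> y - b))))\<^sup>2 \<le> 6 * t / (1 - r)" "\<sigma> (\<theta> y) = y" if y: "norm (T y) < r" for y
  proof -
    define y1 where "y1 = mu y"
    define D where "D = d y1"
    define N where "N = (norm (T (y - mu y *\<^sub>C e)))\<^sup>2"
    have y1: "cmod y1 < r" using Tmu[of y] y by (simp add: y1_def)
    have D: "D \<noteq> 0" "cmod D \<ge> (1 - r) / cmod \<tau>" using d0[OF y1] by (auto simp: D_def)
    have yr: "(cmod y1)\<^sup>2 + N < r\<^sup>2"
      unfolding y1_def N_def Tn[symmetric] using y r by (intro power_strict_mono) auto
    have TV: "(norm (T (A (\<theta> y - b))))\<^sup>2 = ((cmod (1 - y1))\<^sup>2 + (2 * a / c)\<^sup>2 * N) / (cmod D)\<^sup>2"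
    proof -
      have "(norm (T (A (\<theta> y - b))))\<^sup>2 = (cmod ((1 - y1) * inverse D))\<^sup>2 + (cmod (of_real (2 * a / c) * inverse D))\<^sup>2 * N"
        unfolding \<theta>v T_comb N_def y1_def D_def ..
      also have "(cmod (of_real (2 * a / c) * inverse D))\<^sup>2 = (2 * a / c)\<^sup>2 / (cmod D)\<^sup>2"
        unfolding norm_mult norm_inverse norm_of_real power_mult_distrib power_inverse power2_abs by (simp add: divide_inverse)
      also have "(cmod ((1 - y1) * inverse D))\<^sup>2 = (cmod (1 - y1))\<^sup>2 / (cmod D)\<^sup>2"
        unfolding norm_mult norm_inverse power_mult_distrib power_inverse by (simp add: divide_inverse)
      finally show ?thesis by (simp add: add_divide_distrib)
    qed
    have c2: "(2 * a / c)\<^sup>2 = 2 * a / (1 - \<epsilon>)"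
      unfolding power_divide c(2) using a_pos \<epsilon>0 by (simp add: power2_eq_square field_simps)
    have ReD: "Re ((1 - y1) * cnj D) = a * (1 - (cmod y1)\<^sup>2)"
    proof -
      define x where "x = 1 / \<tau>"
      have "D = x + y1 * cnj x" by (simp add: D_def d_def x_def)
      then show ?thesis unfolding a_def x_def[symmetric] cmod_power2 by (simp add: power2_eq_square algebra_simps)
    qed
    have muV: "mu (A (\<theta> y - b)) = (1 - y1) * inverse D" by (simp add: \<theta>mu y1_def D_def)
    have ReV: "Re (mu (A (\<theta> y - b))) = a * (1 - (cmod y1)\<^sup>2) / (cmod D)\<^sup>2"
    proof -
      have "(1 - y1) * inverse D = (1 - y1) * cnj D / of_real ((cmod D)\<^sup>2)"
        unfolding complex_norm_square using D(1) by (simp add: divide_inverse[symmetric])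
      then have "Re ((1 - y1) * inverse D) = Re ((1 - y1) * cnj D) / (cmod D)\<^sup>2" by (simp only: Re_divide_of_real)
      then show ?thesis unfolding muV ReD .
    qed
    have N0: "0 \<le> N" by (simp add: N_def)
    have N1: "N \<le> 1" using yr r2 zero_le_power2[of "cmod y1"] by linarith
    have y12: "(cmod (1 - y1))\<^sup>2 \<le> 4"
    proof -
      have "cmod (1 - y1) \<le> 2" using norm_triangle_ineq4[of 1 y1] y1 r by simp
      then have "(cmod (1 - y1))\<^sup>2 \<le> 2\<^sup>2" by (intro power_mono) auto
      then show ?thesis by simp
    qed
    \<comment> \<open>After clearing the denominator, \<open>4 * \<epsilon>\<close> consumes half of
      the gap \<open>1 - r\<^sup>2\<close>, and the other half times \<open>2 * a\<close> exceeds
      16, enough to absorb the term with \<open>1 - y1\<close>. That term is the contribution of the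
      normal coordinate, which the Siegel domain ignores and the inner ball does not.\<close>
    show main: "(1 + \<epsilon>) * (norm (T (A (\<theta> y - b))))\<^sup>2 < 2 * Re (mu (A (\<theta> y - b)))"
    proof -
      have frac: "(1 + \<epsilon>) / (1 - \<epsilon>) \<le> 1 + 4 * \<epsilon>"
      proof -
        have "(1 + 4 * \<epsilon>) * (1 - \<epsilon>) - (1 + \<epsilon>) = 2 * \<epsilon> * (1 - 2 * \<epsilon>)" by (simp add: algebra_simps)
        also have "\<dots> \<ge> 0" using \<epsilon>0 by simp
        finally show ?thesis using \<epsilon>0 by (simp add: pos_divide_le_eq)
      qed
      have "(1 + \<epsilon>) * ((cmod (1 - y1))\<^sup>2 + (2 * a / c)\<^sup>2 * N)
          = (1 + \<epsilon>) * (cmod (1 - y1))\<^sup>2 + 2 * a * ((1 + \<epsilon>) / (1 - \<epsilon>) * N)"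
        unfolding c2 by (simp add: distrib_left mult_ac)
      also have "\<dots> \<le> 2 * 4 + 2 * a * (N + 4 * \<epsilon>)"
      proof (rule add_mono)
        show "(1 + \<epsilon>) * (cmod (1 - y1))\<^sup>2 \<le> 2 * 4" using \<epsilon>0 y12 by (intro mult_mono) auto
        have "(1 + \<epsilon>) / (1 - \<epsilon>) * N \<le> (1 + 4 * \<epsilon>) * N" by (intro mult_right_mono frac N0)
        also have "\<dots> = N + 4 * \<epsilon> * N" by (simp add: algebra_simps)
        also have "4 * \<epsilon> * N \<le> 4 * \<epsilon> * 1" using \<epsilon>0 N1 by (intro mult_left_mono) auto
        finally show "2 * a * ((1 + \<epsilon>) / (1 - \<epsilon>) * N) \<le> 2 * a * (N + 4 * \<epsilon>)" using a_pos by (intro mult_left_mono) auto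
      qed
      also have "\<dots> < 2 * a * (1 - (cmod y1)\<^sup>2)"
      proof -
        have e4: "4 * \<epsilon> = (1 - r\<^sup>2) / 2" by (simp add: \<epsilon>)
        have "1 - r\<^sup>2 < 2 * (1 - (cmod y1)\<^sup>2 - (N + 4 * \<epsilon>))" unfolding e4 using yr by (simp add: field_simps)
        then have "a * (1 - r\<^sup>2) < a * (2 * (1 - (cmod y1)\<^sup>2 - (N + 4 * \<epsilon>)))" using a_pos by (intro mult_strict_left_mono)
        moreover have "a * (2 * (1 - (cmod y1)\<^sup>2 - (N + 4 * \<epsilon>))) = 2 * a * (1 - (cmod y1)\<^sup>2) - 2 * a * (N + 4 * \<epsilon>)"
          by (simp add: right_diff_distrib)
        moreover have "16 < a * (1 - r\<^sup>2)" using a_big r2 by (simp add: pos_divide_less_eq)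
        ultimately show ?thesis by linarith
      qed
      finally have "(1 + \<epsilon>) * ((cmod (1 - y1))\<^sup>2 + (2 * a / c)\<^sup>2 * N) / (cmod D)\<^sup>2 < 2 * a * (1 - (cmod y1)\<^sup>2) / (cmod D)\<^sup>2"
        using D(1) by (intro divide_strict_right_mono) auto
      then show ?thesis unfolding TV ReV by simp
    qed
    show "(norm (T (A (\<theta> y - b))))\<^sup>2 \<le> 6 * t / (1 - r)"
    proof -
      have "(norm (T (A (\<theta> y - b))))\<^sup>2 \<le> (1 + \<epsilon>) * (norm (T (A (\<theta> y - b))))\<^sup>2"
        using \<epsilon>0 mult_right_mono[of 1 "1 + \<epsilon>" "(norm (T (A (\<theta> y - b))))\<^sup>2"] by simp
      also have "\<dots> \<le> 2 * Re (mu (A (\<theta> y - b)))" using main by simp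
      also have "Re (mu (A (\<theta> y - b))) \<le> cmod ((1 - y1) * inverse D)" unfolding muV by (rule complex_Re_le_cmod)
      also have "cmod ((1 - y1) * inverse D) = cmod (1 - y1) / cmod D" by (simp add: norm_mult norm_inverse divide_inverse)
      also have "\<dots> \<le> 2 / ((1 - r) / cmod \<tau>)"
      proof (rule frac_le)
        show "cmod (1 - y1) \<le> 2" using norm_triangle_ineq4[of 1 y1] y1 r by simp
        show "0 < (1 - r) / cmod \<tau>" using r \<tau>0 by simp
      qed (use D in auto)
      also have "\<dots> = 2 * cmod \<tau> / (1 - r)" by simp
      also have "2 * (2 * cmod \<tau> / (1 - r)) \<le> 6 * t / (1 - r)"
        using \<tau>n r by (simp add: divide_right_mono)
      finally show ?thesis by simp
    qed
    show "\<sigma> (\<theta> y) = y"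
    proof -
      define v where "v = A (\<theta> y - b)"
      have v: "mu v = (1 - y1) * inverse D" unfolding v_def by (rule muV)
      have vu: "v - mu v *\<^sub>C e = (of_real (2 * a / c) * inverse D) *\<^sub>C (y - mu y *\<^sub>C e)"
        unfolding v unfolding v_def \<theta>v by (simp add: D_def y1_def)
      have dn: "den (mu v) = of_real (2 * a) * inverse D" unfolding v D_def by (rule den\<theta>[OF y1])
      have 1: "inverse (den (mu v)) * (1 - mu v / \<tau>) = y1"
      proof -
        have "1 - mu v / \<tau> = (D - (1 - y1) / \<tau>) * inverse D" unfolding v left_diff_distrib[of D] using D(1) by (simp add: divide_inverse mult_ac)
        also have "D - (1 - y1) / \<tau> = y1 * (1 / \<tau> + 1 / cnj \<tau>)" by (simp add: D_def d_def field_simps diff_divide_distrib)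
        finally show ?thesis unfolding dn a2 using a_pos D(1) by (simp add: field_simps)
      qed
      have 2: "inverse (den (mu v)) * of_real c * (of_real (2 * a / c) * inverse D) = 1"
        unfolding dn using a_pos c(1) D(1) by (simp add: field_simps)
      have "\<sigma> (\<theta> y) = (inverse (den (mu v)) * (1 - mu v / \<tau>)) *\<^sub>C e + (inverse (den (mu v)) * of_real c) *\<^sub>C (v - mu v *\<^sub>C e)"
        by (rule \<sigma>_alt[OF v_def refl])
      also have "\<dots> = y1 *\<^sub>C e + (y - mu y *\<^sub>C e)" unfolding 1 vu scaleC_scaleC 2 by simp
      finally show ?thesis by (simp add: y1_def)
    qed
  qed
  have th_hol: "cholomorphic_on \<theta> {y. norm (T y) < r}"
    unfolding \<theta>_def
  proof (rule cholomorphic_on_add[OF cholomorphic_on_const cholomorphic_on_cblinear_compose[OF _ A']])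
    have hm: "cholomorphic_on mu {y. norm (T y) < r}" by (rule cholomorphic_on_cblinear[OF mu(1)])
    have hd: "cholomorphic_on (\<lambda>y. inverse (d (mu y))) {y. norm (T y) < r}"
    proof (rule cholomorphic_on_inverse)
      show "cholomorphic_on (\<lambda>y. d (mu y)) {y. norm (T y) < r}"
        unfolding d_def divide_inverse
        by (rule cholomorphic_on_add[OF cholomorphic_on_const cholomorphic_on_mult[OF hm cholomorphic_on_const]])
      show "d (mu y) \<noteq> 0" if "y \<in> {y. norm (T y) < r}" for y using d0(1)[of "mu y"] Tmu[of y] that by simp
    qed
    show "cholomorphic_on (\<lambda>y. ((1 - mu y) * inverse (d (mu y))) *\<^sub>C e
        + (of_real (2 * a / c) * inverse (d (mu y))) *\<^sub>C (y - mu y *\<^sub>C e)) {y. norm (T y) < r}"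
      by (intro cholomorphic_on_add cholomorphic_on_scaleC cholomorphic_on_mult cholomorphic_on_diff
          cholomorphic_on_const cholomorphic_on_id hm hd)
  qed
  have inv: "\<theta> (\<sigma> w) = w" if w: "w \<in> Bm" "norm (T (\<sigma> w)) < r" for w
  proof -
    define v where "v = A (w - b)"
    define \<zeta> where "\<zeta> = mu v"
    define y where "y = \<sigma> w"
    have dz: "den \<zeta> \<noteq> 0" using den0[OF Re_pos[OF w(1)]] by (simp add: v_def \<zeta>_def)
    have ym: "mu y = inverse (den \<zeta>) * (1 - \<zeta> / \<tau>)" unfolding y_def \<sigma>_alt[OF v_def \<zeta>_def] by (rule mu_comb)
    have yu: "y - mu y *\<^sub>C e = (inverse (den \<zeta>) * of_real c) *\<^sub>C (v - mu v *\<^sub>C e)"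
      unfolding ym unfolding y_def \<sigma>_alt[OF v_def \<zeta>_def] by simp
    have y1: "cmod (mu y) < r" using Tmu[of y] w(2) by (simp add: y_def)
    have dd: "d (mu y) = of_real (2 * a) * inverse (den \<zeta>)"
    proof -
      have "d (mu y) = (den \<zeta> / \<tau> + (1 - \<zeta> / \<tau>) / cnj \<tau>) * inverse (den \<zeta>)"
      proof -
        have "den \<zeta> / \<tau> * inverse (den \<zeta>) = 1 / \<tau>" using dz by simp
        then show ?thesis by (simp only: d_def ym distrib_right) (simp add: divide_inverse mult_ac)
      qed
      also have "den \<zeta> / \<tau> + (1 - \<zeta> / \<tau>) / cnj \<tau> = 1 / \<tau> + 1 / cnj \<tau>"
        by (simp add: den_def add_divide_distrib diff_divide_distrib mult.commute)
      finally show ?thesis unfolding a2 .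
    qed
    have 1: "(1 - mu y) * inverse (d (mu y)) = \<zeta>"
    proof -
      have "1 - mu y = (den \<zeta> - (1 - \<zeta> / \<tau>)) * inverse (den \<zeta>)" using dz by (simp add: ym field_simps)
      also have "den \<zeta> - (1 - \<zeta> / \<tau>) = \<zeta> * (1 / \<tau> + 1 / cnj \<tau>)" by (simp add: den_def field_simps)
      finally show ?thesis unfolding dd a2 using a_pos dz by (simp add: field_simps)
    qed
    have 2: "of_real (2 * a / c) * inverse (d (mu y)) * (inverse (den \<zeta>) * of_real c) = 1"
      unfolding dd using a_pos c(1) dz by (simp add: field_simps)
    have "\<theta> y = b + A' (\<zeta> *\<^sub>C e + (v - mu v *\<^sub>C e))" unfolding \<theta>_def 1 yu scaleC_scaleC 2 by simp
    also have "\<dots> = w" by (simp add: \<zeta>_def v_def A'A)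
    finally show ?thesis by (simp add: y_def)
  qed
  have "\<sigma> (b + t *\<^sub>R e) = 0"
  proof -
    have v: "A ((b + t *\<^sub>R e) - b) = \<tau> *\<^sub>C e"
      by (simp add: A_def \<tau>_def n_def cblinear_scaleC[OF nu(1)] scaleR_scaleC algebra_simps flip: scaleC_add_left)
    show ?thesis unfolding \<sigma>_alt[OF refl refl] v using \<tau>0
      by (simp add: cblinear_scaleC[OF mu(1)] mu(2))
  qed
  then show ?thesis
    using sig_hol sig_ball th_hol th inv by (intro exI[of _ \<sigma>] exI[of _ \<theta>] conjI allI impI ballI) auto
qed

text \<open>A quantitative way of saying that the squeezing function of \<open>D\<close> at
  \<open>x\<close> is at least \<open>r\<close>, with the unit ball taken in the norm of
  \<open>T\<close>. The partial inverse \<open>\<theta>\<close> is part of the data: both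
  compositions are controlled only over the smaller ball, and \<open>\<sigma>\<close> need not be
  injective on all of \<open>D\<close>.\<close>

definition squeezing :: "('x::t2_space, 'e::complex_hilbert_space) chart set \<Rightarrow> ('e \<Rightarrow> ell2) \<Rightarrow> real \<Rightarrow> 'x \<Rightarrow> 'x set
    \<Rightarrow> ('x \<Rightarrow> 'e) \<Rightarrow> ('e \<Rightarrow> 'x) \<Rightarrow> bool"
  where "squeezing \<A> T r x D \<sigma> \<theta> \<longleftrightarrow> holomorphic_map \<A> hilbert_atlas \<sigma> D \<and> (\<forall>y\<in>D. norm (T (\<sigma> y)) < 1) \<and> \<sigma> x = 0 \<and>
    holomorphic_map hilbert_atlas \<A> \<theta> {v. norm (T v) < r} \<and> (\<forall>v. norm (T v) < r \<longrightarrow> \<theta> v \<in> D \<and> \<sigma> (\<theta> v) = v) \<and>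
    (\<forall>y\<in>D. norm (T (\<sigma> y)) < r \<longrightarrow> \<theta> (\<sigma> y) = y)"

lemma open_norm_cblinear_less:
  assumes "cblinear T"
  shows "open {v. norm (T v) < r}"
  by (intro open_Collect_less continuous_on_norm linear_continuous_on[OF cblinear_bounded[OF assms]] continuous_on_const)

text \<open>A nearest boundary point need not exist. The boundary point is found instead on the
  segment in the direction \<open>- e\<close>, so that \<open>x\<close> lies over it exactly in the
  direction in which \<open>ball_squeeze\<close> places its centre.\<close>

lemma frontier_on_segment:
  assumes ch: "is_chart (W, \<kappa>)" and x: "x \<in> W" "x \<in> \<Omega>" and \<Omega>: "open \<Omega>"
    and seg: "\<And>s. 0 \<le> s \<Longrightarrow> s \<le> t1 \<Longrightarrow> \<kappa> x - s *\<^sub>R e \<in> \<kappa> ` W" and t1: "0 \<le> t1"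
    and out: "inv_into W \<kappa> (\<kappa> x - t1 *\<^sub>R e) \<notin> \<Omega>"
  obtains b s where "b \<in> frontier \<Omega>" "b \<in> W" "0 < s" "s \<le> t1" "\<kappa> b = \<kappa> x - s *\<^sub>R e"
proof -
  define \<gamma> where "\<gamma> s = inv_into W \<kappa> (\<kappa> x - s *\<^sub>R e)" for s
  have "continuous_on {0..t1} \<gamma>"
    unfolding \<gamma>_def by (rule continuous_on_compose2[OF is_chartD(5)[OF ch]]) (auto intro!: continuous_intros seg)
  then have "connected (\<gamma> ` {0..t1})" by (rule connected_continuous_image) simp
  moreover have "\<gamma> 0 = x" using x(1) is_chartD(3)[OF ch] by (simp add: \<gamma>_def)
  then have "x \<in> \<gamma> ` {0..t1} \<inter> \<Omega>" using x(2) t1 by (auto intro!: rev_image_eqI[of "0::real"])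
  moreover have "\<gamma> t1 \<in> \<gamma> ` {0..t1} - \<Omega>" using out t1 by (auto simp: \<gamma>_def)
  ultimately have "\<gamma> ` {0..t1} \<inter> frontier \<Omega> \<noteq> {}" by (intro connected_Int_frontier) auto
  then obtain s where s: "0 \<le> s" "s \<le> t1" "\<gamma> s \<in> frontier \<Omega>" by auto
  have "\<gamma> 0 \<notin> frontier \<Omega>" using x is_chartD(3)[OF ch] \<Omega> by (simp add: \<gamma>_def frontier_def interior_open)
  then have "s \<noteq> 0" using s(3) by metis
  show ?thesis
  proof (rule that[of "\<gamma> s" s])
    show "\<gamma> s \<in> W" unfolding \<gamma>_def by (rule inv_into_into[OF seg[OF s(1,2)]])
    show "\<kappa> (\<gamma> s) = \<kappa> x - s *\<^sub>R e" unfolding \<gamma>_def by (rule f_inv_into_f[OF seg[OF s(1,2)]])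
  qed (use s \<open>s \<noteq> 0\<close> in auto)
qed

text \<open>Here \<open>a\<close> and \<open>b\<close> are the norms of a vector before and after
  the tilt. Enlarging the pinching constant from \<open>\<epsilon>0\<close> to
  \<open>\<epsilon>\<close> pays for replacing one by the other.\<close>

lemma pinching_in_tilted_coordinates:
  fixes \<epsilon> \<eta> a b :: real
  assumes "0 < \<epsilon>" "\<epsilon> \<le> 1" "0 \<le> \<eta>" "\<eta> \<le> \<epsilon> / 8" "\<epsilon>0 \<le> \<epsilon> / 8" "0 \<le> a" "0 \<le> b" "\<bar>b - a\<bar> \<le> \<eta> * a"
  shows "(1 - \<epsilon>) * b\<^sup>2 \<le> (1 - \<epsilon>0) * a\<^sup>2" and "(1 + \<epsilon>0) * a\<^sup>2 \<le> (1 + \<epsilon>) * b\<^sup>2" and "a \<le> 2 * b"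
proof -
  have up: "b \<le> (1 + \<eta>) * a" and low: "(1 - \<eta>) * a \<le> b" using assms(8) by (auto simp: algebra_simps)
  have \<eta>2: "\<eta> * \<eta> \<le> \<eta>" "0 \<le> \<eta> * \<eta>" "\<epsilon> * \<epsilon> \<le> \<epsilon>" "\<epsilon> * \<eta> \<le> \<eta>" "0 \<le> \<epsilon> * \<eta>"
    using assms by (auto intro!: mult_left_le mult_left_le_one_le)
  have "(1 - \<epsilon>) * b\<^sup>2 \<le> (1 - \<epsilon>) * ((1 + \<eta>) * a)\<^sup>2" using up assms by (intro mult_left_mono power_mono) auto
  also have "\<dots> = ((1 - \<epsilon>) * (1 + \<eta>)\<^sup>2) * a\<^sup>2" by (simp add: power_mult_distrib)
  also have "\<dots> \<le> (1 - \<epsilon>0) * a\<^sup>2"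
  proof (rule mult_right_mono)
    have "(1 - \<epsilon>) * (1 + \<eta>)\<^sup>2 \<le> (1 - \<epsilon>) * (1 + 3 * \<eta>)"
      using \<eta>2 assms by (intro mult_left_mono) (auto simp: power2_eq_square algebra_simps)
    also have "\<dots> = 1 + 3 * \<eta> - \<epsilon> - 3 * (\<epsilon> * \<eta>)" by (simp add: algebra_simps)
    also have "\<dots> \<le> 1 - \<epsilon>0" using \<eta>2(5) assms by linarith
    finally show "(1 - \<epsilon>) * (1 + \<eta>)\<^sup>2 \<le> 1 - \<epsilon>0" .
  qed simp
  finally show "(1 - \<epsilon>) * b\<^sup>2 \<le> (1 - \<epsilon>0) * a\<^sup>2" .
  have "(1 + \<epsilon>0) * a\<^sup>2 \<le> ((1 + \<epsilon>) * (1 - \<eta>)\<^sup>2) * a\<^sup>2"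
  proof (rule mult_right_mono)
    have "1 + \<epsilon>0 \<le> 1 + \<epsilon> - 2 * \<eta> - 2 * (\<epsilon> * \<eta>)" using \<eta>2(4) assms by linarith
    also have "\<dots> = (1 + \<epsilon>) * (1 - 2 * \<eta>)" by (simp add: algebra_simps)
    also have "\<dots> \<le> (1 + \<epsilon>) * (1 - \<eta>)\<^sup>2" using assms by (intro mult_left_mono) (auto simp: power2_eq_square algebra_simps)
    finally show "1 + \<epsilon>0 \<le> (1 + \<epsilon>) * (1 - \<eta>)\<^sup>2" .
  qed simp
  also have "\<dots> = (1 + \<epsilon>) * ((1 - \<eta>) * a)\<^sup>2" by (simp add: power_mult_distrib)
  also have "\<dots> \<le> (1 + \<epsilon>) * b\<^sup>2" using low assms by (intro mult_left_mono power_mono) auto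
  finally show "(1 + \<epsilon>0) * a\<^sup>2 \<le> (1 + \<epsilon>) * b\<^sup>2" .
  have "\<eta> * a \<le> 1 / 2 * a" using assms by (intro mult_right_mono) auto
  then show "a \<le> 2 * b" using assms(8) by linarith
qed

theorem strongly_pseudoconvex_squeezing:
  fixes \<A> :: "('x::t2_space, 'e::{complex_hilbert_space, second_countable_topology}) chart set"
  assumes A: "complex_manifold \<A>" and spc: "strongly_pseudoconvex_at \<A> \<Omega> p" and pf: "p \<in> frontier \<Omega>"
    and \<Omega>: "open \<Omega>"
  shows "(\<exists>\<theta>>0. localises \<A> \<Omega> p \<theta>) \<and> (\<exists>(T :: 'e \<Rightarrow> ell2) S. cblinear T \<and> cblinear S \<and> (\<forall>x. S (T x) = x) \<and>
    (\<forall>r. 0 < r \<longrightarrow> r < 1 \<longrightarrow> (\<exists>N V. open N \<and> p \<in> N \<and> open V \<and> p \<in> V \<and>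
      (\<forall>x\<in>\<Omega> \<inter> V. \<exists>\<sigma> \<theta>. squeezing \<A> T r x (\<Omega> \<inter> N) \<sigma> \<theta>))))"
proof -
  obtain W \<kappa> and T :: "'e \<Rightarrow> ell2" and S mu e where *: "holomorphic_chart \<A> (W, \<kappa>) \<and> p \<in> W \<and> \<kappa> p = 0 \<and>
    cblinear T \<and> cblinear S \<and> (\<forall>x. S (T x) = x) \<and> cblinear mu \<and> mu e = 1 \<and>
    (\<forall>v. (norm (T v))\<^sup>2 = (cmod (mu v))\<^sup>2 + (norm (T (v - mu v *\<^sub>C e)))\<^sup>2) \<and>
    (\<forall>\<epsilon>. 0 < \<epsilon> \<longrightarrow> \<epsilon> \<le> 1 \<longrightarrow> (\<exists>\<delta>>0. ball 0 \<delta> \<subseteq> \<kappa> ` W \<and>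
      (\<forall>x\<in>frontier \<Omega> \<inter> W. norm (\<kappa> x) < \<delta> \<longrightarrow> (\<exists>\<nu>. cblinear \<nu> \<and> (\<forall>v. cmod (\<nu> v) \<le> \<epsilon> * norm v) \<and>
        (\<forall>y\<in>W. norm (\<kappa> y) < \<delta> \<longrightarrow>
          ((1 + \<epsilon>) * (norm (T (\<kappa> y - \<kappa> x)))\<^sup>2 < 2 * Re (mu (\<kappa> y - \<kappa> x) + \<nu> (\<kappa> y - \<kappa> x)) \<longrightarrow> y \<in> \<Omega>) \<and>
          (y \<in> \<Omega> \<longrightarrow> (1 - \<epsilon>) * (norm (T (\<kappa> y - \<kappa> x)))\<^sup>2 < 2 * Re (mu (\<kappa> y - \<kappa> x) + \<nu> (\<kappa> y - \<kappa> x))))))))"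
    using adapted_chart[OF A spc pf] by (elim exE) (rule that)
  then have hc: "holomorphic_chart \<A> (W, \<kappa>)" and p: "p \<in> W" "\<kappa> p = 0" and TS: "cblinear T" "cblinear S"
    and mu: "cblinear mu" "mu e = 1" and ST: "\<forall>x. S (T x) = x"
    and Tn: "\<forall>v. (norm (T v))\<^sup>2 = (cmod (mu v))\<^sup>2 + (norm (T (v - mu v *\<^sub>C e)))\<^sup>2"
    by blast+
  note pinch = *[THEN conjunct2, THEN conjunct2, THEN conjunct2, THEN conjunct2, THEN conjunct2, THEN conjunct2,
      THEN conjunct2, THEN conjunct2, THEN conjunct2, rule_format]
  note ST = ST[rule_format] and Tn = Tn[rule_format]
  have ch: "is_chart (W, \<kappa>)" using hc by (simp add: holomorphic_chart_def)
  note inj = is_chartD(3)[OF ch]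
  obtain KS where KS: "KS > 0" "\<And>v. norm (S v) \<le> KS * norm v" using cblinear_bound[OF TS(2)] by blast
  obtain Km where Km: "Km > 0" "\<And>v. cmod (mu v) \<le> Km * norm v" using cblinear_bound[OF mu(1)] by blast
  define K where "K = 1 + KS + Km"
  have K1: "K \<ge> 1" "KS \<le> K" "Km \<le> K" using KS(1) Km(1) by (auto simp: K_def)
  have K0: "K > 0" using K1 by simp
  have KT: "norm v \<le> K * norm (T v)" for v
    using KS(2)[of "T v"] mult_right_mono[OF K1(2), of "norm (T v)"] ST[of v] by simp
  have Kmu: "cmod (mu v) \<le> K * norm v" for v
    using Km(2)[of v] mult_right_mono[OF K1(3), of "norm v"] by simp
  have "norm (T e) = 1" using Tn[of e] mu(2) using norm_ge_zero[of "T e"] by (auto simp: cblinear_zero[OF TS(1)] power2_eq_1_iff)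
  then have Ke: "norm e \<le> K" using KT[of e] by simp
  have p': "p \<in> frontier \<Omega> \<inter> W" using pf p by simp
  have "\<exists>\<theta>>0. localises \<A> \<Omega> p \<theta>"
  proof -
    obtain \<delta> where \<delta>: "\<delta> > 0" "ball 0 \<delta> \<subseteq> \<kappa> ` W" "\<forall>x\<in>frontier \<Omega> \<inter> W. norm (\<kappa> x) < \<delta> \<longrightarrow> (\<exists>\<nu>. cblinear \<nu> \<and> (\<forall>v. cmod (\<nu> v) \<le> 1 / 2 * norm v) \<and>
        (\<forall>y\<in>W. norm (\<kappa> y) < \<delta> \<longrightarrow>
          ((1 + 1 / 2) * (norm (T (\<kappa> y - \<kappa> x)))\<^sup>2 < 2 * Re (mu (\<kappa> y - \<kappa> x) + \<nu> (\<kappa> y - \<kappa> x)) \<longrightarrow> y \<in> \<Omega>) \<and>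
          (y \<in> \<Omega> \<longrightarrow> (1 - 1 / 2) * (norm (T (\<kappa> y - \<kappa> x)))\<^sup>2 < 2 * Re (mu (\<kappa> y - \<kappa> x) + \<nu> (\<kappa> y - \<kappa> x)))))"
      using pinch[of "1 / 2"] by auto
    \<comment> \<open>The outer ball at \<open>p\<close> itself makes \<open>mu + \<nu>\<close> a
      peak functional there.\<close>
    from \<delta>(3)[rule_format, OF p'] \<delta>(1) obtain \<nu> where \<nu>: "cblinear \<nu>" and
      y: "\<And>y. y \<in> W \<Longrightarrow> norm (\<kappa> y) < \<delta> \<Longrightarrow> y \<in> \<Omega> \<Longrightarrow> (1 - 1 / 2) * (norm (T (\<kappa> y)))\<^sup>2 < 2 * Re (mu (\<kappa> y) + \<nu> (\<kappa> y))"
      unfolding p(2) norm_zero diff_zero by blast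
    show ?thesis
    proof (rule localises_near_peak[OF A hc p \<delta>(1,2) cblinear_plus[OF mu(1) \<nu>]])
      show "1 / (4 * K\<^sup>2) > 0" using K1 by simp
      fix x assume x: "x \<in> \<Omega>" "x \<in> W" "norm (\<kappa> x) < \<delta>"
      have "(norm (\<kappa> x))\<^sup>2 \<le> (K * norm (T (\<kappa> x)))\<^sup>2" by (intro power_mono KT) simp
      then have "1 / (4 * K\<^sup>2) * (norm (\<kappa> x))\<^sup>2 \<le> 1 / (4 * K\<^sup>2) * (K * norm (T (\<kappa> x)))\<^sup>2" by (intro mult_left_mono) auto
      also have "\<dots> = (norm (T (\<kappa> x)))\<^sup>2 / 4" using K0 by (simp add: power_mult_distrib)
      also have "\<dots> \<le> Re (mu (\<kappa> x) + \<nu> (\<kappa> x))" using y[OF x(2,3,1)] by simp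
      finally show "1 / (4 * K\<^sup>2) * (norm (\<kappa> x))\<^sup>2 \<le> Re (mu (\<kappa> x) + \<nu> (\<kappa> x))" .
    qed
  qed
  moreover have "\<exists>N V. open N \<and> p \<in> N \<and> open V \<and> p \<in> V \<and> (\<forall>x\<in>\<Omega> \<inter> V. \<exists>\<sigma> \<theta>. squeezing \<A> T r x (\<Omega> \<inter> N) \<sigma> \<theta>)"
    if r: "0 < r" "r < 1" for r
  proof -
    have r2: "0 < 1 - r\<^sup>2" "1 - r\<^sup>2 \<le> 1" using r by (auto simp: power_less_one_iff)
    define \<epsilon> where "\<epsilon> = (1 - r\<^sup>2) / 8"
    have \<epsilon>: "0 < \<epsilon>" "\<epsilon> \<le> 1 / 8" using r2 by (auto simp: \<epsilon>_def)
    \<comment> \<open>Since \<open>norm v \<le> K * norm (T v)\<close>, the tilt then changes the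
      norm of a vector at most by the fraction \<open>\<epsilon> / 8\<close>.\<close>
    define \<epsilon>0 where "\<epsilon>0 = \<epsilon> / (8 * K)"
    have \<epsilon>0: "0 < \<epsilon>0" "\<epsilon>0 * K = \<epsilon> / 8" using \<epsilon> K0 by (auto simp: \<epsilon>0_def)
    have \<epsilon>0': "\<epsilon>0 \<le> \<epsilon> / 8"
    proof -
      have "\<epsilon>0 * 1 \<le> \<epsilon>0 * K" using \<epsilon>0(1) K1 by (intro mult_left_mono) auto
      then show ?thesis using \<epsilon>0(2) by simp
    qed
    have "\<epsilon>0 \<le> 1" using \<epsilon>0' \<epsilon>(2) by linarith
    with pinch[OF \<epsilon>0(1)] obtain \<delta> where \<delta>: "\<delta> > 0" "ball 0 \<delta> \<subseteq> \<kappa> ` W" and P: "\<forall>x\<in>frontier \<Omega> \<inter> W. norm (\<kappa> x) < \<delta> \<longrightarrow>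
        (\<exists>\<nu>. cblinear \<nu> \<and> (\<forall>v. cmod (\<nu> v) \<le> \<epsilon>0 * norm v) \<and>
        (\<forall>y\<in>W. norm (\<kappa> y) < \<delta> \<longrightarrow>
          ((1 + \<epsilon>0) * (norm (T (\<kappa> y - \<kappa> x)))\<^sup>2 < 2 * Re (mu (\<kappa> y - \<kappa> x) + \<nu> (\<kappa> y - \<kappa> x)) \<longrightarrow> y \<in> \<Omega>) \<and>
          (y \<in> \<Omega> \<longrightarrow> (1 - \<epsilon>0) * (norm (T (\<kappa> y - \<kappa> x)))\<^sup>2 < 2 * Re (mu (\<kappa> y - \<kappa> x) + \<nu> (\<kappa> y - \<kappa> x)))))"
      by auto
    have small: "cmod (\<nu> e) \<le> 1 / 64" if "\<forall>v. cmod (\<nu> v) \<le> \<epsilon>0 * norm v" for \<nu>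
    proof -
      have "cmod (\<nu> e) \<le> \<epsilon>0 * norm e" using that by simp
      also have "\<dots> \<le> \<epsilon>0 * K" using Ke \<epsilon>0 by (intro mult_left_mono) auto
      finally show ?thesis using \<epsilon>0(2) \<epsilon>(2) by simp
    qed
    define N where "N = {y \<in> W. \<kappa> y \<in> ball 0 \<delta>}"
    have N: "open N" "p \<in> N" unfolding N_def by (rule chart_open_preimage[OF ch open_ball]) (use p \<delta>(1) in simp)
    \<comment> \<open>Bounds the coordinates along the whole segment below by
      \<open>K2 * \<rho>\<close>: the starting point contributes 1, the length \<open>t1\<close>
      times the norm of \<open>e\<close> the rest.\<close>
    define K2 where "K2 = 1 + 2 * (K + 1) * K"
    have K2: "K2 \<ge> 1" "K2 > 0" using K0 by (auto simp: K2_def intro: add_pos_nonneg)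
    \<comment> \<open>The first bound is what \<open>ball_squeeze\<close> asks of the height
      \<open>t\<close>, with strictness to spare; the second confines the image of its inverse map
      to the chart ball of radius \<open>\<delta>\<close>.\<close>
    define tm where "tm = min ((1 - r\<^sup>2) / 144) (\<delta>\<^sup>2 * (1 - r) / (200 * K\<^sup>2))"
    have tm: "tm > 0" using r2 r \<delta>(1) K0 by (auto simp: tm_def)
    define \<rho> where "\<rho> = min (\<delta> / (4 * K2)) (tm / (2 * (K + 1)))"
    have \<rho>: "\<rho> > 0" "K2 * \<rho> \<le> \<delta> / 4" "2 * (K + 1) * \<rho> \<le> tm"
    proof -
      show "\<rho> > 0" using \<delta>(1) K2 tm K0 by (auto simp: \<rho>_def)
      have "K2 * \<rho> \<le> K2 * (\<delta> / (4 * K2))" using K2 unfolding \<rho>_def by (intro mult_left_mono) auto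
      then show "K2 * \<rho> \<le> \<delta> / 4" using K2 by simp
      have "2 * (K + 1) * \<rho> \<le> 2 * (K + 1) * (tm / (2 * (K + 1)))" using K0 unfolding \<rho>_def by (intro mult_left_mono) auto
      then show "2 * (K + 1) * \<rho> \<le> tm" using K0 by simp
    qed
    have \<rho>\<delta>: "\<rho> < \<delta>"
    proof -
      have "1 * \<rho> \<le> K2 * \<rho>" using K2 \<rho>(1) by (intro mult_right_mono) auto
      then show ?thesis using \<rho>(2) \<delta>(1) by linarith
    qed
    define V where "V = {y \<in> W. \<kappa> y \<in> ball 0 \<rho>}"
    have V: "open V" "p \<in> V" unfolding V_def by (rule chart_open_preimage[OF ch open_ball]) (use p \<rho>(1) in simp)
    have "\<exists>\<sigma> \<theta>. squeezing \<A> T r x (\<Omega> \<inter> N) \<sigma> \<theta>" if x: "x \<in> \<Omega> \<inter> V" for x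
    proof -
      have xW: "x \<in> W" "x \<in> \<Omega>" "norm (\<kappa> x) < \<rho>" using x by (auto simp: V_def)
      \<comment> \<open>Going down by \<open>t1\<close> lowers \<open>Re (mu + \<nu>)\<close>, taken
        with the tilt at \<open>p\<close>, at least by \<open>(K + 1) * \<rho>\<close>, its largest
        possible value at the start. So the end point violates the outer pinching at
        \<open>p\<close> and lies outside \<open>\<Omega>\<close>.\<close>
      define t1 where "t1 = 2 * (K + 1) * \<rho>"
      have t1: "0 \<le> t1" using K0 \<rho>(1) by (simp add: t1_def)
      have seg\<delta>: "norm (\<kappa> x - s *\<^sub>R e) < \<delta> / 2" if "0 \<le> s" "s \<le> t1" for s
      proof -
        have "norm (\<kappa> x - s *\<^sub>R e) \<le> norm (\<kappa> x) + s * norm e"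
          using norm_triangle_ineq4[of "\<kappa> x" "s *\<^sub>R e"] that by simp
        also have "\<dots> \<le> \<rho> + t1 * K" using xW that Ke t1 by (intro add_mono mult_mono) auto
        also have "\<dots> = K2 * \<rho>" by (simp add: K2_def t1_def algebra_simps)
        finally show ?thesis using \<rho>(2) \<delta>(1) by linarith
      qed
      then have seg: "\<kappa> x - s *\<^sub>R e \<in> \<kappa> ` W" if "0 \<le> s" "s \<le> t1" for s
        using \<delta>(1,2) that by (force simp: subset_iff)
      have out: "inv_into W \<kappa> (\<kappa> x - t1 *\<^sub>R e) \<notin> \<Omega>"
      proof
        define y where "y = inv_into W \<kappa> (\<kappa> x - t1 *\<^sub>R e)"
        assume "inv_into W \<kappa> (\<kappa> x - t1 *\<^sub>R e) \<in> \<Omega>"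
        then have y\<Omega>: "y \<in> \<Omega>" by (simp add: y_def)
        have y: "y \<in> W" "\<kappa> y = \<kappa> x - t1 *\<^sub>R e"
          unfolding y_def using inv_into_into[OF seg[OF t1]] f_inv_into_f[OF seg[OF t1]] by auto
        have "norm (\<kappa> p) < \<delta>" using \<delta>(1) p by simp
        then obtain \<nu> where \<nu>: "cblinear \<nu>" "\<forall>v. cmod (\<nu> v) \<le> \<epsilon>0 * norm v" and
          "\<forall>y\<in>W. norm (\<kappa> y) < \<delta> \<longrightarrow> y \<in> \<Omega> \<longrightarrow> (1 - \<epsilon>0) * (norm (T (\<kappa> y - \<kappa> p)))\<^sup>2 < 2 * Re (mu (\<kappa> y - \<kappa> p) + \<nu> (\<kappa> y - \<kappa> p))"
          using P[rule_format, OF p'] by blast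
        moreover have "norm (\<kappa> y) < \<delta>" unfolding y(2) using seg\<delta>[OF t1] \<delta>(1) by simp
        ultimately have "(1 - \<epsilon>0) * (norm (T (\<kappa> y)))\<^sup>2 < 2 * Re (mu (\<kappa> y) + \<nu> (\<kappa> y))" using y(1) y\<Omega> p(2) by simp
        moreover have "0 \<le> (1 - \<epsilon>0) * (norm (T (\<kappa> y)))\<^sup>2" using \<open>\<epsilon>0 \<le> 1\<close> by simp
        ultimately have pos: "0 < Re (mu (\<kappa> y) + \<nu> (\<kappa> y))" by linarith
        have "mu (\<kappa> y) + \<nu> (\<kappa> y) = mu (\<kappa> x) + \<nu> (\<kappa> x) - of_real t1 * (1 + \<nu> e)"
          unfolding y(2) by (simp add: cblinear_diff[OF mu(1)] cblinear_diff[OF \<nu>(1)] cblinear_scaleR[OF mu(1)]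
              cblinear_scaleR[OF \<nu>(1)] mu(2) scaleR_conv_of_real algebra_simps)
        then have "Re (mu (\<kappa> y) + \<nu> (\<kappa> y)) = Re (mu (\<kappa> x)) + Re (\<nu> (\<kappa> x)) - t1 * (1 + Re (\<nu> e))" by simp
        also have "\<dots> \<le> K * \<rho> + 1 * \<rho> - t1 * (1 / 2)"
        proof (intro diff_mono add_mono mult_left_mono t1)
          have "Re (mu (\<kappa> x)) \<le> K * norm (\<kappa> x)" using Kmu[of "\<kappa> x"] complex_Re_le_cmod order_trans by blast
          also have "\<dots> \<le> K * \<rho>" using xW K0 by (intro mult_left_mono) auto
          finally show "Re (mu (\<kappa> x)) \<le> K * \<rho>" .
          have "Re (\<nu> (\<kappa> x)) \<le> \<epsilon>0 * norm (\<kappa> x)" using \<nu>(2) complex_Re_le_cmod order_trans by blast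
          also have "\<dots> \<le> 1 * \<rho>" using xW \<open>\<epsilon>0 \<le> 1\<close> \<epsilon>0 by (intro mult_mono) auto
          finally show "Re (\<nu> (\<kappa> x)) \<le> 1 * \<rho>" .
          show "1 / 2 \<le> 1 + Re (\<nu> e)" using small[OF \<nu>(2)] abs_Re_le_cmod[of "\<nu> e"] by linarith
        qed
        also have "\<dots> = 0" by (simp add: t1_def algebra_simps)
        finally show False using pos by simp
      qed
      obtain b' t where b': "b' \<in> frontier \<Omega>" "b' \<in> W" and t: "0 < t" "t \<le> t1" and b: "\<kappa> b' = \<kappa> x - t *\<^sub>R e"
        by (rule frontier_on_segment[OF ch xW(1,2) \<Omega> seg t1 out])
      have b\<delta>: "norm (\<kappa> b') < \<delta> / 2" unfolding b using seg\<delta> t by simp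
      have "norm (\<kappa> b') < \<delta>" using b\<delta> \<delta>(1) by linarith
      then obtain \<nu> where \<nu>: "cblinear \<nu>" "\<forall>v. cmod (\<nu> v) \<le> \<epsilon>0 * norm v" and
        inner: "\<And>y. y \<in> W \<Longrightarrow> norm (\<kappa> y) < \<delta> \<Longrightarrow>
          (1 + \<epsilon>0) * (norm (T (\<kappa> y - \<kappa> b')))\<^sup>2 < 2 * Re (mu (\<kappa> y - \<kappa> b') + \<nu> (\<kappa> y - \<kappa> b')) \<Longrightarrow> y \<in> \<Omega>" and
        outer: "\<And>y. y \<in> W \<Longrightarrow> norm (\<kappa> y) < \<delta> \<Longrightarrow> y \<in> \<Omega> \<Longrightarrow>
          (1 - \<epsilon>0) * (norm (T (\<kappa> y - \<kappa> b')))\<^sup>2 < 2 * Re (mu (\<kappa> y - \<kappa> b') + \<nu> (\<kappa> y - \<kappa> b'))"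
        using P[rule_format, of b'] b' by blast
      have t_small: "t < (1 - r\<^sup>2) / 72" "t \<le> \<delta>\<^sup>2 * (1 - r) / (200 * K\<^sup>2)"
      proof -
        define u where "u = 1 - r\<^sup>2"
        have "t \<le> tm" using t(2) \<rho>(3) unfolding t1_def by linarith
        moreover have "tm \<le> u / 144" "tm \<le> \<delta>\<^sup>2 * (1 - r) / (200 * K\<^sup>2)" unfolding tm_def u_def by (rule min.cobounded1, rule min.cobounded2)
        moreover have "u > 0" using r2(1) by (simp add: u_def)
        ultimately show "t < u / 72" "t \<le> \<delta>\<^sup>2 * (1 - r) / (200 * K\<^sup>2)" by linarith+
      qed
      have \<nu>e: "cmod (\<nu> e) \<le> 1 / 2" using small[OF \<nu>(2)] by simp
      define B where "B = {w. (1 - \<epsilon>) * (norm (T ((w - \<kappa> b') + \<nu> (w - \<kappa> b') *\<^sub>C e)))\<^sup>2 < 2 * Re (mu ((w - \<kappa> b') + \<nu> (w - \<kappa> b') *\<^sub>C e))}"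
      from ball_squeeze[OF TS(1) mu \<nu>(1) \<nu>e Tn r \<epsilon>_def t(1) t_small(1), of "\<kappa> b'", folded B_def]
      obtain \<sigma> \<theta> where \<sigma>0: "\<sigma> (\<kappa> b' + t *\<^sub>R e) = 0"
        and \<sigma>: "cholomorphic_on \<sigma> B"
        and \<sigma>1: "\<forall>w\<in>B. norm (T (\<sigma> w)) < 1" and \<theta>: "cholomorphic_on \<theta> {y. norm (T y) < r}"
        and \<theta>1: "\<forall>y. norm (T y) < r \<longrightarrow> (1 + \<epsilon>) * (norm (T ((\<theta> y - \<kappa> b') + \<nu> (\<theta> y - \<kappa> b') *\<^sub>C e)))\<^sup>2 < 2 * Re (mu ((\<theta> y - \<kappa> b') + \<nu> (\<theta> y - \<kappa> b') *\<^sub>C e)) \<and>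
          (norm (T ((\<theta> y - \<kappa> b') + \<nu> (\<theta> y - \<kappa> b') *\<^sub>C e)))\<^sup>2 \<le> 6 * t / (1 - r) \<and> \<sigma> (\<theta> y) = y"
        and \<theta>\<sigma>: "\<forall>w\<in>B. norm (T (\<sigma> w)) < r \<longrightarrow> \<theta> (\<sigma> w) = w"
        by (elim exE conjE) (rule that)
      \<comment> \<open>Absorbs the tilt: \<open>mu \<circ> Q = mu + \<nu>\<close>, so in the
        coordinates \<open>Q\<close> the pinching balls have their normal in the standard
        direction.\<close>
      define Q where "Q v = v + \<nu> v *\<^sub>C e" for v
      have muQ: "mu (Q v) = mu v + \<nu> v" for v
        by (simp add: Q_def cblinear_add[OF mu(1)] cblinear_scaleC[OF mu(1)] mu(2))
      have QT: "\<bar>norm (T (Q v)) - norm (T v)\<bar> \<le> (\<epsilon> / 8) * norm (T v)" for v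
      proof -
        have "\<bar>norm (T (Q v)) - norm (T v)\<bar> \<le> norm (T (Q v) - T v)" by (rule norm_triangle_ineq3)
        also have "T (Q v) - T v = \<nu> v *\<^sub>C T e"
          by (simp add: Q_def cblinear_add[OF TS(1)] cblinear_scaleC[OF TS(1)])
        also have "norm (\<nu> v *\<^sub>C T e) = cmod (\<nu> v)" using \<open>norm (T e) = 1\<close> by simp
        also have "\<dots> \<le> \<epsilon>0 * norm v" using \<nu>(2) by simp
        also have "\<dots> \<le> \<epsilon>0 * (K * norm (T v))" using \<epsilon>0(1) by (intro mult_left_mono KT) auto
        also have "\<dots> = (\<epsilon> / 8) * norm (T v)" using \<epsilon>0(2) by (simp flip: mult.assoc)
        finally show ?thesis .
      qed
      have \<epsilon>1: "\<epsilon> \<le> 1" "0 \<le> \<epsilon> / 8" "\<epsilon> / 8 \<le> \<epsilon> / 8" using \<epsilon> by auto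
      note tilt = pinching_in_tilted_coordinates[OF \<epsilon>(1) \<epsilon>1 \<epsilon>0' norm_ge_zero norm_ge_zero QT]
      have oN: "open (\<Omega> \<inter> N)" using \<Omega> N by blast
      have inB: "\<kappa> y \<in> B" if y: "y \<in> \<Omega> \<inter> N" for y
        using outer[of y] tilt(1)[of "\<kappa> y - \<kappa> b'"] y unfolding B_def mem_Collect_eq Q_def[symmetric] muQ
        by (auto simp: N_def)
      define \<theta>' where "\<theta>' v = inv_into W \<kappa> (\<theta> v)" for v
      \<comment> \<open>The pinching only describes \<open>\<Omega>\<close> within coordinate norm
        \<open>\<delta>\<close>, so the inverse map must be seen to stay there before the inner
        inclusion may be used.\<close>
      have \<theta>N: "norm (\<theta> v) < \<delta>" if v: "norm (T v) < r" for v
      proof -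
        define w where "w = \<theta> v - \<kappa> b'"
        have "(norm w)\<^sup>2 \<le> (K * (2 * norm (T (Q w))))\<^sup>2"
          using KT[of w] tilt(3)[of w] K0 by (intro power_mono) (auto intro: order_trans mult_left_mono)
        also have "\<dots> = 4 * K\<^sup>2 * (norm (T (Q w)))\<^sup>2" by (simp add: power_mult_distrib)
        also have "\<dots> \<le> 4 * K\<^sup>2 * (6 * t / (1 - r))"
          using \<theta>1 v unfolding Q_def w_def by (intro mult_left_mono) auto
        also have "\<dots> \<le> 4 * K\<^sup>2 * (6 * (\<delta>\<^sup>2 * (1 - r) / (200 * K\<^sup>2)) / (1 - r))"
          using t_small(2) r by (intro mult_left_mono divide_right_mono) auto
        also have "\<dots> = 24 / 200 * \<delta>\<^sup>2" using r K0 by simp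
        also have "\<dots> < (\<delta> / 2)\<^sup>2" using \<delta>(1) by (simp add: power_divide)
        finally have "norm w < \<delta> / 2" using \<delta>(1) power_less_imp_less_base[of "norm w" 2 "\<delta> / 2"] by simp
        then show ?thesis using b\<delta> norm_triangle_ineq[of w "\<kappa> b'"] by (simp add: w_def)
      qed
      have \<theta>': "\<theta>' v \<in> W" "\<kappa> (\<theta>' v) = \<theta> v" if v: "norm (T v) < r" for v
      proof -
        have "\<theta> v \<in> \<kappa> ` W" using \<theta>N[OF v] \<delta>(2) by auto
        then show "\<theta>' v \<in> W" "\<kappa> (\<theta>' v) = \<theta> v" unfolding \<theta>'_def by (rule inv_into_into, rule f_inv_into_f)
      qed
      have \<theta>\<Omega>: "\<theta>' v \<in> \<Omega> \<inter> N" if v: "norm (T v) < r" for v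
      proof -
        have "(1 + \<epsilon>) * (norm (T (Q (\<theta> v - \<kappa> b'))))\<^sup>2 < 2 * Re (mu (Q (\<theta> v - \<kappa> b')))"
          using \<theta>1 v unfolding Q_def by blast
        then have "(1 + \<epsilon>0) * (norm (T (\<theta> v - \<kappa> b')))\<^sup>2 < 2 * Re (mu (\<theta> v - \<kappa> b') + \<nu> (\<theta> v - \<kappa> b'))"
          using tilt(2)[of "\<theta> v - \<kappa> b'"] unfolding muQ by linarith
        then have "\<theta>' v \<in> \<Omega>" using inner[of "\<theta>' v"] \<theta>'[OF v] \<theta>N[OF v] by simp
        then show ?thesis using \<theta>'[OF v] \<theta>N[OF v] by (simp add: N_def)
      qed
      have "squeezing \<A> T r x (\<Omega> \<inter> N) (\<lambda>y. \<sigma> (\<kappa> y)) \<theta>'"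
        unfolding squeezing_def
      proof (intro conjI ballI allI impI)
        show "holomorphic_map \<A> hilbert_atlas (\<lambda>y. \<sigma> (\<kappa> y)) (\<Omega> \<inter> N)"
        proof (rule holomorphic_map_compose[where f = \<kappa> and g = \<sigma> and T = B, OF A complex_manifold_hilbert_atlas _ _ oN])
          show "holomorphic_map \<A> hilbert_atlas \<kappa> (\<Omega> \<inter> N)"
            by (rule holomorphic_map_subset[OF holomorphic_chart_map[OF hc]]) (auto simp: N_def)
          show "holomorphic_map hilbert_atlas hilbert_atlas \<sigma> B" using \<sigma> by (simp only: holomorphic_map_hilbert_iff)
          show "\<kappa> ` (\<Omega> \<inter> N) \<subseteq> B" using inB by blast
        qed
        show "norm (T (\<sigma> (\<kappa> y))) < 1" if "y \<in> \<Omega> \<inter> N" for y using \<sigma>1 inB[OF that] by blast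
        show "\<sigma> (\<kappa> x) = 0" using \<sigma>0 b by simp
        show "holomorphic_map hilbert_atlas \<A> \<theta>' {v. norm (T v) < r}"
          unfolding \<theta>'_def
        proof (rule holomorphic_map_compose[where f = \<theta> and g = "inv_into W \<kappa>" and T = "\<kappa> ` W",
              OF complex_manifold_hilbert_atlas complex_manifold_hilbert_atlas _ holomorphic_chart_inv_map[OF hc] open_norm_cblinear_less[OF TS(1)]])
          show "holomorphic_map hilbert_atlas hilbert_atlas \<theta> {v. norm (T v) < r}" using \<theta> by (simp only: holomorphic_map_hilbert_iff)
          show "\<theta> ` {v. norm (T v) < r} \<subseteq> \<kappa> ` W" using \<theta>'(2) \<theta>'(1) by (metis (no_types, lifting) image_eqI image_subsetI mem_Collect_eq)
        qed
        show "\<theta>' v \<in> \<Omega> \<inter> N" if "norm (T v) < r" for v by (rule \<theta>\<Omega>[OF that])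
        show "\<sigma> (\<kappa> (\<theta>' v)) = v" if "norm (T v) < r" for v using \<theta>1 that \<theta>'(2)[OF that] by simp
        show "\<theta>' (\<sigma> (\<kappa> y)) = y" if "y \<in> \<Omega> \<inter> N" "norm (T (\<sigma> (\<kappa> y))) < r" for y
        proof -
          have "\<theta> (\<sigma> (\<kappa> y)) = \<kappa> y" using \<theta>\<sigma> inB[OF that(1)] that(2) by blast
          then show ?thesis unfolding \<theta>'_def using inj that(1) by (simp add: N_def inv_into_f_f)
        qed
      qed
      then show ?thesis by blast
    qed
    then show ?thesis using N V by blast
  qed
  ultimately show ?thesis using TS ST by blast
qed

text \<open>A stability version of the Schwarz lemma: if the derivative \<open>a\<close> has norm
  close to 1 then the map is close to \<open>z *\<^sub>C a\<close>. The component of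
  \<open>\<phi>\<close> along \<open>a\<close>, divided by the variable, has modulus at most 1 and
  value \<open>(norm a)\<^sup>2\<close> at 0, so Harnack applied to 1 minus this quotient controls
  the deviation.\<close>

lemma hilbert_near_linear:
  fixes \<phi> :: "complex \<Rightarrow> 'a::complex_hilbert_space"
  assumes \<phi>: "cholomorphic_on \<phi> (ball 0 1)" "\<phi> 0 = 0" "\<And>z. cmod z < 1 \<Longrightarrow> norm (\<phi> z) \<le> 1"
    and D: "(\<phi> has_derivative (\<lambda>c. c *\<^sub>C a)) (at 0)" and z: "cmod z < 1"
  shows "norm a \<le> 1" and "(1 - cmod z) * (norm (\<phi> z - z *\<^sub>C a))\<^sup>2 \<le> 2 * (1 + cmod z) * (1 - (norm a)\<^sup>2)"
proof -
  have S: "norm (\<phi> w) \<le> cmod w" if "cmod w < 1" for w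
    using Schwarz_hilbert[OF \<phi> that] by simp
  have "norm (1 *\<^sub>C a) \<le> 1"
  proof (rule derivative_norm_bound[OF D bounded_linear_ident zero_less_one])
    fix t :: real assume "0 < t" "t < 1"
    then show "norm (\<phi> (0 + t *\<^sub>R 1) - \<phi> 0) \<le> 1 * t" using S[of "of_real t"] \<phi>(2) by (simp add: scaleR_conv_of_real)
  qed
  then show a: "norm a \<le> 1" by simp
  define f where "f \<zeta> = cinner (\<phi> \<zeta>) a" for \<zeta>
  have f0: "f 0 = 0" by (simp add: f_def \<phi>(2) cblinear_zero[OF cblinear_cinner])
  have hf: "f holomorphic_on ball 0 1" unfolding f_def by (rule cholomorphic_cinner[OF \<phi>(1)])
  have "(f has_derivative (\<lambda>c. cinner (c *\<^sub>C a) a)) (at 0)"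
    unfolding f_def by (rule bounded_linear.has_derivative[OF cblinear_bounded[OF cblinear_cinner] D])
  then have "(f has_field_derivative cinner a a) (at 0)"
    by (simp add: has_field_derivative_def cinner_scaleC_left mult_commute_abs)
  then have df: "deriv f 0 = of_real ((norm a)\<^sup>2)" using DERIV_imp_deriv cinner_self by metis
  \<comment> \<open>Dividing out the zero at the origin gains one order over applying Harnack to
    \<open>f\<close> itself.\<close>
  define dd where "dd = divided_difference f 0"
  have fdd: "f \<zeta> = \<zeta> * dd \<zeta>" for \<zeta> by (simp add: dd_def divided_difference_def f0)
  have dd0: "dd 0 = of_real ((norm a)\<^sup>2)" by (simp add: dd_def divided_difference_def df)
  have hdd: "dd holomorphic_on ball 0 1" unfolding dd_def by (rule divided_difference_holomorphic[OF hf open_ball])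
  have pos: "Re (1 - dd \<zeta>) \<ge> 0" if "cmod \<zeta> < 1" for \<zeta>
  proof (cases "\<zeta> = 0")
    case True
    then show ?thesis using a by (simp add: dd0 power_le_one)
  next
    case False
    have "cmod \<zeta> * cmod (dd \<zeta>) \<le> norm (\<phi> \<zeta>) * norm a"
      using norm_cinner_le[of "\<phi> \<zeta>" a] fdd[of \<zeta>] by (simp add: f_def norm_mult)
    also have "\<dots> \<le> cmod \<zeta> * 1" using S[OF that] a by (intro mult_mono) auto
    finally have "cmod (dd \<zeta>) \<le> 1" using False by simp
    then show ?thesis using complex_Re_le_cmod[of "dd \<zeta>"] by simp
  qed
  have "(\<lambda>\<zeta>. 1 - dd \<zeta>) holomorphic_on ball 0 1" by (intro holomorphic_intros hdd)
  from Harnack(1)[OF this pos z] have H: "(1 - cmod z) * Re (1 - dd z) \<le> (1 + cmod z) * (1 - (norm a)\<^sup>2)"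
    by (simp add: dd0)
  have "(norm (\<phi> z - z *\<^sub>C a))\<^sup>2 = (norm (\<phi> z))\<^sup>2 + (cmod z)\<^sup>2 * (norm a)\<^sup>2 - 2 * Re (cinner (\<phi> z) (z *\<^sub>C a))"
  proof -
    have "(norm (u - v))\<^sup>2 = (norm u)\<^sup>2 + (norm v)\<^sup>2 - 2 * Re (cinner u v)" for u v :: 'a
      by (simp add: power2_norm_eq_inner inner_diff_left inner_diff_right inner_commute flip: inner_eq_Re_cinner)
    then show ?thesis by (simp only: norm_scaleC power_mult_distrib)
  qed
  also have "cinner (\<phi> z) (z *\<^sub>C a) = of_real ((cmod z)\<^sup>2) * dd z"
    unfolding complex_norm_square using fdd[of z] by (simp add: cinner_scaleC_right f_def mult_ac)
  also have "Re (of_real ((cmod z)\<^sup>2) * dd z) = (cmod z)\<^sup>2 * Re (dd z)" by simp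
  also have "(norm (\<phi> z))\<^sup>2 + (cmod z)\<^sup>2 * (norm a)\<^sup>2 - 2 * ((cmod z)\<^sup>2 * Re (dd z)) \<le> (cmod z)\<^sup>2 * (2 * Re (1 - dd z))"
  proof -
    have "(norm (\<phi> z))\<^sup>2 \<le> (cmod z)\<^sup>2" using S[OF z] by (intro power_mono) auto
    moreover have "(cmod z)\<^sup>2 * (norm a)\<^sup>2 \<le> (cmod z)\<^sup>2 * 1" using a by (intro mult_left_mono) (auto simp: power_le_one)
    moreover have "(cmod z)\<^sup>2 * (2 * Re (1 - dd z)) = 2 * (cmod z)\<^sup>2 - 2 * ((cmod z)\<^sup>2 * Re (dd z))"
      by (simp add: algebra_simps)
    ultimately show ?thesis by linarith
  qed
  also have "\<dots> \<le> 1 * (2 * Re (1 - dd z))" using pos[OF z] z by (intro mult_right_mono) (auto simp: power_le_one)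
  finally have "(1 - cmod z) * (norm (\<phi> z - z *\<^sub>C a))\<^sup>2 \<le> (1 - cmod z) * (2 * Re (1 - dd z))"
    using z by (intro mult_left_mono) auto
  also have "\<dots> = 2 * ((1 - cmod z) * Re (1 - dd z))" by simp
  also have "\<dots> \<le> 2 * ((1 + cmod z) * (1 - (norm a)\<^sup>2))" using H by simp
  finally show "(1 - cmod z) * (norm (\<phi> z - z *\<^sub>C a))\<^sup>2 \<le> 2 * (1 + cmod z) * (1 - (norm a)\<^sup>2)" by (simp only: mult.assoc)
qed

section \<open>Pulling the squeezing back along the automorphisms\<close>

lemma squeezing_pullback:
  assumes A: "complex_manifold \<A>" and T: "cblinear T" and sq: "squeezing \<A> T r x D \<sigma> \<theta>" and D: "D \<subseteq> \<Omega>" "open D'"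
    and \<phi>: "holomorphic_map \<A> \<A> \<phi> \<Omega>" "\<phi> q = x" and \<eta>: "holomorphic_map \<A> \<A> \<eta> \<Omega>" "\<And>y. y \<in> \<Omega> \<Longrightarrow> \<eta> y \<in> \<Omega>"
    and inv: "\<And>y. y \<in> \<Omega> \<Longrightarrow> \<eta> (\<phi> y) = y" "\<And>y. y \<in> \<Omega> \<Longrightarrow> \<phi> (\<eta> y) = y"
    and D': "D' = {y \<in> \<Omega>. \<phi> y \<in> D}"
  shows "squeezing \<A> T r q D' (\<lambda>y. \<sigma> (\<phi> y)) (\<lambda>v. \<eta> (\<theta> v))"
proof -
  note sq' = sq[unfolded squeezing_def]
  have \<theta>: "\<theta> v \<in> D" "\<sigma> (\<theta> v) = v" if "norm (T v) < r" for v using sq' that by blast+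
  have "holomorphic_map \<A> hilbert_atlas (\<lambda>y. \<sigma> (\<phi> y)) D'"
  proof (rule holomorphic_map_compose[where f = \<phi> and g = \<sigma> and T = D, OF A A _ _ D(2)])
    show "holomorphic_map \<A> \<A> \<phi> D'" by (rule holomorphic_map_subset[OF \<phi>(1)]) (auto simp: D')
    show "holomorphic_map \<A> hilbert_atlas \<sigma> D" using sq' by blast
  qed (auto simp: D')
  moreover have "holomorphic_map hilbert_atlas \<A> (\<lambda>v. \<eta> (\<theta> v)) {v. norm (T v) < r}"
  proof (rule holomorphic_map_compose[where f = \<theta> and g = \<eta> and T = \<Omega>,
        OF complex_manifold_hilbert_atlas A _ \<eta>(1) open_norm_cblinear_less[OF T]])
    show "holomorphic_map hilbert_atlas \<A> \<theta> {v. norm (T v) < r}" using sq' by blast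
    show "\<theta> ` {v. norm (T v) < r} \<subseteq> \<Omega>" using \<theta>(1) D by blast
  qed
  moreover have "\<eta> (\<theta> v) \<in> D' \<and> \<sigma> (\<phi> (\<eta> (\<theta> v))) = v" if "norm (T v) < r" for v
    using \<theta>[OF that] \<eta>(2) inv(2) D(1) by (auto simp: D')
  moreover have "norm (T (\<sigma> (\<phi> y))) < 1" if "y \<in> D'" for y using sq' that by (simp add: D')
  moreover have "\<eta> (\<theta> (\<sigma> (\<phi> y))) = y" if "y \<in> D'" "norm (T (\<sigma> (\<phi> y))) < r" for y
    using sq' that inv(1) by (simp add: D')
  moreover have "\<sigma> (\<phi> q) = 0" using sq' \<phi>(2) by simp
  ultimately show ?thesis unfolding squeezing_def by blast
qed

text \<open>This stands in for containing a given compact set. The two parameters grow for different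
  uses: the radius makes the transition maps defined on almost the whole ball, and the chain length
  makes every point of \<open>\<Omega>\<close> belong to all later domains.\<close>

definition exhausts :: "('x::t2_space, 'e::complex_hilbert_space) chart set \<Rightarrow> 'x set \<Rightarrow> 'x \<Rightarrow> nat \<Rightarrow> real \<Rightarrow> 'x set \<Rightarrow> bool"
  where "exhausts \<A> \<Omega> q n r D \<longleftrightarrow> (\<forall>k\<le>n. \<forall>f \<zeta>. disc_in \<A> \<Omega> f \<longrightarrow> f 0 \<in> reach \<A> \<Omega> q k \<longrightarrow> cmod \<zeta> < r \<longrightarrow> f \<zeta> \<in> D)"

text \<open>An automorphism that moves \<open>q\<close> close to \<open>p\<close> moves the short
  chains from \<open>q\<close> and the discs attached to them into the neighbourhood where the
  squeezing maps live, by localisation. Pulling back that neighbourhood gives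
  \<open>D\<close>.\<close>

lemma squeezing_orbit_step:
  fixes \<A> :: "('x::t2_space, 'e::{complex_hilbert_space, second_countable_topology}) chart set"
  assumes A: "complex_manifold \<A>" and \<Omega>: "open \<Omega>" "q \<in> \<Omega>" and T: "cblinear T" and r: "0 < r" "r < 1"
    and loc: "\<theta>0 > 0" "localises \<A> \<Omega> p \<theta>0"
    and N: "open N" "p \<in> N" and V: "open V" "p \<in> V" "\<forall>x\<in>\<Omega> \<inter> V. \<exists>\<sigma> \<theta>. squeezing \<A> T r x (\<Omega> \<inter> N) \<sigma> \<theta>"
    and \<phi>: "\<And>j. \<phi> j \<in> Aut \<A> \<Omega>" and lim: "(\<lambda>j. \<phi> j q) \<longlonglongrightarrow> p"
  shows "\<exists>D G H. squeezing \<A> T r q D G H \<and> open D \<and> q \<in> D \<and> D \<subseteq> \<Omega> \<and> exhausts \<A> \<Omega> q n r D"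
proof -
  have "localises \<A> \<Omega> p r" by (rule localises_all[OF A loc r])
  with N obtain V1 where V1: "open V1" "p \<in> V1"
    "\<And>f \<zeta>. disc_in \<A> \<Omega> f \<Longrightarrow> f 0 \<in> V1 \<Longrightarrow> cmod \<zeta> < r \<Longrightarrow> f \<zeta> \<in> N"
    unfolding localises_def by meson
  have "localises \<A> \<Omega> p (3 / 4)" by (rule localises_all[OF A loc]) auto
  from localises_reach[OF this] V1(1,2) have "\<exists>V. open V \<and> p \<in> V \<and> (\<forall>x\<in>V. reach \<A> \<Omega> x k \<subseteq> V1)" for k by blast
  then obtain V2 where V2: "\<And>k. open (V2 k)" "\<And>k. p \<in> V2 k" "\<And>k x. x \<in> V2 k \<Longrightarrow> reach \<A> \<Omega> x k \<subseteq> V1" by metis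
  \<comment> \<open>Only finitely many chain lengths are imposed at stage \<open>n\<close>, so the
    intersection is still open.\<close>
  have "open (N \<inter> V \<inter> (\<Inter>k\<le>n. V2 k))" using N V V2 by (intro open_Int open_INT) auto
  moreover have "p \<in> N \<inter> V \<inter> (\<Inter>k\<le>n. V2 k)" using N V V2 by blast
  ultimately have "\<forall>\<^sub>F j in sequentially. \<phi> j q \<in> N \<inter> V \<inter> (\<Inter>k\<le>n. V2 k)" using lim by (rule topological_tendstoD[rotated])
  then obtain j where j: "\<phi> j q \<in> N" "\<phi> j q \<in> V" "\<And>k. k \<le> n \<Longrightarrow> \<phi> j q \<in> V2 k"
    unfolding eventually_sequentially by blast
  define \<psi> where "\<psi> = \<phi> j"
  define \<eta> where "\<eta> = inv_into \<Omega> \<psi>"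
  have bi: "biholomorphism \<A> \<Omega> \<A> \<Omega> \<psi>" using \<phi>[of j] by (simp add: Aut_def \<psi>_def)
  then have bij: "bij_betw \<psi> \<Omega> \<Omega>" and \<psi>: "holomorphic_map \<A> \<A> \<psi> \<Omega>" and \<eta>: "holomorphic_map \<A> \<A> \<eta> \<Omega>"
    by (simp_all add: biholomorphism_def \<eta>_def)
  have \<eta>\<Omega>: "\<eta> y \<in> \<Omega>" "\<psi> (\<eta> y) = y" "\<psi> y \<in> \<Omega>" "\<eta> (\<psi> y) = y" if "y \<in> \<Omega>" for y
    using that bij unfolding \<eta>_def bij_betw_def by (auto simp: inv_into_into f_inv_into_f)
  define D where "D = {y \<in> \<Omega>. \<psi> y \<in> \<Omega> \<inter> N}"
  have D: "D = \<Omega> \<inter> \<psi> -` N" using \<eta>\<Omega>(3) by (auto simp: D_def)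
  have oD: "open D" unfolding D by (rule continuous_open_preimage[OF holomorphic_mapD(1)[OF \<psi>] \<Omega>(1) N(1)])
  have "\<psi> q \<in> \<Omega> \<inter> V" using j \<eta>\<Omega>(3)[OF \<Omega>(2)] by (simp add: \<psi>_def)
  with V(3) obtain \<sigma> \<theta> where sq: "squeezing \<A> T r (\<psi> q) (\<Omega> \<inter> N) \<sigma> \<theta>" by blast
  have "squeezing \<A> T r q D (\<lambda>y. \<sigma> (\<psi> y)) (\<lambda>v. \<eta> (\<theta> v))"
    by (rule squeezing_pullback[OF A T sq _ oD \<psi> refl \<eta> \<eta>\<Omega>(1,4,2) D_def]) auto
  moreover have "q \<in> D" using j \<Omega>(2) by (simp add: D \<psi>_def)
  moreover have "exhausts \<A> \<Omega> q n r D"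
    unfolding exhausts_def
  proof (intro allI impI)
    fix k f \<zeta> assume k: "k \<le> n" and f: "disc_in \<A> \<Omega> f" "f 0 \<in> reach \<A> \<Omega> q k" "cmod \<zeta> < r"
    have \<psi>': "\<psi> ` \<Omega> \<subseteq> \<Omega>" using \<eta>\<Omega>(3) by blast
    have "\<psi> (f 0) \<in> reach \<A> \<Omega> (\<psi> q) k" by (rule reach_compose[OF A \<psi> \<psi>' f(2)])
    then have "\<psi> (f 0) \<in> V1" using V2(3)[OF j(3)[OF k]] by (auto simp: \<psi>_def)
    moreover have "disc_in \<A> \<Omega> (\<lambda>\<zeta>. \<psi> (f \<zeta>))" by (rule disc_in_compose[OF A A f(1) \<psi> \<psi>'])
    ultimately have "\<psi> (f \<zeta>) \<in> N" using V1(3)[of "\<lambda>\<zeta>. \<psi> (f \<zeta>)" \<zeta>] f(3) by blast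
    moreover have "\<zeta> \<in> ball 0 1" using f(3) r by simp
    then have "f \<zeta> \<in> \<Omega>" using f(1) unfolding disc_in_def by blast
    ultimately show "f \<zeta> \<in> D" by (simp add: D)
  qed
  moreover have "D \<subseteq> \<Omega>" by (auto simp: D)
  ultimately show ?thesis using oD by blast
qed

theorem squeezing_sequence:
  fixes \<A> :: "('x::t2_space, 'e::{complex_hilbert_space, second_countable_topology}) chart set"
  assumes A: "complex_manifold \<A>" and \<Omega>: "open \<Omega>" "q \<in> \<Omega>" and pf: "p \<in> frontier \<Omega>"
    and spc: "strongly_pseudoconvex_at \<A> \<Omega> p" and \<phi>: "\<And>j. \<phi> j \<in> Aut \<A> \<Omega>" and lim: "(\<lambda>j. \<phi> j q) \<longlonglongrightarrow> p"
  shows "\<exists>(T :: 'e \<Rightarrow> ell2) S r D G H. cblinear T \<and> cblinear S \<and> (\<forall>x. S (T x) = x) \<and>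
    (\<forall>n. 3 / 4 \<le> r n \<and> r n < 1) \<and> r \<longlonglongrightarrow> 1 \<and> (\<forall>n. squeezing \<A> T (r n) q (D n) (G n) (H n)) \<and>
    (\<forall>n::nat. open (D n) \<and> q \<in> D n \<and> D n \<subseteq> \<Omega> \<and> exhausts \<A> \<Omega> q n (r n) (D n))"
proof -
  from strongly_pseudoconvex_squeezing[OF A spc pf \<Omega>(1)]
  obtain \<theta>0 and T :: "'e \<Rightarrow> ell2" and S where loc: "\<theta>0 > 0" "localises \<A> \<Omega> p \<theta>0" and T: "cblinear T" "cblinear S" "\<forall>x. S (T x) = x"
    and sq: "\<forall>r. 0 < r \<longrightarrow> r < 1 \<longrightarrow> (\<exists>N V. open N \<and> p \<in> N \<and> open V \<and> p \<in> V \<and>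
      (\<forall>x\<in>\<Omega> \<inter> V. \<exists>\<sigma> \<theta>. squeezing \<A> T r x (\<Omega> \<inter> N) \<sigma> \<theta>))" by (elim exE conjE) (rule that)
  \<comment> \<open>The shift by 4 makes every radius at least 3/4, so that a disc restricted to
    this radius and rescaled still has its link parameter at modulus at most 2/3.\<close>
  define r where "r n = 1 - 1 / real (n + 4)" for n
  have r: "3 / 4 \<le> r n" "r n < 1" for n by (auto simp: r_def field_simps)
  have "(\<lambda>n. 1 - 1 / real (n + 4)) \<longlonglongrightarrow> 1 - 0"
    by (intro tendsto_diff tendsto_const LIMSEQ_ignore_initial_segment[OF lim_1_over_n])
  then have r1: "r \<longlonglongrightarrow> 1" by (simp add: r_def[abs_def])
  have "\<exists>D G H. squeezing \<A> T (r n) q D G H \<and> open D \<and> q \<in> D \<and> D \<subseteq> \<Omega> \<and> exhausts \<A> \<Omega> q n (r n) D" for n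
  proof -
    have r0: "0 < r n" using r(1)[of n] by linarith
    from sq[rule_format, OF this r(2)] obtain N V where NV: "open N" "p \<in> N" "open V" "p \<in> V"
      "\<forall>x\<in>\<Omega> \<inter> V. \<exists>\<sigma> \<theta>. squeezing \<A> T (r n) x (\<Omega> \<inter> N) \<sigma> \<theta>" by (elim exE conjE) (rule that)
    show ?thesis by (rule squeezing_orbit_step[OF A \<Omega> T(1) r0 r(2) loc NV \<phi> lim])
  qed
  then obtain D G H where "\<And>n. squeezing \<A> T (r n) q (D n) (G n) (H n)" "\<And>n. open (D n)" "\<And>n. q \<in> D n" "\<And>n. D n \<subseteq> \<Omega>"
    "\<And>n. exhausts \<A> \<Omega> q n (r n) (D n)" by metis
  then show ?thesis using T r r1
    by (intro exI[of _ T] exI[of _ S] exI[of _ r] exI[of _ D] exI[of _ G] exI[of _ H]) simp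
qed

section \<open>Transition maps between the squeezing maps\<close>

locale squeezed =
  fixes \<A> :: "('x::t2_space, 'e::{complex_hilbert_space, second_countable_topology}) chart set"
    and \<Omega> :: "'x set" and q :: 'x and T :: "'e \<Rightarrow> ell2" and S :: "ell2 \<Rightarrow> 'e"
    and r :: "nat \<Rightarrow> real" and D :: "nat \<Rightarrow> 'x set" and G :: "nat \<Rightarrow> 'x \<Rightarrow> 'e" and H :: "nat \<Rightarrow> 'e \<Rightarrow> 'x"
  assumes A: "complex_manifold \<A>" and \<Omega>: "open \<Omega>" "connected \<Omega>" "q \<in> \<Omega>"
    and T: "cblinear T" and S: "cblinear S" and ST: "S (T x) = x"
    and r: "3 / 4 \<le> r n" "r n < 1" and r_lim: "r \<longlonglongrightarrow> 1"
    and squeezing: "squeezing \<A> T (r n) q (D n) (G n) (H n)"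
    and D: "open (D n)" "q \<in> D n" "D n \<subseteq> \<Omega>" and exhausts: "exhausts \<A> \<Omega> q n (r n) (D n)"
begin

lemma r_pos: "0 < r n" using r(1)[of n] by linarith

lemma rr: "9 / 16 \<le> r j * r k" "r j * r k < 1" "r j * r k < r j" "r j * r k < r k" "0 < r j * r k"
proof -
  have "3 / 4 * (3 / 4) \<le> r j * r k" using r(1)[of j] r(1)[of k] by (intro mult_mono) auto
  then show "9 / 16 \<le> r j * r k" by simp
  show 1: "r j * r k < r j" "r j * r k < r k"
    using mult_strict_left_mono[OF r(2)[of k] r_pos[of j]] mult_strict_right_mono[OF r(2)[of j] r_pos[of k]] by simp_all
  then show "r j * r k < 1" using r(2)[of j] by linarith
  show "0 < r j * r k" by (intro mult_pos_pos r_pos)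
qed

lemma rr_close: "e > 0 \<Longrightarrow> \<exists>M. \<forall>m\<ge>M. \<forall>n\<ge>M. 1 - r m * r n < e"
proof -
  assume "e > 0"
  then obtain M where M: "\<And>n. n \<ge> M \<Longrightarrow> \<bar>r n - 1\<bar> < e / 2"
    using LIMSEQ_D[OF r_lim, of "e / 2"] by auto
  have "1 - r m * r n < e" if "m \<ge> M" "n \<ge> M" for m n
  proof -
    have "0 \<le> (1 - r m) * (1 - r n)" using r(2)[of m] r(2)[of n] by simp
    then have "1 - r m * r n \<le> (1 - r m) + (1 - r n)" by (simp add: algebra_simps)
    then show ?thesis using M[OF that(1)] M[OF that(2)] by linarith
  qed
  then show ?thesis by blast
qed

lemma G_hol: "holomorphic_map \<A> hilbert_atlas (G n) (D n)"
  and G_less: "y \<in> D n \<Longrightarrow> norm (T (G n y)) < 1"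
  and G_q: "G n q = 0"
  and H_hol: "holomorphic_map hilbert_atlas \<A> (H n) {v. norm (T v) < r n}"
  and H_D: "norm (T v) < r n \<Longrightarrow> H n v \<in> D n"
  and G_H: "norm (T v) < r n \<Longrightarrow> G n (H n v) = v"
  and H_G: "y \<in> D n \<Longrightarrow> norm (T (G n y)) < r n \<Longrightarrow> H n (G n y) = y"
  using squeezing[of n] unfolding squeezing_def by blast+

lemma T0: "norm (T 0) = 0" by (simp add: cblinear_zero[OF T])

lemma H_0: "H n 0 = q"
  using H_G[OF D(2)[of n]] r_pos[of n] by (simp add: G_q T0)

text \<open>Along a complex line, \<open>H j\<close> is an analytic disc in \<open>\<Omega>\<close>
  centred at \<open>q\<close>, so \<open>exhausts\<close> for \<open>D k\<close> with chains of
  length 0 covers the part of radius less than \<open>r k\<close>. This makes the transition maps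
  defined on almost the whole ball.\<close>

lemma H_in_D:
  assumes v: "norm (T v) < r j * r k"
  shows "H j v \<in> D k"
proof -
  have "norm (T v) / r j < r k" using v r_pos[of j] by (simp add: pos_divide_less_eq mult.commute)
  \<comment> \<open>Room on both sides: dividing \<open>v\<close> by \<open>\<rho>\<close> keeps the
    whole disc in the domain of \<open>H j\<close>, while the parameter \<open>\<rho>\<close> is
    below \<open>r k\<close>.\<close>
  then obtain \<rho> where \<rho>: "norm (T v) / r j < \<rho>" "\<rho> < r k" using dense by blast
  have \<rho>0: "\<rho> > 0" using \<rho>(1) r_pos[of j] by (smt (verit) divide_nonneg_pos norm_ge_zero)
  define v' where "v' = (1 / \<rho>) *\<^sub>R v"
  have "norm (T v) < \<rho> * r j" using \<rho>(1) r_pos[of j] by (simp add: pos_divide_less_eq)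
  then have Tv': "norm (T v') < r j" using \<rho>0 by (simp add: v'_def cblinear_scaleR[OF T] pos_divide_less_eq mult.commute)
  have "disc_in \<A> \<Omega> (\<lambda>\<zeta>. H j (\<zeta> *\<^sub>C v'))"
  proof (rule disc_in_hilbert[where k = "\<lambda>\<zeta>. \<zeta> *\<^sub>C v'", OF A H_hol])
    show "H j ` {v. norm (T v) < r j} \<subseteq> \<Omega>" using H_D D(3) by blast
    show "cholomorphic_on (\<lambda>\<zeta>. \<zeta> *\<^sub>C v') (ball 0 1)" by (rule cholomorphic_on_cblinear[OF cblinear_scaleC_left])
    show "(\<lambda>\<zeta>. \<zeta> *\<^sub>C v') ` ball 0 1 \<subseteq> {v. norm (T v) < r j}"
    proof (intro image_subsetI CollectI)
      fix \<zeta> :: complex assume "\<zeta> \<in> ball 0 1"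
      then have "norm (T (\<zeta> *\<^sub>C v')) \<le> 1 * norm (T v')"
        unfolding cblinear_scaleC[OF T] norm_scaleC by (intro mult_right_mono) auto
      then show "norm (T (\<zeta> *\<^sub>C v')) < r j" using Tv' by simp
    qed
  qed
  moreover have "H j (0 *\<^sub>C v') \<in> reach \<A> \<Omega> q 0" using H_0[of j] by (simp add: cblinear_zero[OF cblinear_scaleC_left])
  moreover have "cmod (of_real \<rho>) < r k" using \<rho>(2) \<rho>0 by simp
  ultimately have "H j (of_real \<rho> *\<^sub>C v') \<in> D k"
    using exhausts[of k, unfolded exhausts_def, rule_format, of 0 "\<lambda>\<zeta>. H j (\<zeta> *\<^sub>C v')" "of_real \<rho>"] by blast
  then show ?thesis using \<rho>0 by (simp add: v'_def flip: scaleR_scaleC)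
qed

definition Psi :: "nat \<Rightarrow> nat \<Rightarrow> 'e \<Rightarrow> 'e" where "Psi k j v = G k (H j v)"

lemma Psi_hol: "cholomorphic_on (Psi k j) {v. norm (T v) < r j * r k}"
proof -
  have "holomorphic_map hilbert_atlas hilbert_atlas (\<lambda>v. G k (H j v)) {v. norm (T v) < r j * r k}"
  proof (rule holomorphic_map_compose[where f = "H j" and g = "G k" and T = "D k",
        OF complex_manifold_hilbert_atlas A _ G_hol open_norm_cblinear_less[OF T]])
    show "holomorphic_map hilbert_atlas \<A> (H j) {v. norm (T v) < r j * r k}"
      by (rule holomorphic_map_subset[OF H_hol]) (use rr(3)[of j k] in auto)
    show "H j ` {v. norm (T v) < r j * r k} \<subseteq> D k" using H_in_D by blast
  qed
  then show ?thesis by (simp add: holomorphic_map_hilbert_iff Psi_def[abs_def])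
qed

lemma Psi_0: "Psi k j 0 = 0" by (simp add: Psi_def H_0 G_q)

lemma Psi_less: "norm (T v) < r j * r k \<Longrightarrow> norm (T (Psi k j v)) < 1"
  unfolding Psi_def by (rule G_less[OF H_in_D])

lemma H_Psi: "norm (T v) < r j * r k \<Longrightarrow> norm (T (Psi k j v)) < r k \<Longrightarrow> H k (Psi k j v) = H j v"
  unfolding Psi_def by (rule H_G[OF H_in_D])

lemma norm_T_scaleC: "norm (T (\<zeta> *\<^sub>C v)) = cmod \<zeta> * norm (T v)"
  by (simp add: cblinear_scaleC[OF T])

lemma Psi_disc:
  assumes v: "norm (T v) \<le> r j * r k"
  defines "\<phi> \<equiv> \<lambda>\<zeta>. T (Psi k j (\<zeta> *\<^sub>C v))"
  shows "cholomorphic_on \<phi> (ball 0 1)" "\<phi> 0 = 0" "cmod z < 1 \<Longrightarrow> norm (\<phi> z) \<le> 1"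
proof -
  have less: "norm (T (\<zeta> *\<^sub>C v)) < r j * r k" if "cmod \<zeta> < 1" for \<zeta>
  proof (cases "norm (T v) = 0")
    case False
    then have "cmod \<zeta> * norm (T v) < 1 * norm (T v)" using that by (intro mult_strict_right_mono) auto
    then show ?thesis using v unfolding norm_T_scaleC by linarith
  qed (use rr(5)[of j k] in \<open>simp add: norm_T_scaleC\<close>)
  have "cholomorphic_on (\<lambda>\<zeta>. Psi k j (\<zeta> *\<^sub>C v)) (ball 0 1)"
    by (rule cholomorphic_on_compose[OF cholomorphic_on_cblinear[OF cblinear_scaleC_left] Psi_hol]) (use less in auto)
  then show "cholomorphic_on \<phi> (ball 0 1)" unfolding \<phi>_def by (rule cholomorphic_on_cblinear_compose[OF _ T])
  show "\<phi> 0 = 0" by (simp add: \<phi>_def Psi_0 cblinear_zero[OF T] cblinear_zero[OF cblinear_scaleC_left])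
  show "cmod z < 1 \<Longrightarrow> norm (\<phi> z) \<le> 1" unfolding \<phi>_def using Psi_less[OF less] by (simp add: less_imp_le)
qed

lemma T_inj: "norm (T v) = 0 \<longleftrightarrow> v = 0"
  using ST[of v] cblinear_zero[OF S] cblinear_zero[OF T] by (metis norm_eq_zero)

lemma scaleC_rescale: "a \<noteq> 0 \<Longrightarrow> s \<noteq> 0 \<Longrightarrow> of_real (a / s) *\<^sub>C of_real (s / a) *\<^sub>C v = (v :: 'e)"
proof -
  assume "a \<noteq> 0" "s \<noteq> 0"
  then have "complex_of_real (a / s) * of_real (s / a) = 1" by simp
  then show ?thesis by (simp only: scaleC_scaleC) simp
qed

text \<open>The Schwarz lemma on the complex line through \<open>v\<close>, after rescaling
  \<open>v\<close> to the sphere of radius \<open>r j * r k\<close>.\<close>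

lemma Psi_Schwarz:
  assumes v: "norm (T v) < r j * r k"
  shows "norm (T (Psi k j v)) * (r j * r k) \<le> norm (T v)"
proof (cases "v = 0")
  case False
  define s where "s = r j * r k"
  have a: "norm (T v) > 0" using False T_inj[of v] by simp
  have s: "s > 0" unfolding s_def by (rule rr(5))
  define w where "w = of_real (s / norm (T v)) *\<^sub>C v"
  have Tw: "norm (T w) = s" unfolding w_def norm_T_scaleC norm_of_real using a s by simp
  then have w: "norm (T w) \<le> r j * r k" by (simp add: s_def)
  have z: "of_real (norm (T v) / s) *\<^sub>C w = v" unfolding w_def by (rule scaleC_rescale) (use a s in auto)
  have cz: "cmod (of_real (norm (T v) / s)) = norm (T v) / s" unfolding norm_of_real using s by (simp only: abs_of_nonneg[OF divide_nonneg_pos[OF norm_ge_zero s]])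
  have vs: "norm (T v) < s" using v unfolding s_def .
  have "norm (T v) / s < 1" using vs s by (simp only: pos_divide_less_eq mult_1_left)
  then have lt: "cmod (of_real (norm (T v) / s)) < 1" unfolding cz .
  note SS = Schwarz_hilbert[OF Psi_disc(1)[OF w] Psi_disc(2)[OF w] Psi_disc(3)[OF w] lt]
  have "norm (T (Psi k j (of_real (norm (T v) / s) *\<^sub>C w))) * 1 \<le> 1 * cmod (of_real (norm (T v) / s))" by (rule SS)
  then show ?thesis unfolding z cz s_def[symmetric] using s by (simp only: mult_1_right mult_1_left pos_le_divide_eq)
qed (simp add: Psi_0 cblinear_zero[OF T])

end

section \<open>Linear parts of the transition maps\<close>

context squeezed
begin

definition E :: "nat \<Rightarrow> nat \<Rightarrow> 'e \<Rightarrow> 'e"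
  where "E k j = (SOME L. cblinear L \<and> (Psi k j has_derivative L) (at 0))"

lemma E: "cblinear (E k j)" "(Psi k j has_derivative E k j) (at 0)"
proof -
  have "0 \<in> {v. norm (T v) < r j * r k}" using rr(5)[of j k] T0 by simp
  from cholomorphic_on_openD[OF Psi_hol open_norm_cblinear_less[OF T] this]
  have "\<exists>L. cblinear L \<and> (Psi k j has_derivative L) (at 0)" by blast
  from someI_ex[OF this] show "cblinear (E k j)" "(Psi k j has_derivative E k j) (at 0)" unfolding E_def by blast+
qed

text \<open>Near the origin \<open>H k\<close> undoes \<open>G k\<close>, so the transition maps
  compose exactly there, and the chain rule gives the cocycle identity without any error
  term.\<close>

lemma E_comp: "E l k (E k j v) = E l j v"
proof -
  have "(Psi l k has_derivative E l k) (at (Psi k j 0))" unfolding Psi_0 by (rule E(2))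
  from has_derivative_compose[where f = "Psi k j" and g = "Psi l k", OF E(2) this]
  have 1: "((\<lambda>v. Psi l k (Psi k j v)) has_derivative (\<lambda>v. E l k (E k j v))) (at 0)" .
  \<comment> \<open>On this smaller ball the Schwarz lemma puts \<open>Psi k j v\<close> into the
    ball of radius \<open>r k\<close>, where \<open>H k\<close> inverts \<open>G k\<close>.\<close>
  have s: "r j * r k * r k < r j * r k" "0 < r j * r k * r k" using mult_strict_left_mono[OF r(2)[of k] rr(5)[of j k]] mult_pos_pos[OF rr(5)[of j k] r_pos[of k]] by simp_all
  have "(Psi l j has_derivative (\<lambda>v. E l k (E k j v))) (at 0)"
  proof (rule has_derivative_transform_within_open[OF 1 open_norm_cblinear_less[OF T, of "r j * r k * r k"]])
    show "0 \<in> {v. norm (T v) < r j * r k * r k}" using s T0 by simp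
    fix v assume "v \<in> {v. norm (T v) < r j * r k * r k}"
    then have v: "norm (T v) < r j * r k * r k" "norm (T v) < r j * r k" using s by auto
    have "norm (T (Psi k j v)) * (r j * r k) < r k * (r j * r k)" using Psi_Schwarz[OF v(2)] v(1) by (simp add: mult_ac)
    then have "norm (T (Psi k j v)) < r k" using rr(5)[of j k] by (simp only: mult_less_cancel_right_pos)
    from H_Psi[OF v(2) this] show "Psi l k (Psi k j v) = Psi l j v" by (simp add: Psi_def)
  qed
  from has_derivative_unique[OF this E(2)] show ?thesis by metis
qed

lemma E_self: "E j j v = v"
proof -
  have "((\<lambda>v. v) has_derivative E j j) (at 0)"
  proof (rule has_derivative_transform_within_open[OF E(2) open_norm_cblinear_less[OF T, of "r j"]])
    show "0 \<in> {v. norm (T v) < r j}" using r_pos[of j] T0 by simp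
  qed (simp add: Psi_def G_H)
  from has_derivative_unique[OF this has_derivative_ident] show ?thesis by metis
qed

lemma E_inverse: "E j k (E k j v) = v" by (simp add: E_comp E_self)

lemma Psi_disc_derivative:
  "((\<lambda>\<zeta>. T (Psi k j (\<zeta> *\<^sub>C v))) has_derivative (\<lambda>c. c *\<^sub>C T (E k j v))) (at 0)"
proof -
  have 0: "(0::complex) *\<^sub>C v = 0" by (rule cblinear_zero[OF cblinear_scaleC_left])
  have 1: "((\<lambda>\<zeta>. \<zeta> *\<^sub>C v) has_derivative (\<lambda>\<zeta>. \<zeta> *\<^sub>C v)) (at 0)"
    by (rule bounded_linear_imp_has_derivative[OF cblinear_bounded[OF cblinear_scaleC_left]])
  have "(Psi k j has_derivative E k j) (at (0 *\<^sub>C v))" unfolding 0 by (rule E(2))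
  from has_derivative_compose[where f = "\<lambda>\<zeta>. \<zeta> *\<^sub>C v" and g = "Psi k j", OF 1 this]
  have "((\<lambda>\<zeta>. Psi k j (\<zeta> *\<^sub>C v)) has_derivative (\<lambda>c. E k j (c *\<^sub>C v))) (at 0)" .
  from bounded_linear.has_derivative[OF cblinear_bounded[OF T] this]
  show ?thesis by (simp add: cblinear_scaleC[OF E(1)] cblinear_scaleC[OF T])
qed

lemma E_upper: "norm (T (E k j v)) * (r j * r k) \<le> norm (T v)"
proof (cases "v = 0")
  case False
  define s where "s = r j * r k"
  have a: "norm (T v) > 0" using False T_inj[of v] by simp
  have s: "s > 0" unfolding s_def by (rule rr(5))
  define w where "w = of_real (s / norm (T v)) *\<^sub>C v"
  have Tw: "norm (T w) = s" unfolding w_def norm_T_scaleC norm_of_real using a s by simp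
  then have w: "norm (T w) \<le> r j * r k" by (simp add: s_def)
  have "norm (T (E k j w)) \<le> 1"
    by (rule hilbert_near_linear(1)[OF Psi_disc(1,2,3)[OF w] Psi_disc_derivative, of 0]) auto
  then have "(s / norm (T v)) * norm (T (E k j v)) \<le> 1"
    unfolding w_def cblinear_scaleC[OF E(1)] norm_T_scaleC norm_of_real using a s by simp
  then have "s * norm (T (E k j v)) / norm (T v) \<le> 1" by (simp only: times_divide_eq_left)
  then have "s * norm (T (E k j v)) \<le> norm (T v)" using a by (simp only: pos_divide_le_eq mult_1_left)
  then show ?thesis unfolding s_def[symmetric] by (simp only: mult.commute[of s])
qed (simp add: cblinear_zero[OF E(1)] cblinear_zero[OF T])

text \<open>The upper bound for the inverse map: by the cocycle rule, \<open>E j k\<close> inverts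
  \<open>E k j\<close>. So these maps are nearly isometric for large indices.\<close>

lemma E_lower: "norm (T v) * (r j * r k) \<le> norm (T (E k j v))"
  using E_upper[of j k "E k j v"] unfolding E_inverse mult.commute[of "r k" "r j"] .

text \<open>On the line through \<open>y\<close>, rescaled to the sphere of radius
  \<open>s = r j * r k\<close>, the derivative is at least \<open>s\<^sup>2\<close> in norm by
  \<open>E_lower\<close>. The stability version of the Schwarz lemma then bounds the nonlinear
  part.\<close>

lemma Psi_near_linear:
  assumes y: "norm (T y) < r j * r k"
  shows "(r j * r k - norm (T y)) * (norm (T (Psi k j y - E k j y)))\<^sup>2 \<le> 4 * (1 - (r j * r k)^4)"
proof (cases "y = 0")
  case True
  have "(r j * r k)^4 \<le> 1" using rr(2,5)[of j k] by (intro power_le_one) auto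
  then show ?thesis using True by (simp add: Psi_0 cblinear_zero[OF E(1)] cblinear_zero[OF T])
next
  case False
  define s where "s = r j * r k"
  define a where "a = norm (T y)"
  have a: "a > 0" "a < s" using False T_inj[of y] y by (simp_all add: a_def s_def)
  have s: "s > 0" "s < 1" unfolding s_def by (rule rr(5), rule rr(2))
  define w where "w = of_real (s / a) *\<^sub>C y"
  have Tw: "norm (T w) = s" unfolding w_def norm_T_scaleC norm_of_real a_def[symmetric] using a s by simp
  then have w: "norm (T w) \<le> r j * r k" unfolding s_def by (rule eq_refl)
  define z where "z = complex_of_real (a / s)"
  have z: "z *\<^sub>C w = y" unfolding w_def z_def by (rule scaleC_rescale) (use a s in auto)
  have cz: "cmod z = a / s" unfolding z_def norm_of_real using a s by simp
  have z1: "cmod z < 1" unfolding cz using a s by simp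
  have "s * s \<le> norm (T (E k j w))" using E_lower[of w j k] unfolding Tw s_def[symmetric] .
  then have "(s * s)\<^sup>2 \<le> (norm (T (E k j w)))\<^sup>2" using s by (intro power_mono) auto
  then have s4: "1 - (norm (T (E k j w)))\<^sup>2 \<le> 1 - s^4" by (simp add: power2_eq_square power4_eq_xxxx mult_ac)
  have as1: "a / s \<le> 1" "0 \<le> a / s" using a s(1) by simp_all
  have s41: "s^4 \<le> 1" using s by (intro power_le_one) auto
  have "(1 - a / s) * (norm (T (Psi k j y) - z *\<^sub>C T (E k j w)))\<^sup>2 \<le> 2 * (1 + a / s) * (1 - (norm (T (E k j w)))\<^sup>2)"
    using hilbert_near_linear(2)[OF Psi_disc(1,2,3)[OF w] Psi_disc_derivative z1] unfolding z cz .
  also have "\<dots> \<le> 2 * (1 + a / s) * (1 - s^4)" by (rule mult_left_mono[OF s4]) (use as1 in simp)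
  also have "\<dots> \<le> 4 * (1 - s^4)" by (rule mult_right_mono) (use as1 s41 in simp_all)
  also have "z *\<^sub>C T (E k j w) = T (E k j y)" by (simp only: z cblinear_scaleC[OF T, symmetric] cblinear_scaleC[OF E(1), symmetric])
  finally have 1: "(1 - a / s) * (norm (T (Psi k j y - E k j y)))\<^sup>2 \<le> 4 * (1 - s^4)" by (simp only: cblinear_diff[OF T])
  have "s * (1 - a / s) = s - a" using s(1) by (simp add: right_diff_distrib)
  then have "(s - a) * (norm (T (Psi k j y - E k j y)))\<^sup>2 = s * ((1 - a / s) * (norm (T (Psi k j y - E k j y)))\<^sup>2)"
    by (simp only: mult.assoc[symmetric])
  also have "\<dots> \<le> 1 * (4 * (1 - s^4))"
  proof (rule mult_mono[OF less_imp_le[OF s(2)] 1 zero_le_one])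
    show "0 \<le> (1 - a / s) * (norm (T (Psi k j y - E k j y)))\<^sup>2" using as1(1) by (intro mult_nonneg_nonneg) simp_all
  qed
  finally show ?thesis unfolding mult_1_left s_def a_def .
qed

lemma transition_near_linear:
  assumes c: "0 \<le> c" "c < 1" and e: "e > 0"
  shows "\<exists>M. \<forall>j\<ge>M. \<forall>k\<ge>M. \<forall>y. norm (T y) \<le> c \<longrightarrow> norm (T y) < r j * r k \<and> norm (E 0 k (Psi k j y) - E 0 j y) \<le> e"
proof -
  obtain KS where KS: "KS > 0" "\<And>v. norm (S v) \<le> KS * norm v" using cblinear_bound[OF S] by blast
  \<comment> \<open>The first term keeps \<open>y\<close> at distance \<open>(1 - c) / 2\<close>
    from the sphere of radius \<open>r j * r k\<close>. The second makes
    \<open>16 * (1 - r j * r k)\<close> at most \<open>(1 - c) / 2\<close> times the square of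
    \<open>e / (2 * KS)\<close>, where the 2 accounts for \<open>E 0 k\<close> and \<open>KS\<close>
    for passing from \<open>T\<close> back to the norm.\<close>
  define d where "d = min ((1 - c) / 2) (e\<^sup>2 * (1 - c) / (128 * KS\<^sup>2))"
  have "(1 - c) / 2 > 0" "e\<^sup>2 * (1 - c) / (128 * KS\<^sup>2) > 0" using c e KS(1) by simp_all
  then have "d > 0" unfolding d_def by (rule min_less_iff_conj[THEN iffD2, OF conjI])
  have dle: "d \<le> (1 - c) / 2" "d \<le> e\<^sup>2 * (1 - c) / (128 * KS\<^sup>2)" unfolding d_def by (rule min.cobounded1, rule min.cobounded2)
  from rr_close[OF \<open>d > 0\<close>] obtain M where M: "\<And>j k. j \<ge> M \<Longrightarrow> k \<ge> M \<Longrightarrow> 1 - r j * r k < d" by blast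
  have "norm (T y) < r j * r k \<and> norm (E 0 k (Psi k j y) - E 0 j y) \<le> e"
    if jk: "j \<ge> M" "k \<ge> M" and y: "norm (T y) \<le> c" for j k y
  proof -
    define s where "s = r j * r k"
    have s: "0 < s" "s < 1" unfolding s_def by (rule rr(5), rule rr(2))
    have "1 - s < d" unfolding s_def by (rule M[OF jk])
    from less_le_trans[OF this dle(1)] less_le_trans[OF this dle(2)]
    have sd: "1 - s < (1 - c) / 2" "1 - s < e\<^sup>2 * (1 - c) / (128 * KS\<^sup>2)" .
    have sc: "(1 - c) / 2 \<le> s - norm (T y)" "norm (T y) < s" using sd(1) y c(2) by (simp_all add: field_simps)
    have ys: "norm (T y) < r j * r k" unfolding s_def[symmetric] by (rule sc(2))
    define n where "n = norm (T (Psi k j y - E k j y))"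
    have s4: "1 - s^4 \<le> 4 * (1 - s)"
    proof -
      have "1 - s^4 = (1 - s) * (1 + s + s\<^sup>2 + s^3)" by (simp add: power2_eq_square power3_eq_cube power4_eq_xxxx algebra_simps)
      also have "\<dots> \<le> (1 - s) * 4"
      proof (rule mult_left_mono)
        have "s\<^sup>2 \<le> 1" "s^3 \<le> 1" using s by (auto intro!: power_le_one)
        then show "1 + s + s\<^sup>2 + s^3 \<le> 4" using s by linarith
      qed (use s in auto)
      finally show ?thesis by simp
    qed
    have "(1 - c) / 2 * n\<^sup>2 \<le> (s - norm (T y)) * n\<^sup>2" by (rule mult_right_mono[OF sc(1)]) simp
    also have "\<dots> \<le> 4 * (1 - s^4)" unfolding s_def n_def by (rule Psi_near_linear[OF ys])
    also have "\<dots> \<le> 16 * (1 - s)" using s4 by (simp add: algebra_simps)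
    also have "\<dots> \<le> 16 * (e\<^sup>2 * (1 - c) / (128 * KS\<^sup>2))" by (rule mult_left_mono[OF less_imp_le[OF sd(2)]]) simp
    also have "\<dots> = (1 - c) / 2 * (e / (2 * KS))\<^sup>2" using KS(1) by (simp add: power_divide power_mult_distrib)
    finally have "n\<^sup>2 \<le> (e / (2 * KS))\<^sup>2" by (rule mult_left_le_imp_le) (use c in simp)
    then have n: "n \<le> e / (2 * KS)" by (rule power2_le_imp_le) (use e KS(1) in simp)
    define x where "x = E 0 k (Psi k j y - E k j y)"
    have "norm (T x) * (9 / 16) \<le> norm (T x) * (r k * r 0)" using rr(1)[of k 0] by (intro mult_left_mono) auto
    also have "\<dots> \<le> n" unfolding x_def n_def by (rule E_upper)
    finally have "norm (T x) \<le> 2 * n" using norm_ge_zero[of "T x"] by linarith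
    then have "KS * norm (T x) \<le> KS * (2 * (e / (2 * KS)))" using n KS(1) by (intro mult_left_mono) auto
    moreover have "KS * (2 * (e / (2 * KS))) = e" using KS(1) by simp
    ultimately have "norm x \<le> e" using KS(2)[of "T x"] unfolding ST by linarith
    moreover have "x = E 0 k (Psi k j y) - E 0 j y" by (simp add: x_def cblinear_diff[OF E(1)] E_comp)
    ultimately show ?thesis using ys by simp
  qed
  then show ?thesis by blast
qed

text \<open>\<open>G n\<close> normalised to have the same derivative at \<open>q\<close> as
  \<open>G 0\<close>. Comparing two of these maps then only involves the nonlinear part of a
  transition map.\<close>

definition g :: "nat \<Rightarrow> 'x \<Rightarrow> 'e" where "g n x = E 0 n (G n x)"

text \<open>Each link multiplies the distance to the sphere at least by 1/5: after rescaling to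
  radius \<open>r n\<close>, the parameter has modulus at most 2/3, and the Schwarz-Pick estimate
  gives the factor \<open>(1 - 2 / 3) / (1 + 2 / 3)\<close>. The bound is independent of
  \<open>n\<close>.\<close>

lemma G_bound: "x \<in> reach \<A> \<Omega> q k \<Longrightarrow> k \<le> n \<Longrightarrow> x \<in> D n \<and> norm (T (G n x)) \<le> 1 - (1 / 5) ^ k"
proof (induction k arbitrary: x)
  case 0
  then show ?case using D(2) by (simp add: G_q T0)
next
  case (Suc k)
  from Suc.prems(1) obtain f \<zeta> where f: "disc_in \<A> \<Omega> f" "f 0 \<in> reach \<A> \<Omega> q k" "cmod \<zeta> \<le> 1 / 2" and x: "x = f \<zeta>" by auto
  have kn: "k \<le> n" using Suc.prems(2) by simp
  have fD: "f \<xi> \<in> D n" if "cmod \<xi> < r n" for \<xi>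
    using exhausts[of n, unfolded exhausts_def, rule_format, OF kn f(1,2) that] .
  define F where "F z = T (G n (f (of_real (r n) * z)))" for z
  have rz: "cmod (of_real (r n) * z) < r n" if "cmod z < 1" for z
    using that r_pos[of n] by (simp add: norm_mult)
  have F1: "norm (F z) \<le> 1" if "cmod z < 1" for z
    unfolding F_def by (rule less_imp_le[OF G_less[OF fD[OF rz[OF that]]]])
  have hF: "cholomorphic_on F (ball 0 1)"
  proof -
    have 1: "holomorphic_map hilbert_atlas hilbert_atlas (\<lambda>z. G n (f z)) (ball 0 (r n))"
    proof (rule holomorphic_map_compose[where f = f and g = "G n" and T = "D n", OF complex_manifold_hilbert_atlas A _ G_hol open_ball])
      show "holomorphic_map hilbert_atlas \<A> f (ball 0 (r n))"
        by (rule holomorphic_map_subset[OF f(1)[unfolded disc_in_def, THEN conjunct1]]) (use r(2)[of n] in auto)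
      show "f ` ball 0 (r n) \<subseteq> D n" using fD by auto
    qed
    have 2: "cholomorphic_on (\<lambda>z::complex. of_real (r n) * z) (ball 0 1)"
      by (intro cholomorphic_on_mult cholomorphic_on_const cholomorphic_on_id)
    have "cholomorphic_on (\<lambda>z. G n (f (of_real (r n) * z))) (ball 0 1)"
      by (rule cholomorphic_on_compose[OF 2 1[unfolded holomorphic_map_hilbert_iff]]) (use rz in auto)
    then show ?thesis unfolding F_def by (rule cholomorphic_on_cblinear_compose[OF _ T])
  qed
  define z where "z = \<zeta> / of_real (r n)"
  have cz: "cmod z \<le> 2 / 3"
  proof -
    have "cmod z = cmod \<zeta> / r n" using r_pos[of n] by (simp add: z_def norm_divide)
    also have "\<dots> \<le> (1 / 2) / (3 / 4)" using f(3) r(1)[of n] by (intro frac_le) auto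
    finally show ?thesis by simp
  qed
  have z1: "cmod z < 1" using cz by simp
  have Fz: "F z = T (G n x)" using r_pos[of n] by (simp add: F_def z_def x)
  have F0: "F 0 = T (G n (f 0))" by (simp add: F_def)
  have 0: "(1 / 5) ^ k \<le> 1 - norm (F 0)" using Suc.IH[OF f(2) kn] unfolding F0 by simp
  have "1 / 3 * (1 - norm (F 0)) \<le> (1 - cmod z) * (1 - norm (F 0))"
    using cz F1[of 0] by (intro mult_right_mono) auto
  also have "\<dots> \<le> (1 + cmod z) * (1 - norm (F z))" by (rule hilbert_Schwarz_Pick[OF hF F1 z1])
  also have "\<dots> \<le> 5 / 3 * (1 - norm (F z))" using cz F1[OF z1] by (intro mult_right_mono) auto
  finally have 1: "1 / 5 * (1 - norm (F 0)) \<le> 1 - norm (F z)" by (simp add: field_simps)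
  have "1 / 5 * (1 / 5) ^ k \<le> 1 / 5 * (1 - norm (F 0))" using 0 by (rule mult_left_mono) simp
  from order_trans[OF this 1] have nF: "norm (F z) \<le> 1 - (1 / 5) * (1 / 5) ^ k" by (simp only: le_diff_eq add.commute)
  have "cmod \<zeta> < r n" using f(3) r(1)[of n] by linarith
  then have xD: "x \<in> D n" unfolding x by (rule fD)
  show ?case unfolding power_Suc Fz[symmetric] by (rule conjI[OF xD nF])
qed

lemma reach_bound: "0 \<le> 1 - (1 / 5 :: real) ^ k" "1 - (1 / 5 :: real) ^ k < 1"
proof -
  have 1: "(1 / 5 :: real) ^ k \<le> 1" by (rule power_le_one) simp_all
  have 2: "0 < (1 / 5 :: real) ^ k" by (rule zero_less_power) simp
  show "0 \<le> 1 - (1 / 5 :: real) ^ k" using 1 by (simp only: diff_ge_0_iff_ge)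
  show "1 - (1 / 5 :: real) ^ k < 1" using 2 by (simp only: diff_less_eq less_add_same_cancel1)
qed

text \<open>For \<open>y = G n x\<close> one has \<open>x = H n y\<close>, so
  \<open>g m x - g n x\<close> is the quantity \<open>E 0 m (Psi m n y) - E 0 n y\<close> of
  \<open>transition_near_linear\<close>, and \<open>G_bound\<close> keeps \<open>y\<close> in a
  fixed smaller ball.\<close>

lemma g_uniformly_Cauchy:
  assumes "e > 0"
  shows "\<exists>M. \<forall>m\<ge>M. \<forall>n\<ge>M. \<forall>x\<in>reach \<A> \<Omega> q k. norm (g m x - g n x) \<le> e"
proof -
  from transition_near_linear[OF reach_bound[of k] assms] obtain M where
    M: "\<And>j i y. j \<ge> M \<Longrightarrow> i \<ge> M \<Longrightarrow> norm (T y) \<le> 1 - (1 / 5) ^ k \<Longrightarrow> norm (T y) < r j * r i \<and> norm (E 0 i (Psi i j y) - E 0 j y) \<le> e"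
    by blast
  have *: "norm (g m x - g n x) \<le> e" if "m \<ge> max M k" "n \<ge> max M k" "x \<in> reach \<A> \<Omega> q k" for m n x
  proof -
    have x: "x \<in> D n" "norm (T (G n x)) \<le> 1 - (1 / 5) ^ k" using G_bound[OF that(3), of n] that(2) by auto
    have tr: "norm (T (G n x)) < r n * r m" "norm (E 0 m (Psi m n (G n x)) - E 0 n (G n x)) \<le> e"
      using M[OF _ _ x(2), of n m] that by auto
    have "norm (T (G n x)) < r n" using tr(1) rr(3)[of n m] by (rule less_trans)
    then have "H n (G n x) = x" by (rule H_G[OF x(1)])
    then show ?thesis using tr(2) by (simp add: g_def Psi_def)
  qed
  show ?thesis by (intro exI[of _ "max M k"] allI impI ballI) (rule *)
qed

lemma reach_all: "x \<in> \<Omega> \<Longrightarrow> \<exists>k. x \<in> reach \<A> \<Omega> q k"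
  using subsetD[OF reach_cover[OF A \<Omega>], of x] by simp

definition gl :: "'x \<Rightarrow> 'e" where "gl x = lim (\<lambda>n. g n x)"

lemma gl: "x \<in> \<Omega> \<Longrightarrow> (\<lambda>n. g n x) \<longlonglongrightarrow> gl x"
proof -
  assume "x \<in> \<Omega>"
  then obtain k where k: "x \<in> reach \<A> \<Omega> q k" using reach_all by blast
  have "Cauchy (\<lambda>n. g n x)"
  proof (rule CauchyI)
    fix e :: real assume "e > 0"
    from g_uniformly_Cauchy[OF half_gt_zero[OF this], of k]
    obtain M where M: "\<forall>m\<ge>M. \<forall>n\<ge>M. \<forall>x\<in>reach \<A> \<Omega> q k. norm (g m x - g n x) \<le> e / 2" by (elim exE) (rule that)
    show "\<exists>M. \<forall>m\<ge>M. \<forall>n\<ge>M. norm (g m x - g n x) < e"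
    proof (intro exI[of _ M] allI impI)
      fix m n assume "M \<le> m" "M \<le> n"
      then have "norm (g m x - g n x) \<le> e / 2" using M k by simp
      also have "\<dots> < e" using \<open>e > 0\<close> by simp
      finally show "norm (g m x - g n x) < e" .
    qed
  qed
  then show ?thesis unfolding gl_def convergent_LIMSEQ_iff[symmetric] by (rule Cauchy_convergent)
qed

text \<open>Uniform convergence is known on the sets \<open>reach\<close>, which need not be open.
  Around a point of one of them, however, half of a chart ball lies in the next one, since radial
  discs cover it.\<close>

lemma gl_hol: "holomorphic_map \<A> hilbert_atlas gl \<Omega>"
proof (rule holomorphic_map_local[OF A])
  fix x assume x: "x \<in> \<Omega>"
  then obtain k0 where k0: "x \<in> reach \<A> \<Omega> q k0" using reach_all by blast
  obtain h :: "'e \<Rightarrow> 'x" and k N where h: "holomorphic_map hilbert_atlas \<A> h (ball 0 1)" "h ` ball 0 1 \<subseteq> \<Omega>" "h 0 = x"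
    and k: "holomorphic_map \<A> hilbert_atlas k N" "N = h ` ball 0 1" "open N" "\<And>z. z \<in> ball 0 1 \<Longrightarrow> k (h z) = z"
    and op: "\<And>B. open B \<Longrightarrow> B \<subseteq> ball 0 1 \<Longrightarrow> open (h ` B)"
    using chart_ball[OF A \<Omega>(1) x] by metis
  have hr: "h z \<in> reach \<A> \<Omega> q (Suc k0)" if "z \<in> ball 0 (1 / 2)" for z
  proof -
    define z' where "z' = (2::complex) *\<^sub>C z"
    have nz': "norm z' < 1" using that by (simp add: z'_def)
    have "disc_in \<A> \<Omega> (\<lambda>\<zeta>. h (\<zeta> *\<^sub>C z'))"
    proof (rule disc_in_hilbert[where k = "\<lambda>\<zeta>. \<zeta> *\<^sub>C z'", OF A h(1,2)])
      show "cholomorphic_on (\<lambda>\<zeta>. \<zeta> *\<^sub>C z') (ball 0 1)" by (rule cholomorphic_on_cblinear[OF cblinear_scaleC_left])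
      show "(\<lambda>\<zeta>. \<zeta> *\<^sub>C z') ` ball 0 1 \<subseteq> ball 0 1"
      proof (intro image_subsetI)
        fix \<zeta> :: complex assume "\<zeta> \<in> ball 0 1"
        then have "cmod \<zeta> * norm z' \<le> 1 * norm z'" by (intro mult_right_mono) auto
        then show "\<zeta> *\<^sub>C z' \<in> ball 0 1" using nz' by simp
      qed
    qed
    moreover have "h (0 *\<^sub>C z') \<in> reach \<A> \<Omega> q k0" using k0 h(3) by (simp add: cblinear_zero[OF cblinear_scaleC_left])
    moreover have "h z = h ((1 / 2) *\<^sub>C z')" by (simp add: z'_def scaleC_scaleC)
    moreover have "cmod (1 / 2) \<le> 1 / 2" by (simp add: norm_divide)
    ultimately show ?thesis unfolding reach.simps mem_Collect_eq by (intro exI[of _ "\<lambda>\<zeta>. h (\<zeta> *\<^sub>C z')"] exI[of _ "1 / 2"]) blast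
  qed
  have "cholomorphic_on (\<lambda>z. gl (h z)) (ball 0 (1 / 2 / 2))"
  proof (rule cholomorphic_limit[where f = "\<lambda>n z. g n (h z)" and N = "Suc k0"])
    fix n assume n: "n \<ge> Suc k0"
    have "holomorphic_map hilbert_atlas hilbert_atlas (\<lambda>z. G n (h z)) (ball 0 (1 / 2))"
    proof (rule holomorphic_map_compose[where f = h and g = "G n" and T = "D n", OF complex_manifold_hilbert_atlas A _ G_hol open_ball])
      show "holomorphic_map hilbert_atlas \<A> h (ball 0 (1 / 2))" by (rule holomorphic_map_subset[OF h(1)]) auto
      show "h ` ball 0 (1 / 2) \<subseteq> D n" using G_bound[OF hr n] by blast
    qed
    then show "cholomorphic_on (\<lambda>z. g n (h z)) (ball 0 (1 / 2))"
      unfolding g_def holomorphic_map_hilbert_iff by (rule cholomorphic_on_cblinear_compose[OF _ E(1)])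
  next
    show "\<exists>M. \<forall>m\<ge>M. \<forall>n\<ge>M. \<forall>z\<in>ball 0 (1 / 2). norm (g m (h z) - g n (h z)) \<le> e" if "e > 0" for e
      using g_uniformly_Cauchy[OF that, of "Suc k0"] hr by blast
    show "(\<lambda>n. g n (h z)) \<longlonglongrightarrow> gl (h z)" if "z \<in> ball 0 (1 / 2)" for z
    proof (rule gl)
      have "z \<in> ball 0 1" using that by simp
      then show "h z \<in> \<Omega>" using h(2) by blast
    qed
  qed simp
  then have hol: "cholomorphic_on (\<lambda>z. gl (h z)) (ball 0 (1 / 4))" by simp
  define B where "B = h ` ball 0 (1 / 4)"
  have sub: "(ball 0 (1 / 4) :: 'e set) \<subseteq> ball 0 1" by auto
  have oB: "open B" unfolding B_def by (rule op[OF open_ball sub])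
  have B: "B \<subseteq> N" "B \<subseteq> \<Omega>" using sub h(2) k(2) by (auto simp: B_def)
  have kh: "k (h z) = z" if "z \<in> ball 0 (1 / 4)" for z by (rule k(4)) (use that in auto)
  have "holomorphic_map \<A> hilbert_atlas (\<lambda>y. gl (h (k y))) B"
  proof (rule holomorphic_map_compose[where f = k and g = "\<lambda>z. gl (h z)" and T = "ball 0 (1 / 4)", OF A complex_manifold_hilbert_atlas _ _ oB])
    show "holomorphic_map \<A> hilbert_atlas k B" by (rule holomorphic_map_subset[OF k(1) B(1)])
    show "holomorphic_map hilbert_atlas hilbert_atlas (\<lambda>z. gl (h z)) (ball 0 (1 / 4))"
      using hol by (simp only: holomorphic_map_hilbert_iff)
    show "k ` B \<subseteq> ball 0 (1 / 4)" using kh unfolding B_def by force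
  qed
  then have "holomorphic_map \<A> hilbert_atlas gl B"
    by (rule holomorphic_map_cong[OF A]) (use kh in \<open>auto simp: B_def\<close>)
  moreover have "\<Omega> \<inter> B = B" using B by blast
  moreover have "x \<in> B" using h(3) unfolding B_def by (force intro: image_eqI[where x = 0])
  ultimately show "\<exists>N. open N \<and> x \<in> N \<and> holomorphic_map \<A> hilbert_atlas gl (\<Omega> \<inter> N)" using oB by (intro exI[of _ B]) simp
qed

end

section \<open>The limit of the pulled back norms\<close>

context squeezed
begin

definition nrm :: "nat \<Rightarrow> 'e \<Rightarrow> real" where "nrm n v = norm (T (E n 0 v))"

text \<open>Combines \<open>E_upper\<close> with the cocycle rule. The norms are mutually comparable
  with constants tending to 1, so they form a Cauchy sequence even though the maps
  \<open>E n 0\<close> need not converge.\<close>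

lemma nrm_compare: "nrm m v * (r n * r m) \<le> nrm n v"
  using E_upper[of m n "E n 0 v"] by (simp add: nrm_def E_comp)

lemma nrm_0: "nrm 0 v = norm (T v)" by (simp add: nrm_def E_self)

lemma nrm_convergent: "convergent (\<lambda>n. nrm n v)"
proof -
  have B: "nrm n v \<le> 2 * norm (T v)" for n
  proof -
    have "nrm n v * (9 / 16) \<le> nrm n v * (r 0 * r n)" using rr(1) by (intro mult_left_mono) (auto simp: nrm_def)
    also have "\<dots> \<le> norm (T v)" using nrm_compare[of n v 0] by (simp add: nrm_0)
    finally show ?thesis using norm_ge_zero[of "T v"] by linarith
  qed
  have diff: "nrm m v - nrm n v \<le> 2 * norm (T v) * (1 - r n * r m)" for m n
  proof -
    have "nrm m v - nrm n v \<le> nrm m v * (1 - r n * r m)" using nrm_compare[of m v n] by (simp add: algebra_simps)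
    also have "\<dots> \<le> 2 * norm (T v) * (1 - r n * r m)" using rr(2)[of n m] B by (intro mult_right_mono) auto
    finally show ?thesis .
  qed
  have "Cauchy (\<lambda>n. nrm n v)"
  proof (rule CauchyI)
    fix e :: real assume e: "e > 0"
    define K where "K = 2 * norm (T v) + 1"
    have K: "K > 0" by (simp add: K_def add_nonneg_pos)
    obtain M where M: "\<And>m n. m \<ge> M \<Longrightarrow> n \<ge> M \<Longrightarrow> 1 - r m * r n < e / K" using rr_close[of "e / K"] e K by auto
    have "norm (nrm m v - nrm n v) < e" if "m \<ge> M" "n \<ge> M" for m n
    proof -
      have le: "2 * norm (T v) * (1 - r n * r m) \<le> K * (1 - r n * r m)"
        using rr(2)[of n m] by (intro mult_right_mono) (auto simp: K_def)
      have "K * (1 - r n * r m) < K * (e / K)" using M[OF that(2,1)] K by (intro mult_strict_left_mono)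
      then have "2 * norm (T v) * (1 - r n * r m) < e" using le K by simp
      then show ?thesis using diff[of m n] diff[of n m] by (simp add: mult.commute[of "r n"] abs_less_iff)
    qed
    then show "\<exists>M. \<forall>m\<ge>M. \<forall>n\<ge>M. norm (nrm m v - nrm n v) < e" by blast
  qed
  then show ?thesis by (simp add: Cauchy_convergent_iff)
qed

definition lim_nrm :: "'e \<Rightarrow> real" where "lim_nrm v = lim (\<lambda>n. nrm n v)"

lemma nrm_lim: "(\<lambda>n. nrm n v) \<longlonglongrightarrow> lim_nrm v"
  using nrm_convergent[of v] by (simp add: lim_nrm_def convergent_LIMSEQ_iff)

lemma lim_nrm_bounds: "r n * nrm n v \<le> lim_nrm v" "r n * lim_nrm v \<le> nrm n v"
proof -
  have "(\<lambda>m. nrm n v * (r m * r n)) \<longlonglongrightarrow> nrm n v * (1 * r n)" by (intro tendsto_intros r_lim)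
  then have "nrm n v * (1 * r n) \<le> lim_nrm v" by (rule LIMSEQ_le[OF _ nrm_lim]) (use nrm_compare in blast)
  then show "r n * nrm n v \<le> lim_nrm v" by (simp add: mult.commute)
  have "(\<lambda>m. nrm m v * (r n * r m)) \<longlonglongrightarrow> lim_nrm v * (r n * 1)" by (intro tendsto_intros r_lim nrm_lim)
  then have "lim_nrm v * (r n * 1) \<le> nrm n v" by (rule LIMSEQ_le_const2) (use nrm_compare in blast)
  then show "r n * lim_nrm v \<le> nrm n v" by (simp add: mult.commute)
qed

text \<open>The limit norm comes from an inner product because polarisation commutes with limits:
  bilinearity, symmetry and invariance under multiplication by the imaginary unit hold for each
  \<open>I n\<close> and pass to \<open>R\<close>. Comparison with \<open>nrm 0\<close> makes
  \<open>R\<close> equivalent to the given inner product.\<close>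

lemma limit_coordinates:
  "\<exists>(T' :: 'e \<Rightarrow> ell2) S'. cblinear T' \<and> cblinear S' \<and> (\<forall>x. S' (T' x) = x) \<and> (\<forall>v. norm (T' v) = lim_nrm v)"
proof -
  define I where "I n v w = inner (T (E n 0 v)) (T (E n 0 w))" for n v w
  define R where "R v w = ((lim_nrm (v + w))\<^sup>2 - (lim_nrm (v - w))\<^sup>2) / 4" for v w
  have TE: "cblinear (\<lambda>v. T (E n 0 v))" for n by (rule cblinear_compose[OF E(1) T])
  have "I n v w = ((nrm n (v + w))\<^sup>2 - (nrm n (v - w))\<^sup>2) / 4" for n v w
    unfolding I_def nrm_def cblinear_add[OF TE] cblinear_diff[OF TE]
    by (simp add: power2_norm_eq_inner inner_add_left inner_add_right inner_diff_left inner_diff_right inner_commute)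
  then have lim: "(\<lambda>n. I n v w) \<longlonglongrightarrow> R v w" for v w
    unfolding R_def by (simp only:) (intro tendsto_intros nrm_lim, simp)
  have Rvv: "R v v = (lim_nrm v)\<^sup>2" for v
  proof (rule LIMSEQ_unique[OF lim])
    have "I n v v = (nrm n v)\<^sup>2" for n by (simp add: I_def nrm_def power2_norm_eq_inner)
    then show "(\<lambda>n. I n v v) \<longlonglongrightarrow> (lim_nrm v)\<^sup>2" by (simp add: nrm_lim tendsto_power)
  qed
  obtain KS where KS: "KS > 0" "\<And>v. norm (S v) \<le> KS * norm v" using cblinear_bound[OF S] by blast
  obtain KT where KT: "KT > 0" "\<And>v. norm (T v) \<le> KT * norm v" using cblinear_bound[OF T] by blast
  interpret R: equivalent_inner R "(1 / (2 * KS))\<^sup>2" "(2 * KT)\<^sup>2"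
  proof
    fix x y z :: 'e and a :: real
    show "R (x + y) z = R x z + R y z"
    proof (rule LIMSEQ_unique[OF lim])
      have "I n (x + y) z = I n x z + I n y z" for n by (simp add: I_def cblinear_add[OF TE] inner_add_left)
      then show "(\<lambda>n. I n (x + y) z) \<longlonglongrightarrow> R x z + R y z" by (simp add: tendsto_add lim)
    qed
    show "R (a *\<^sub>R x) y = a * R x y"
    proof (rule LIMSEQ_unique[OF lim])
      have "I n (a *\<^sub>R x) y = a * I n x y" for n by (simp add: I_def cblinear_scaleR[OF TE])
      then show "(\<lambda>n. I n (a *\<^sub>R x) y) \<longlonglongrightarrow> a * R x y" by (simp add: tendsto_mult lim)
    qed
    show "R x y = R y x"
    proof (rule LIMSEQ_unique[OF lim])
      have "I n x y = I n y x" for n by (simp add: I_def inner_commute)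
      then show "(\<lambda>n. I n x y) \<longlonglongrightarrow> R y x" by (simp add: lim)
    qed
    show "R (\<i> *\<^sub>C x) (\<i> *\<^sub>C y) = R x y"
    proof (rule LIMSEQ_unique[OF lim])
      have "I n (\<i> *\<^sub>C x) (\<i> *\<^sub>C y) = I n x y" for n
        by (simp add: I_def cblinear_scaleC[OF TE] inner_eq_Re_cinner cinner_scaleC_left cinner_scaleC_right)
      then show "(\<lambda>n. I n (\<i> *\<^sub>C x) (\<i> *\<^sub>C y)) \<longlonglongrightarrow> R x y" by (simp add: lim)
    qed
    show "(1 / (2 * KS))\<^sup>2 > 0" using KS by simp
    have Tx: "norm x \<le> KS * norm (T x)" using KS(2)[of "T x"] by (simp add: ST)
    have "1 / 2 * norm (T x) \<le> r 0 * norm (T x)" using r(1)[of 0] by (intro mult_right_mono) auto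
    then have "norm (T x) \<le> 2 * lim_nrm x" using lim_nrm_bounds(1)[of 0 x] unfolding nrm_0 by linarith
    then have "norm x \<le> KS * (2 * lim_nrm x)" by (rule order_trans[OF Tx mult_left_mono]) (use KS(1) in simp)
    then have "norm x / (2 * KS) \<le> lim_nrm x" using KS(1) by (simp add: pos_divide_le_eq mult_ac)
    then have "(norm x / (2 * KS))\<^sup>2 \<le> (lim_nrm x)\<^sup>2" using KS(1) by (intro power_mono) auto
    then show "(1 / (2 * KS))\<^sup>2 * (norm x)\<^sup>2 \<le> R x x" by (simp add: Rvv power_divide)
    have ge: "0 \<le> lim_nrm x" using lim_nrm_bounds(1)[of 0 x] r_pos[of 0] unfolding nrm_0
      by (meson mult_nonneg_nonneg norm_ge_zero order_trans less_imp_le)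
    then have "1 / 2 * lim_nrm x \<le> r 0 * lim_nrm x" using r(1)[of 0] by (intro mult_right_mono) auto
    then have "lim_nrm x \<le> 2 * KT * norm x" using lim_nrm_bounds(2)[of 0 x] KT(2)[of x] unfolding nrm_0 by linarith
    then have "(lim_nrm x)\<^sup>2 \<le> (2 * KT * norm x)\<^sup>2" using ge by (intro power_mono) auto
    then show "R x x \<le> (2 * KT)\<^sup>2 * (norm x)\<^sup>2" by (simp add: Rvv power_mult_distrib)
  qed
  obtain T' :: "'e \<Rightarrow> ell2" and S' where T': "cblinear T'" "cblinear S'" "\<forall>x. S' (T' x) = x" "\<forall>x. (norm (T' x))\<^sup>2 = R x x"
    using R.orthonormal_coordinates by (elim exE conjE) (rule that)
  have N: "norm (T' v) = lim_nrm v" for v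
  proof (rule power2_eq_imp_eq)
    show "(norm (T' v))\<^sup>2 = (lim_nrm v)\<^sup>2" using T'(4) by (simp add: Rvv)
    show "0 \<le> lim_nrm v" using lim_nrm_bounds(1)[of 0 v] r_pos[of 0] unfolding nrm_0
      by (meson mult_nonneg_nonneg norm_ge_zero order_trans less_imp_le)
  qed simp
  show ?thesis by (rule exI[of _ T'], rule exI[of _ S']) (intro conjI allI T'(1,2) T'(3)[rule_format] N)
qed

end

section \<open>The limit map is a biholomorphism onto the ball\<close>

locale squeezed_limit = squeezed +
  fixes T' :: "'b \<Rightarrow> ell2" and S' :: "ell2 \<Rightarrow> 'b"
  assumes T': "cblinear T'" and S': "cblinear S'" and ST': "S' (T' v) = v"
    and T'_nrm: "norm (T' v) = lim_nrm v"
begin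

lemma T'_bounds: "r n * norm (T (E n 0 v)) \<le> norm (T' v)" "r n * norm (T' v) \<le> norm (T (E n 0 v))"
  using lim_nrm_bounds[of n v] by (simp_all add: T'_nrm nrm_def)

lemma gl_norm:
  assumes "x \<in> reach \<A> \<Omega> q k"
  shows "norm (T' (gl x)) \<le> 1 - (1 / 5) ^ k"
proof -
  have "x \<in> \<Omega>" using assms reach_subset[OF \<Omega>(3)] by blast
  note gl = gl[OF this]
  have "(\<lambda>n. r n * norm (T' (g n x))) \<longlonglongrightarrow> 1 * norm (T' (gl x))"
    by (intro tendsto_mult r_lim tendsto_norm bounded_linear.tendsto[OF cblinear_bounded[OF T']] gl)
  moreover have "r n * norm (T' (g n x)) \<le> 1 - (1 / 5) ^ k" if "n \<ge> k" for n
    using T'_bounds(2)[of n "g n x"] G_bound[OF assms that] by (simp add: g_def E_inverse)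
  ultimately show ?thesis by (intro LIMSEQ_le_const2[where X = "\<lambda>n. r n * norm (T' (g n x))"]) auto
qed

lemma gl_less: "x \<in> \<Omega> \<Longrightarrow> norm (T' (gl x)) < 1"
proof -
  assume "x \<in> \<Omega>"
  from reach_all[OF this] obtain k where "x \<in> reach \<A> \<Omega> q k" by (rule exE)
  from le_less_trans[OF gl_norm[OF this] reach_bound(2)] show "norm (T' (gl x)) < 1" .
qed

text \<open>The candidate inverses, with the normalisation of \<open>g n\<close> undone:
  \<open>g n (h n v) = v\<close> wherever \<open>H n\<close> is defined.\<close>

definition h :: "nat \<Rightarrow> 'b \<Rightarrow> 'a" where "h n v = H n (E n 0 v)"

lemma r_close: "c < 1 \<Longrightarrow> \<exists>M. \<forall>n\<ge>M. c < r n"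
proof -
  assume "c < 1"
  then have "\<forall>\<^sub>F n in sequentially. c < r n" using r_lim by (rule order_tendstoD(1)[rotated])
  then show ?thesis by (simp add: eventually_sequentially)
qed

text \<open>Removing a factor \<open>s\<close> close to 1 enlarges the bound \<open>c\<close> only
  to the midpoint of \<open>c\<close> and 1, because the square of that midpoint is still larger
  than \<open>c\<close>.\<close>

lemma close_bound:
  fixes a c s :: real
  assumes "0 \<le> c" "c < 1" "s * a \<le> c" "(1 + c) / 2 < s"
  shows "a \<le> (1 + c) / 2"
proof (rule ccontr)
  assume "\<not> ?thesis"
  then have "(1 + c) / 2 * ((1 + c) / 2) \<le> s * a" using assms by (intro mult_mono) auto
  moreover have "(1 + c) / 2 * ((1 + c) / 2) - c = ((1 - c) / 2)\<^sup>2" by (simp add: power2_eq_square field_simps)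
  moreover have "((1 - c) / 2)\<^sup>2 > 0" using assms by simp
  ultimately show False using assms(3) by linarith
qed

text \<open>For large \<open>m\<close> the value \<open>g m (h n v)\<close> is
  \<open>E 0 m (Psi m n (E n 0 v))\<close>, which is close to \<open>E 0 n (E n 0 v) = v\<close>;
  now let \<open>m\<close> tend to infinity with \<open>n\<close> fixed.\<close>

lemma h_approximates_inverse:
  assumes c: "0 \<le> c" "c < 1" and e: "e > 0"
  shows "\<exists>M. \<forall>n\<ge>M. \<forall>v. norm (T' v) \<le> c \<longrightarrow> norm (T (E n 0 v)) < r n \<and> h n v \<in> \<Omega> \<and> norm (gl (h n v) - v) \<le> e"
proof -
  have c': "0 \<le> (1 + c) / 2" "(1 + c) / 2 < 1" using c by auto
  from transition_near_linear[OF c' e] obtain M1 where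
    M1: "\<And>j i y. j \<ge> M1 \<Longrightarrow> i \<ge> M1 \<Longrightarrow> norm (T y) \<le> (1 + c) / 2 \<Longrightarrow> norm (T y) < r j * r i \<and> norm (E 0 i (Psi i j y) - E 0 j y) \<le> e"
    by blast
  obtain M2 where M2: "\<And>n. n \<ge> M2 \<Longrightarrow> (1 + c) / 2 < r n" using r_close[OF c'(2)] by blast
  have "norm (T (E n 0 v)) < r n \<and> h n v \<in> \<Omega> \<and> norm (gl (h n v) - v) \<le> e" if n: "n \<ge> max M1 M2" and v: "norm (T' v) \<le> c" for n v
  proof -
    have y: "norm (T (E n 0 v)) \<le> (1 + c) / 2"
      by (rule close_bound[OF c _ M2]) (use T'_bounds(1)[of n v] v n in auto)
    have yr: "norm (T (E n 0 v)) < r n" using M2[of n] y n by auto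
    have hD: "h n v \<in> \<Omega>" unfolding h_def using H_D[OF yr] D(3) by blast
    have "(\<lambda>m. norm (g m (h n v) - v)) \<longlonglongrightarrow> norm (gl (h n v) - v)" by (intro tendsto_intros gl hD)
    moreover have "norm (g m (h n v) - v) \<le> e" if "m \<ge> M1" for m
    proof -
      have "M1 \<le> n" using n by simp
      from M1[OF this that y] show ?thesis by (simp add: g_def h_def Psi_def E_inverse)
    qed
    ultimately have "norm (gl (h n v) - v) \<le> e" by (intro LIMSEQ_le_const2) auto
    then show ?thesis using yr hD by blast
  qed
  then show ?thesis by blast
qed

lemma h_hol:
  assumes "\<And>v. v \<in> X \<Longrightarrow> norm (T (E n 0 v)) < r n" and "open X"
  shows "holomorphic_map hilbert_atlas \<A> (h n) X"
  unfolding h_def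
proof (rule holomorphic_map_compose[where f = "E n 0" and g = "H n" and T = "{v. norm (T v) < r n}",
      OF complex_manifold_hilbert_atlas complex_manifold_hilbert_atlas _ H_hol assms(2)])
  show "holomorphic_map hilbert_atlas hilbert_atlas (E n 0) X"
    unfolding holomorphic_map_hilbert_iff by (rule cholomorphic_on_cblinear[OF E(1)])
qed (use assms(1) in auto)

text \<open>Closeness of \<open>gl \<circ> h n\<close> to the identity on a slightly larger ball
  gives closeness of the derivative on the ball of radius \<open>c\<close> by Cauchy's estimate.
  This is the input that \<open>near_identity\<close> requires.\<close>

lemma local_inverse:
  assumes c: "0 \<le> c" "c < 1" and e: "e > 0"
  shows "\<exists>M. \<forall>n\<ge>M. (\<forall>v. norm (T' v) < c \<longrightarrow> h n v \<in> \<Omega> \<and> norm (gl (h n v) - v) \<le> e) \<and>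
    holomorphic_map hilbert_atlas \<A> (h n) {v. norm (T' v) < c} \<and>
    cholomorphic_on (\<lambda>v. gl (h n v)) {v. norm (T' v) < c} \<and>
    (\<forall>x\<in>{v. norm (T' v) < c}. \<forall>L v. ((\<lambda>v. gl (h n v)) has_derivative L) (at x) \<longrightarrow> norm (L v - v) \<le> norm v / 2)"
proof -
  obtain K where K: "K > 0" "\<And>v. norm (T' v) \<le> K * norm v" using cblinear_bound[OF T'] by blast
  define c' where "c' = (1 + c) / 2"
  have c': "0 \<le> c'" "c' < 1" "c < c'" using c by (auto simp: c'_def)
  \<comment> \<open>The ball of radius \<open>d\<close> about a point of the smaller ball stays in
    the larger one. An error of \<open>d / 4\<close> on it means a derivative error of 1/2.\<close>
  define d where "d = (c' - c) / K"
  have d: "d > 0" using c' K by (simp add: d_def)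
  have "min e (d / 4) > 0" using e d by simp
  from h_approximates_inverse[OF c'(1,2) this] obtain M where
    M: "\<And>n v. n \<ge> M \<Longrightarrow> norm (T' v) \<le> c' \<Longrightarrow> norm (T (E n 0 v)) < r n \<and> h n v \<in> \<Omega> \<and> norm (gl (h n v) - v) \<le> min e (d / 4)"
    by blast
  define X where "X = {v. norm (T' v) < c'}"
  have oX: "open X" unfolding X_def by (rule open_norm_cblinear_less[OF T'])
  have sub: "{v. norm (T' v) < c} \<subseteq> X" using c' by (auto simp: X_def)
  have "(\<forall>v. norm (T' v) < c \<longrightarrow> h n v \<in> \<Omega> \<and> norm (gl (h n v) - v) \<le> e) \<and>
    holomorphic_map hilbert_atlas \<A> (h n) {v. norm (T' v) < c} \<and>
    cholomorphic_on (\<lambda>v. gl (h n v)) {v. norm (T' v) < c} \<and>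
    (\<forall>x\<in>{v. norm (T' v) < c}. \<forall>L v. ((\<lambda>v. gl (h n v)) has_derivative L) (at x) \<longrightarrow> norm (L v - v) \<le> norm v / 2)"
    if n: "n \<ge> M" for n
  proof -
    have Mn: "norm (T (E n 0 v)) < r n" "h n v \<in> \<Omega>" "norm (gl (h n v) - v) \<le> e" "norm (gl (h n v) - v) \<le> d / 4" if "v \<in> X" for v
      using M[OF n, of v] that by (auto simp: X_def)
    have hh: "holomorphic_map hilbert_atlas \<A> (h n) X" by (rule h_hol[OF Mn(1) oX])
    have "holomorphic_map hilbert_atlas hilbert_atlas (\<lambda>v. gl (h n v)) X"
      by (rule holomorphic_map_compose[where f = "h n" and g = gl and T = \<Omega>, OF complex_manifold_hilbert_atlas A hh gl_hol oX])
        (use Mn(2) in auto)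
    then have hol: "cholomorphic_on (\<lambda>v. gl (h n v)) X" by (simp only: holomorphic_map_hilbert_iff)
    have der: "norm (L v - v) \<le> norm v / 2" if x: "norm (T' x) < c" and L: "((\<lambda>v. gl (h n v)) has_derivative L) (at x)" for x L v
    proof -
      have b: "ball x d \<subseteq> X"
      proof
        fix y assume "y \<in> ball x d"
        then have "K * norm (y - x) < K * d" using K(1) by (simp add: dist_norm norm_minus_commute)
        then have "norm (T' (y - x)) < c' - c" using K by (simp add: d_def) (meson le_less_trans)
        then show "y \<in> X" using x norm_triangle_ineq[of "T' (y - x)" "T' x"] unfolding X_def by (simp add: cblinear_diff[OF T'])
      qed
      have 1: "cholomorphic_on (\<lambda>v. gl (h n v) - v) (ball x d)"
        by (intro cholomorphic_on_diff cholomorphic_on_id cholomorphic_on_subset[OF hol b])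
      have 2: "((\<lambda>v. gl (h n v) - v) has_derivative (\<lambda>v. L v - v)) (at x)" by (intro has_derivative_diff L has_derivative_ident)
      have "norm (L v - v) \<le> 2 * (d / 4) / d * norm v"
        by (rule Cauchy_estimate[OF 1 _ 2 d]) (use Mn(4) b in blast)
      then show ?thesis using d by simp
    qed
    show ?thesis
      using Mn(2,3) sub der holomorphic_map_subset[OF hh sub] cholomorphic_on_subset[OF hol sub] by (intro conjI ballI allI impI) (blast intro: der)+
  qed
  then show ?thesis by blast
qed

lemma T'_ball: "open {v. norm (T' v) < c}" "convex {v. norm (T' v) < c}"
proof -
  show "open {v. norm (T' v) < c}" by (rule open_norm_cblinear_less[OF T'])
  have "{v. norm (T' v) < c} = T' -` ball 0 c" by auto
  then show "convex {v. norm (T' v) < c}"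
    using convex_linear_vimage[OF bounded_linear.linear[OF cblinear_bounded[OF T']] convex_ball] by simp
qed

text \<open>For one large \<open>n\<close> both points are of the form \<open>h n (g n x)\<close>,
  with \<open>g n x\<close> in a ball on which \<open>gl \<circ> h n\<close> is injective. So
  \<open>gl x = gl y\<close> gives \<open>g n x = g n y\<close>, and applying \<open>h n\<close>
  recovers the points.\<close>

lemma gl_inj: "inj_on gl \<Omega>"
proof (rule inj_onI)
  fix x y assume xy: "x \<in> \<Omega>" "y \<in> \<Omega>" "gl x = gl y"
  obtain k l where kl: "x \<in> reach \<A> \<Omega> q k" "y \<in> reach \<A> \<Omega> q l" using reach_all xy by blast
  define c where "c = max (1 - (1 / 5) ^ k) (1 - (1 / 5 :: real) ^ l)"
  have c: "0 \<le> c" "c < 1" unfolding c_def le_max_iff_disj max_less_iff_conj using reach_bound[of k] reach_bound[of l] by blast+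
  \<comment> \<open>Strictly beyond \<open>(1 + c) / 2\<close>, the bound that
    \<open>close_bound\<close> yields for \<open>g n\<close>, so that these values lie in the open
    ball.\<close>
  define c' where "c' = (3 + c) / 4"
  have c': "0 \<le> c'" "c' < 1" using c by (auto simp: c'_def)
  from local_inverse[OF c' zero_less_one] obtain M1 where M1: "\<And>n. n \<ge> M1 \<Longrightarrow>
    cholomorphic_on (\<lambda>v. gl (h n v)) {v. norm (T' v) < c'} \<and>
    (\<forall>x\<in>{v. norm (T' v) < c'}. \<forall>L v. ((\<lambda>v. gl (h n v)) has_derivative L) (at x) \<longrightarrow> norm (L v - v) \<le> norm v / 2)"
    by blast
  have "(1 + c) / 2 < 1" using c by simp
  from r_close[OF this] obtain M2 where M2: "\<And>n. n \<ge> M2 \<Longrightarrow> (1 + c) / 2 < r n" by blast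
  define n where "n = max (max M1 M2) (max k l)"
  have n: "n \<ge> M1" "n \<ge> M2" "n \<ge> k" "n \<ge> l" by (auto simp: n_def)
  have inj: "inj_on (\<lambda>v. gl (h n v)) {v. norm (T' v) < c'}"
    by (rule near_identity_inj[OF T'_ball]) (use M1[OF n(1)] in blast)+
  have *: "norm (T' (g n z)) < c'" "h n (g n z) = z" if z: "z \<in> D n" "norm (T (G n z)) \<le> c" for z
  proof -
    have "r n * norm (T' (g n z)) \<le> c" using T'_bounds(2)[of n "g n z"] z(2) by (simp add: g_def E_inverse)
    then have "norm (T' (g n z)) \<le> (1 + c) / 2" by (rule close_bound[OF c _ M2[OF n(2)]])
    then show "norm (T' (g n z)) < c'" using c by (simp add: c'_def)
    have "c < (1 + c) / 2" using c(2) by simp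
    then have "norm (T (G n z)) < r n" by (rule le_less_trans[OF z(2) less_trans[OF _ M2[OF n(2)]]])
    then show "h n (g n z) = z" using H_G[OF z(1)] by (simp add: h_def g_def E_inverse)
  qed
  have x: "x \<in> D n" "norm (T (G n x)) \<le> c" using G_bound[OF kl(1) n(3)] by (auto simp: c_def)
  have y: "y \<in> D n" "norm (T (G n y)) \<le> c" using G_bound[OF kl(2) n(4)] by (auto simp: c_def)
  have "gl (h n (g n x)) = gl (h n (g n y))" unfolding *(2)[OF x] *(2)[OF y] by (rule xy(3))
  then have "g n x = g n y" by (rule inj_onD[OF inj]) (rule CollectI, rule *(1)[OF x], rule CollectI, rule *(1)[OF y])
  then have "h n (g n x) = h n (g n y)" by (rule arg_cong)
  then show "x = y" unfolding *(2)[OF x] *(2)[OF y] .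
qed

text \<open>With \<open>F = gl \<circ> h n\<close> close to the identity, \<open>F v = w\<close> is
  solvable near \<open>w\<close>, and the inverse of \<open>gl\<close> is locally \<open>h n\<close>
  after the holomorphic inverse of \<open>F\<close>. So surjectivity and holomorphy of the inverse
  come from the same map.\<close>

lemma gl_local_inverse:
  assumes w: "norm (T' w) < 1"
  shows "\<exists>N. open N \<and> w \<in> N \<and> N \<subseteq> gl ` \<Omega> \<and> holomorphic_map hilbert_atlas \<A> (inv_into \<Omega> gl) N"
proof -
  obtain K where K: "K > 0" "\<And>v. norm (T' v) \<le> K * norm v" using cblinear_bound[OF T'] by blast
  define c where "c = (1 + norm (T' w)) / 2"
  have c: "0 \<le> c" "c < 1" "norm (T' w) < c" using w by (auto simp: c_def)
  define X where "X = {v. norm (T' v) < c}"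
  have X: "open X" "convex X" unfolding X_def by (rule T'_ball)+
  define e where "e = (c - norm (T' w)) / (2 * K)"
  have e: "e > 0" using c K by (simp add: e_def)
  have cb: "cball w e \<subseteq> X"
  proof
    fix y assume "y \<in> cball w e"
    then have "K * norm (y - w) \<le> K * e" using K(1) by (simp add: dist_norm norm_minus_commute)
    then have "norm (T' (y - w)) \<le> (c - norm (T' w)) / 2" using K(2)[of "y - w"] K(1) by (simp add: e_def)
    then show "y \<in> X" using c norm_triangle_ineq[of "T' (y - w)" "T' w"] unfolding X_def by (simp add: cblinear_diff[OF T'])
  qed
  have "e / 2 > 0" using e by simp
  from local_inverse[OF c(1,2) this] obtain n where L: "\<forall>m\<ge>n. (\<forall>v. norm (T' v) < c \<longrightarrow> h m v \<in> \<Omega> \<and> norm (gl (h m v) - v) \<le> e / 2) \<and>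
    holomorphic_map hilbert_atlas \<A> (h m) {v. norm (T' v) < c} \<and>
    cholomorphic_on (\<lambda>v. gl (h m v)) {v. norm (T' v) < c} \<and>
    (\<forall>x\<in>{v. norm (T' v) < c}. \<forall>L v. ((\<lambda>v. gl (h m v)) has_derivative L) (at x) \<longrightarrow> norm (L v - v) \<le> norm v / 2)"
    by (elim exE) (rule that)
  note L = L[THEN spec, THEN mp, OF order_refl, folded X_def]
  have n: "h n v \<in> \<Omega> \<and> norm (gl (h n v) - v) \<le> e / 2" if "v \<in> X" for v
    using L[THEN conjunct1] that by (simp add: X_def)
  note hh = L[THEN conjunct2, THEN conjunct1] and hol = L[THEN conjunct2, THEN conjunct2, THEN conjunct1]
  have near: "norm (L' v - v) \<le> norm v / 2" if "x \<in> X" "((\<lambda>v. gl (h n v)) has_derivative L') (at x)" for x L' v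
    using L[THEN conjunct2, THEN conjunct2, THEN conjunct2] that by blast
  define F where "F v = gl (h n v)" for v
  note near' = near[folded F_def] and hol' = hol[folded F_def]
  have "w \<in> X" using c by (simp add: X_def)
  then have "norm (w - F w) \<le> e / 2" using n[of w] by (simp add: F_def norm_minus_commute)
  then have "w \<in> F ` cball w e" by (rule near_identity_solve[OF X hol' _ cb, rotated]) (rule near')
  then have wF: "w \<in> F ` X" using cb by blast
  have oF: "open (F ` X)" by (rule near_identity_open[OF X hol']) (rule near')
  have iF: "cholomorphic_on (inv_into X F) (F ` X)" by (rule near_identity_inverse[OF X hol']) (rule near')
  have inv: "h n (inv_into X F y) = inv_into \<Omega> gl y" if "y \<in> F ` X" for y
  proof -
    have u: "inv_into X F y \<in> X" "F (inv_into X F y) = y" using that by (auto intro: inv_into_into f_inv_into_f)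
    then show ?thesis using n[OF u(1)] inv_into_f_f[OF gl_inj, of "h n (inv_into X F y)"] by (simp add: F_def)
  qed
  have "holomorphic_map hilbert_atlas \<A> (\<lambda>y. h n (inv_into X F y)) (F ` X)"
  proof (rule holomorphic_map_compose[where f = "inv_into X F" and g = "h n" and T = X,
        OF complex_manifold_hilbert_atlas complex_manifold_hilbert_atlas _ hh oF])
    show "holomorphic_map hilbert_atlas hilbert_atlas (inv_into X F) (F ` X)" using iF by (simp only: holomorphic_map_hilbert_iff)
  qed (auto intro: inv_into_into)
  then have "holomorphic_map hilbert_atlas \<A> (inv_into \<Omega> gl) (F ` X)"
    by (rule holomorphic_map_cong[OF complex_manifold_hilbert_atlas _ inv])
  moreover have "F ` X \<subseteq> gl ` \<Omega>" using n unfolding F_def by blast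
  ultimately show ?thesis using oF wF by blast
qed

lemma gl_image: "gl ` \<Omega> = {w. norm (T' w) < 1}"
proof
  show "gl ` \<Omega> \<subseteq> {w. norm (T' w) < 1}" by (intro image_subsetI CollectI gl_less)
  show "{w. norm (T' w) < 1} \<subseteq> gl ` \<Omega>"
  proof
    fix w assume "w \<in> {w. norm (T' w) < 1}"
    then have "norm (T' w) < 1" by simp
    from gl_local_inverse[OF this] obtain N where "w \<in> N" "N \<subseteq> gl ` \<Omega>" by (elim exE conjE) (rule that)
    then show "w \<in> gl ` \<Omega>" by (rule subsetD[rotated])
  qed
qed

lemma gl_inverse_hol: "holomorphic_map hilbert_atlas \<A> (inv_into \<Omega> gl) {w. norm (T' w) < 1}"
proof (rule holomorphic_map_local[OF complex_manifold_hilbert_atlas])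
  fix w assume "w \<in> {w. norm (T' w) < 1}"
  then have "norm (T' w) < 1" by simp
  from gl_local_inverse[OF this] obtain N where N: "open N" "w \<in> N" "N \<subseteq> gl ` \<Omega>" "holomorphic_map hilbert_atlas \<A> (inv_into \<Omega> gl) N"
    by (elim exE conjE) (rule that)
  have "{w. norm (T' w) < 1} \<inter> N = N" using N(3) unfolding gl_image by (rule Int_absorb1)
  then show "\<exists>N. open N \<and> w \<in> N \<and> holomorphic_map hilbert_atlas \<A> (inv_into \<Omega> gl) ({w. norm (T' w) < 1} \<inter> N)"
    using N by (intro exI[of _ N]) simp
qed

text \<open>The isometric coordinates \<open>T'\<close> carry the unit ball of the limit norm into
  \<open>ell2\<close>. Since \<open>S'\<close> is a left inverse, the range of \<open>T'\<close> is
  the fixed point set of \<open>T' \<circ> S'\<close>, which makes it closed.\<close>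

lemma biholomorphic_ball: "\<exists>H :: ell2 set. closed_complex_subspace H \<and> biholomorphic \<A> \<Omega> hilbert_atlas (H \<inter> ball 0 1)"
proof -
  define Y where "Y = range T'"
  have Y: "Y = {x. T' (S' x) = x}"
  proof
    show "Y \<subseteq> {x. T' (S' x) = x}" unfolding Y_def by (intro image_subsetI CollectI arg_cong[where f = T'] ST')
    show "{x. T' (S' x) = x} \<subseteq> Y"
    proof
      fix x assume "x \<in> {x. T' (S' x) = x}"
      then have "x = T' (S' x)" by simp
      then show "x \<in> Y" unfolding Y_def by (rule range_eqI)
    qed
  qed
  have "closed Y"
    unfolding Y by (rule closed_Collect_eq[OF linear_continuous_on[OF cblinear_bounded[OF cblinear_compose[OF S' T']]] continuous_on_id])
  then have cs: "closed_complex_subspace Y"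
    unfolding closed_complex_subspace_def Y
    by (simp add: cblinear_zero[OF T'] cblinear_zero[OF S'] cblinear_add[OF T'] cblinear_add[OF S'] cblinear_scaleC[OF T'] cblinear_scaleC[OF S'])
  define F where "F x = T' (gl x)" for x
  have im: "F ` \<Omega> = Y \<inter> ball 0 1"
  proof
    show "F ` \<Omega> \<subseteq> Y \<inter> ball 0 1" using gl_less by (auto simp: F_def Y_def)
    show "Y \<inter> ball 0 1 \<subseteq> F ` \<Omega>"
    proof
      fix y assume "y \<in> Y \<inter> ball 0 1"
      then obtain v where v: "y = T' v" "norm (T' v) < 1" by (auto simp: Y_def)
      then have "v \<in> gl ` \<Omega>" unfolding gl_image by simp
      then show "y \<in> F ` \<Omega>" using v(1) unfolding F_def by blast
    qed
  qed
  have inj: "inj_on F \<Omega>"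
  proof (rule inj_onI)
    fix x y assume xy: "x \<in> \<Omega>" "y \<in> \<Omega>" "F x = F y"
    have "gl x = gl y" using arg_cong[OF xy(3), of S'] unfolding F_def ST' .
    then show "x = y" using xy(1,2) by (rule inj_onD[OF gl_inj])
  qed
  have T'_hol: "holomorphic_map hilbert_atlas hilbert_atlas T' UNIV"
    unfolding holomorphic_map_hilbert_iff by (rule cholomorphic_on_cblinear[OF T'])
  have F: "F = (\<lambda>x. T' (gl x))" by (rule ext) (rule F_def)
  have Fhol: "holomorphic_map \<A> hilbert_atlas F \<Omega>"
    unfolding F
  proof (rule holomorphic_map_compose[where f = gl and g = T' and T = UNIV and S = \<Omega>])
    show "complex_manifold \<A>" by (rule A)
    show "complex_manifold (hilbert_atlas :: ('b, 'b) chart set)" by (rule complex_manifold_hilbert_atlas)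
    show "holomorphic_map \<A> hilbert_atlas gl \<Omega>" by (rule gl_hol)
    show "holomorphic_map hilbert_atlas hilbert_atlas T' UNIV" by (rule T'_hol)
    show "open \<Omega>" by (rule \<Omega>(1))
    show "gl ` \<Omega> \<subseteq> UNIV" by (rule subset_UNIV)
  qed
  have inv: "inv_into \<Omega> F y = inv_into \<Omega> gl (S' y)" if "y \<in> Y \<inter> ball 0 1" for y
  proof -
    have "y \<in> F ` \<Omega>" using that unfolding im .
    then obtain x where x: "y = F x" "x \<in> \<Omega>" by (rule imageE)
    show ?thesis unfolding x(1) inv_into_f_f[OF inj x(2)]
      by (simp only: F_def ST' inv_into_f_f[OF gl_inj x(2)])
  qed
  \<comment> \<open>The domain is only relatively open in \<open>ell2\<close>, so holomorphy is
    obtained by composing the inverse of \<open>gl\<close>, holomorphic on an open set, with the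
    linear map \<open>S'\<close>, defined on all of \<open>ell2\<close>.\<close>
  have "holomorphic_map hilbert_atlas \<A> (inv_into \<Omega> F) (Y \<inter> ball 0 1)"
  proof (rule holomorphic_mapI)
    have S'Y: "S' ` (Y \<inter> ball 0 1) \<subseteq> {w. norm (T' w) < 1}" by (auto simp: Y)
    have "continuous_on (Y \<inter> ball 0 1) (\<lambda>y. inv_into \<Omega> gl (S' y))"
      by (rule continuous_on_compose2[OF holomorphic_mapD(1)[OF gl_inverse_hol] linear_continuous_on[OF cblinear_bounded[OF S']] S'Y])
    then show "continuous_on (Y \<inter> ball 0 1) (inv_into \<Omega> F)"
      using inv continuous_on_cong[of "Y \<inter> ball 0 1" "Y \<inter> ball 0 1" "inv_into \<Omega> F" "\<lambda>y. inv_into \<Omega> gl (S' y)"] by simp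
    fix U V \<mu> and \<kappa> :: "ell2 \<Rightarrow> ell2" assume c: "(U, \<kappa>) \<in> hilbert_atlas" "(V, \<mu>) \<in> \<A>"
    then have U: "U = UNIV" "\<kappa> = id" by (simp_all add: hilbert_atlas_iff)
    define B where "B = {w. norm (T' w) < 1} \<inter> inv_into \<Omega> gl -` V"
    have "(UNIV, id) \<in> (hilbert_atlas :: ('b, 'b) chart set)" by (simp add: hilbert_atlas_iff)
    from holomorphic_mapD(2)[OF gl_inverse_hol this c(2)]
    have 1: "cholomorphic_on (\<lambda>z. \<mu> (inv_into \<Omega> gl z)) B" by (simp add: inv_id B_def)
    define B' where "B' = Y \<inter> ball 0 1 \<inter> inv_into \<Omega> F -` V"
    have "S' ` B' \<subseteq> B" using S'Y inv by (auto simp: B'_def B_def)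
    from cholomorphic_on_compose[OF cholomorphic_on_cblinear[OF S'] 1 this]
    have "cholomorphic_on (\<lambda>y. \<mu> (inv_into \<Omega> gl (S' y))) B'" .
    then have "cholomorphic_on (\<lambda>y. \<mu> (inv_into \<Omega> F y)) B'"
      by (rule cholomorphic_on_cong) (use inv in \<open>auto simp: B'_def\<close>)
    then show "cholomorphic_on (\<lambda>z. \<mu> (inv_into \<Omega> F (inv_into U \<kappa> z))) (\<kappa> ` (U \<inter> (Y \<inter> ball 0 1) \<inter> inv_into \<Omega> F -` V))"
      by (simp add: U inv_id B'_def)
  qed
  then have "biholomorphism \<A> \<Omega> hilbert_atlas (Y \<inter> ball 0 1) F"
    unfolding biholomorphism_def using Fhol inj im by (simp add: bij_betw_def)
  then show ?thesis using cs unfolding biholomorphic_def by blast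
qed

end

theorem theorem6p1:
  fixes \<A> :: "('x::t2_space, 'e::{complex_hilbert_space, second_countable_topology}) chart set"
    and \<Omega> :: "'x set"
    and p q :: 'x
    and \<phi> :: "nat \<Rightarrow> 'x \<Rightarrow> 'x"
  assumes "complex_manifold \<A>"
    and "open \<Omega>" and "connected \<Omega>"
    and "p \<in> frontier \<Omega>"
    and "strongly_pseudoconvex_at \<A> \<Omega> p"
    and "q \<in> \<Omega>"
    and "\<And>j. \<phi> j \<in> Aut \<A> \<Omega>"
    and "(\<lambda>j. \<phi> j q) \<longlonglongrightarrow> p"
  shows "\<exists>H :: ell2 set. closed_complex_subspace H \<and>
    biholomorphic \<A> \<Omega> hilbert_atlas (H \<inter> ball 0 1)"
proof -
  from squeezing_sequence[OF assms(1,2,6,4,5,7,8)]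
  obtain T :: "'e \<Rightarrow> ell2" and S r D G H where *: "cblinear T" "cblinear S" "\<forall>x. S (T x) = x"
    "\<forall>n. 3 / 4 \<le> r n \<and> r n < 1" "r \<longlonglongrightarrow> 1" "\<forall>n. squeezing \<A> T (r n) q (D n) (G n) (H n)"
    "\<forall>n::nat. open (D n) \<and> q \<in> D n \<and> D n \<subseteq> \<Omega> \<and> exhausts \<A> \<Omega> q n (r n) (D n)" by (elim exE conjE) (rule that)
  interpret squeezed \<A> \<Omega> q T S r D G H
    by unfold_locales (use assms(1-3,6) * in auto)
  obtain T' :: "'e \<Rightarrow> ell2" and S' where T': "cblinear T'" "cblinear S'" "\<forall>x. S' (T' x) = x" "\<forall>v. norm (T' v) = lim_nrm v"
    using limit_coordinates by (elim exE conjE) (rule that)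
  interpret squeezed_limit \<A> \<Omega> q T S r D G H T' S'
    by unfold_locales (use T' in auto)
  show ?thesis by (rule biholomorphic_ball)
qed

end
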